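(* For all $\vec{x}=(a,b,c,d,e,f,g)^T\in V$ we have the relation $$\gamma(\sigma^2\vec{x})\beta(\sigma\vec{x})K_{p_0}(\vec{x})+\gamma(\sigma\vec{x})\beta(\vec{x})K_{n_4}(\vec{x})+\gamma(\vec{x})\beta(\sigma^{-1}\vec{x})K_{p_5}(\vec{x})=0,$$ or in other words, $$\sum_{j=0}^2\gamma(\sigma^{2-j}\vec{x})\,\beta(\sigma^{1-j}\vec{x})\,K(\sigma^{-j}\vec{x})=0,$$ where $\sigma:V\to V$ is the map (with $\sigma^3=\mathrm{id}$) $$\sigma\vec{x}=(1+b-e,\;b,\;f-c,\;g-c,\;1+a+b-e,\;1+b-c,\;1+b+d-e)^T.$$ This is a $444$ relation, i.e. the triple $(p_0,n_4,p_5)$ has Hamming type $444$.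
   Context: Let $V=\{(a,b,c,d,e,f,g)^T\in\mathbb{C}^7 : e+f+g-a-b-c-d=1\}$. With $(u)_k=u(u+1)\cdots(u+k-1)$, $(u)_0=1$, and ${}_4F_3(a,b,c,d;e,f,g;1)=\sum_{k\ge0}\frac{(a)_k(b)_k(c)_k(d)_k}{k!\,(e)_k(f)_k(g)_k}$, define for $\vec{x}=(a,b,c,d,e,f,g)^T\in V$ $$K(\vec{x})=K(a;b,c,d;e,f,g)=\frac{{}_4F_3(a,b,c,d;e,f,g;1)}{\Gamma(e)\Gamma(f)\Gamma(g)\Gamma(1+a-e)\Gamma(1+a-f)\Gamma(1+a-g)}+\frac{{}_4F_3(a,1+a-e,1+a-f,1+a-g;1+a-b,1+a-c,1+a-d;1)}{\Gamma(1+a-b)\Gamma(1+a-c)\Gamma(1+a-d)\Gamma(b)\Gamma(c)\Gamma(d)},$$ where each ${}_4F_3(A,B,C,D;E,F,G;1)/(\Gamma(E)\Gamma(F)\Gamma(G))$ is read as $\sum_{k\ge0}\frac{(A)_k(B)_k(C)_k(D)_k}{k!\,\Gamma(k+E)\Gamma(k+F)\Gamma(k+G)}$, so $K$ is entire on $V$. Put $$\beta(\vec{x})=\frac{1}{\Gamma(a)\Gamma(1+b-e)\Gamma(f-c)\Gamma(f-d)\Gamma(g-c)\Gamma(g-d)},$$ $$\gamma(\vec{x})=\frac{\sin\pi(e-b)}{\sin\pi(c-b)}\Bigl[\sin\pi(a-c)\sin\pi(e-a-b)\sin\pi(f-b)\sin\pi(g-b)-\sin\pi(a-b)\sin\pi(e-a-c)\sin\pi(f-c)\sin\pi(g-c)\Bigr],$$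 with $\gamma$ extended by continuity across its removable singularities $c-b\in\mathbb{Z}$. For an element $\mu$ of the group $M_K$ below, $K_\mu(\vec{x})=K(\mu\vec{x})$. The elements $p_0,n_4,p_5\in M_K$ act on $V$ by $p_0\vec{x}=\vec{x}$, $n_4\vec{x}=(e-a,e-b,e-c,e-d,1+e-f,1+e-g,e)^T$, $p_5\vec{x}=(1+b-e,1+c-e,1+d-e,1+a-e,1+f-e,1+g-e,2-e)^T$. Hamming type. Let $S\in GL(7,\mathbb{R})$ be the matrix with rows $(1,0,0,0,0,0,0)$, $(0,0,1,1,0,0,0)$, $(0,1,0,1,0,0,0)$, $(0,1,1,0,0,0,0)$, $(0,1,1,1,1,0,0)$, $(0,1,1,1,0,1,0)$, $(0,1,1,1,0,0,1)$; $P_{1,6}$ the group of $7\times7$ permutation matrices fixing the first coordinate; $G_K=SP_{1,6}S^{-1}$ (under which $K$ is invariant); $M_K\subset GL(7,\mathbb{R})$ the subgroup generated by $G_K$ and the permutation matrix $(12)$. For $1\le i<j\le6$, $\varepsilon=\pm1$, let $M_6^{\varepsilon}(i,j)$ be the $6\times6$ permutation matrix of the transposition $(i\,j)$ with its two off-diagonal $1$'s replaced by $\varepsilon$. There is a unique injective homomorphism $\theta:M_K\to GL(6,\mathbb{R})$ with $S(i,i+1)S^{-1}\mapsto M_6^{+}(i-1,i)$ for $2\le i\le6$ and $(12)\mapsto M_6^{-}(2,3)$. With $\omega_0=(1,1,1,1,1,1)^T$, the Hamming distance between $\mu,\nu\in M_K$ is the number of coordinates in which $\theta(\mu)^{-1}\omega_0$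 and $\theta(\nu)^{-1}\omega_0$ differ (it depends only on the right cosets $G_K\mu,G_K\nu$). The Hamming type of a triple is the list of its three pairwise Hamming distances in nondecreasing order. *)

theory Defs
  imports
    "HOL-Analysis.Analysis"
    "HOL-Algebra.Generated_Groups"
    "HOL-Combinatorics.Transposition"
begin

text \<open>
  A vector \<open>(a,b,c,d,e,f,g)\<close> is an element of \<open>complex^7\<close> with components \<open>x$1\<close>, ..., \<open>x$7\<close>
  (in the index type, \<open>7 = 0\<close>; similarly \<open>6 = 0\<close> in the index type of \<open>real^6\<close>).
\<close>

lemma exhaust_7:
  fixes i :: 7
  shows "i = 1 \<or> i = 2 \<or> i = 3 \<or> i = 4 \<or> i = 5 \<or> i = 6 \<or> i = 7"
proof (induct i)
  case (of_int z)
  then have "0 \<le> z" and "z < 7" by simp_all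
  then have "z = 0 \<or> z = 1 \<or> z = 2 \<or> z = 3 \<or> z = 4 \<or> z = 5 \<or> z = 6" by arith
  then show ?case by auto
qed

lemma forall_7:
  "(\<forall>i::7. P i) \<longleftrightarrow> P 1 \<and> P 2 \<and> P 3 \<and> P 4 \<and> P 5 \<and> P 6 \<and> P 7"
  by (metis exhaust_7)

lemma UNIV_7: "UNIV = {1, 2, 3, 4, 5, 6, 7::7}"
  using exhaust_7 by auto

lemma sum_7: "sum f (UNIV::7 set) = f 1 + f 2 + f 3 + f 4 + f 5 + f 6 + f 7"
  unfolding UNIV_7 by (simp add: ac_simps)

lemma vector_7 [simp]:
  "(vector [a,b,c,d,e,f,g] :: 'a::zero^7) $ 1 = a"
  "(vector [a,b,c,d,e,f,g] :: 'a::zero^7) $ 2 = b"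
  "(vector [a,b,c,d,e,f,g] :: 'a::zero^7) $ 3 = c"
  "(vector [a,b,c,d,e,f,g] :: 'a::zero^7) $ 4 = d"
  "(vector [a,b,c,d,e,f,g] :: 'a::zero^7) $ 5 = e"
  "(vector [a,b,c,d,e,f,g] :: 'a::zero^7) $ 6 = f"
  "(vector [a,b,c,d,e,f,g] :: 'a::zero^7) $ 7 = g"
  unfolding vector_def by simp_all

definition V :: "(complex^7) set" where
  "V = {x. x$5 + x$6 + x$7 - x$1 - x$2 - x$3 - x$4 = 1}"


subsection \<open>The functions \<open>K\<close>, \<open>\<beta>\<close>, \<open>\<gamma>\<close> and the map \<open>\<sigma>\<close>\<close>

text \<open>
  \<open>rGamma\<close> is the entire function \<open>1/\<Gamma>\<close>, so \<open>F43_reg A B C D E F G\<close> is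
  \<open>4F3(A,B,C,D;E,F,G;1) / (\<Gamma>(E) \<Gamma>(F) \<Gamma>(G))\<close> in its regularised reading.
\<close>

definition F43_reg ::
  "complex \<Rightarrow> complex \<Rightarrow> complex \<Rightarrow> complex \<Rightarrow> complex \<Rightarrow> complex \<Rightarrow> complex \<Rightarrow> complex" where
  "F43_reg A B C D E F G =
     (\<Sum>k. pochhammer A k * pochhammer B k * pochhammer C k * pochhammer D k / fact k
            * rGamma (of_nat k + E) * rGamma (of_nat k + F) * rGamma (of_nat k + G))"

definition K_fun :: "complex^7 \<Rightarrow> complex" where
  "K_fun x =
     (let a = x$1; b = x$2; c = x$3; d = x$4; e = x$5; f = x$6; g = x$7 in
       F43_reg a b c d e f g * rGamma (1 + a - e) * rGamma (1 + a - f) * rGamma (1 + a - g)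
     + F43_reg a (1 + a - e) (1 + a - f) (1 + a - g) (1 + a - b) (1 + a - c) (1 + a - d)
         * rGamma b * rGamma c * rGamma d)"

definition beta_fun :: "complex^7 \<Rightarrow> complex" where
  "beta_fun x =
     (let a = x$1; b = x$2; c = x$3; d = x$4; e = x$5; f = x$6; g = x$7 in
       rGamma a * rGamma (1 + b - e) * rGamma (f - c) * rGamma (f - d)
         * rGamma (g - c) * rGamma (g - d))"

definition gamma_formula :: "complex^7 \<Rightarrow> complex" where
  "gamma_formula x =
     (let a = x$1; b = x$2; c = x$3; d = x$4; e = x$5; f = x$6; g = x$7;
          s = (\<lambda>z. sin (of_real pi * z)) in
       s (e - b) / s (c - b) *
         (s (a - c) * s (e - a - b) * s (f - b) * s (g - b)
          - s (a - b) * s (e - a - c) * s (f - c) * s (g - c)))"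

text \<open>On \<open>c - b \<in> \<int>\<close> the formula is extended by its limit along regular points of \<open>V\<close>.\<close>

definition gamma_fun :: "complex^7 \<Rightarrow> complex" where
  "gamma_fun x =
     (if x$3 - x$2 \<in> \<int>
      then Lim (at x within {y \<in> V. y$3 - y$2 \<notin> \<int>}) gamma_formula
      else gamma_formula x)"

definition sigma_map :: "complex^7 \<Rightarrow> complex^7" where
  "sigma_map x =
     (let a = x$1; b = x$2; c = x$3; d = x$4; e = x$5; f = x$6; g = x$7 in
       vector [1 + b - e, b, f - c, g - c, 1 + a + b - e, 1 + b - c, 1 + b + d - e])"

text \<open>Integer powers of \<open>\<sigma>\<close> as a self-map of \<open>V\<close>.\<close>

definition sigma_pow :: "int \<Rightarrow> complex^7 \<Rightarrow> complex^7" where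
  "sigma_pow k =
     (if k \<ge> 0 then sigma_map ^^ nat k else inv_into V sigma_map ^^ nat (- k))"


subsection \<open>The group \<open>M\<^sub>K\<close> and its action on \<open>V\<close>\<close>

definition GL :: "(real^'n^'n) monoid" where
  "GL = \<lparr>carrier = {A. invertible A}, monoid.mult = (**), one = mat 1\<rparr>"

definition perm_mat :: "('n \<Rightarrow> 'n) \<Rightarrow> real^'n^'n" where
  "perm_mat p = (\<chi> i j. if i = p j then 1 else 0)"

definition swap_mat :: "'n \<Rightarrow> 'n \<Rightarrow> real^'n^'n" where
  "swap_mat i j = perm_mat (Transposition.transpose i j)"

definition S_mat :: "real^7^7" where
  "S_mat = vector
     [vector [1,0,0,0,0,0,0],
      vector [0,0,1,1,0,0,0],
      vector [0,1,0,1,0,0,0],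
      vector [0,1,1,0,0,0,0],
      vector [0,1,1,1,1,0,0],
      vector [0,1,1,1,0,1,0],
      vector [0,1,1,1,0,0,1]]"

definition P16 :: "(real^7^7) set" where
  "P16 = {perm_mat p | p. bij p \<and> p 1 = 1}"

definition G_K :: "(real^7^7) set" where
  "G_K = (\<lambda>P. S_mat ** P ** matrix_inv S_mat) ` P16"

definition M_K :: "(real^7^7) set" where
  "M_K = generate GL (insert (swap_mat 1 2) G_K)"

definition act :: "real^7^7 \<Rightarrow> complex^7 \<Rightarrow> complex^7" where
  "act \<mu> x = map_matrix complex_of_real \<mu> *v x"

definition K_sub :: "real^7^7 \<Rightarrow> complex^7 \<Rightarrow> complex" where
  "K_sub \<mu> x = K_fun (act \<mu> x)"

text \<open>
  The elements \<open>p\<^sub>0\<close>, \<open>n\<^sub>4\<close>, \<open>p\<^sub>5\<close> act on \<open>V\<close> by the affine formulas of the lemmas below. As \<open>V\<close> spans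
  \<open>complex^7\<close>, these determine the matrices, which arise by writing the constants \<open>1\<close> and \<open>2\<close>
  as \<open>e+f+g-a-b-c-d\<close> and \<open>2(e+f+g-a-b-c-d)\<close>.
\<close>

definition p0_mat :: "real^7^7" where
  "p0_mat = mat 1"

definition n4_mat :: "real^7^7" where
  "n4_mat = vector
     [vector [-1, 0, 0, 0,1,0,0],
      vector [ 0,-1, 0, 0,1,0,0],
      vector [ 0, 0,-1, 0,1,0,0],
      vector [ 0, 0, 0,-1,1,0,0],
      vector [-1,-1,-1,-1,2,0,1],
      vector [-1,-1,-1,-1,2,1,0],
      vector [ 0, 0, 0, 0,1,0,0]]"

definition p5_mat :: "real^7^7" where
  "p5_mat = vector
     [vector [-1, 0,-1,-1,0,1,1],
      vector [-1,-1, 0,-1,0,1,1],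
      vector [-1,-1,-1, 0,0,1,1],
      vector [ 0,-1,-1,-1,0,1,1],
      vector [-1,-1,-1,-1,0,2,1],
      vector [-1,-1,-1,-1,0,1,2],
      vector [-2,-2,-2,-2,1,2,2]]"

lemma act_p0:
  "act p0_mat x = x"
proof -
  have "map_matrix complex_of_real p0_mat = mat 1"
    by (simp add: p0_mat_def vec_eq_iff mat_def)
  then show ?thesis by (simp add: act_def)
qed

lemma act_n4:
  assumes "vector [a,b,c,d,e,f,g] \<in> V"
  shows "act n4_mat (vector [a,b,c,d,e,f,g]) =
    vector [e - a, e - b, e - c, e - d, 1 + e - f, 1 + e - g, e]"
proof -
  have "e + f + g - a - b - c - d = 1"
    using assms by (simp add: V_def)
  then have g: "g = 1 + a + b + c + d - e - f" by (simp add: algebra_simps)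
  show ?thesis
    by (simp add: act_def n4_mat_def vec_eq_iff matrix_vector_mult_def forall_7 sum_7 g)
qed

lemma act_p5:
  assumes "vector [a,b,c,d,e,f,g] \<in> V"
  shows "act p5_mat (vector [a,b,c,d,e,f,g]) =
    vector [1 + b - e, 1 + c - e, 1 + d - e, 1 + a - e, 1 + f - e, 1 + g - e, 2 - e]"
proof -
  have "e + f + g - a - b - c - d = 1"
    using assms by (simp add: V_def)
  then have g: "g = 1 + a + b + c + d - e - f" by (simp add: algebra_simps)
  show ?thesis
    by (simp add: act_def p5_mat_def vec_eq_iff matrix_vector_mult_def forall_7 sum_7 g)
qed


subsection \<open>Hamming type\<close>

definition M6 :: "real \<Rightarrow> 6 \<Rightarrow> 6 \<Rightarrow> real^6^6" where
  "M6 \<epsilon> i j = (\<chi> r s. if {r, s} = {i, j} then \<epsilon> else swap_mat i j $ r $ s)"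

text \<open>
  These conditions determine \<open>\<theta>\<close> uniquely on \<open>M_K\<close>, so the choice in the definition of \<open>theta\<close>
  only concerns its irrelevant values outside \<open>M_K\<close>.
\<close>

definition is_theta :: "(real^7^7 \<Rightarrow> real^6^6) \<Rightarrow> bool" where
  "is_theta \<theta> \<longleftrightarrow>
     \<theta> \<in> hom (GL\<lparr>carrier := M_K\<rparr>) GL \<and> inj_on \<theta> M_K \<and>
     (\<forall>i\<in>{2..6}. \<theta> (S_mat ** swap_mat (of_nat i) (of_nat (i + 1)) ** matrix_inv S_mat)
                   = M6 1 (of_nat (i - 1)) (of_nat i)) \<and>
     \<theta> (swap_mat 1 2) = M6 (-1) 2 3"

definition theta :: "real^7^7 \<Rightarrow> real^6^6" where
  "theta = (SOME \<theta>. is_theta \<theta>)"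

definition omega0 :: "real^6" where
  "omega0 = (\<chi> i. 1)"

definition hamming_dist :: "real^7^7 \<Rightarrow> real^7^7 \<Rightarrow> nat" where
  "hamming_dist \<mu> \<nu> =
     card {i. (matrix_inv (theta \<mu>) *v omega0) $ i \<noteq> (matrix_inv (theta \<nu>) *v omega0) $ i}"

definition hamming_type :: "real^7^7 \<Rightarrow> real^7^7 \<Rightarrow> real^7^7 \<Rightarrow> nat list" where
  "hamming_type \<mu> \<nu> \<rho> = sort [hamming_dist \<mu> \<nu>, hamming_dist \<mu> \<rho>, hamming_dist \<nu> \<rho>]"

end

theory Submission imports Defs
begin

text \<open>
  Write \<open>K(a;b,c,d;e,f,g)\<close> as a sum of two regularised balanced series. Expanding part of each series by the
  convolution form of Euler's transformation and summing the inner series by the nonterminating form of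
  Saalschuetz's theorem gives both series in terms of one symmetric double series, and the double series
  cancel in \<open>K\<close>: hence \<open>K(a;b,c,d;e,f,g) = K(a;e-c,e-b,d;e,f-\<beta>,g-\<beta>)\<close> with \<open>\<beta> = b+c-e\<close>, the invariance under \<open>G_K\<close>.

  For numbers \<open>A_i\<close>, \<open>E_j\<close> with \<open>\<Sum>(E_i - A_i) = 2\<close>, consider \<open>\<phi>(t) = \<Prod> \<Gamma>(A_i+t) / \<Gamma>(E_i+t)\<close>. Its partial fraction
  expansion has two consequences: the suitably normalised series \<open>g_i\<close> of residues of \<open>\<phi>\<close> along \<open>-A_i-k\<close> satisfy
  \<open>\<Sum> \<rho>_i g_i = 0\<close>, and the series \<open>f_j\<close> of the values of \<open>\<phi>\<close> along \<open>n+1-E_j\<close> satisfy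
  \<open>f_j = \<Sum> \<rho>_i g_i cot \<pi>(A_i - E_j)\<close>, where \<open>\<rho>_i\<close> is a quotient of products of sines. Up to Gamma factors \<open>f_j + g_i\<close>
  is a value of \<open>K\<close>, and in a frame \<open>(A, E)\<close> adapted to \<open>x\<close> the three values in the theorem belong to
  \<open>f_1 + g_1\<close>, \<open>f_2 + g_2\<close>, \<open>f_3 + g_3\<close>. Eliminating the \<open>f_j\<close> and one \<open>g_i\<close> reduces the relation at generic \<open>x\<close> to a
  trigonometric identity for the coefficients \<open>\<gamma>\<close>; continuity along a line extends it to all of \<open>V\<close>.

  For the Hamming type, in the coordinates \<open>\<alpha>_i = y_(i+1) - y_1/2\<close> with \<open>x = S y\<close> the group \<open>M_K\<close> acts linearly by signed
  permutations; this action is \<open>\<theta>\<close>, and words in the generators give its values at \<open>n_4\<close> and \<open>p_5\<close>.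
\<close>

subsection \<open>Growth of Pochhammer symbols and reciprocal Gamma values\<close>

text \<open>The relation is claimed at every point of \<open>V\<close>, also where Gamma factors
  have poles. The invariance of \<open>K\<close> is therefore proved in regularised form for all
  parameters, while the partial fractions need nonintegral differences and hold only at generic
  points; the passage to all of \<open>V\<close> requires term estimates that are uniform on bounded
  sets of parameters. The value 2 of \<Sum>(E_i - A_i) is the equation of \<open>V\<close> in the
  frame. It gives \<phi>(t) the decay t^(-2), so t \<phi>(t) vanishes at infinity and the residues
  sum to zero. The cotangents appear because 1/\<Gamma>(E_j + t) kills \<phi> on the other half of
  the lattice 1 - E_j + n: the one-sided sum f_j is already a two-sided one. With g_4 eliminated,
  the coefficients of g_1, g_2, g_3 are shown to vanish separately; the three conditions are cyclic
  copies of a single identity. The frame is A = (a, f-c, d, f-b), E = (1, e+f-b-c, g+f-b-c, f); one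
  use of the invariance of \<open>K\<close> takes each of the three values in the theorem to a value
  f_i + g_i of it.\<close>

text \<open>Keeping Re w instead of \<open>norm w\<close> in the linear term is what gives products
  over w = (z-1)/(j+1) the sharp growth exponent Re z - 1.\<close>

lemma norm_one_plus_le_exp:
  fixes w :: complex
  shows "norm (1 + w) \<le> exp (Re w + (norm w)\<^sup>2 / 2)"
proof -
  have "(norm (1 + w))\<^sup>2 = 1 + (2 * Re w + (norm w)\<^sup>2)"
    unfolding cmod_power2 by (simp add: power2_eq_square algebra_simps)
  also have "\<dots> \<le> exp (2 * Re w + (norm w)\<^sup>2)" by (rule exp_ge_add_one_self)
  also have "\<dots> = (exp (Re w + (norm w)\<^sup>2 / 2))\<^sup>2"
    by (simp add: exp_double [symmetric] algebra_simps)
  finally show ?thesis by (rule power2_le_imp_le) simp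
qed

text \<open>Since 1/(1+w) = 1 + v with v = -w/(1+w) = -w + O(w^2), the upper bound for
  \<open>norm (1 + v)\<close> is a lower bound for \<open>norm (1 + w)\<close> with the same linear
  term. The radius 1/2 keeps 1 + w away from zero.\<close>

lemma inverse_norm_one_plus_le_exp:
  fixes w :: complex
  assumes "norm w \<le> 1 / 2"
  shows "1 / norm (1 + w) \<le> exp (- Re w + 4 * (norm w)\<^sup>2)"
proof -
  define v where "v = - w / (1 + w)"
  have "1 \<le> norm (1 + w) + norm w"
    using norm_triangle_ineq4 [of "1 + w" w] by simp
  with assms have half: "1 / 2 \<le> norm (1 + w)" by simp
  then have nz: "1 + w \<noteq> 0" by auto
  have v1: "1 + v = 1 / (1 + w)" and v2: "v = - w + w\<^sup>2 / (1 + w)"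
    using nz by (auto simp: v_def field_simps power2_eq_square)
  have q: "norm (w\<^sup>2 / (1 + w)) \<le> 2 * (norm w)\<^sup>2"
  proof -
    have "(norm w)\<^sup>2 \<le> (norm w)\<^sup>2 * (2 * norm (1 + w))"
      using half by (intro mult_le_cancel_left1 [THEN iffD2]) auto
    then show ?thesis
      using half nz by (simp add: norm_divide norm_power divide_le_eq algebra_simps)
  qed
  have "Re v = - Re w + Re (w\<^sup>2 / (1 + w))"
    by (simp add: v2)
  also have "\<dots> \<le> - Re w + 2 * (norm w)\<^sup>2"
    using q complex_Re_le_cmod [of "w\<^sup>2 / (1 + w)"] by linarith
  finally have rv: "Re v \<le> - Re w + 2 * (norm w)\<^sup>2" .
  have "norm v \<le> 2 * norm w"
  proof -
    have "norm w \<le> norm w * (2 * norm (1 + w))"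
      using half by (intro mult_le_cancel_left1 [THEN iffD2]) auto
    then show ?thesis
      using half nz by (simp add: v_def norm_divide divide_le_eq algebra_simps)
  qed
  then have "(norm v)\<^sup>2 \<le> (2 * norm w)\<^sup>2" by (rule power_mono) simp
  then have nv: "(norm v)\<^sup>2 / 2 \<le> 2 * (norm w)\<^sup>2" by (simp add: power_mult_distrib)
  have "1 / norm (1 + w) = norm (1 + v)" by (simp add: v1 norm_divide)
  also have "\<dots> \<le> exp (Re v + (norm v)\<^sup>2 / 2)" by (rule norm_one_plus_le_exp)
  also have "\<dots> \<le> exp (- Re w + 4 * (norm w)\<^sup>2)" using rv nv by simp
  finally show ?thesis .
qed

lemma sum_inverse_squares_le: "(\<Sum>j<k. 1 / (real j + 1)\<^sup>2) \<le> 2"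
proof -
  have "(\<Sum>j<k. 1 / (real j + 1)\<^sup>2) \<le> 2 - 1 / real k"
  proof (induction k)
    case (Suc k)
    have "1 / (x + 1)\<^sup>2 \<le> 1 / x - 1 / (x + 1)" if "x > 0" for x :: real
      using that by (simp add: divide_simps) (simp add: power2_eq_square algebra_simps)
    from this [of "real k"] show ?case using Suc
      by (cases "k = 0") (auto simp: add.commute)
  qed simp
  also have "\<dots> \<le> 2" by simp
  finally show ?thesis .
qed

lemma harm_ln_bounds: "\<bar>harm k - ln (real k + 1)\<bar> \<le> 1"
proof (cases k)
  case (Suc n)
  have "harm (Suc n) - ln (real (Suc n)) \<le> harm (Suc 0) - ln (real (Suc 0))"
    using decseq_harm_diff_ln by (rule decseqD) simp
  moreover have "ln (real (Suc n)) \<le> ln (real (Suc n) + 1)" by simp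
  moreover have "harm (Suc 0) - ln (real (Suc 0)) = 1" by (simp add: harm_def)
  ultimately show ?thesis
    using harm_ge_ln [of k] unfolding Suc by linarith
qed (simp add: harm_def)

text \<open>The quotient (z)_k / k! is the product of the factors 1 + (z-1)/(j+1); the linear terms
  add up to Re z - 1 times a harmonic number, the quadratic ones stay bounded. The constant is
  uniform for \<open>norm z \<le> R\<close>, as required for uniform convergence of series in their
  parameters.\<close>

lemma norm_pochhammer_le:
  fixes R :: real
  assumes "R \<ge> 0"
  obtains C where "C > 0"
    "\<And>z k. norm (z :: complex) \<le> R \<Longrightarrow>
       norm (pochhammer z k) \<le> C * fact k * (real k + 1) powr (Re z - 1)"
proof
  let ?C = "exp ((R + 1) + (R + 1)\<^sup>2)"
  show "?C > 0" by simp
  fix z :: complex and k :: nat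
  assume z: "norm z \<le> R"
  have z1: "norm (z - 1) \<le> R + 1" using norm_triangle_ineq4 [of z 1] z by simp
  have r1: "\<bar>Re (z - 1)\<bar> \<le> R + 1" using abs_Re_le_cmod [of "z - 1"] z1 by linarith
  have *: "norm ((z + of_nat j) / (of_nat j + 1))
             \<le> exp (Re (z - 1) / (real j + 1) + (R + 1)\<^sup>2 / 2 * (1 / (real j + 1)\<^sup>2))" for j
  proof -
    have j: "complex_of_real (real j + 1) \<noteq> 0" unfolding of_real_eq_0_iff by simp
    let ?w = "(z - 1) / complex_of_real (real j + 1)"
    have "(z + of_nat j) / (of_nat j + 1) = 1 + ?w"
      using j by (simp add: field_simps)
    then have "norm ((z + of_nat j) / (of_nat j + 1)) \<le> exp (Re ?w + (norm ?w)\<^sup>2 / 2)"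
      by (simp only: norm_one_plus_le_exp)
    also have "Re ?w = Re (z - 1) / (real j + 1)"
      by (rule Re_divide_of_real)
    also have "(norm ?w)\<^sup>2 \<le> (R + 1)\<^sup>2 * (1 / (real j + 1)\<^sup>2)"
      using power_mono [OF z1, of 2]
      by (simp add: norm_divide power_divide divide_right_mono del: of_real_add)
    finally show ?thesis by (simp add: mult.commute)
  qed
  have "norm (pochhammer z k) / fact k = (\<Prod>j<k. norm ((z + of_nat j) / (of_nat j + 1)))"
  proof (induction k)
    case (Suc k)
    have "norm (of_nat k + 1 :: complex) = real k + 1"
      by (metis norm_of_nat of_nat_Suc add.commute)
    then have "norm (pochhammer z (Suc k)) / fact (Suc k)
        = norm (pochhammer z k) / fact k * norm ((z + of_nat k) / (of_nat k + 1))"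
      by (simp add: pochhammer_Suc norm_mult norm_divide add.commute)
    with Suc show ?case by simp
  qed simp
  also have "\<dots> \<le> (\<Prod>j<k. exp (Re (z - 1) / (real j + 1) + (R + 1)\<^sup>2 / 2 * (1 / (real j + 1)\<^sup>2)))"
    using * by (intro prod_mono) auto
  also have "\<dots> = exp (Re (z - 1) * harm k + (R + 1)\<^sup>2 / 2 * (\<Sum>j<k. 1 / (real j + 1)\<^sup>2))"
    by (simp add: exp_sum [symmetric] harm_altdef sum.distrib sum_distrib_left inverse_eq_divide
          del: of_nat_Suc) (simp add: add.commute)
  also have "\<dots> \<le> exp (Re (z - 1) * ln (real k + 1) + ((R + 1) + (R + 1)\<^sup>2))"
  proof -
    have "Re (z - 1) * (harm k - ln (real k + 1)) \<le> (R + 1) * 1"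
    proof -
      have "Re (z - 1) * (harm k - ln (real k + 1)) \<le> \<bar>Re (z - 1)\<bar> * \<bar>harm k - ln (real k + 1)\<bar>"
        by (metis abs_ge_self abs_mult)
      also have "\<dots> \<le> (R + 1) * 1"
        by (rule mult_mono) (use harm_ln_bounds [of k] r1 assms in auto)
      finally show ?thesis .
    qed
    moreover have "(R + 1)\<^sup>2 / 2 * (\<Sum>j<k. 1 / (real j + 1)\<^sup>2) \<le> (R + 1)\<^sup>2 / 2 * 2"
      by (intro mult_left_mono sum_inverse_squares_le) simp
    ultimately show ?thesis by (simp add: algebra_simps)
  qed
  also have "\<dots> = ?C * (real k + 1) powr (Re z - 1)"
    by (simp add: powr_def exp_add)
  finally show "norm (pochhammer z k) \<le> ?C * fact k * (real k + 1) powr (Re z - 1)"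
    by (simp add: divide_le_eq mult_ac)
qed

text \<open>The recursion divides by z + j, which may vanish for small j. Hence compactness bounds
  the values with index up to \<open>m\<close>, and the recursion starts at \<open>m\<close>, where
  z + j stays away from zero for all z with \<open>norm z \<le> R\<close>.\<close>

lemma norm_rGamma_le:
  fixes R :: real
  assumes "R \<ge> 0"
  obtains C where "C > 0"
    "\<And>z k. norm (z :: complex) \<le> R \<Longrightarrow>
       norm (rGamma (of_nat k + z)) \<le> C * (real k + 1) powr (1 - Re z) / fact k"
proof -
  \<comment> \<open>For j \<ge> m this gives \<open>norm (z - 1) / (j + 1) \<le> 1 / 2\<close>, the
    range of the lower estimate for 1 + w.\<close>
  define m where "m = nat \<lceil>2 * (R + 1)\<rceil>"
  have m: "2 * (R + 1) \<le> real m" unfolding m_def by linarith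
  have "continuous_on (cball 0 (R + real m)) (rGamma :: complex \<Rightarrow> complex)"
    by (intro holomorphic_on_imp_continuous_on holomorphic_rGamma)
  then have "compact (rGamma ` cball (0::complex) (R + real m))"
    by (rule compact_continuous_image) simp
  then have "bounded (rGamma ` cball (0::complex) (R + real m))"
    by (rule compact_imp_bounded)
  then obtain B where "B > 0" "\<forall>v\<in>rGamma ` cball (0::complex) (R + real m). norm v \<le> B"
    unfolding bounded_pos by (elim exE conjE)
  then have B: "B > 0" "norm w \<le> R + real m \<Longrightarrow> norm (rGamma (w::complex)) \<le> B" for w
    by auto
  define C1 where "C1 = B * fact m * (real m + 1) powr (R + 1)"
  define C2 where "C2 = B * fact m * exp ((R + 1) * harm m + (R + 1) + 8 * (R + 1)\<^sup>2)"
  have C1: "C1 > 0" using B by (simp add: C1_def)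
  have C2: "C2 > 0" using B by (simp add: C2_def)
  have "norm (rGamma (of_nat k + z)) \<le> max C1 C2 * (real k + 1) powr (1 - Re z) / fact k"
    if z: "norm z \<le> R" for z :: complex and k
  proof (cases "k \<le> m")
    case True
    have rz: "\<bar>Re z\<bar> \<le> R" using abs_Re_le_cmod [of z] z by linarith
    have "norm (rGamma (of_nat k + z)) \<le> B"
      using True z norm_triangle_ineq [of "of_nat k" z] by (intro B) simp
    moreover have "B * fact k \<le> C1 * (real k + 1) powr (1 - Re z)"
    proof -
      have "1 = (real k + 1) powr (R + 1) * (real k + 1) powr (- R - 1)"
        unfolding powr_add [symmetric] by simp
      also have "\<dots> \<le> (real m + 1) powr (R + 1) * (real k + 1) powr (1 - Re z)"
        using True rz assms by (intro mult_mono powr_mono2 powr_mono) auto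
      finally have "B * fact k * 1 \<le> B * fact m * ((real m + 1) powr (R + 1) * (real k + 1) powr (1 - Re z))"
        using True B by (intro mult_mono fact_mono) auto
      then show ?thesis by (simp add: C1_def mult_ac)
    qed
    moreover have "C1 * (real k + 1) powr (1 - Re z) \<le> max C1 C2 * (real k + 1) powr (1 - Re z)"
      by (intro mult_right_mono) auto
    ultimately have "norm (rGamma (of_nat k + z)) * fact k \<le> max C1 C2 * (real k + 1) powr (1 - Re z)"
      by (meson fact_ge_zero mult_right_mono order_trans)
    then show ?thesis by (simp add: le_divide_eq)
  next
    case False
    have z1: "norm (z - 1) \<le> R + 1" using norm_triangle_ineq4 [of z 1] z by simp
    have r1: "\<bar>Re (z - 1)\<bar> \<le> R + 1" using abs_Re_le_cmod [of "z - 1"] z1 by linarith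
    let ?w = "\<lambda>j. (z - 1) / complex_of_real (real j + 1)"
    have *: "(real j + 1) / norm (of_nat j + z) \<le> exp (- Re (z - 1) / (real j + 1) + 4 * (R + 1)\<^sup>2 * (1 / (real j + 1)\<^sup>2))
        \<and> norm (of_nat j + z) > 0" if "m \<le> j" for j
    proof -
      have nw: "norm (?w j) = norm (z - 1) / (real j + 1)"
        by (simp add: norm_divide del: of_real_add)
      have "norm (?w j) \<le> 1 / 2"
        unfolding nw using that m z1 by (simp add: divide_le_eq)
      note b = inverse_norm_one_plus_le_exp [OF this]
      have e: "1 + ?w j = (of_nat j + z) / complex_of_real (real j + 1)"
      proof -
        have "complex_of_real (real j + 1) \<noteq> 0" unfolding of_real_eq_0_iff by simp
        then show ?thesis by (simp add: field_simps)
      qed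
      have "(real j + 1) / norm (of_nat j + z) = 1 / norm (1 + ?w j)"
        unfolding e by (simp add: norm_divide del: of_real_add)
      also note b
      also have "- Re (?w j) = - Re (z - 1) / (real j + 1)" by (simp only: Re_divide_of_real minus_divide_left)
      also have "exp (- Re (z - 1) / (real j + 1) + 4 * (norm (?w j))\<^sup>2)
          \<le> exp (- Re (z - 1) / (real j + 1) + 4 * (R + 1)\<^sup>2 * (1 / (real j + 1)\<^sup>2))"
        using power_mono [OF z1, of 2] unfolding nw by (simp add: power_divide divide_right_mono)
      finally have 1: "(real j + 1) / norm (of_nat j + z) \<le> exp (- Re (z - 1) / (real j + 1) + 4 * (R + 1)\<^sup>2 * (1 / (real j + 1)\<^sup>2))" .
      have "norm (of_nat j :: complex) - norm z \<le> norm (of_nat j + z)"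
        by (rule norm_diff_ineq)
      then have "norm (of_nat j + z) > 0" using that m z assms by (simp del: zero_less_norm_iff)
      with 1 show ?thesis by blast
    qed
    have ind: "norm (rGamma (of_nat k + z)) * fact k \<le>
        B * fact m * exp (- Re (z - 1) * (harm k - harm m) + 4 * (R + 1)\<^sup>2 * (\<Sum>j=m..<k. 1 / (real j + 1)\<^sup>2))"
      if "m \<le> k" for k using that
    proof (induction k rule: dec_induct)
      case base
      then show ?case
        using z norm_triangle_ineq [of "of_nat m" z] by (simp add: B mult_right_mono)
    next
      case (step j)
      note b = * [OF step.hyps(1)]
      have "(of_nat j + z) * rGamma (of_nat j + z + 1) = rGamma (of_nat j + z)"
        by (rule rGamma_plus1)
      then have "rGamma (of_nat (Suc j) + z) = rGamma (of_nat j + z) / (of_nat j + z)"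
        using b by (simp add: field_simps)
      then have "norm (rGamma (of_nat (Suc j) + z)) * fact (Suc j) =
          (norm (rGamma (of_nat j + z)) * fact j) * ((real j + 1) / norm (of_nat j + z))"
        by (simp add: norm_divide field_simps)
      also have "\<dots> \<le> (B * fact m * exp (- Re (z - 1) * (harm j - harm m) + 4 * (R + 1)\<^sup>2 * (\<Sum>j=m..<j. 1 / (real j + 1)\<^sup>2)))
         * exp (- Re (z - 1) / (real j + 1) + 4 * (R + 1)\<^sup>2 * (1 / (real j + 1)\<^sup>2))"
        by (rule mult_mono [OF step.IH conjunct1 [OF b]]) (use B in auto)
      also have "\<dots> = B * fact m * exp (- Re (z - 1) * (harm (Suc j) - harm m) + 4 * (R + 1)\<^sup>2 * (\<Sum>j=m..<Suc j. 1 / (real j + 1)\<^sup>2))"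
        using step.hyps by (simp add: harm_Suc exp_add [symmetric] algebra_simps divide_inverse)
      finally show ?case .
    qed
    have "(\<Sum>j=m..<k. 1 / (real j + 1)\<^sup>2) \<le> (\<Sum>j<k. 1 / (real j + 1)\<^sup>2)"
      by (intro sum_mono2) auto
    also have "\<dots> \<le> 2" by (rule sum_inverse_squares_le)
    finally have "4 * (R + 1)\<^sup>2 * (\<Sum>j=m..<k. 1 / (real j + 1)\<^sup>2) \<le> 4 * (R + 1)\<^sup>2 * 2"
      by (intro mult_left_mono) auto
    moreover have "- Re (z - 1) * (harm k - ln (real k + 1)) \<le> (R + 1) * 1"
    proof -
      have "- Re (z - 1) * (harm k - ln (real k + 1)) \<le> \<bar>- Re (z - 1)\<bar> * \<bar>harm k - ln (real k + 1)\<bar>"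
        by (metis abs_ge_self abs_mult)
      also have "\<dots> \<le> (R + 1) * 1"
        by (rule mult_mono) (use harm_ln_bounds [of k] r1 assms in auto)
      finally show ?thesis .
    qed
    moreover have "Re (z - 1) * harm m \<le> (R + 1) * harm m"
      using r1 by (intro mult_right_mono) (auto simp: harm_nonneg)
    ultimately have "exp (- Re (z - 1) * (harm k - harm m) + 4 * (R + 1)\<^sup>2 * (\<Sum>j=m..<k. 1 / (real j + 1)\<^sup>2))
       \<le> exp (- Re (z - 1) * ln (real k + 1) + ((R + 1) * harm m + (R + 1) + 8 * (R + 1)\<^sup>2))"
      unfolding exp_le_cancel_iff by (simp add: algebra_simps)
    also have "\<dots> = exp ((R + 1) * harm m + (R + 1) + 8 * (R + 1)\<^sup>2) * (real k + 1) powr (1 - Re z)"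
      by (simp add: powr_def exp_add [symmetric] algebra_simps)
    finally have e: "exp (- Re (z - 1) * (harm k - harm m) + 4 * (R + 1)\<^sup>2 * (\<Sum>j=m..<k. 1 / (real j + 1)\<^sup>2)) \<le> exp ((R + 1) * harm m + (R + 1) + 8 * (R + 1)\<^sup>2) * (real k + 1) powr (1 - Re z)"
      (is "?e \<le> ?f") .
    have "norm (rGamma (of_nat k + z)) * fact k \<le> C2 * (real k + 1) powr (1 - Re z)"
    proof -
      have "norm (rGamma (of_nat k + z)) * fact k \<le> B * fact m * ?e"
        using ind [of k] False by simp
      also have "\<dots> \<le> B * fact m * ?f"
        using e B by (intro mult_left_mono) auto
      finally show ?thesis by (simp add: C2_def mult_ac)
    qed
    also have "\<dots> \<le> max C1 C2 * (real k + 1) powr (1 - Re z)"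
      by (intro mult_right_mono) auto
    finally show ?thesis by (simp add: le_divide_eq)
  qed
  moreover have "max C1 C2 > 0" using C1 by simp
  ultimately show thesis using that by blast
qed

section \<open>Asymptotics of Pochhammer symbols and shifted reciprocal Gamma values\<close>

lemma of_nat_powr_eq_mult:
  assumes "n \<noteq> 0"
  shows "of_nat n powr z = of_nat n powr (z - 1) * (of_nat n :: complex)"
  using assms by (simp add: powr_def exp_diff algebra_simps exp_of_real)

text \<open>\<open>rGamma_series\<close> contains the Pochhammer symbol of length n + 1; dividing by
  z/n + 1 removes its last factor together with one power of n.\<close>

lemma pochhammer_asymp:
  fixes z :: complex
  shows "(\<lambda>n. pochhammer z n / (fact n * of_nat n powr (z - 1))) \<longlonglongrightarrow> rGamma z"
proof -
  have "(\<lambda>n. z / of_nat n + 1) \<longlonglongrightarrow> 0 + 1"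
    by (intro tendsto_add tendsto_const lim_const_over_n)
  then have A: "(\<lambda>n. rGamma_series z n / (z / of_nat n + 1)) \<longlonglongrightarrow> rGamma z / (0 + 1)"
    by (intro tendsto_divide rGamma_series_LIMSEQ) auto
  have B: "\<forall>\<^sub>F n in sequentially. rGamma_series z n / (z / of_nat n + 1)
      = pochhammer z n / (fact n * of_nat n powr (z - 1))"
  proof (rule eventually_sequentiallyI [of "nat \<lceil>norm z\<rceil> + 1"])
    fix n assume "nat \<lceil>norm z\<rceil> + 1 \<le> n"
    then have n: "norm z < real n" by linarith
    then have n0: "n \<noteq> 0" by (cases n) auto
    have nz: "z + of_nat n \<noteq> 0"
    proof
      assume "z + of_nat n = 0"
      then have "norm z = real n" by (metis add_eq_0_iff2 norm_minus_cancel norm_of_nat)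
      with n show False by simp
    qed
    have "exp (z * of_real (ln (real n))) = of_nat n powr z"
      using n0 by (simp add: powr_def)
    also have "\<dots> = of_nat n powr (z - 1) * of_nat n"
      using n0 by (rule of_nat_powr_eq_mult)
    finally have e: "exp (z * of_real (ln (real n))) = of_nat n powr (z - 1) * of_nat n" .
    have "z / of_nat n + 1 = (z + of_nat n) / of_nat n"
      using n0 by (simp add: field_simps)
    then show "rGamma_series z n / (z / of_nat n + 1) = pochhammer z n / (fact n * of_nat n powr (z - 1))"
      using n0 nz by (simp add: rGamma_series_def pochhammer_Suc e)
  qed
  from Lim_transform_eventually [OF A B] show ?thesis by simp
qed

text \<open>For Re z > 0 the claim follows from the previous limit by division, as
  \<open>rGamma z\<close> is nonzero. The functional equation then carries the limit from z + 1 down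
  to z, which also reaches the zeros of \<open>rGamma\<close>.\<close>

lemma rGamma_asymp:
  fixes z :: complex
  shows "(\<lambda>n. rGamma (of_nat n + z) * fact n * of_nat n powr (z - 1)) \<longlonglongrightarrow> 1"
proof -
  have pos: "(\<lambda>n. rGamma (of_nat n + z) * fact n * of_nat n powr (z - 1)) \<longlonglongrightarrow> 1"
    if "Re z > 0" for z :: complex
  proof -
    have nz: "z \<notin> \<int>\<^sub>\<le>\<^sub>0" using that by (auto elim!: nonpos_Ints_cases)
    then have r: "rGamma z \<noteq> 0" by (simp add: rGamma_eq_zero_iff)
    have "(\<lambda>n. rGamma z / (pochhammer z n / (fact n * of_nat n powr (z - 1)))) \<longlonglongrightarrow> rGamma z / rGamma z"
      by (intro tendsto_divide tendsto_const pochhammer_asymp r)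
    moreover have "rGamma z / (pochhammer z n / (fact n * of_nat n powr (z - 1))) = rGamma (of_nat n + z) * fact n * of_nat n powr (z - 1)" for n
    proof -
      have "pochhammer z n \<noteq> 0" using nz by (auto simp: pochhammer_eq_0_iff)
      moreover have "rGamma z = pochhammer z n * rGamma (z + of_nat n)"
        using pochhammer_rGamma [of z n] by simp
      ultimately show ?thesis by (simp add: field_simps add.commute)
    qed
    ultimately show ?thesis using r by simp
  qed
  have down: "(\<lambda>n. rGamma (of_nat n + z) * fact n * of_nat n powr (z - 1)) \<longlonglongrightarrow> 1"
    if "(\<lambda>n. rGamma (of_nat n + (z + 1)) * fact n * of_nat n powr (z + 1 - 1)) \<longlonglongrightarrow> 1" for z :: complex
  proof -
    have "(\<lambda>n. z / of_nat n + 1) \<longlonglongrightarrow> 0 + 1"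
      by (intro tendsto_add tendsto_const lim_const_over_n)
    then have A: "(\<lambda>n. rGamma (of_nat n + (z + 1)) * fact n * of_nat n powr (z + 1 - 1) * (z / of_nat n + 1)) \<longlonglongrightarrow> 1 * (0 + 1)"
      by (intro tendsto_mult that)
    have B: "\<forall>\<^sub>F n in sequentially. rGamma (of_nat n + (z + 1)) * fact n * of_nat n powr (z + 1 - 1) * (z / of_nat n + 1)
        = rGamma (of_nat n + z) * fact n * of_nat n powr (z - 1)"
    proof (rule eventually_sequentiallyI [of 1])
      fix n :: nat assume "1 \<le> n"
      then have n0: "n \<noteq> 0" by simp
      have "(of_nat n + z) * rGamma (of_nat n + z + 1) = rGamma (of_nat n + z)"
        by (rule rGamma_plus1)
      moreover note of_nat_powr_eq_mult [OF n0, of z]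
      ultimately show "rGamma (of_nat n + (z + 1)) * fact n * of_nat n powr (z + 1 - 1) * (z / of_nat n + 1)
        = rGamma (of_nat n + z) * fact n * of_nat n powr (z - 1)"
        using n0 by (simp add: field_simps add.assoc)
    qed
    from Lim_transform_eventually [OF A B] show ?thesis by simp
  qed
  define m where "m = nat \<lceil>norm z\<rceil> + 1"
  have "(\<lambda>n. rGamma (of_nat n + (z + of_nat j)) * fact n * of_nat n powr (z + of_nat j - 1)) \<longlonglongrightarrow> 1"
    if "j \<le> m" for j using that
  proof (induction rule: inc_induct)
    case base
    have "Re (z + of_nat m) > 0"
      using abs_Re_le_cmod [of z] unfolding m_def by simp linarith
    then show ?case by (rule pos)
  next
    case (step j)
    then show ?case using down [of "z + of_nat j"] by (simp add: add_ac)
  qed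
  from this [of 0] show ?thesis by simp
qed

text \<open>These are the coefficients in Euler's transformation 2F1(b,c;e;x) = (1-x)^(e-b-c)
  2F1(e-b,e-c;e;x), multiplied by (e)_k. The quotient (e)_k / (e)_j is written as (e+j)_(k-j), so
  that e may be a nonpositive integer. The proof is by creative telescoping in k.\<close>

lemma pochhammer_euler_convolution:
  fixes b c e :: complex
  shows "pochhammer b k * pochhammer c k / fact k =
    (\<Sum>j\<le>k. pochhammer (e - b) j * pochhammer (e - c) j / fact j * pochhammer (e + of_nat j) (k - j)
       * (pochhammer (b + c - e) (k - j) / fact (k - j)))"
proof -
  define T where "T k j = pochhammer (e - b) j * pochhammer (e - c) j / fact j * pochhammer (e + of_nat j) (k - j)
       * (pochhammer (b + c - e) (k - j) / fact (k - j))" for k j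
  \<comment> \<open>\<open>G\<close> is the certificate: the first-order recurrence in k, applied to
    the summand, is a difference of \<open>G\<close> in j. At j = 0 the factor 1/(j-1)! stands for
    zero, while truncated subtraction would read it as 1; hence the case distinction.\<close>
  define G where "G k j = (if j = 0 then 0 else - (pochhammer (e - b) j * pochhammer (e - c) j
       / fact (j - 1) * pochhammer (e + of_nat j - 1) (k + 1 - j) * (pochhammer (b + c - e) (k + 1 - j) / fact (k + 1 - j))))" for k j
  have *: "of_nat (k + 1) * T (k + 1) j - (b + of_nat k) * (c + of_nat k) * T k j = G k (j + 1) - G k j" if jk: "j \<le> k" for j k
  proof -
    obtain m where m: "k = j + m" using jk le_Suc_ex by blast
    let ?P = "pochhammer (e - b) j * pochhammer (e - c) j / fact j * pochhammer (e + of_nat j) m * (pochhammer (b + c - e) m / fact m)"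
    have m1: "(of_nat m + 1 :: complex) \<noteq> 0" by (metis of_nat_Suc of_nat_neq_0 add.commute)
    have "T k j = ?P" by (simp add: T_def m)
    moreover have "T (k + 1) j = ?P * ((e + of_nat (j + m)) * (b + c - e + of_nat m) / (of_nat m + 1))"
      using m1 by (simp add: T_def m Suc_diff_le pochhammer_Suc field_simps)
    moreover have "G k (j + 1) = - ?P * ((e - b + of_nat j) * (e - c + of_nat j))"
      by (simp add: G_def m pochhammer_Suc)
    moreover have "G k j = - ?P * (of_nat j * (e + of_nat j - 1) * (b + c - e + of_nat m) / (of_nat m + 1))"
    proof (cases "j = 0")
      case False
      have "pochhammer (e + of_nat j - 1) (Suc m) = (e + of_nat j - 1) * pochhammer (e + of_nat j) m"
        by (simp add: pochhammer_rec)
      moreover have "k + 1 - j = Suc m" by (simp add: m)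
      moreover have "fact j = (of_nat j * fact (j - 1) :: complex)"
        using False by (simp add: fact_reduce)
      ultimately show ?thesis
        using False m1 by (simp add: G_def pochhammer_Suc [of "b + c - e"]) (simp add: divide_simps add.commute [of 1])
    qed (simp add: G_def)
    moreover have "of_nat (k + 1) * ((e + of_nat (j + m)) * (b + c - e + of_nat m) / (of_nat m + 1)) - (b + of_nat k) * (c + of_nat k)
       = - ((e - b + of_nat j) * (e - c + of_nat j)) + of_nat j * (e + of_nat j - 1) * (b + c - e + of_nat m) / (of_nat m + 1)"
      using m1 by (simp add: m divide_simps) (simp add: algebra_simps)
    moreover have "N * (P * X) - W * P = - P * Y - (- P * Z)" if "N * X - W = - Y + Z" for N X W P Y Z :: complex
      using that by algebra
    ultimately show ?thesis by (simp only:)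
  qed
  have rec: "of_nat (k + 1) * (\<Sum>j\<le>k + 1. T (k + 1) j) = (b + of_nat k) * (c + of_nat k) * (\<Sum>j\<le>k. T k j)" for k
  proof -
    have "(\<Sum>j\<le>k. of_nat (k + 1) * T (k + 1) j - (b + of_nat k) * (c + of_nat k) * T k j) = (\<Sum>j\<le>k. G k (j + 1) - G k j)"
      using * by (intro sum.cong) auto
    also have "\<dots> = G k (k + 1)"
      using sum_lessThan_telescope [of "G k" "Suc k"] by (simp add: lessThan_Suc_atMost G_def)
    \<comment> \<open>The boundary term is exactly the summand j = k + 1 that the shorter sum over j
      \<le> k misses.\<close>
    also have "\<dots> = - of_nat (k + 1) * T (k + 1) (k + 1)"
      by (simp add: G_def T_def field_simps del: of_nat_Suc)
    finally have "of_nat (k + 1) * (\<Sum>j\<le>k. T (k + 1) j) - (b + of_nat k) * (c + of_nat k) * (\<Sum>j\<le>k. T k j)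
        = - of_nat (k + 1) * T (k + 1) (k + 1)"
      by (simp only: sum_subtractf sum_distrib_left)
    then show ?thesis by (simp add: algebra_simps)
  qed
  have "pochhammer b k * pochhammer c k / fact k = (\<Sum>j\<le>k. T k j)"
  proof (induction k)
    case (Suc k)
    have "of_nat (k + 1) * (pochhammer b (Suc k) * pochhammer c (Suc k) / fact (Suc k)) = (b + of_nat k) * (c + of_nat k) * (pochhammer b k * pochhammer c k / fact k)"
      by (simp add: pochhammer_Suc field_simps del: of_nat_Suc)
    also have "\<dots> = of_nat (k + 1) * (\<Sum>j\<le>k + 1. T (k + 1) j)"
      by (simp only: Suc.IH rec)
    finally show ?case
      by (metis Suc_eq_plus1 mult_cancel_left of_nat_neq_0)
  qed (simp add: T_def)
  then show ?thesis by (simp add: T_def)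
qed

section \<open>Majorants for hypergeometric terms and limits of balanced products\<close>

lemma pochhammer_bound:
  fixes z :: complex
  shows "\<exists>C>0. \<forall>k. norm (pochhammer z k) \<le> C * fact k * (real k + 1) powr (Re z - 1)"
  by (rule norm_pochhammer_le [of "norm z"]) auto

lemma rGamma_bound:
  fixes z :: complex
  shows "\<exists>C>0. \<forall>k. norm (rGamma (of_nat k + z)) \<le> C * (real k + 1) powr (1 - Re z) / fact k"
  by (rule norm_rGamma_le [of "norm z"]) auto

lemma summable_powr_succ:
  fixes p :: real
  assumes "p < - 1"
  shows "summable (\<lambda>k. (real k + 1) powr p)"
proof -
  have "summable (\<lambda>k. real k powr p)" using assms by (simp add: summable_real_powr_iff)
  then have "summable (\<lambda>k. real (Suc k) powr p)" by (subst summable_Suc_iff)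
  then show ?thesis by (simp add: add.commute)
qed

lemma hyp2_term_bound:
  fixes b c f :: complex
  shows "\<exists>C>0. \<forall>k. norm (pochhammer b k * pochhammer c k / fact k * rGamma (of_nat k + f)) \<le> C * (real k + 1) powr (Re (b + c - f) - 1)"
proof -
  obtain B where B: "B > 0" "\<And>k. norm (pochhammer b k) \<le> B * fact k * (real k + 1) powr (Re b - 1)"
    using pochhammer_bound [of b] by blast
  obtain C where C: "C > 0" "\<And>k. norm (pochhammer c k) \<le> C * fact k * (real k + 1) powr (Re c - 1)"
    using pochhammer_bound [of c] by blast
  obtain D where D: "D > 0" "\<And>k. norm (rGamma (of_nat k + f)) \<le> D * (real k + 1) powr (1 - Re f) / fact k"
    using rGamma_bound [of f] by blast
  have "norm (pochhammer b k * pochhammer c k / fact k * rGamma (of_nat k + f)) \<le> (B * C * D) * (real k + 1) powr (Re (b + c - f) - 1)" for k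
  proof -
    have "norm (pochhammer b k * pochhammer c k / fact k * rGamma (of_nat k + f))
      = norm (pochhammer b k) * norm (pochhammer c k) / fact k * norm (rGamma (of_nat k + f))"
      by (simp add: norm_mult norm_divide)
    also have "\<dots> \<le> (B * fact k * (real k + 1) powr (Re b - 1)) * (C * fact k * (real k + 1) powr (Re c - 1)) / fact k
       * (D * (real k + 1) powr (1 - Re f) / fact k)"
      using B C D by (intro mult_mono divide_right_mono) auto
    also have "\<dots> = (B * C * D) * ((real k + 1) powr (Re b - 1) * (real k + 1) powr (Re c - 1) * (real k + 1) powr (1 - Re f))"
      by (simp add: field_simps)
    also have "(real k + 1) powr (Re b - 1) * (real k + 1) powr (Re c - 1) * (real k + 1) powr (1 - Re f) = (real k + 1) powr (Re (b + c - f) - 1)"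
      by (simp add: powr_add [symmetric] algebra_simps)
    finally show ?thesis .
  qed
  then show ?thesis using B C D by (intro exI [of _ "B * C * D"]) simp
qed

text \<open>The instance b = 1 of the previous bound, because (1)_k = k!.\<close>

lemma pochhammer_rGamma_bound:
  fixes c f :: complex
  shows "\<exists>C>0. \<forall>k. norm (pochhammer c k * rGamma (of_nat k + f)) \<le> C * (real k + 1) powr (Re (c - f))"
proof -
  obtain C where C: "C > 0" "\<And>k. norm (pochhammer 1 k * pochhammer c k / fact k * rGamma (of_nat k + f)) \<le> C * (real k + 1) powr (Re (1 + c - f) - 1)"
    using hyp2_term_bound [of 1 c f] by blast
  then show ?thesis by (intro exI [of _ C]) (simp add: pochhammer_fact [symmetric])
qed

subsection \<open>Gauss and nonterminating Saalschuetz summation\<close>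

definition F32_reg :: "complex \<Rightarrow> complex \<Rightarrow> complex \<Rightarrow> complex \<Rightarrow> complex \<Rightarrow> complex" where
  "F32_reg A B C E F =
     (\<Sum>k. pochhammer A k * pochhammer B k * pochhammer C k / fact k * rGamma (of_nat k + E) * rGamma (of_nat k + F))"

lemma hyp3_term_bound:
  fixes a b c e f :: complex
  shows "\<exists>C>0. \<forall>k. norm (pochhammer a k * pochhammer b k * pochhammer c k / fact k * rGamma (of_nat k + e) * rGamma (of_nat k + f))
       \<le> C * (real k + 1) powr (Re (a + b + c - e - f) - 1)"
proof -
  obtain B where B: "B > 0" "\<And>k. norm (pochhammer b k * pochhammer c k / fact k * rGamma (of_nat k + f)) \<le> B * (real k + 1) powr (Re (b + c - f) - 1)"
    using hyp2_term_bound by blast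
  obtain C where C: "C > 0" "\<And>k. norm (pochhammer a k * rGamma (of_nat k + e)) \<le> C * (real k + 1) powr (Re (a - e))"
    using pochhammer_rGamma_bound by blast
  have "norm (pochhammer a k * pochhammer b k * pochhammer c k / fact k * rGamma (of_nat k + e) * rGamma (of_nat k + f))
       \<le> (B * C) * (real k + 1) powr (Re (a + b + c - e - f) - 1)" for k
  proof -
    have "norm (pochhammer a k * pochhammer b k * pochhammer c k / fact k * rGamma (of_nat k + e) * rGamma (of_nat k + f))
        = norm (pochhammer b k * pochhammer c k / fact k * rGamma (of_nat k + f)) * norm (pochhammer a k * rGamma (of_nat k + e))"
      by (simp add: norm_mult norm_divide)
    also have "\<dots> \<le> (B * (real k + 1) powr (Re (b + c - f) - 1)) * (C * (real k + 1) powr (Re (a - e)))"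
      using B C by (intro mult_mono) auto
    also have "\<dots> = (B * C) * ((real k + 1) powr (Re (b + c - f) - 1) * (real k + 1) powr (Re (a - e)))"
      by simp
    also have "(real k + 1) powr (Re (b + c - f) - 1) * (real k + 1) powr (Re (a - e)) = (real k + 1) powr (Re (a + b + c - e - f) - 1)"
      by (simp add: powr_add [symmetric] algebra_simps)
    finally show ?thesis .
  qed
  then show ?thesis using B C by (intro exI [of _ "B * C"]) simp
qed

lemma F32_summable:
  assumes "Re (e + f - a - b - c) > 0"
  shows "summable (\<lambda>k. norm (pochhammer a k * pochhammer b k * pochhammer c k / fact k * rGamma (of_nat k + e) * rGamma (of_nat k + f)))"
proof -
  obtain C where "C > 0" and C:
    "\<And>k. norm (pochhammer a k * pochhammer b k * pochhammer c k / fact k * rGamma (of_nat k + e) * rGamma (of_nat k + f))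
       \<le> C * (real k + 1) powr (Re (a + b + c - e - f) - 1)"
    using hyp3_term_bound by blast
  have "summable (\<lambda>k. C * (real k + 1) powr (Re (a + b + c - e - f) - 1))"
    using assms by (intro summable_mult summable_powr_succ) simp
  then show ?thesis
    by (rule summable_comparison_test') (use C in auto)
qed

lemma tannery_sequentially:
  fixes a :: "nat \<Rightarrow> nat \<Rightarrow> 'a :: {real_normed_algebra, banach}"
  assumes "\<And>k. (\<lambda>n. a k n) \<longlonglongrightarrow> b k" "\<And>k n. N \<le> n \<Longrightarrow> norm (a k n) \<le> M k" "summable M"
  shows "(\<lambda>n. \<Sum>k. a k n) \<longlonglongrightarrow> suminf b" "summable (\<lambda>n. norm (b n))"
proof -
  have "\<forall>\<^sub>F (k, n) in sequentially \<times>\<^sub>F sequentially. norm (a k n) \<le> M k"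
    unfolding eventually_prod_filter using assms(2)
    by (intro exI [of _ "\<lambda>_. True"] exI [of _ "\<lambda>n. N \<le> n"]) (auto intro: eventually_ge_at_top)
  from tannerys_theorem [OF assms(1) this assms(3)]
  show "(\<lambda>n. \<Sum>k. a k n) \<longlonglongrightarrow> suminf b" "summable (\<lambda>n. norm (b n))" by auto
qed

text \<open>With equally many factors of both kinds the factorials in the two asymptotic formulas
  cancel and only a power of n is left. Its exponent separates the two corollaries below, which
  evaluate the boundary terms of telescoping sums.\<close>

lemma pochhammer_rGamma_lists_asymp:
  fixes zs ws :: "complex list"
  assumes "length zs = length ws"
  shows "(\<lambda>n. prod_list (map (\<lambda>z. pochhammer z n) zs) * prod_list (map (\<lambda>w. rGamma (of_nat n + w)) ws)
           / of_nat n powr (sum_list zs - sum_list ws)) \<longlonglongrightarrow> prod_list (map rGamma zs)"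
  using assms
proof (induction zs ws rule: list_induct2)
  case Nil
  show ?case
    by (rule Lim_transform_eventually [where f = "\<lambda>n. 1"], simp, rule eventually_sequentiallyI [of 1]) auto
next
  case (Cons z zs w ws)
  have A: "(\<lambda>n. (prod_list (map (\<lambda>z. pochhammer z n) zs) * prod_list (map (\<lambda>w. rGamma (of_nat n + w)) ws)
           / of_nat n powr (sum_list zs - sum_list ws)) * ((pochhammer z n / (fact n * of_nat n powr (z - 1)))
            * (rGamma (of_nat n + w) * fact n * of_nat n powr (w - 1)))) \<longlonglongrightarrow> prod_list (map rGamma zs) * (rGamma z * 1)"
    by (intro tendsto_mult Cons.IH pochhammer_asymp rGamma_asymp)
  have B: "\<forall>\<^sub>F n in sequentially. (prod_list (map (\<lambda>z. pochhammer z n) zs) * prod_list (map (\<lambda>w. rGamma (of_nat n + w)) ws)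
           / of_nat n powr (sum_list zs - sum_list ws)) * ((pochhammer z n / (fact n * of_nat n powr (z - 1)))
            * (rGamma (of_nat n + w) * fact n * of_nat n powr (w - 1))) =
        prod_list (map (\<lambda>z. pochhammer z n) (z # zs)) * prod_list (map (\<lambda>w. rGamma (of_nat n + w)) (w # ws))
           / of_nat n powr (sum_list (z # zs) - sum_list (w # ws))"
  proof (rule eventually_sequentiallyI [of 1])
    fix n :: nat assume "1 \<le> n"
    then have n: "(of_nat n :: complex) \<noteq> 0" by simp
    have h1: "(of_nat n :: complex) powr (sum_list (z # zs) - sum_list (w # ws)) * of_nat n powr (w - 1)
      = of_nat n powr (sum_list zs - sum_list ws) * of_nat n powr (z - 1)"
      unfolding powr_add [symmetric] by (simp add: algebra_simps)
    have h2: "of_nat n powr p \<noteq> (0 :: complex)" for p using n by simp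
    have quot: "X * Y / P1 * (pz / (F * P2) * (rw * F * P3)) = pz * X * (rw * Y) / P4"
      if "P4 * P3 = P1 * P2" "P1 \<noteq> 0" "P2 \<noteq> 0" "P4 \<noteq> 0" "F \<noteq> 0" for P4 P3 P1 P2 X Y pz F rw :: complex
    proof -
      have "X * Y / P1 * (pz / (F * P2) * (rw * F * P3)) = pz * X * (rw * Y) * (P3 / (P1 * P2))"
        using that by simp
      also have "P3 / (P1 * P2) = 1 / P4"
        using that by (simp add: frac_eq_eq mult.commute)
      finally show ?thesis by simp
    qed
    show "(prod_list (map (\<lambda>z. pochhammer z n) zs) * prod_list (map (\<lambda>w. rGamma (of_nat n + w)) ws)
           / of_nat n powr (sum_list zs - sum_list ws)) * ((pochhammer z n / (fact n * of_nat n powr (z - 1)))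
            * (rGamma (of_nat n + w) * fact n * of_nat n powr (w - 1))) =
        prod_list (map (\<lambda>z. pochhammer z n) (z # zs)) * prod_list (map (\<lambda>w. rGamma (of_nat n + w)) (w # ws))
           / of_nat n powr (sum_list (z # zs) - sum_list (w # ws))"
      unfolding list.map prod_list.Cons by (rule quot [OF h1 h2 h2 h2]) simp
  qed
  from Lim_transform_eventually [OF A B] show ?case by (simp add: mult_ac)
qed

lemma pochhammer_rGamma_lists_tendsto:
  fixes zs ws :: "complex list"
  assumes "length zs = length ws" "sum_list zs = sum_list ws"
  shows "(\<lambda>n. prod_list (map (\<lambda>z. pochhammer z n) zs) * prod_list (map (\<lambda>w. rGamma (of_nat n + w)) ws))
           \<longlonglongrightarrow> prod_list (map rGamma zs)"
  by (rule Lim_transform_eventually [OF pochhammer_rGamma_lists_asymp [OF assms(1)]],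
      rule eventually_sequentiallyI [of 1]) (auto simp: assms(2))

lemma pochhammer_rGamma_lists_tendsto_0:
  fixes zs ws :: "complex list"
  assumes "length zs = length ws" "Re (sum_list zs) < Re (sum_list ws)"
  shows "(\<lambda>n. prod_list (map (\<lambda>z. pochhammer z n) zs) * prod_list (map (\<lambda>w. rGamma (of_nat n + w)) ws)) \<longlonglongrightarrow> 0"
proof -
  let ?s = "sum_list zs - sum_list ws"
  have "(\<lambda>n. real n powr Re ?s) \<longlonglongrightarrow> 0"
    using assms(2) by (intro tendsto_neg_powr filterlim_real_sequentially) simp
  then have "(\<lambda>n. norm ((of_nat n :: complex) powr ?s)) \<longlonglongrightarrow> 0"
    by (rule Lim_transform_eventually, intro eventually_sequentiallyI [of 1])
       (auto simp: norm_powr_real_powr)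
  then have "(\<lambda>n. (of_nat n :: complex) powr ?s) \<longlonglongrightarrow> 0"
    by (rule tendsto_norm_zero_cancel)
  then have "(\<lambda>n. prod_list (map (\<lambda>z. pochhammer z n) zs) * prod_list (map (\<lambda>w. rGamma (of_nat n + w)) ws)
           / of_nat n powr ?s * of_nat n powr ?s) \<longlonglongrightarrow> prod_list (map rGamma zs) * 0"
    by (intro tendsto_mult pochhammer_rGamma_lists_asymp assms(1))
  then have A: "(\<lambda>n. prod_list (map (\<lambda>z. pochhammer z n) zs) * prod_list (map (\<lambda>w. rGamma (of_nat n + w)) ws)
           / of_nat n powr ?s * of_nat n powr ?s) \<longlonglongrightarrow> 0" by simp
  show ?thesis
    by (rule Lim_transform_eventually [OF A], rule eventually_sequentiallyI [of 1]) auto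
qed

section \<open>Inhomogeneous contiguous relations for balanced 3F2 series\<close>

lemma rGamma_of_nat_plus_one: "rGamma (of_nat n + 1 :: complex) = 1 / fact n"
  using Gamma_fact [of n, where 'a = complex] by (simp add: rGamma_inverse_Gamma inverse_eq_divide add.commute)

text \<open>The combination of the k-th terms is a difference of a certificate \<open>G\<close>.
  Because the series is balanced, \<open>G\<close> does not tend to zero but to the product on the
  right-hand side.\<close>

lemma F32_contiguous_1:
  fixes a b c e f :: complex
  assumes bal: "e + f = 1 + a + b + c"
  shows "(1 + a - f) * F32_reg a b c e f - (e - b) * (e - c) * F32_reg (a + 1) b c (e + 1) f
     = - rGamma (a + 1) * rGamma b * rGamma c"
proof -
  define U where "U k = pochhammer a k * pochhammer b k * pochhammer c k / fact k * rGamma (of_nat k + e) * rGamma (of_nat k + f)" for k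
  define V where "V k = pochhammer (a + 1) k * pochhammer b k * pochhammer c k / fact k * rGamma (of_nat k + (e + 1)) * rGamma (of_nat k + f)" for k
  \<comment> \<open>The shifted indexing makes \<open>G 0 = 0\<close>, so the telescoped sum is the
    limit at infinity alone.\<close>
  define G where "G k = (case k of 0 \<Rightarrow> 0 | Suc k \<Rightarrow>
     - (pochhammer (a + 1) k * pochhammer b (Suc k) * pochhammer c (Suc k) / fact k * rGamma (of_nat k + f) * rGamma (of_nat k + (e + 1))))" for k
  have sU: "summable U" and sV: "summable V"
    unfolding U_def V_def
    by (rule summable_norm_cancel, rule F32_summable,
        use arg_cong [OF bal, of Re] in simp)+
  have f: "f = 1 + a + b + c - e" using bal by (simp add: algebra_simps)
  have "(1 + a - f) * U k - (e - b) * (e - c) * V k = G (Suc k) - G k" for k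
  proof (cases k)
    case 0
    have "rGamma e = e * rGamma (e + 1)" by (simp add: rGamma_plus1)
    then show ?thesis by (simp add: 0 U_def V_def G_def f algebra_simps)
  next
    case (Suc i)
    let ?K = "of_nat k :: complex"
    let ?Q = "pochhammer (a + 1) i * pochhammer b k * pochhammer c k / fact k * rGamma (?K + f) * rGamma (?K + e + 1)"
    have rf: "rGamma (of_nat i + f) = (?K + f - 1) * rGamma (?K + f)"
      using rGamma_plus1 [of "of_nat i + f"] by (simp add: Suc add_ac)
    have re: "rGamma (?K + e) = (?K + e) * rGamma (?K + e + 1)"
      by (simp add: rGamma_plus1)
    have fk: "1 / fact i = (?K / fact k :: complex)" by (simp add: Suc del: of_nat_Suc)
    have "U k = ?Q * (a * (?K + e))"
      unfolding U_def re by (simp add: Suc pochhammer_rec [of a] mult_ac)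
    moreover have "V k = ?Q * (a + ?K)"
      unfolding V_def by (simp add: Suc pochhammer_Suc [of "1 + a"] add_ac mult_ac)
    moreover have "G (Suc k) = - ?Q * ((a + ?K) * (b + ?K) * (c + ?K))"
      by (simp add: G_def Suc pochhammer_Suc [of "1 + a"] pochhammer_Suc [of _ "Suc i"] add_ac mult_ac)
    moreover have "G k = - ?Q * (?K * (?K + f - 1) * (?K + e))"
    proof -
      have "G k = - (pochhammer (a + 1) i * pochhammer b k * pochhammer c k * (1 / fact i) * rGamma (of_nat i + f) * rGamma (of_nat i + (e + 1)))"
        by (simp add: G_def Suc)
      also have "of_nat i + (e + 1) = ?K + e" by (simp add: Suc add_ac)
      finally show ?thesis unfolding fk rf re by (simp add: mult_ac)
    qed
    moreover have "(1 + a - f) * (a * (?K + e)) - (e - b) * (e - c) * (a + ?K)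
       = - ((a + ?K) * (b + ?K) * (c + ?K)) + ?K * (?K + f - 1) * (?K + e)"
      unfolding f by (simp add: algebra_simps)
    moreover have "M * (Q * X) - L * (Q * Y) = - Q * Z - (- Q * W)" if "M * X - L * Y = - Z + W" for M L Q X Y Z W :: complex
      using that by algebra
    ultimately show ?thesis by (simp only:)
  qed
  moreover have "G \<longlonglongrightarrow> - rGamma (a + 1) * rGamma b * rGamma c"
  proof -
    \<comment> \<open>One factor is taken out of (b)_(n+1) and of (c)_(n+1), and 1/n! is read as
      \<open>rGamma (n + 1)\<close>. This leaves three Pochhammer symbols against three
      \<open>rGamma\<close> values with equal parameter sums.\<close>
    have "(\<lambda>n. - b * c * (prod_list (map (\<lambda>z. pochhammer z n) [a + 1, b + 1, c + 1]) * prod_list (map (\<lambda>w. rGamma (of_nat n + w)) [1, f, e + 1])))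
           \<longlonglongrightarrow> - b * c * prod_list (map rGamma [a + 1, b + 1, c + 1])"
      by (intro tendsto_mult tendsto_const pochhammer_rGamma_lists_tendsto) (auto simp: f)
    moreover have "- b * c * prod_list (map rGamma [a + 1, b + 1, c + 1]) = - rGamma (a + 1) * rGamma b * rGamma c"
      using rGamma_plus1 [of b, symmetric] rGamma_plus1 [of c, symmetric] by simp
    moreover have "(\<lambda>n. - b * c * (prod_list (map (\<lambda>z. pochhammer z n) [a + 1, b + 1, c + 1]) * prod_list (map (\<lambda>w. rGamma (of_nat n + w)) [1, f, e + 1])))
        = (\<lambda>n. G (Suc n))"
      by (auto simp: G_def rGamma_of_nat_plus_one pochhammer_rec [of b] pochhammer_rec [of c])
    ultimately show ?thesis by (simp only: filterlim_sequentially_Suc [of G, symmetric])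
  qed
  then have "(\<lambda>k. G (Suc k) - G k) sums (- rGamma (a + 1) * rGamma b * rGamma c - G 0)"
    by (rule telescope_sums)
  ultimately have "(\<lambda>k. (1 + a - f) * U k - (e - b) * (e - c) * V k) sums (- rGamma (a + 1) * rGamma b * rGamma c)"
    by (simp add: G_def)
  moreover have "(\<lambda>k. (1 + a - f) * U k - (e - b) * (e - c) * V k) sums ((1 + a - f) * suminf U - (e - b) * (e - c) * suminf V)"
    by (intro sums_diff sums_mult summable_sums sU sV)
  ultimately show ?thesis
    unfolding F32_reg_def U_def V_def by (rule sums_unique2 [symmetric])
qed

text \<open>Meant for the companion series in Saalschuetz's theorem, which is balanced too. The
  certificate carries the linear factor a + c + 1 + k; in the limit it splits into a part with equal
  parameter sums, which converges to the right-hand side, and a part that tends to zero.\<close>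

lemma F32_contiguous_2:
  fixes a b c e f :: complex
  assumes bal: "e + f = 1 + a + b + c"
  shows "F32_reg a b c e f - (e - b) * (f - b) * F32_reg (a + 1) b (c + 1) (e + 1) (f + 1)
     = rGamma (a + 1) * rGamma b * rGamma (c + 1)"
proof -
  define U where "U k = pochhammer a k * pochhammer b k * pochhammer c k / fact k * rGamma (of_nat k + e) * rGamma (of_nat k + f)" for k
  define V where "V k = pochhammer (a + 1) k * pochhammer b k * pochhammer (c + 1) k / fact k * rGamma (of_nat k + (e + 1)) * rGamma (of_nat k + (f + 1))" for k
  define G where "G k = (case k of 0 \<Rightarrow> 0 | Suc k \<Rightarrow>
     (a + c + 1 + of_nat k) * (pochhammer (a + 1) k * pochhammer b (Suc k) * pochhammer (c + 1) k / fact k * rGamma (of_nat k + (e + 1)) * rGamma (of_nat k + (f + 1))))" for k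
  have sU: "summable U" and sV: "summable V"
    unfolding U_def V_def
    by (rule summable_norm_cancel, rule F32_summable,
        use arg_cong [OF bal, of Re] in simp)+
  have f: "f = 1 + a + b + c - e" using bal by (simp add: algebra_simps)
  have "U k - (e - b) * (f - b) * V k = G (Suc k) - G k" for k
  proof (cases k)
    case 0
    have "rGamma e = e * rGamma (e + 1)" "rGamma f = f * rGamma (f + 1)" by (simp_all add: rGamma_plus1)
    then show ?thesis by (simp add: 0 U_def V_def G_def) (simp add: f algebra_simps)
  next
    case (Suc i)
    let ?K = "of_nat k :: complex"
    let ?Q = "pochhammer (a + 1) i * pochhammer b k * pochhammer (c + 1) i / fact k * rGamma (?K + f + 1) * rGamma (?K + e + 1)"
    have rf: "rGamma (?K + f) = (?K + f) * rGamma (?K + f + 1)"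
      by (simp add: rGamma_plus1)
    have re: "rGamma (?K + e) = (?K + e) * rGamma (?K + e + 1)"
      by (simp add: rGamma_plus1)
    have fk: "1 / fact i = (?K / fact k :: complex)" by (simp add: Suc del: of_nat_Suc)
    have "U k = ?Q * (a * c * (?K + e) * (?K + f))"
      unfolding U_def re rf by (simp add: Suc pochhammer_rec [of a] pochhammer_rec [of c] mult_ac)
    moreover have "V k = ?Q * ((a + ?K) * (c + ?K))"
      unfolding V_def by (simp add: Suc pochhammer_Suc [of "1 + a"] pochhammer_Suc [of "1 + c"] add_ac mult_ac)
    moreover have "G (Suc k) = ?Q * ((a + c + 1 + ?K) * ((a + ?K) * (b + ?K) * (c + ?K)))"
      by (simp add: G_def Suc pochhammer_Suc [of "1 + a"] pochhammer_Suc [of "1 + c"] pochhammer_Suc [of _ "Suc i"] add_ac mult_ac)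
    moreover have "G k = ?Q * ((a + c + ?K) * (?K * (?K + f) * (?K + e)))"
    proof -
      have "G k = (a + c + ?K) * (pochhammer (a + 1) i * pochhammer b k * pochhammer (c + 1) i * (1 / fact i) * rGamma (of_nat i + (e + 1)) * rGamma (of_nat i + (f + 1)))"
        by (simp add: G_def Suc add_ac)
      also have "of_nat i + (e + 1) = ?K + e" by (simp add: Suc add_ac)
      also have "of_nat i + (f + 1) = ?K + f" by (simp add: Suc add_ac)
      finally show ?thesis unfolding fk rf re by (simp add: mult_ac)
    qed
    moreover have "(a * c * (?K + e) * (?K + f)) - (e - b) * (f - b) * ((a + ?K) * (c + ?K))
       = (a + c + 1 + ?K) * ((a + ?K) * (b + ?K) * (c + ?K)) - (a + c + ?K) * (?K * (?K + f) * (?K + e))"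
      unfolding f by (simp add: algebra_simps)
    moreover have "(Q * X) - L * (Q * Y) = Q * Z - (Q * W)" if "X - L * Y = Z - W" for L Q X Y Z W :: complex
      using that by algebra
    ultimately show ?thesis by (simp only:)
  qed
  moreover have "G \<longlonglongrightarrow> rGamma (a + 1) * rGamma b * rGamma (c + 1)"
  proof -
    have "(\<lambda>n. b * (c + 1) * (prod_list (map (\<lambda>z. pochhammer z n) [a + 1, b + 1, c + 1 + 1]) * prod_list (map (\<lambda>w. rGamma (of_nat n + w)) [1, e + 1, f + 1]))
         + a * b * (prod_list (map (\<lambda>z. pochhammer z n) [a + 1, b + 1, c + 1]) * prod_list (map (\<lambda>w. rGamma (of_nat n + w)) [1, e + 1, f + 1])))
           \<longlonglongrightarrow> b * (c + 1) * prod_list (map rGamma [a + 1, b + 1, c + 1 + 1]) + a * b * 0"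
      by (intro tendsto_add tendsto_mult tendsto_const pochhammer_rGamma_lists_tendsto pochhammer_rGamma_lists_tendsto_0) (auto simp: f)
    moreover have "b * (c + 1) * prod_list (map rGamma [a + 1, b + 1, c + 1 + 1]) + a * b * 0 = rGamma (a + 1) * rGamma b * rGamma (c + 1)"
      using rGamma_plus1 [of b, symmetric] rGamma_plus1 [of "c + 1", symmetric] by simp
    moreover have "(\<lambda>n. b * (c + 1) * (prod_list (map (\<lambda>z. pochhammer z n) [a + 1, b + 1, c + 1 + 1]) * prod_list (map (\<lambda>w. rGamma (of_nat n + w)) [1, e + 1, f + 1]))
         + a * b * (prod_list (map (\<lambda>z. pochhammer z n) [a + 1, b + 1, c + 1]) * prod_list (map (\<lambda>w. rGamma (of_nat n + w)) [1, e + 1, f + 1])))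
        = (\<lambda>n. G (Suc n))"
    proof
      fix n
      have "(c + 1) * pochhammer (c + 1 + 1) n = (c + 1 + of_nat n) * pochhammer (c + 1) n"
        using pochhammer_rec [of "c + 1" n] pochhammer_Suc [of "c + 1" n] by (simp add: mult.commute)
      then have "b * (c + 1) * (prod_list (map (\<lambda>z. pochhammer z n) [a + 1, b + 1, c + 1 + 1]) * prod_list (map (\<lambda>w. rGamma (of_nat n + w)) [1, e + 1, f + 1]))
        = b * ((c + 1 + of_nat n) * pochhammer (c + 1) n) * pochhammer (a + 1) n * pochhammer (b + 1) n * (1 / fact n) * rGamma (of_nat n + (e + 1)) * rGamma (of_nat n + (f + 1))"
        by (simp add: rGamma_of_nat_plus_one mult_ac)
      then show "b * (c + 1) * (prod_list (map (\<lambda>z. pochhammer z n) [a + 1, b + 1, c + 1 + 1]) * prod_list (map (\<lambda>w. rGamma (of_nat n + w)) [1, e + 1, f + 1]))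
         + a * b * (prod_list (map (\<lambda>z. pochhammer z n) [a + 1, b + 1, c + 1]) * prod_list (map (\<lambda>w. rGamma (of_nat n + w)) [1, e + 1, f + 1]))
        = G (Suc n)"
        by (simp add: G_def rGamma_of_nat_plus_one rGamma_of_nat_plus_one [unfolded add.commute [of _ 1]]
            pochhammer_rec [of b] field_simps)
    qed
    ultimately show ?thesis by (simp only: filterlim_sequentially_Suc [of G, symmetric])
  qed
  then have "(\<lambda>k. G (Suc k) - G k) sums (rGamma (a + 1) * rGamma b * rGamma (c + 1) - G 0)"
    by (rule telescope_sums)
  ultimately have "(\<lambda>k. U k - (e - b) * (f - b) * V k) sums (rGamma (a + 1) * rGamma b * rGamma (c + 1))"
    by (simp add: G_def)
  moreover have "(\<lambda>k. U k - (e - b) * (f - b) * V k) sums (suminf U - (e - b) * (f - b) * suminf V)"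
    by (intro sums_diff sums_mult summable_sums sU sV)
  ultimately show ?thesis
    unfolding F32_reg_def U_def V_def by (rule sums_unique2 [symmetric])
qed

section \<open>Gauss's theorem\<close>

text \<open>The left side is the reciprocal of a binomial coefficient. For n \<ge> M it decays in k
  with power M, uniformly in n, and so beats any prescribed power of k in a majorant.\<close>

lemma fact_ratio_le:
  assumes "M \<le> n"
  shows "fact n * fact k / fact (n + k) \<le> (fact M / (real k + 1) ^ M :: real)"
  using assms
proof (induction n rule: dec_induct)
  case base
  show ?case
  proof (induction M)
    case (Suc M)
    have "fact (Suc M) * fact k / fact (Suc M + k) = (fact M * fact k / fact (M + k) :: real) * ((real M + 1) / (real M + 1 + real k))"
      by (simp add: field_simps)
    also have "\<dots> \<le> fact M / (real k + 1) ^ M * ((real M + 1) / (real k + 1))"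
      by (intro mult_mono Suc divide_left_mono) auto
    finally show ?case by (simp add: field_simps)
  qed simp
next
  case (step n)
  have "fact (Suc n) * fact k / fact (Suc n + k) = (fact n * fact k / fact (n + k) :: real) * ((real n + 1) / (real n + 1 + real k))"
    by (simp add: field_simps)
  also have "\<dots> \<le> (fact n * fact k / fact (n + k) :: real) * 1"
    by (intro mult_left_mono) auto
  finally show ?case using step.IH by simp
qed

text \<open>Opposite powers of n + 1 and n + k + 1 cost at most a power of k + 1, whatever the sign
  of p; this is how majorants become uniform in n.\<close>

lemma powr_ratio_le:
  fixes p :: real
  shows "(real n + 1) powr (- p) * (real (n + k) + 1) powr p \<le> (real k + 1) powr \<bar>p\<bar>"
proof -
  have r: "(real n + 1) powr (- p) * (real (n + k) + 1) powr p = ((real (n + k) + 1) / (real n + 1)) powr p"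
    by (simp add: powr_divide powr_minus_divide)
  have "1 \<le> (real (n + k) + 1) / (real n + 1)" by simp
  then have "((real (n + k) + 1) / (real n + 1)) powr p \<le> ((real (n + k) + 1) / (real n + 1)) powr \<bar>p\<bar>"
    by (intro powr_mono) auto
  also have "\<dots> \<le> (real k + 1) powr \<bar>p\<bar>"
    by (intro powr_mono2) (auto simp: divide_le_eq algebra_simps)
  finally show ?thesis unfolding r .
qed

text \<open>A contiguous relation raises f by 1. After n such steps, as n tends to infinity, only
  the term k = 0 of the series survives, since 1/\<Gamma>(k+f+n) is negligible against
  1/\<Gamma>(f+n) for k > 0.\<close>

lemma gauss_2F1_sums:
  fixes b c f :: complex
  assumes s: "Re (f - b - c) > 0"
  shows "(\<lambda>k. pochhammer b k * pochhammer c k / fact k * rGamma (of_nat k + f)) sums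
           (Gamma (f - b - c) * rGamma (f - b) * rGamma (f - c))"
proof -
  define t where "t f k = pochhammer b k * pochhammer c k / fact k * rGamma (of_nat k + f)" for f k
  have summ: "summable (t f)" if "Re (f - b - c) > 0" for f
  proof -
    obtain C where "C > 0" and C: "\<And>k. norm (pochhammer b k * pochhammer c k / fact k * rGamma (of_nat k + f)) \<le> C * (real k + 1) powr (Re (b + c - f) - 1)"
      using hyp2_term_bound [of b c f] by blast
    have "summable (\<lambda>k. C * (real k + 1) powr (Re (b + c - f) - 1))"
      using that by (intro summable_mult summable_powr_succ) simp
    then show ?thesis
      by (rule summable_comparison_test') (use C in \<open>auto simp: t_def\<close>)
  qed
  have rec: "(f - b) * (f - c) * suminf (t (f + 1)) = (f - b - c) * suminf (t f)" if s: "Re (f - b - c) > 0" for f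
  proof -
    define G where "G k = of_nat k * t f k" for k
    have "(f - b) * (f - c) * t (f + 1) k - (f - b - c) * t f k = G (Suc k) - G k" for k
    proof -
      let ?K = "of_nat k :: complex"
      let ?Q = "pochhammer b k * pochhammer c k / fact k * rGamma (?K + f + 1)"
      have "rGamma (?K + f) = (?K + f) * rGamma (?K + f + 1)" by (simp add: rGamma_plus1)
      then have "t f k = ?Q * (f + ?K)" by (simp add: t_def add.commute)
      moreover have "t (f + 1) k = ?Q" by (simp add: t_def add_ac)
      moreover have "G (Suc k) = ?Q * ((b + ?K) * (c + ?K))"
      proof -
        have "rGamma (of_nat (Suc k) + f) = rGamma (?K + f + 1)" by (simp add: add_ac)
        then show ?thesis by (simp add: G_def t_def pochhammer_Suc mult_ac del: of_nat_Suc)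
      qed
      moreover have "(f - b) * (f - c) * Q - (f - b - c) * (Q * (f + K)) = Q * ((b + K) * (c + K)) - K * (Q * (f + K))"
        for Q K :: complex
        by (simp add: algebra_simps)
      ultimately show ?thesis by (simp only: G_def)
    qed
    moreover have "G \<longlonglongrightarrow> 0"
    proof -
      have "(\<lambda>n. b * c * (prod_list (map (\<lambda>z. pochhammer z n) [b + 1, c + 1]) * prod_list (map (\<lambda>w. rGamma (of_nat n + w)) [1, f + 1])))
           \<longlonglongrightarrow> b * c * 0"
        using s by (intro tendsto_mult tendsto_const pochhammer_rGamma_lists_tendsto_0) auto
      moreover have "(\<lambda>n. b * c * (prod_list (map (\<lambda>z. pochhammer z n) [b + 1, c + 1]) * prod_list (map (\<lambda>w. rGamma (of_nat n + w)) [1, f + 1])))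
           = (\<lambda>n. G (Suc n))"
      proof
        fix n
        have "rGamma (of_nat (Suc n) + f) = rGamma (of_nat n + (f + 1))" by (simp add: add_ac)
        then show "b * c * (prod_list (map (\<lambda>z. pochhammer z n) [b + 1, c + 1]) * prod_list (map (\<lambda>w. rGamma (of_nat n + w)) [1, f + 1])) = G (Suc n)"
          by (simp add: G_def t_def rGamma_of_nat_plus_one pochhammer_rec [of b] pochhammer_rec [of c] del: of_nat_Suc)
      qed
      ultimately show ?thesis by (simp add: filterlim_sequentially_Suc [of G, symmetric])
    qed
    then have "(\<lambda>k. G (Suc k) - G k) sums (0 - G 0)" by (rule telescope_sums)
    ultimately have "(\<lambda>k. (f - b) * (f - c) * t (f + 1) k - (f - b - c) * t f k) sums 0"
      by (simp add: G_def)
    moreover have "(\<lambda>k. (f - b) * (f - c) * t (f + 1) k - (f - b - c) * t f k) sums ((f - b) * (f - c) * suminf (t (f + 1)) - (f - b - c) * suminf (t f))"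
      using s by (intro sums_diff sums_mult summable_sums summ) auto
    ultimately show ?thesis using sums_unique2 by fastforce
  qed
  define q where "q = f - b - c"
  have q: "Re q > 0" using s by (simp add: q_def)
  have qn: "q \<notin> \<int>\<^sub>\<le>\<^sub>0" using q by (auto elim!: nonpos_Ints_cases)
  have iter: "pochhammer (f - b) n * pochhammer (f - c) n * suminf (t (f + of_nat n)) = pochhammer q n * suminf (t f)" for n
  proof (induction n)
    case (Suc n)
    have "(f + of_nat n - b) * (f + of_nat n - c) * suminf (t (f + of_nat n + 1)) = (f + of_nat n - b - c) * suminf (t (f + of_nat n))"
      using q by (intro rec) (simp add: q_def)
    moreover have e: "f + of_nat (Suc n) = f + of_nat n + 1" "f - b + of_nat n = f + of_nat n - b"
      "f - c + of_nat n = f + of_nat n - c" "f + of_nat n - b - c = q + of_nat n" by (simp_all add: q_def)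
    moreover have "pochhammer (f - b) (Suc n) * pochhammer (f - c) (Suc n) * suminf (t (f + of_nat (Suc n)))
       = pochhammer (f - b) n * pochhammer (f - c) n * ((f + of_nat n - b) * (f + of_nat n - c) * suminf (t (f + of_nat n + 1)))"
      by (simp only: pochhammer_Suc e mult_ac)
    ultimately have "pochhammer (f - b) (Suc n) * pochhammer (f - c) (Suc n) * suminf (t (f + of_nat (Suc n)))
       = (q + of_nat n) * (pochhammer (f - b) n * pochhammer (f - c) n * suminf (t (f + of_nat n)))"
      by (simp only: mult_ac)
    also note Suc
    finally show ?case by (simp add: pochhammer_Suc mult_ac)
  qed simp
  \<comment> \<open>With this normalisation \<open>D n\<close> times the shifted sum does not depend
    on n, so the termwise limit evaluates the original sum.\<close>
  define D where "D n = pochhammer (f - b) n * pochhammer (f - c) n * rGamma (of_nat n + q)" for n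
  define a where "a k n = D n * t (f + of_nat n) k" for k n
  have const: "(\<Sum>k. a k n) = rGamma q * suminf (t f)" for n
  proof -
    have "summable (t (f + of_nat n))" using s by (intro summ) simp
    then have "(\<Sum>k. a k n) = D n * suminf (t (f + of_nat n))"
      unfolding a_def by (rule suminf_mult)
    also have "\<dots> = rGamma (of_nat n + q) * (pochhammer q n * suminf (t f))"
      by (simp add: D_def iter [symmetric])
    also have "\<dots> = pochhammer q n * rGamma (q + of_nat n) * suminf (t f)"
      by (simp add: add.commute)
    also have "pochhammer q n * rGamma (q + of_nat n) = rGamma q"
      by (rule pochhammer_rGamma [symmetric])
    finally show ?thesis .
  qed
  define l where "l k = (if k = 0 then rGamma (f - b) * rGamma (f - c) else 0)" for k :: nat
  have lim: "(\<lambda>n. a k n) \<longlonglongrightarrow> l k" for k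
  proof -
    have e: "(\<lambda>n. a k n) = (\<lambda>n. pochhammer b k * pochhammer c k / fact k * (prod_list (map (\<lambda>z. pochhammer z n) [f - b, f - c]) * prod_list (map (\<lambda>w. rGamma (of_nat n + w)) [q, f + of_nat k])))"
      by (simp add: a_def t_def D_def add_ac mult_ac)
    show ?thesis
    proof (cases "k = 0")
      case True
      have "(\<lambda>n. pochhammer b k * pochhammer c k / fact k * (prod_list (map (\<lambda>z. pochhammer z n) [f - b, f - c]) * prod_list (map (\<lambda>w. rGamma (of_nat n + w)) [q, f + of_nat k])))
         \<longlonglongrightarrow> pochhammer b k * pochhammer c k / fact k * prod_list (map rGamma [f - b, f - c])"
        using True by (intro tendsto_mult tendsto_const pochhammer_rGamma_lists_tendsto) (auto simp: q_def)
      then show ?thesis unfolding e using True by (simp add: l_def)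
    next
      case False
      have "(\<lambda>n. pochhammer b k * pochhammer c k / fact k * (prod_list (map (\<lambda>z. pochhammer z n) [f - b, f - c]) * prod_list (map (\<lambda>w. rGamma (of_nat n + w)) [q, f + of_nat k])))
         \<longlonglongrightarrow> pochhammer b k * pochhammer c k / fact k * 0"
        using False by (intro tendsto_mult tendsto_const pochhammer_rGamma_lists_tendsto_0) (auto simp: q_def)
      then show ?thesis unfolding e using False by (simp add: l_def)
    qed
  qed
  obtain B1 where B1: "B1 > 0" "\<And>k. norm (pochhammer (f - b) k * rGamma (of_nat k + q)) \<le> B1 * (real k + 1) powr (Re (f - b - q))"
    using pochhammer_rGamma_bound [of "f - b" q] by blast
  obtain B2 where B2: "B2 > 0" "\<And>k. norm (pochhammer (f - c) k) \<le> B2 * fact k * (real k + 1) powr (Re (f - c) - 1)"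
    using pochhammer_bound [of "f - c"] by blast
  obtain B3 where B3: "B3 > 0" "\<And>k. norm (rGamma (of_nat k + f)) \<le> B3 * (real k + 1) powr (1 - Re f) / fact k"
    using rGamma_bound [of f] by blast
  obtain B4 where B4: "B4 > 0" "\<And>k. norm (pochhammer b k) \<le> B4 * fact k * (real k + 1) powr (Re b - 1)"
    using pochhammer_bound [of b] by blast
  obtain B5 where B5: "B5 > 0" "\<And>k. norm (pochhammer c k) \<le> B5 * fact k * (real k + 1) powr (Re c - 1)"
    using pochhammer_bound [of c] by blast
  \<comment> \<open>The power M gained from the factorial ratio absorbs the exponents |1 - Re f| and
    Re (b + c) and leaves the summable exponent -2.\<close>
  define M where "M = nat \<lceil>\<bar>1 - Re f\<bar> + \<bar>Re (b + c)\<bar>\<rceil>"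
  have M: "\<bar>1 - Re f\<bar> + \<bar>Re (b + c)\<bar> \<le> real M" unfolding M_def by linarith
  let ?B = "B1 * B2 * B3 * B4 * B5 * fact M"
  have bound: "norm (a k n) \<le> ?B * (real k + 1) powr (- 2)" if n: "M \<le> n" for k n
  proof -
    have "norm (a k n) = norm (pochhammer (f - b) n * rGamma (of_nat n + q)) * norm (pochhammer (f - c) n)
        * norm (rGamma (of_nat (n + k) + f)) * (norm (pochhammer b k) * norm (pochhammer c k) / fact k)"
      by (simp add: a_def t_def D_def norm_mult norm_divide add_ac mult_ac)
    also have "\<dots> \<le> (B1 * (real n + 1) powr (Re (f - b - q))) * (B2 * fact n * (real n + 1) powr (Re (f - c) - 1))
        * (B3 * (real (n + k) + 1) powr (1 - Re f) / fact (n + k))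
        * ((B4 * fact k * (real k + 1) powr (Re b - 1)) * (B5 * fact k * (real k + 1) powr (Re c - 1)) / fact k)"
      by (intro mult_mono divide_right_mono B1 B2 B3 B4 B5) (use B1 B2 B3 B4 B5 in \<open>auto intro!: mult_nonneg_nonneg\<close>)
    also have "\<dots> = (B1 * B2 * B3 * B4 * B5) * (fact n * fact k / fact (n + k)) *
        ((real n + 1) powr (Re (f - b - q)) * (real n + 1) powr (Re (f - c) - 1) * (real (n + k) + 1) powr (1 - Re f)) * ((real k + 1) powr (Re b - 1) * (real k + 1) powr (Re c - 1))"
      by (simp add: field_simps)
    also have "(real n + 1) powr (Re (f - b - q)) * (real n + 1) powr (Re (f - c) - 1) = (real n + 1) powr (- (1 - Re f))"
      unfolding powr_add [symmetric] by (simp add: q_def)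
    also have "(real k + 1) powr (Re b - 1) * (real k + 1) powr (Re c - 1) = (real k + 1) powr (Re (b + c) - 2)"
      unfolding powr_add [symmetric] by simp
    also have "(B1 * B2 * B3 * B4 * B5) * (fact n * fact k / fact (n + k)) *
        ((real n + 1) powr (- (1 - Re f)) * (real (n + k) + 1) powr (1 - Re f)) * (real k + 1) powr (Re (b + c) - 2)
       \<le> (B1 * B2 * B3 * B4 * B5) * (fact M / (real k + 1) ^ M) * (real k + 1) powr \<bar>1 - Re f\<bar> * (real k + 1) powr (Re (b + c) - 2)"
      by (intro mult_mono fact_ratio_le powr_ratio_le n) (use B1 B2 B3 B4 B5 in \<open>auto intro!: mult_nonneg_nonneg\<close>)
    also have "\<dots> = ?B * ((real k + 1) powr (- real M) * (real k + 1) powr \<bar>1 - Re f\<bar> * (real k + 1) powr (Re (b + c) - 2))"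
      by (simp add: powr_minus powr_realpow field_simps)
    also have "\<dots> \<le> ?B * (real k + 1) powr (- 2)"
      unfolding powr_add [symmetric] using M B1 B2 B3 B4 B5 by (intro mult_left_mono powr_mono) auto
    finally show ?thesis .
  qed
  have "summable (\<lambda>k. ?B * (real k + 1) powr (- 2))"
    by (intro summable_mult summable_powr_succ) simp
  from tannery_sequentially(1) [OF lim bound this]
  have "(\<lambda>n. rGamma q * suminf (t f)) \<longlonglongrightarrow> suminf l" by (simp add: const)
  then have "rGamma q * suminf (t f) = suminf l" by (simp add: LIMSEQ_const_iff)
  also have "suminf l = rGamma (f - b) * rGamma (f - c)"
    using suminf_finite [of "{0}" l] by (simp add: l_def)
  finally have "suminf (t f) = Gamma q * rGamma (f - b) * rGamma (f - c)"
    using qn by (simp add: rGamma_inverse_Gamma field_simps Gamma_eq_zero_iff)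
  moreover have "t f sums suminf (t f)" by (intro summable_sums summ s)
  ultimately have "t f sums (Gamma (f - b - c) * rGamma (f - b) * rGamma (f - c))"
    by (simp add: q_def)
  moreover have "t f = (\<lambda>k. pochhammer b k * pochhammer c k / fact k * rGamma (of_nat k + f))"
    by (rule ext) (rule t_def)
  ultimately show ?thesis by (simp only:)
qed

section \<open>The nonterminating form of Saalschuetz's theorem\<close>

definition saalschuetz_sum :: "complex \<Rightarrow> complex \<Rightarrow> complex \<Rightarrow> complex \<Rightarrow> complex \<Rightarrow> complex" where
  "saalschuetz_sum a b c e f = F32_reg a b c e f * rGamma (1 + a - e) * rGamma (1 + a - f)
     + F32_reg a (1 + a - e) (1 + a - f) (1 + a - b) (1 + a - c) * rGamma b * rGamma c"

lemma saalschuetz_sum_swap: "saalschuetz_sum a b c e f = saalschuetz_sum a b c f e"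
  by (simp add: saalschuetz_sum_def F32_reg_def mult_ac)

text \<open>The first contiguous relation is applied to the first series, the second one to the
  companion series. Multiplied by the Gamma factors of the sum, their inhomogeneous terms are
  opposite and cancel, so a homogeneous first-order recurrence remains.\<close>

lemma saalschuetz_sum_shift:
  assumes bal: "e + f = 1 + a + b + c"
  shows "saalschuetz_sum a b c e f = (e - b) * (e - c) * saalschuetz_sum (a + 1) b c (e + 1) f"
proof -
  note c1 = F32_contiguous_1 [OF bal]
  have bal2: "(1 + a - b) + (1 + a - c) = 1 + a + (1 + a - e) + (1 + a - f)"
    using bal by (simp add: algebra_simps)
  note c2 = F32_contiguous_2 [OF bal2]
  have s: "1 + a - b - (1 + a - e) = e - b" "1 + a - c - (1 + a - e) = e - c" by simp_all
  have g: "rGamma (1 + a - f) = (1 + a - f) * rGamma (1 + a - f + 1)"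
    by (simp only: rGamma_plus1)
  have t: "1 + (a + 1) - (e + 1) = 1 + a - e" "1 + (a + 1) - f = 1 + a - f + 1"
    "1 + (a + 1) - b = 1 + a - b + 1" "1 + (a + 1) - c = 1 + a - c + 1" by simp_all
  have "X * R1 * (p * R2) + Y * R3 * R4 = q * (X' * R1 * R2 + Y' * R3 * R4)"
    if "p * X - q * X' = - R5 * R3 * R4" "Y - q * Y' = R5 * R1 * R2"
    for X R1 p R2 Y R3 R4 q X' Y' R5 :: complex
    using that by algebra
  from this [OF c1 c2 [unfolded s]] show ?thesis
    by (simp only: saalschuetz_sum_def t g)
qed

lemma saalschuetz_sum_shift_pow:
  assumes bal: "e + f = 1 + a + b + c"
  shows "saalschuetz_sum a b c e f = pochhammer (e - b) n * pochhammer (e - c) n * saalschuetz_sum (a + of_nat n) b c (e + of_nat n) f"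
proof (induction n)
  case (Suc n)
  have "saalschuetz_sum (a + of_nat n) b c (e + of_nat n) f = (e + of_nat n - b) * (e + of_nat n - c) * saalschuetz_sum (a + of_nat n + 1) b c (e + of_nat n + 1) f"
    using bal by (intro saalschuetz_sum_shift) (simp add: algebra_simps)
  with Suc show ?case by (simp add: pochhammer_Suc algebra_simps)
qed simp

text \<open>Shifting a and e by n and letting n tend to infinity turns the first series into the
  Gauss series 2F1(b,c;f;1) and sends the second one to zero. The bounds on real parts yield the
  majorants and keep the arguments of the Gamma functions off their poles.\<close>

lemma nonterminating_saalschuetz_large_params:
  fixes a b c e f :: complex
  assumes bal: "e + f = 1 + a + b + c" and re: "Re a \<ge> 1" "Re (1 + a - e) \<ge> 1" "Re (1 + a - f) \<ge> 1"
  shows "saalschuetz_sum a b c e f = rGamma (e - b) * rGamma (e - c) * rGamma (f - b) * rGamma (f - c)"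
proof -
  \<comment> \<open>By balance d = f - b - c, the convergence parameter of the limiting Gauss
    series.\<close>
  define d where "d = 1 + a - e"
  have d: "f - b - c = d" "e = 1 + a - d" using bal by (simp_all add: d_def algebra_simps)
  have notint: "z + of_nat k \<notin> \<int>\<^sub>\<le>\<^sub>0" if "Re z \<ge> 1" for z and k :: nat
    using that by (auto elim!: nonpos_Ints_cases simp: complex_eq_iff)
  \<comment> \<open>Both ways of splitting (z)_(n+k) express (z+n)_k through symbols of length n at
    fixed k, whose asymptotics in n are known.\<close>
  define r where "r z k n = Gamma (z + of_nat k) * pochhammer (z + of_nat k) n * rGamma (of_nat n + z)" for z :: complex and k n :: nat
  have r: "pochhammer (z + of_nat n) k = r z k n" if "Re z \<ge> 1" for z k n
  proof -
    have "pochhammer z (n + k) = pochhammer z (k + n)" by (simp add: add.commute)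
    then have "pochhammer z n * pochhammer (z + of_nat n) k = pochhammer z k * pochhammer (z + of_nat k) n"
      by (simp add: pochhammer_product')
    moreover have "pochhammer z k = Gamma (z + of_nat k) / Gamma z"
      using notint [OF that, of 0] by (intro pochhammer_Gamma) simp
    moreover have "Gamma (z + of_nat n) = pochhammer z n * Gamma z"
      using notint [OF that, of 0] pochhammer_Gamma [of z n] by (simp add: Gamma_eq_zero_iff field_simps)
    moreover have "Gamma z \<noteq> 0" "Gamma (z + of_nat n) \<noteq> 0"
      using notint [OF that, of 0] notint [OF that, of n] by (simp_all add: Gamma_eq_zero_iff)
    ultimately show ?thesis
      by (simp add: r_def rGamma_inverse_Gamma field_simps add.commute)
  qed
  define u where "u k n = pochhammer (e - b) n * pochhammer (e - c) n * rGamma (of_nat n + (1 + a - f)) *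
     (pochhammer (a + of_nat n) k * rGamma (of_nat (n + k) + e))" for k n
  define v where "v k n = pochhammer (e - b) n * pochhammer (e - c) n * pochhammer (a + of_nat n) k *
     pochhammer (1 + a - f + of_nat n) k * rGamma (of_nat (n + k) + (1 + a - b)) * rGamma (of_nat (n + k) + (1 + a - c))" for k n
  define p where "p k = pochhammer b k * pochhammer c k / fact k * rGamma (of_nat k + f)" for k
  define q where "q k = pochhammer d k / fact k" for k
  have shift: "saalschuetz_sum a b c e f = rGamma d * (\<Sum>k. p k * u k n) + rGamma b * rGamma c * (\<Sum>k. q k * v k n)" for n
  proof -
    let ?a = "a + of_nat n" and ?e = "e + of_nat n"
    have R: "Re ?e + Re f - Re ?a - Re b - Re c = 1"
      using arg_cong [OF bal, of Re] by simp
    have "summable (\<lambda>k. pochhammer ?a k * pochhammer b k * pochhammer c k / fact k * rGamma (of_nat k + ?e) * rGamma (of_nat k + f))"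
      by (rule summable_norm_cancel, rule F32_summable) (use R in simp)
    note s1 = suminf_mult [OF this, of "pochhammer (e - b) n * pochhammer (e - c) n * rGamma (1 + ?a - f)"]
    have "summable (\<lambda>k. pochhammer ?a k * pochhammer (1 + ?a - ?e) k * pochhammer (1 + ?a - f) k / fact k * rGamma (of_nat k + (1 + ?a - b)) * rGamma (of_nat k + (1 + ?a - c)))"
      by (rule summable_norm_cancel, rule F32_summable) (use R in simp)
    note s2 = suminf_mult [OF this, of "pochhammer (e - b) n * pochhammer (e - c) n"]
    have "saalschuetz_sum a b c e f = pochhammer (e - b) n * pochhammer (e - c) n * saalschuetz_sum ?a b c ?e f"
      by (rule saalschuetz_sum_shift_pow [OF bal])
    also have "\<dots> = rGamma d * (pochhammer (e - b) n * pochhammer (e - c) n * rGamma (1 + ?a - f) * F32_reg ?a b c ?e f)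
       + rGamma b * rGamma c * (pochhammer (e - b) n * pochhammer (e - c) n * F32_reg ?a (1 + ?a - ?e) (1 + ?a - f) (1 + ?a - b) (1 + ?a - c))"
      by (simp add: saalschuetz_sum_def d_def algebra_simps)
    also have "pochhammer (e - b) n * pochhammer (e - c) n * rGamma (1 + ?a - f) * F32_reg ?a b c ?e f = (\<Sum>k. p k * u k n)"
      unfolding F32_reg_def s1 [symmetric] by (simp add: p_def u_def algebra_simps)
    also have "pochhammer (e - b) n * pochhammer (e - c) n * F32_reg ?a (1 + ?a - ?e) (1 + ?a - f) (1 + ?a - b) (1 + ?a - c) = (\<Sum>k. q k * v k n)"
      unfolding F32_reg_def s2 [symmetric] by (simp add: q_def v_def d_def algebra_simps)
    finally show ?thesis .
  qed
  have limu: "(\<lambda>n. p k * u k n) \<longlonglongrightarrow> p k * (rGamma (e - b) * rGamma (e - c))" for k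
  proof -
    have e: "u k n = Gamma (a + of_nat k) * (prod_list (map (\<lambda>z. pochhammer z n) [e - b, e - c, a + of_nat k]) *
          prod_list (map (\<lambda>w. rGamma (of_nat n + w)) [1 + a - f, e + of_nat k, a]))" for n
      by (simp only: u_def r [OF re(1), of n k]) (simp add: r_def add_ac mult_ac)
    have "(\<lambda>n. u k n) \<longlonglongrightarrow> Gamma (a + of_nat k) * prod_list (map rGamma [e - b, e - c, a + of_nat k])"
      unfolding e using bal by (intro tendsto_mult tendsto_const pochhammer_rGamma_lists_tendsto) (auto simp: algebra_simps)
    moreover have "Gamma (a + of_nat k) * rGamma (a + of_nat k) = 1"
      using notint [OF re(1), of k] by (simp add: rGamma_inverse_Gamma Gamma_eq_zero_iff)
    ultimately have "(\<lambda>n. u k n) \<longlonglongrightarrow> rGamma (e - b) * rGamma (e - c)"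
      by (simp add: mult_ac)
    then show ?thesis by (intro tendsto_mult tendsto_const)
  qed
  have gn: "pochhammer (z + of_nat n) k = Gamma z * (pochhammer z (n + k) * rGamma (of_nat n + z))" if "Re z \<ge> 1" for z k n
  proof -
    have "pochhammer z n * Gamma z = Gamma (z + of_nat n)" "Gamma (z + of_nat n) \<noteq> 0"
      using notint [OF that, of 0] notint [OF that, of n] pochhammer_Gamma [of z n] by (simp_all add: Gamma_eq_zero_iff field_simps)
    moreover have "pochhammer z (n + k) = pochhammer z n * pochhammer (z + of_nat n) k"
      by (rule pochhammer_product')
    moreover have "rGamma (of_nat n + z) = inverse (Gamma (z + of_nat n))"
      by (simp add: rGamma_inverse_Gamma add.commute)
    ultimately show ?thesis by (simp only:) (simp add: field_simps)
  qed
  obtain A1 where A1: "A1 > 0" "\<And>k. norm (pochhammer (e - b) k * rGamma (of_nat k + a)) \<le> A1 * (real k + 1) powr (Re (e - b - a))"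
    using pochhammer_rGamma_bound [of "e - b" a] by blast
  obtain A2 where A2: "A2 > 0" "\<And>k. norm (pochhammer (e - c) k * rGamma (of_nat k + (1 + a - f))) \<le> A2 * (real k + 1) powr (Re (e - c - (1 + a - f)))"
    using pochhammer_rGamma_bound [of "e - c" "1 + a - f"] by blast
  obtain A3 where A3: "A3 > 0" "\<And>k. norm (pochhammer a k * rGamma (of_nat k + e)) \<le> A3 * (real k + 1) powr (Re (a - e))"
    using pochhammer_rGamma_bound [of a e] by blast
  obtain A4 where A4: "A4 > 0" "\<And>k. norm (p k) \<le> A4 * (real k + 1) powr (Re (b + c - f) - 1)"
    unfolding p_def using hyp2_term_bound [of b c f] by blast
  obtain A5 where A5: "A5 > 0" "\<And>k. norm (pochhammer a k * rGamma (of_nat k + (1 + a - b))) \<le> A5 * (real k + 1) powr (Re (a - (1 + a - b)))"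
    using pochhammer_rGamma_bound [of a "1 + a - b"] by blast
  obtain A6 where A6: "A6 > 0" "\<And>k. norm (pochhammer (1 + a - f) k * rGamma (of_nat k + (1 + a - c))) \<le> A6 * (real k + 1) powr (Re (1 + a - f - (1 + a - c)))"
    using pochhammer_rGamma_bound [of "1 + a - f" "1 + a - c"] by blast
  obtain A7 where A7: "A7 > 0" "\<And>k. norm (pochhammer d k * rGamma (of_nat k + 1)) \<le> A7 * (real k + 1) powr (Re (d - 1))"
    using pochhammer_rGamma_bound [of d 1] by blast
  have q': "norm (q k) \<le> A7 * (real k + 1) powr (Re (d - 1))" for k
    using A7(2) [of k] by (simp add: q_def rGamma_of_nat_plus_one)
  have d1: "Re d \<ge> 1" using re by (simp add: d_def)
  let ?B = "norm (Gamma a) * A1 * A2 * A3 * A4"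
  have bu: "norm (p k * u k n) \<le> ?B * (real k + 1) powr (- 2)" for k n
  proof -
    have "norm (p k * u k n) = norm (Gamma a) * norm (pochhammer (e - b) n * rGamma (of_nat n + a)) * norm (pochhammer (e - c) n * rGamma (of_nat n + (1 + a - f)))
       * norm (pochhammer a (n + k) * rGamma (of_nat (n + k) + e)) * norm (p k)"
      by (simp only: u_def gn [OF re(1)] norm_mult mult_ac)
    also have "\<dots> \<le> norm (Gamma a) * (A1 * (real n + 1) powr (Re (e - b - a))) * (A2 * (real n + 1) powr (Re (e - c - (1 + a - f))))
       * (A3 * (real (n + k) + 1) powr (Re (a - e))) * (A4 * (real k + 1) powr (Re (b + c - f) - 1))"
      by (intro mult_mono A1 A2 A3 A4 order_refl) (use A1 A2 A3 A4 in \<open>auto intro!: mult_nonneg_nonneg\<close>)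
    also have "\<dots> = ?B * ((real n + 1) powr (Re (e - b - a)) * (real n + 1) powr (Re (e - c - (1 + a - f))) * (real (n + k) + 1) powr (Re (a - e))) * (real k + 1) powr (Re (b + c - f) - 1)"
      by (simp only: mult_ac)
    also have "(real n + 1) powr (Re (e - b - a)) * (real n + 1) powr (Re (e - c - (1 + a - f))) = (real n + 1) powr (- Re (a - e))"
      unfolding powr_add [symmetric] using arg_cong [OF bal, of Re] by (intro arg_cong2 [of _ _ _ _ "(powr)"]) auto
    also have "?B * ((real n + 1) powr (- Re (a - e)) * (real (n + k) + 1) powr (Re (a - e))) * (real k + 1) powr (Re (b + c - f) - 1)
       \<le> ?B * ((real k + 1) powr \<bar>Re (a - e)\<bar>) * (real k + 1) powr (Re (b + c - f) - 1)"
      by (intro mult_right_mono mult_left_mono powr_ratio_le) (use A1 A2 A3 A4 in \<open>auto intro!: mult_nonneg_nonneg\<close>)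
    also have "\<dots> = ?B * ((real k + 1) powr \<bar>Re (a - e)\<bar> * (real k + 1) powr (Re (b + c - f) - 1))"
      by (simp only: mult_ac)
    also have "(real k + 1) powr \<bar>Re (a - e)\<bar> * (real k + 1) powr (Re (b + c - f) - 1) = (real k + 1) powr (- 2)"
      unfolding powr_add [symmetric] using arg_cong [OF bal, of Re] re(2) by (intro arg_cong2 [of _ _ _ _ "(powr)"]) auto
    finally show ?thesis .
  qed
  have sB: "summable (\<lambda>k. B * (real k + 1) powr (- 2))" for B :: real
    by (intro summable_mult summable_powr_succ) simp
  have lim1: "(\<lambda>n. \<Sum>k. p k * u k n) \<longlonglongrightarrow> (\<Sum>k. p k * (rGamma (e - b) * rGamma (e - c)))"
    by (rule tannery_sequentially(1) [OF limu bu sB])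
  have "p sums (Gamma (f - b - c) * rGamma (f - b) * rGamma (f - c))"
    unfolding p_def using d d1 by (intro gauss_2F1_sums) simp
  from sums_mult2 [OF this, of "rGamma (e - b) * rGamma (e - c)"]
  have sum1: "(\<Sum>k. p k * (rGamma (e - b) * rGamma (e - c))) = Gamma d * rGamma (f - b) * rGamma (f - c) * (rGamma (e - b) * rGamma (e - c))"
    by (simp add: sums_iff d)
  \<comment> \<open>The bound with this constant tends to zero in n for each fixed k and is at most
    a multiple of (k+1)^(-2) for all n; dominated convergence then removes the second
    series.\<close>
  let ?C = "norm (Gamma a) * norm (Gamma (1 + a - f)) * A1 * A2 * A5 * A6 * A7"
  have bv0: "norm (q k * v k n) \<le> ?C * ((real k + 1) powr (Re d - 1) * (real (n + k) + 1) powr (- Re d - 1))" for k n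
  proof -
    have "norm (q k * v k n) = norm (Gamma a) * norm (Gamma (1 + a - f)) * norm (pochhammer (e - b) n * rGamma (of_nat n + a)) * norm (pochhammer (e - c) n * rGamma (of_nat n + (1 + a - f)))
       * norm (pochhammer a (n + k) * rGamma (of_nat (n + k) + (1 + a - b))) * norm (pochhammer (1 + a - f) (n + k) * rGamma (of_nat (n + k) + (1 + a - c))) * norm (q k)"
      by (simp only: v_def gn [OF re(1)] gn [OF re(3)] norm_mult mult_ac)
    also have "\<dots> \<le> norm (Gamma a) * norm (Gamma (1 + a - f)) * (A1 * (real n + 1) powr (Re (e - b - a))) * (A2 * (real n + 1) powr (Re (e - c - (1 + a - f))))
       * (A5 * (real (n + k) + 1) powr (Re (a - (1 + a - b)))) * (A6 * (real (n + k) + 1) powr (Re (1 + a - f - (1 + a - c)))) * (A7 * (real k + 1) powr (Re (d - 1)))"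
      by (intro mult_mono A1 A2 A5 A6 q' order_refl) (use A1 A2 A5 A6 A7 in \<open>auto intro!: mult_nonneg_nonneg\<close>)
    also have "\<dots> = ?C * ((real n + 1) powr (Re (e - b - a)) * (real n + 1) powr (Re (e - c - (1 + a - f)))
        * ((real k + 1) powr (Re (d - 1)) * ((real (n + k) + 1) powr (Re (a - (1 + a - b))) * (real (n + k) + 1) powr (Re (1 + a - f - (1 + a - c))))))"
      by (simp only: mult_ac)
    also have "(real n + 1) powr (Re (e - b - a)) * (real n + 1) powr (Re (e - c - (1 + a - f))) = (real n + 1) powr (1 - Re d)"
      unfolding powr_add [symmetric] using arg_cong [OF bal, of Re] by (intro arg_cong2 [of _ _ _ _ "(powr)"]) (auto simp: d_def)
    also have "(real (n + k) + 1) powr (Re (a - (1 + a - b))) * (real (n + k) + 1) powr (Re (1 + a - f - (1 + a - c))) = (real (n + k) + 1) powr (- Re d - 1)"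
      unfolding powr_add [symmetric] using arg_cong [OF bal, of Re] by (intro arg_cong2 [of _ _ _ _ "(powr)"]) (auto simp: d_def)
    also have "?C * ((real n + 1) powr (1 - Re d) * ((real k + 1) powr (Re (d - 1)) * (real (n + k) + 1) powr (- Re d - 1)))
      \<le> ?C * (1 * ((real k + 1) powr (Re (d - 1)) * (real (n + k) + 1) powr (- Re d - 1)))"
    proof -
      have "(real n + 1) powr (1 - Re d) \<le> (real n + 1) powr 0"
        using d1 by (intro powr_mono) auto
      then have "(real n + 1) powr (1 - Re d) \<le> 1" by simp
      then show ?thesis
        by (intro mult_left_mono mult_right_mono) (use A1 A2 A5 A6 A7 in \<open>auto intro!: mult_nonneg_nonneg\<close>)
    qed
    finally show ?thesis by simp
  qed
  have bv: "norm (q k * v k n) \<le> ?C * (real k + 1) powr (- 2)" for k n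
  proof -
    have "(real (n + k) + 1) powr (- Re d - 1) \<le> (real k + 1) powr (- Re d - 1)"
      using d1 by (intro powr_mono2') auto
    then have "(real k + 1) powr (Re d - 1) * (real (n + k) + 1) powr (- Re d - 1) \<le> (real k + 1) powr (Re d - 1) * (real k + 1) powr (- Re d - 1)"
      by (intro mult_left_mono) auto
    also have "\<dots> = (real k + 1) powr (- 2)"
      unfolding powr_add [symmetric] by simp
    finally have "?C * ((real k + 1) powr (Re d - 1) * (real (n + k) + 1) powr (- Re d - 1)) \<le> ?C * (real k + 1) powr (- 2)"
      by (intro mult_left_mono) (use A1 A2 A5 A6 A7 in \<open>auto intro!: mult_nonneg_nonneg\<close>)
    with bv0 show ?thesis by (rule order_trans)
  qed
  have limv: "(\<lambda>n. q k * v k n) \<longlonglongrightarrow> 0" for k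
  proof (rule Lim_null_comparison)
    show "\<forall>\<^sub>F n in sequentially. norm (q k * v k n) \<le> ?C * ((real k + 1) powr (Re d - 1) * (real (n + k) + 1) powr (- Re d - 1))"
      using bv0 by simp
    have "(\<lambda>n. real n powr (- Re d - 1)) \<longlonglongrightarrow> 0"
      using d1 by (intro tendsto_neg_powr filterlim_real_sequentially) simp
    from LIMSEQ_ignore_initial_segment [OF this, of "k + 1"]
    have "(\<lambda>n. (real (n + k) + 1) powr (- Re d - 1)) \<longlonglongrightarrow> 0"
      by (simp add: add_ac)
    then have "(\<lambda>n. ?C * ((real k + 1) powr (Re d - 1) * (real (n + k) + 1) powr (- Re d - 1))) \<longlonglongrightarrow> ?C * ((real k + 1) powr (Re d - 1) * 0)"
      by (intro tendsto_mult tendsto_const)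
    then show "(\<lambda>n. ?C * ((real k + 1) powr (Re d - 1) * (real (n + k) + 1) powr (- Re d - 1))) \<longlonglongrightarrow> 0" by simp
  qed
  have lim2: "(\<lambda>n. \<Sum>k. q k * v k n) \<longlonglongrightarrow> (\<Sum>k. 0)"
    by (rule tannery_sequentially(1) [OF limv bv sB])
  have "(\<lambda>n. rGamma d * (\<Sum>k. p k * u k n) + rGamma b * rGamma c * (\<Sum>k. q k * v k n))
     \<longlonglongrightarrow> rGamma d * (\<Sum>k. p k * (rGamma (e - b) * rGamma (e - c))) + rGamma b * rGamma c * (\<Sum>k. 0)"
    by (intro tendsto_add tendsto_mult tendsto_const lim1 lim2)
  then have "saalschuetz_sum a b c e f = rGamma d * (\<Sum>k. p k * (rGamma (e - b) * rGamma (e - c)))"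
    by (simp add: shift [symmetric] LIMSEQ_const_iff)
  also have "\<dots> = (rGamma d * Gamma d) * (rGamma (e - b) * rGamma (e - c) * rGamma (f - b) * rGamma (f - c))"
    by (simp add: sum1 mult_ac)
  also have "rGamma d * Gamma d = 1"
    using notint [OF d1, of 0] by (simp add: rGamma_inverse_Gamma Gamma_eq_zero_iff)
  finally show ?thesis by simp
qed

text \<open>Shifting (a,f) by m and (a,e) by n reaches the half-planes of the previous lemma. The
  Pochhammer factors collected on the way are absorbed by the \<open>rGamma\<close> factors of the
  closed form.\<close>

lemma nonterminating_saalschuetz:
  fixes a b c e f :: complex
  assumes bal: "e + f = 1 + a + b + c"
  shows "F32_reg a b c e f * rGamma (1 + a - e) * rGamma (1 + a - f)
     + F32_reg a (1 + a - e) (1 + a - f) (1 + a - b) (1 + a - c) * rGamma b * rGamma c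
     = rGamma (e - b) * rGamma (e - c) * rGamma (f - b) * rGamma (f - c)"
proof -
  define m where "m = nat \<lceil>\<bar>Re (a - e)\<bar>\<rceil>"
  define n where "n = nat \<lceil>\<bar>Re (a - f)\<bar> + \<bar>Re a\<bar> + 1\<rceil>"
  have m: "\<bar>Re (a - e)\<bar> \<le> real m" unfolding m_def by linarith
  have n: "\<bar>Re (a - f)\<bar> + \<bar>Re a\<bar> + 1 \<le> real n" unfolding n_def by linarith
  let ?a = "a + of_nat m + of_nat n" and ?f = "f + of_nat m" and ?e = "e + of_nat n"
  have "saalschuetz_sum a b c e f = saalschuetz_sum a b c f e" by (rule saalschuetz_sum_swap)
  also have "\<dots> = pochhammer (f - b) m * pochhammer (f - c) m * saalschuetz_sum (a + of_nat m) b c ?f e"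
    using bal by (intro saalschuetz_sum_shift_pow) (simp add: algebra_simps)
  also have "saalschuetz_sum (a + of_nat m) b c ?f e = saalschuetz_sum (a + of_nat m) b c e ?f" by (rule saalschuetz_sum_swap)
  also have "\<dots> = pochhammer (e - b) n * pochhammer (e - c) n * saalschuetz_sum ?a b c ?e ?f"
    using bal by (intro saalschuetz_sum_shift_pow) (simp add: algebra_simps)
  also have "saalschuetz_sum ?a b c ?e ?f = rGamma (?e - b) * rGamma (?e - c) * rGamma (?f - b) * rGamma (?f - c)"
    using bal m n by (intro nonterminating_saalschuetz_large_params) (auto simp: algebra_simps)
  also have "pochhammer (f - b) m * pochhammer (f - c) m * (pochhammer (e - b) n * pochhammer (e - c) n *
      (rGamma (?e - b) * rGamma (?e - c) * rGamma (?f - b) * rGamma (?f - c)))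
     = rGamma (e - b) * rGamma (e - c) * rGamma (f - b) * rGamma (f - c)"
    unfolding pochhammer_rGamma [of "e - b" n] pochhammer_rGamma [of "e - c" n] pochhammer_rGamma [of "f - b" m] pochhammer_rGamma [of "f - c" m]
    by (simp add: algebra_simps)
  finally show ?thesis by (simp add: saalschuetz_sum_def)
qed

subsection \<open>Invariance of the function K\<close>

lemma infsum_nat_eq_suminf:
  fixes f :: "nat \<Rightarrow> 'a :: banach"
  assumes "f summable_on UNIV"
  shows "infsum f UNIV = suminf f" "summable f"
  using has_sum_imp_sums [OF has_sum_infsum [OF assms]] by (auto simp: sums_iff)

text \<open>A product majorant gives absolute summability over pairs (j,m), hence both the
  interchange of the sums and the regrouping along the antidiagonals j + m = k.\<close>

lemma double_suminf_dominated:
  fixes h :: "nat \<Rightarrow> nat \<Rightarrow> complex"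
  assumes h: "\<And>j m. norm (h j m) \<le> A j * B m" and A: "summable A" and B: "summable B"
    and nonneg: "\<And>j. A j \<ge> 0" "\<And>m. B m \<ge> 0"
  shows "summable (h j)"
    and "summable (\<lambda>j. \<Sum>m. h j m)"
    and "(\<Sum>j. \<Sum>m. h j m) = (\<Sum>m. \<Sum>j. h j m)"
    and "(\<Sum>k. \<Sum>j\<le>k. h j (k - j)) = (\<Sum>j. \<Sum>m. h j m)"
proof -
  have A': "A summable_on UNIV" and B': "B summable_on UNIV"
    using A B nonneg by (auto intro!: norm_summable_imp_summable_on)
  have "(\<lambda>x. norm (case x of (j, m) \<Rightarrow> A j * B m)) summable_on UNIV \<times> UNIV"
  proof (subst Infinite_Sum.abs_summable_on_Sigma_iff, intro conjI ballI)
    have e: "(\<lambda>y. norm (case (j, y) of (j, m) \<Rightarrow> A j * B m)) = (\<lambda>y. A j * B y)" for j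
      using nonneg by (simp add: abs_mult)
    show "(\<lambda>y. norm (case (j, y) of (j, m) \<Rightarrow> A j * B m)) summable_on UNIV" for j
      unfolding e by (intro summable_on_cmult_right B')
    have "infsum (\<lambda>y. A j * B y) UNIV = A j * infsum B UNIV" for j
      by (rule infsum_cmult_right') 
    moreover have "infsum B UNIV \<ge> 0" using nonneg by (intro infsum_nonneg)
    ultimately show "(\<lambda>x. norm (infsum (\<lambda>y. norm (case (x, y) of (j, m) \<Rightarrow> A j * B m)) UNIV)) summable_on UNIV"
      unfolding e using nonneg A' by (simp add: abs_mult summable_on_cmult_left)
  qed
  moreover have "(\<lambda>x. norm (case x of (j, m) \<Rightarrow> A j * B m)) = (\<lambda>(j, m). A j * B m)"
    using nonneg by auto
  ultimately have g: "(\<lambda>(j, m). A j * B m) summable_on UNIV \<times> UNIV" by simp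
  have abs: "(\<lambda>x. norm (case x of (j, m) \<Rightarrow> h j m)) summable_on UNIV \<times> UNIV"
    by (rule Infinite_Sum.abs_summable_on_comparison_test' [OF g]) (use h in auto)
  then have S: "(\<lambda>(j, m). h j m) summable_on UNIV \<times> UNIV"
    by (rule abs_summable_summable)
  have S': "(\<lambda>(m, j). h j m) summable_on UNIV \<times> UNIV"
    using summable_on_swap [of "\<lambda>(j, m). h j m" UNIV UNIV] S by (simp add: case_prod_unfold)
  have 1: "(\<lambda>m. h j m) summable_on UNIV" for j
    using abs unfolding Infinite_Sum.abs_summable_on_Sigma_iff by (auto intro: abs_summable_summable)
  have abs': "(\<lambda>x. norm (case x of (m, j) \<Rightarrow> h j m)) summable_on UNIV \<times> UNIV"
    using summable_on_swap [of "\<lambda>x. norm (case x of (j, m) \<Rightarrow> h j m)" UNIV UNIV] abs by (simp add: case_prod_unfold)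
  then have 2: "(\<lambda>j. h j m) summable_on UNIV" for m
    unfolding Infinite_Sum.abs_summable_on_Sigma_iff by (auto intro: abs_summable_summable)
  have 3: "(\<lambda>j. infsum (\<lambda>m. h j m) UNIV) summable_on UNIV"
    using summable_on_Sigma_banach [OF S] by simp
  have 4: "(\<lambda>m. infsum (\<lambda>j. h j m) UNIV) summable_on UNIV"
    using summable_on_Sigma_banach [OF S'] by simp
  show "summable (h j)" using infsum_nat_eq_suminf(2) [OF 1] .
  have e1: "(\<lambda>j. infsum (\<lambda>m. h j m) UNIV) = (\<lambda>j. \<Sum>m. h j m)"
    using infsum_nat_eq_suminf(1) [OF 1] by simp
  have e2: "(\<lambda>m. infsum (\<lambda>j. h j m) UNIV) = (\<lambda>m. \<Sum>j. h j m)"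
    using infsum_nat_eq_suminf(1) [OF 2] by simp
  show "summable (\<lambda>j. \<Sum>m. h j m)" using infsum_nat_eq_suminf(2) [OF 3] e1 by simp
  have I: "infsum (\<lambda>j. infsum (\<lambda>m. h j m) UNIV) UNIV = (\<Sum>j. \<Sum>m. h j m)"
    using infsum_nat_eq_suminf(1) [OF 3] e1 by simp
  have J: "infsum (\<lambda>m. infsum (\<lambda>j. h j m) UNIV) UNIV = (\<Sum>m. \<Sum>j. h j m)"
    using infsum_nat_eq_suminf(1) [OF 4] e2 by simp
  show "(\<Sum>j. \<Sum>m. h j m) = (\<Sum>m. \<Sum>j. h j m)"
    using infsum_swap_banach [OF S] I J by simp
  have bij: "bij_betw (\<lambda>(k, j). (j, k - j)) (Sigma UNIV (\<lambda>k. {..k})) (UNIV \<times> UNIV :: (nat \<times> nat) set)"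
    by (rule bij_betwI [where g = "\<lambda>(j, m). (j + m, j)"]) auto
  have S3: "(\<lambda>(k, j). h j (k - j)) summable_on (Sigma UNIV (\<lambda>k. {..k}))"
    using summable_on_reindex_bij_betw [OF bij, of "\<lambda>(j, m). h j m"] S by (simp add: case_prod_unfold)
  have "infsum (\<lambda>(k, j). h j (k - j)) (Sigma UNIV (\<lambda>k. {..k})) = infsum (\<lambda>(j, m). h j m) (UNIV \<times> UNIV)"
    using infsum_reindex_bij_betw [OF bij, of "\<lambda>(j, m). h j m"] by (simp add: case_prod_unfold)
  also have "\<dots> = (\<Sum>j. \<Sum>m. h j m)"
    using infsum_Sigma'_banach [OF S] I by simp
  also have "infsum (\<lambda>(k, j). h j (k - j)) (Sigma UNIV (\<lambda>k. {..k})) = infsum (\<lambda>k. \<Sum>j\<le>k. h j (k - j)) UNIV"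
    using infsum_Sigma'_banach [OF S3] by simp
  also have "\<dots> = (\<Sum>k. \<Sum>j\<le>k. h j (k - j))"
    using summable_on_Sigma_banach [OF S3] by (intro infsum_nat_eq_suminf) simp
  finally show "(\<Sum>k. \<Sum>j\<le>k. h j (k - j)) = (\<Sum>j. \<Sum>m. h j m)" .
qed

text \<open>Two series of type 2F1, coupled only through j + m. Exchanging the triples (p,q,r) and
  (s,t,u) therefore amounts to exchanging the summations; this is the symmetry by which the double
  series cancel.\<close>

definition double_F32 :: "complex \<Rightarrow> complex \<Rightarrow> complex \<Rightarrow> complex \<Rightarrow> complex \<Rightarrow> complex \<Rightarrow> complex \<Rightarrow> complex \<Rightarrow> complex" where
  "double_F32 a h p q r s t u = (\<Sum>j. \<Sum>m. pochhammer a (j + m) * rGamma (of_nat (j + m) + h)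
     * (pochhammer p j * pochhammer q j / fact j * rGamma (of_nat j + r))
     * (pochhammer s m * pochhammer t m / fact m * rGamma (of_nat m + u)))"

lemma powr_add_nat_le:
  fixes p :: real
  assumes "p \<le> 0"
  shows "(real (j + m) + 1) powr p \<le> (real j + 1) powr (p / 2) * (real m + 1) powr (p / 2)"
proof -
  have "((real j + 1) * (real m + 1)) powr (1 / 2) \<le> ((real (j + m) + 1)\<^sup>2) powr (1 / 2)"
    by (intro powr_mono2) (auto simp: power2_eq_square algebra_simps)
  also have "\<dots> = real (j + m) + 1"
    by (simp add: powr_half_sqrt)
  finally have "(real (j + m) + 1) powr p \<le> (((real j + 1) * (real m + 1)) powr (1 / 2)) powr p"
    using assms by (intro powr_mono2') auto
  also have "\<dots> = (real j + 1) powr (p / 2) * (real m + 1) powr (p / 2)"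
    by (simp add: powr_powr powr_mult)
  finally show ?thesis .
qed

lemma powr_add_nat_le_exponents:
  fixes p :: real
  assumes "p \<ge> 0"
  shows "(real (j + m) + 1) powr p \<le> (real j + 1) powr p * (real m + 1) powr p"
proof -
  have "(real (j + m) + 1) powr p \<le> ((real j + 1) * (real m + 1)) powr p"
    using assms by (intro powr_mono2) (auto simp: algebra_simps)
  then show ?thesis by (simp add: powr_mult)
qed

text \<open>The coupled factor has exponent Re \<beta> - 1. Its part Re \<beta> is given to both
  indices and absorbed by their decay; the part -1 is divided evenly by (j+1)(m+1) \<le> (j+m+1)^2.
  Each index keeps the exponent -3/2.\<close>

lemma double_F32_swap:
  fixes a h p q r s t u :: complex
  assumes b: "Re (a - h) = Re \<beta> - 1" "Re (p + q - r) = - Re \<beta>" "Re (s + t - u) = - Re \<beta>" "Re \<beta> \<ge> 0"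
  shows "double_F32 a h p q r s t u = double_F32 a h s t u p q r"
    and "summable (\<lambda>j. \<Sum>m. pochhammer a (j + m) * rGamma (of_nat (j + m) + h)
     * (pochhammer p j * pochhammer q j / fact j * rGamma (of_nat j + r))
     * (pochhammer s m * pochhammer t m / fact m * rGamma (of_nat m + u)))"
proof -
  define H where "H j m = pochhammer a (j + m) * rGamma (of_nat (j + m) + h)
     * (pochhammer p j * pochhammer q j / fact j * rGamma (of_nat j + r))
     * (pochhammer s m * pochhammer t m / fact m * rGamma (of_nat m + u))" for j m
  obtain C1 where C1: "C1 > 0" "\<And>k. norm (pochhammer a k * rGamma (of_nat k + h)) \<le> C1 * (real k + 1) powr (Re (a - h))"
    using pochhammer_rGamma_bound by blast
  obtain C2 where C2: "C2 > 0" "\<And>k. norm (pochhammer p k * pochhammer q k / fact k * rGamma (of_nat k + r)) \<le> C2 * (real k + 1) powr (Re (p + q - r) - 1)"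
    using hyp2_term_bound by blast
  obtain C3 where C3: "C3 > 0" "\<And>k. norm (pochhammer s k * pochhammer t k / fact k * rGamma (of_nat k + u)) \<le> C3 * (real k + 1) powr (Re (s + t - u) - 1)"
    using hyp2_term_bound by blast
  have "norm (H j m) \<le> (C1 * (real j + 1) powr (- 3 / 2)) * ((C2 * C3) * (real m + 1) powr (- 3 / 2))" for j m
  proof -
    have "norm (H j m) \<le> (C1 * (real (j + m) + 1) powr (Re \<beta> - 1)) * (C2 * (real j + 1) powr (- Re \<beta> - 1)) * (C3 * (real m + 1) powr (- Re \<beta> - 1))"
      unfolding H_def norm_mult [of "_ * _ * _ :: complex"] norm_mult [of "pochhammer a (j + m) * rGamma (of_nat (j + m) + h)"]
      using C1(2) [of "j + m"] C2(2) [of j] C3(2) [of m] C1(1) C2(1) C3(1) b by (intro mult_mono) auto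
    also have "(real (j + m) + 1) powr (Re \<beta> - 1) = (real (j + m) + 1) powr Re \<beta> * (real (j + m) + 1) powr (- 1)"
      unfolding powr_add [symmetric] by simp
    also have "C1 * ((real (j + m) + 1) powr Re \<beta> * (real (j + m) + 1) powr (- 1)) * (C2 * (real j + 1) powr (- Re \<beta> - 1)) * (C3 * (real m + 1) powr (- Re \<beta> - 1))
      \<le> C1 * (((real j + 1) powr Re \<beta> * (real m + 1) powr Re \<beta>) * ((real j + 1) powr (- 1 / 2) * (real m + 1) powr (- 1 / 2)))
        * (C2 * (real j + 1) powr (- Re \<beta> - 1)) * (C3 * (real m + 1) powr (- Re \<beta> - 1))"
      using C1(1) C2(1) C3(1) b powr_add_nat_le [of "- 1" j m] powr_add_nat_le_exponents [of "Re \<beta>" j m]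
      by (intro mult_right_mono mult_left_mono mult_mono) auto
    also have "\<dots> = (C1 * C2 * C3) * (((real j + 1) powr Re \<beta> * (real j + 1) powr (- 1 / 2) * (real j + 1) powr (- Re \<beta> - 1)) *
        ((real m + 1) powr Re \<beta> * (real m + 1) powr (- 1 / 2) * (real m + 1) powr (- Re \<beta> - 1)))"
      by (simp only: mult_ac)
    also have "\<dots> = (C1 * (real j + 1) powr (- 3 / 2)) * ((C2 * C3) * (real m + 1) powr (- 3 / 2))"
      unfolding powr_add [symmetric] by simp
    finally show ?thesis .
  qed
  note D = double_suminf_dominated [OF this]
  have sA: "summable (\<lambda>j. C * (real j + 1) powr (- 3 / 2))" for C :: real
    by (intro summable_mult summable_powr_succ) simp
  have n: "C1 * (real j + 1) powr (- 3 / 2) \<ge> 0" "C2 * C3 * (real j + 1) powr (- 3 / 2) \<ge> 0" for j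
    using C1(1) C2(1) C3(1) by auto
  show "summable (\<lambda>j. \<Sum>m. pochhammer a (j + m) * rGamma (of_nat (j + m) + h)
     * (pochhammer p j * pochhammer q j / fact j * rGamma (of_nat j + r))
     * (pochhammer s m * pochhammer t m / fact m * rGamma (of_nat m + u)))"
    using D(2) [OF sA sA n] by (simp only: H_def)
  have "double_F32 a h p q r s t u = (\<Sum>m. \<Sum>j. H j m)"
    using D(3) [OF sA sA n] by (simp only: H_def double_F32_def)
  also have "\<dots> = double_F32 a h s t u p q r"
    by (simp only: H_def double_F32_def add.commute mult_ac)
  finally show "double_F32 a h p q r s t u = double_F32 a h s t u p q r" .
qed

lemma F43_summable:
  fixes a b c d e f g :: complex
  assumes "e + f + g = 1 + a + b + c + d"
  shows "summable (\<lambda>k. norm (pochhammer a k * pochhammer b k * pochhammer c k * pochhammer d k / fact k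
            * rGamma (of_nat k + e) * rGamma (of_nat k + f) * rGamma (of_nat k + g)))"
proof -
  obtain C1 where C1: "C1 > 0" "\<And>k. norm (pochhammer a k * rGamma (of_nat k + e)) \<le> C1 * (real k + 1) powr (Re (a - e))"
    using pochhammer_rGamma_bound by blast
  obtain C2 where C2: "C2 > 0" "\<And>k. norm (pochhammer b k * pochhammer c k * pochhammer d k / fact k * rGamma (of_nat k + f) * rGamma (of_nat k + g))
      \<le> C2 * (real k + 1) powr (Re (b + c + d - f - g) - 1)"
    using hyp3_term_bound by blast
  have "norm (norm (pochhammer a k * pochhammer b k * pochhammer c k * pochhammer d k / fact k
            * rGamma (of_nat k + e) * rGamma (of_nat k + f) * rGamma (of_nat k + g))) \<le> C1 * C2 * (real k + 1) powr (- 2)" for k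
  proof -
    have "norm (norm (pochhammer a k * pochhammer b k * pochhammer c k * pochhammer d k / fact k
            * rGamma (of_nat k + e) * rGamma (of_nat k + f) * rGamma (of_nat k + g))) =
       norm (pochhammer a k * rGamma (of_nat k + e)) * norm (pochhammer b k * pochhammer c k * pochhammer d k / fact k * rGamma (of_nat k + f) * rGamma (of_nat k + g))"
      by (simp add: norm_mult norm_divide)
    also have "\<dots> \<le> (C1 * (real k + 1) powr (Re (a - e))) * (C2 * (real k + 1) powr (Re (b + c + d - f - g) - 1))"
      using C1 C2 by (intro mult_mono) auto
    also have "\<dots> = C1 * C2 * ((real k + 1) powr (Re (a - e)) * (real k + 1) powr (Re (b + c + d - f - g) - 1))"
      by simp
    also have "(real k + 1) powr (Re (a - e)) * (real k + 1) powr (Re (b + c + d - f - g) - 1) = (real k + 1) powr (- 2)"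
      unfolding powr_add [symmetric] using arg_cong [OF assms, of Re] by (intro arg_cong2 [of _ _ _ _ "(powr)"]) auto
    finally show ?thesis .
  qed
  then show ?thesis
    by (rule summable_comparison_test' [rotated]) (intro summable_mult summable_powr_succ, simp)
qed

text \<open>After the convolution the inner sum over m is a balanced 3F2 with parameters (a+j,
  \<beta>, d+j; f+j, g+j). Saalschuetz's theorem replaces it by a product, which reassembles into a
  single 4F3, minus a companion 3F2, which produces the double series.\<close>

lemma F43_reg_transform_step:
  fixes a b c d e f g :: complex
  assumes bal: "e + f + g = 1 + a + b + c + d" and \<beta>: "\<beta> = b + c - e" "Re \<beta> \<ge> 0"
  shows "F43_reg a b c d e f g * rGamma (1 + a - f) * rGamma (1 + a - g) =
    rGamma (f - d) * rGamma (g - d) * F43_reg a (e - b) (e - c) d e (f - \<beta>) (g - \<beta>)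
    - rGamma \<beta> * rGamma d * double_F32 a (1 + a - \<beta>) (e - b) (e - c) e (1 + a - f) (1 + a - g) (1 + a - d)"
proof -
  define H where "H j m = (pochhammer a (j + m) * rGamma (of_nat (j + m) + f)) * (pochhammer d (j + m) * rGamma (of_nat (j + m) + g))
     * (pochhammer (e - b) j * pochhammer (e - c) j / fact j * rGamma (of_nat j + e)) * (pochhammer \<beta> m / fact m)" for j m
  define P where "P j = pochhammer a j * pochhammer d j * (pochhammer (e - b) j * pochhammer (e - c) j / fact j * rGamma (of_nat j + e))" for j
  define Xt where "Xt j m = pochhammer a (j + m) * rGamma (of_nat (j + m) + (1 + a - \<beta>))
     * (pochhammer (e - b) j * pochhammer (e - c) j / fact j * rGamma (of_nat j + e))
     * (pochhammer (1 + a - f) m * pochhammer (1 + a - g) m / fact m * rGamma (of_nat m + (1 + a - d)))" for j m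
  have bal': "f + g = 1 + a + d + \<beta>" using bal by (simp add: \<beta> algebra_simps)
  obtain C1 where C1: "C1 > 0" "\<And>k. norm (pochhammer a k * rGamma (of_nat k + f)) \<le> C1 * (real k + 1) powr (Re (a - f))"
    using pochhammer_rGamma_bound by blast
  obtain C2 where C2: "C2 > 0" "\<And>k. norm (pochhammer d k * rGamma (of_nat k + g)) \<le> C2 * (real k + 1) powr (Re (d - g))"
    using pochhammer_rGamma_bound by blast
  obtain C3 where C3: "C3 > 0" "\<And>k. norm (pochhammer (e - b) k * pochhammer (e - c) k / fact k * rGamma (of_nat k + e))
      \<le> C3 * (real k + 1) powr (Re ((e - b) + (e - c) - e) - 1)"
    using hyp2_term_bound by blast
  obtain C4 where C4': "C4 > 0" "\<And>k. norm (pochhammer \<beta> k * rGamma (of_nat k + 1)) \<le> C4 * (real k + 1) powr (Re (\<beta> - 1))"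
    using pochhammer_rGamma_bound by blast
  then have C4: "C4 > 0" "\<And>k. norm (pochhammer \<beta> k / fact k) \<le> C4 * (real k + 1) powr (Re (\<beta> - 1))"
    by (simp_all add: rGamma_of_nat_plus_one)
  \<comment> \<open>Here Re \<beta> \<ge> 0 enters: the factor (j+m+1)^(-Re \<beta>) is given
    entirely to m, where it offsets the growth (m+1)^(Re \<beta> - 1) of the convolution
    weights.\<close>
  have Hb: "norm (H j m) \<le> ((C1 * C2) * (real j + 1) powr (- 3 / 2)) * ((C3 * C4) * (real m + 1) powr (- 3 / 2))" for j m
  proof -
    have "norm (H j m) \<le> (C1 * (real (j + m) + 1) powr (Re (a - f))) * (C2 * (real (j + m) + 1) powr (Re (d - g)))
        * (C3 * (real j + 1) powr (Re ((e - b) + (e - c) - e) - 1)) * (C4 * (real m + 1) powr (Re (\<beta> - 1)))"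
      unfolding H_def norm_mult [of "_ * _ * _ :: complex"] norm_mult [of "pochhammer a (j + m) * rGamma (of_nat (j + m) + f)"]
      using C1(2) [of "j + m"] C2(2) [of "j + m"] C3(2) [of j] C4(2) [of m] C1(1) C2(1) C3(1) C4(1)
      by (intro mult_mono) auto
    also have "\<dots> = (C1 * C2) * ((real (j + m) + 1) powr (Re (a - f)) * (real (j + m) + 1) powr (Re (d - g)))
        * (C3 * (real j + 1) powr (Re ((e - b) + (e - c) - e) - 1)) * (C4 * (real m + 1) powr (Re (\<beta> - 1)))"
      by (simp only: mult_ac)
    also have "(real (j + m) + 1) powr (Re (a - f)) * (real (j + m) + 1) powr (Re (d - g)) = (real (j + m) + 1) powr (- Re \<beta>) * (real (j + m) + 1) powr (- 1)"
      unfolding powr_add [symmetric] using arg_cong [OF bal', of Re] by (intro arg_cong2 [of _ _ _ _ "(powr)"]) auto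
    also have "Re ((e - b) + (e - c) - e) - 1 = - Re \<beta> - 1" by (simp add: \<beta>)
    also have "(C1 * C2) * ((real (j + m) + 1) powr (- Re \<beta>) * (real (j + m) + 1) powr (- 1)) * (C3 * (real j + 1) powr (- Re \<beta> - 1)) * (C4 * (real m + 1) powr (Re (\<beta> - 1)))
       \<le> (C1 * C2) * ((real m + 1) powr (- Re \<beta>) * ((real j + 1) powr (- 1 / 2) * (real m + 1) powr (- 1 / 2))) * (C3 * (real j + 1) powr (- 1)) * (C4 * (real m + 1) powr (Re (\<beta> - 1)))"
    proof -
      have "(real (j + m) + 1) powr (- Re \<beta>) \<le> (real m + 1) powr (- Re \<beta>)"
        using \<beta> by (intro powr_mono2') auto
      moreover have "(real j + 1) powr (- Re \<beta> - 1) \<le> (real j + 1) powr (- 1)"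
        using \<beta> by (intro powr_mono) auto
      ultimately show ?thesis
        using C1(1) C2(1) C3(1) C4(1) powr_add_nat_le [of "- 1" j m]
        by (intro mult_right_mono mult_left_mono mult_mono) auto
    qed
    also have "\<dots> = (C1 * C2) * ((real j + 1) powr (- 1 / 2) * (real j + 1) powr (- 1)) * ((C3 * C4) * ((real m + 1) powr (- Re \<beta>) * (real m + 1) powr (- 1 / 2) * (real m + 1) powr (Re (\<beta> - 1))))"
      by (simp only: mult_ac)
    also have "\<dots> = ((C1 * C2) * (real j + 1) powr (- 3 / 2)) * ((C3 * C4) * (real m + 1) powr (- 3 / 2))"
      unfolding powr_add [symmetric] by simp
    finally show ?thesis .
  qed
  have sA: "summable (\<lambda>j. C * (real j + 1) powr (- 3 / 2))" for C :: real
    by (intro summable_mult summable_powr_succ) simp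
  have nonneg: "C1 * C2 * (real j + 1) powr (- 3 / 2) \<ge> 0" "C3 * C4 * (real j + 1) powr (- 3 / 2) \<ge> 0" for j
    using C1(1) C2(1) C3(1) C4(1) by auto
  note D = double_suminf_dominated [OF Hb sA sA nonneg]
  have conv: "pochhammer a k * pochhammer b k * pochhammer c k * pochhammer d k / fact k
            * rGamma (of_nat k + e) * rGamma (of_nat k + f) * rGamma (of_nat k + g) = (\<Sum>j\<le>k. H j (k - j))" for k
  proof -
    have "pochhammer b k * pochhammer c k / fact k * rGamma (of_nat k + e) =
      (\<Sum>j\<le>k. pochhammer (e - b) j * pochhammer (e - c) j / fact j * rGamma (of_nat j + e) * (pochhammer \<beta> (k - j) / fact (k - j)))"
      unfolding pochhammer_euler_convolution [of b k c e] sum_distrib_right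
    proof (rule sum.cong)
      fix j assume "j \<in> {..k}"
      then have "rGamma (of_nat j + e) = pochhammer (e + of_nat j) (k - j) * rGamma (of_nat k + e)"
        using pochhammer_rGamma [of "of_nat j + e" "k - j"] by (simp add: add_ac of_nat_diff)
      then show "pochhammer (e - b) j * pochhammer (e - c) j / fact j * pochhammer (e + of_nat j) (k - j) *
          (pochhammer (b + c - e) (k - j) / fact (k - j)) * rGamma (of_nat k + e) =
        pochhammer (e - b) j * pochhammer (e - c) j / fact j * rGamma (of_nat j + e) * (pochhammer \<beta> (k - j) / fact (k - j))"
        by (simp add: \<beta>)
    qed simp
    then have "(pochhammer a k * pochhammer d k * rGamma (of_nat k + f) * rGamma (of_nat k + g)) * (pochhammer b k * pochhammer c k / fact k * rGamma (of_nat k + e))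
      = (pochhammer a k * pochhammer d k * rGamma (of_nat k + f) * rGamma (of_nat k + g)) *
      (\<Sum>j\<le>k. pochhammer (e - b) j * pochhammer (e - c) j / fact j * rGamma (of_nat j + e) * (pochhammer \<beta> (k - j) / fact (k - j)))"
      by (rule arg_cong)
    also have "\<dots> = (\<Sum>j\<le>k. H j (k - j))"
      unfolding sum_distrib_left by (intro sum.cong) (auto simp: H_def)
    finally show ?thesis by (simp add: mult_ac)
  qed
  have F: "F43_reg a b c d e f g = (\<Sum>j. \<Sum>m. H j m)"
    unfolding F43_reg_def conv by (rule D(4))
  have inner: "(\<Sum>m. H j m) = P j * F32_reg (a + of_nat j) \<beta> (d + of_nat j) (f + of_nat j) (g + of_nat j)" for j
  proof -
    have R: "Re (f + of_nat j) + Re (g + of_nat j) - Re (a + of_nat j) - Re \<beta> - Re (d + of_nat j) = 1"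
      using arg_cong [OF bal', of Re] by simp
    have "summable (\<lambda>k. pochhammer (a + of_nat j) k * pochhammer \<beta> k * pochhammer (d + of_nat j) k / fact k * rGamma (of_nat k + (f + of_nat j)) * rGamma (of_nat k + (g + of_nat j)))"
      by (rule summable_norm_cancel, rule F32_summable) (use R in simp)
    note s = suminf_mult [OF this, of "P j"]
    have "H j m = P j * (pochhammer (a + of_nat j) m * pochhammer \<beta> m * pochhammer (d + of_nat j) m / fact m * rGamma (of_nat m + (f + of_nat j)) * rGamma (of_nat m + (g + of_nat j)))" for m
    proof -
      have "of_nat (j + m) + f = of_nat m + (f + of_nat j)" "of_nat (j + m) + g = of_nat m + (g + of_nat j)" by simp_all
      then show ?thesis by (simp only: H_def P_def pochhammer_product') simp
    qed
    then show ?thesis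
      unfolding F32_reg_def by (simp only: s)
  qed
  \<comment> \<open>Writing \<open>rGamma d\<close> as (d)_j \<open>rGamma (d + j)\<close> supplies
    the symbol (d)_j that the double series lacks, so the companion 3F2 gets the same prefactor
    \<open>P j\<close> as the inner sum.\<close>
  have Xi: "(\<Sum>m. Xt j m) * rGamma d = P j * rGamma (d + of_nat j) * F32_reg (a + of_nat j) (1 + a - f) (1 + a - g) (1 + a + of_nat j - \<beta>) (1 + a - d)" for j
  proof -
    have R: "Re (1 + a + of_nat j - \<beta>) + Re (1 + a - d) - Re (a + of_nat j) - Re (1 + a - f) - Re (1 + a - g) = 1"
      using arg_cong [OF bal', of Re] by simp
    have "summable (\<lambda>k. pochhammer (a + of_nat j) k * pochhammer (1 + a - f) k * pochhammer (1 + a - g) k / fact k * rGamma (of_nat k + (1 + a + of_nat j - \<beta>)) * rGamma (of_nat k + (1 + a - d)))"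
      by (rule summable_norm_cancel, rule F32_summable) (use R in simp)
    note s = suminf_mult [OF this, of "pochhammer a j * (pochhammer (e - b) j * pochhammer (e - c) j / fact j * rGamma (of_nat j + e))"]
    have "Xt j m = pochhammer a j * (pochhammer (e - b) j * pochhammer (e - c) j / fact j * rGamma (of_nat j + e)) *
       (pochhammer (a + of_nat j) m * pochhammer (1 + a - f) m * pochhammer (1 + a - g) m / fact m * rGamma (of_nat m + (1 + a + of_nat j - \<beta>)) * rGamma (of_nat m + (1 + a - d)))" for m
    proof -
      have "of_nat (j + m) + (1 + a - \<beta>) = of_nat m + (1 + a + of_nat j - \<beta>)" by simp
      then show ?thesis by (simp only: Xt_def pochhammer_product') simp
    qed
    then have "(\<Sum>m. Xt j m) = pochhammer a j * (pochhammer (e - b) j * pochhammer (e - c) j / fact j * rGamma (of_nat j + e)) *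
        F32_reg (a + of_nat j) (1 + a - f) (1 + a - g) (1 + a + of_nat j - \<beta>) (1 + a - d)"
      unfolding F32_reg_def by (simp only: s)
    moreover have "rGamma d = pochhammer d j * rGamma (d + of_nat j)" by (rule pochhammer_rGamma)
    ultimately show ?thesis by (simp add: P_def)
  qed
  have key: "(\<Sum>m. H j m) * (rGamma (1 + a - f) * rGamma (1 + a - g)) =
      rGamma (f - d) * rGamma (g - d) * (P j * rGamma (of_nat j + (f - \<beta>)) * rGamma (of_nat j + (g - \<beta>))) - rGamma \<beta> * rGamma d * (\<Sum>m. Xt j m)" for j
  proof -
    have "(f + of_nat j) + (g + of_nat j) = 1 + (a + of_nat j) + \<beta> + (d + of_nat j)"
      using bal' by (simp add: algebra_simps)
    from nonterminating_saalschuetz [OF this]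
    have "F32_reg (a + of_nat j) \<beta> (d + of_nat j) (f + of_nat j) (g + of_nat j) * rGamma (1 + a - f) * rGamma (1 + a - g)
       + F32_reg (a + of_nat j) (1 + a - f) (1 + a - g) (1 + a + of_nat j - \<beta>) (1 + a - d) * rGamma \<beta> * rGamma (d + of_nat j)
       = rGamma (of_nat j + (f - \<beta>)) * rGamma (f - d) * rGamma (of_nat j + (g - \<beta>)) * rGamma (g - d)"
      by (simp add: algebra_simps)
    moreover have "P * F * (R1 * R2) = A * B * (P * U * W) - rb * (P * rd * Y)" if "F * R1 * R2 + Y * rb * rd = U * A * W * B"
      for P F R1 R2 A B U W rb rd Y :: complex
      using that by algebra
    ultimately show ?thesis
      unfolding inner mult.assoc [of "rGamma \<beta>"] mult.commute [of "rGamma d"] Xi by blast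
  qed
  have sX: "summable (\<lambda>j. \<Sum>m. Xt j m)"
    unfolding Xt_def using \<beta> arg_cong [OF bal', of Re]
    by (intro double_F32_swap(2) [where \<beta> = \<beta>]) auto
  have bal2: "e + (f - \<beta>) + (g - \<beta>) = 1 + a + (e - b) + (e - c) + d"
    using bal by (simp add: \<beta> algebra_simps)
  have trm: "P j * rGamma (of_nat j + (f - \<beta>)) * rGamma (of_nat j + (g - \<beta>)) =
    pochhammer a j * pochhammer (e - b) j * pochhammer (e - c) j * pochhammer d j / fact j
            * rGamma (of_nat j + e) * rGamma (of_nat j + (f - \<beta>)) * rGamma (of_nat j + (g - \<beta>))" for j
    by (simp add: P_def)
  have sF: "summable (\<lambda>j. P j * rGamma (of_nat j + (f - \<beta>)) * rGamma (of_nat j + (g - \<beta>)))"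
    unfolding trm by (rule summable_norm_cancel) (rule F43_summable [OF bal2])
  have "F43_reg a b c d e f g * (rGamma (1 + a - f) * rGamma (1 + a - g)) = (\<Sum>j. (\<Sum>m. H j m) * (rGamma (1 + a - f) * rGamma (1 + a - g)))"
    unfolding F by (rule suminf_mult2) (rule D(2))
  also have "\<dots> = rGamma (f - d) * rGamma (g - d) * (\<Sum>j. P j * rGamma (of_nat j + (f - \<beta>)) * rGamma (of_nat j + (g - \<beta>))) - rGamma \<beta> * rGamma d * (\<Sum>j. \<Sum>m. Xt j m)"
    unfolding key by (subst suminf_diff [symmetric]) (auto intro: summable_mult sF sX simp: suminf_mult sF sX)
  also have "(\<Sum>j. P j * rGamma (of_nat j + (f - \<beta>)) * rGamma (of_nat j + (g - \<beta>))) = F43_reg a (e - b) (e - c) d e (f - \<beta>) (g - \<beta>)"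
    unfolding trm F43_reg_def ..
  also have "(\<Sum>j. \<Sum>m. Xt j m) = double_F32 a (1 + a - \<beta>) (e - b) (e - c) e (1 + a - f) (1 + a - g) (1 + a - d)"
    unfolding Xt_def double_F32_def ..
  finally show ?thesis by (simp only: mult.assoc)
qed

text \<open>\<open>K_fun\<close> in seven separate arguments, so that permutations and substitutions
  of parameters become rewriting.\<close>

definition KK :: "complex \<Rightarrow> complex \<Rightarrow> complex \<Rightarrow> complex \<Rightarrow> complex \<Rightarrow> complex \<Rightarrow> complex \<Rightarrow> complex" where
  "KK a b c d e f g = F43_reg a b c d e f g * rGamma (1 + a - e) * rGamma (1 + a - f) * rGamma (1 + a - g)
     + F43_reg a (1 + a - e) (1 + a - f) (1 + a - g) (1 + a - b) (1 + a - c) (1 + a - d)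
         * rGamma b * rGamma c * rGamma d"

lemma KK_transform:
  fixes a b c d e f g :: complex
  assumes bal: "e + f + g = 1 + a + b + c + d"
  shows "KK a b c d e f g = KK a (e - b) (e - c) d e (f - (b + c - e)) (g - (b + c - e))"
proof -
  have main: "KK a b c d e f g = KK a (e - b) (e - c) d e (f - (b + c - e)) (g - (b + c - e))"
    if bal: "e + f + g = 1 + a + b + c + d" and re: "Re (b + c - e) \<ge> 0" for b c d e f g
  proof -
    define \<beta> where "\<beta> = b + c - e"
    have bal': "f + g = 1 + a + d + \<beta>" using bal by (simp add: \<beta>_def algebra_simps)
    have g: "g = 1 + a + d + \<beta> - f" using bal' by (simp add: algebra_simps)
    have b: "b = \<beta> + e - c" by (simp add: \<beta>_def)
    note L1 = F43_reg_transform_step [OF bal \<beta>_def re [folded \<beta>_def]]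
    have "(1 + a - d) + (1 + a - e + b) + (1 + a - e + c) = 1 + a + (1 + a - (f - \<beta>)) + (1 + a - (g - \<beta>)) + (1 + a - e)"
      by (simp add: g b)
    moreover have "\<beta> = (1 + a - (f - \<beta>)) + (1 + a - (g - \<beta>)) - (1 + a - d)"
      by (simp add: g)
    \<comment> \<open>The same step applied to the companion series of the transformed side leads
      back to the companion series of the original side, with the same \<beta>. Its double series
      agrees with that of \<open>L1\<close> after the swap.\<close>
    ultimately have L2: "F43_reg a (1 + a - (f - \<beta>)) (1 + a - (g - \<beta>)) (1 + a - e) (1 + a - d) (1 + a - e + b) (1 + a - e + c)
        * rGamma (1 + a - (1 + a - e + b)) * rGamma (1 + a - (1 + a - e + c)) =
      rGamma (1 + a - e + b - (1 + a - e)) * rGamma (1 + a - e + c - (1 + a - e)) *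
        F43_reg a (1 + a - d - (1 + a - (f - \<beta>))) (1 + a - d - (1 + a - (g - \<beta>))) (1 + a - e) (1 + a - d) (1 + a - e + b - \<beta>) (1 + a - e + c - \<beta>)
      - rGamma \<beta> * rGamma (1 + a - e) * double_F32 a (1 + a - \<beta>) (1 + a - d - (1 + a - (f - \<beta>))) (1 + a - d - (1 + a - (g - \<beta>))) (1 + a - d)
         (1 + a - (1 + a - e + b)) (1 + a - (1 + a - e + c)) (1 + a - (1 + a - e))"
      by (intro F43_reg_transform_step re [folded \<beta>_def])
    have s: "1 + a - (1 + a - e + b) = e - b" "1 + a - (1 + a - e + c) = e - c" "1 + a - e + b - (1 + a - e) = b"
      "1 + a - e + c - (1 + a - e) = c" "1 + a - d - (g - d) = 1 + a - g" "1 + a - d - (f - d) = 1 + a - f"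
      "1 + a - e + b - \<beta> = 1 + a - c" "1 + a - e + c - \<beta> = 1 + a - b" "1 + a - (1 + a - e) = e"
      "1 + a - (f - \<beta>) = g - d" "1 + a - (g - \<beta>) = f - d"
      by (simp_all add: g b)
    have s': "1 + a - (e - b) = 1 + a - e + b" "1 + a - (e - c) = 1 + a - e + c" by simp_all
    have Fsym1: "F43_reg a (1 + a - g) (1 + a - f) (1 + a - e) (1 + a - d) (1 + a - c) (1 + a - b) = F43_reg a (1 + a - e) (1 + a - f) (1 + a - g) (1 + a - b) (1 + a - c) (1 + a - d)"
      by (simp add: F43_reg_def mult_ac)
    have Fsym2: "F43_reg a (g - d) (f - d) (1 + a - e) (1 + a - d) (1 + a - e + b) (1 + a - e + c) = F43_reg a (1 + a - e) (g - d) (f - d) (1 + a - e + b) (1 + a - e + c) (1 + a - d)"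
      by (simp add: F43_reg_def mult_ac)
    have Xsym: "double_F32 a (1 + a - \<beta>) (1 + a - g) (1 + a - f) (1 + a - d) (e - b) (e - c) e = double_F32 a (1 + a - \<beta>) (e - b) (e - c) e (1 + a - f) (1 + a - g) (1 + a - d)"
    proof -
      have "double_F32 a (1 + a - \<beta>) (1 + a - g) (1 + a - f) (1 + a - d) (e - b) (e - c) e = double_F32 a (1 + a - \<beta>) (e - b) (e - c) e (1 + a - g) (1 + a - f) (1 + a - d)"
        using re by (intro double_F32_swap(1) [where \<beta> = \<beta>]) (auto simp: g b)
      also have "\<dots> = double_F32 a (1 + a - \<beta>) (e - b) (e - c) e (1 + a - f) (1 + a - g) (1 + a - d)"
        by (simp add: double_F32_def mult_ac)
      finally show ?thesis .
    qed
    have "F * r1 * r2 * r3 + G * rb * rc * rd = F' * r1 * r4 * r5 + G' * rp * rq * rd"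
      if "F * r2 * r3 = r5 * r4 * F' - rB * rd * X" "G' * rp * rq = rb * rc * G - rB * r1 * X"
      for F r1 r2 r3 G rb rc rd F' r4 r5 G' rp rq rB X :: complex
      using that by algebra
    from this [OF L1 L2 [unfolded s Fsym1 Fsym2 Xsym]]
    show ?thesis
      unfolding KK_def \<beta>_def [symmetric] s s' .
  qed
  show ?thesis
  proof (cases "Re (b + c - e) \<ge> 0")
    case True
    with bal show ?thesis by (rule main)
  next
    \<comment> \<open>The substitution is an involution that changes the sign of b + c - e, so the
      case already proved applies to the transformed parameters.\<close>
    case False
    have "KK a (e - b) (e - c) d e (f - (b + c - e)) (g - (b + c - e)) = KK a (e - (e - b)) (e - (e - c)) d e (f - (b + c - e) - (e - b + (e - c) - e)) (g - (b + c - e) - (e - b + (e - c) - e))"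
      using False bal by (intro main) (simp_all add: algebra_simps)
    then show ?thesis by simp
  qed
qed

subsection \<open>Partial fractions of balanced Gamma quotients\<close>

text \<open>Compare top coefficients in Lagrange's interpolation formula, which reproduces p because
  its degree is below the number of nodes.\<close>

lemma sum_poly_over_nodes:
  fixes p :: "complex poly"
  assumes X: "finite X" and deg: "degree p < card X"
  shows "(\<Sum>x\<in>X. poly p x / (\<Prod>y\<in>X - {x}. x - y)) = coeff p (card X - 1)"
proof -
  define L where "L x = (\<Prod>y\<in>X - {x}. [:- y, 1:])" for x :: complex
  define q where "q = (\<Sum>x\<in>X. smult (poly p x / (\<Prod>y\<in>X - {x}. x - y)) (L x))"
  have L: "degree (L x) = card X - 1" "coeff (L x) (card X - 1) = 1" if "x \<in> X" for x
  proof -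
    have d: "degree (L x) = card X - 1"
      unfolding L_def using X that by (subst degree_prod_eq_sum_degree) auto
    have "lead_coeff (L x) = 1"
      unfolding L_def by (simp add: lead_coeff_prod)
    with d show "degree (L x) = card X - 1" "coeff (L x) (card X - 1) = 1" by simp_all
  qed
  have "degree q \<le> card X - 1"
    unfolding q_def using L by (intro degree_sum_le X) (auto intro: order_trans [OF degree_smult_le])
  then have dq: "degree q < card X" using deg by simp
  have poly_L: "poly (L x) z = (\<Prod>y\<in>X - {x}. z - y)" for x z
    by (simp add: L_def poly_prod)
  have off: "(\<Prod>y\<in>X - {x}. z - y) = 0" if "x \<noteq> z" "z \<in> X" for x z
    using that X by (intro prod_zero) auto
  have nz: "(\<Prod>y\<in>X - {x}. x - y) \<noteq> 0" for x
    using X by auto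
  have pq: "poly q z = poly p z" if "z \<in> X" for z
  proof -
    have "poly q z = (\<Sum>x\<in>X. if x = z then poly p z else 0)"
      unfolding q_def poly_sum poly_smult poly_L
    proof (rule sum.cong [OF refl])
      fix x
      show "poly p x / (\<Prod>y\<in>X - {x}. x - y) * (\<Prod>y\<in>X - {x}. z - y) = (if x = z then poly p z else 0)"
        using that off [of x z] nz [of z] by (cases "x = z") auto
    qed
    then show ?thesis using that X by simp
  qed
  have "p = q"
  proof (rule ccontr)
    assume "p \<noteq> q"
    then have nz: "p - q \<noteq> 0" by simp
    have "card X \<le> card {x. poly (p - q) x = 0}"
      using pq by (intro card_mono poly_roots_finite nz) auto
    also have "\<dots> \<le> degree (p - q)" by (rule card_poly_roots_bound [OF nz])
    also have "\<dots> < card X" using deg dq by (rule degree_diff_less)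
    finally show False by simp
  qed
  then have "coeff p (card X - 1) = coeff q (card X - 1)" by (rule arg_cong)
  also have "\<dots> = (\<Sum>x\<in>X. poly p x / (\<Prod>y\<in>X - {x}. x - y) * coeff (L x) (card X - 1))"
    by (simp add: q_def coeff_sum)
  also have "\<dots> = (\<Sum>x\<in>X. poly p x / (\<Prod>y\<in>X - {x}. x - y))"
    using L by (intro sum.cong) auto
  finally show ?thesis by simp
qed

lemma prod_pochhammer_rGamma_bound:
  fixes z w :: "'i \<Rightarrow> complex"
  assumes "finite I"
  shows "\<exists>C>0. \<forall>k. norm (\<Prod>i\<in>I. pochhammer (z i) k * rGamma (of_nat k + w i)) \<le> C * (real k + 1) powr Re (\<Sum>i\<in>I. z i - w i)"
  using assms
proof (induction I rule: finite_induct)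
  case empty
  show ?case by (intro exI [of _ 1]) auto
next
  case (insert i I)
  obtain C where C: "C > 0" "\<And>k. norm (\<Prod>i\<in>I. pochhammer (z i) k * rGamma (of_nat k + w i)) \<le> C * (real k + 1) powr Re (\<Sum>i\<in>I. z i - w i)"
    using insert.IH by blast
  obtain B where B: "B > 0" "\<And>k. norm (pochhammer (z i) k * rGamma (of_nat k + w i)) \<le> B * (real k + 1) powr Re (z i - w i)"
    using pochhammer_rGamma_bound by blast
  have "norm (\<Prod>i\<in>insert i I. pochhammer (z i) k * rGamma (of_nat k + w i)) \<le> B * C * (real k + 1) powr Re (\<Sum>i\<in>insert i I. z i - w i)" for k
  proof -
    have "norm (\<Prod>i\<in>insert i I. pochhammer (z i) k * rGamma (of_nat k + w i))
      = norm (pochhammer (z i) k * rGamma (of_nat k + w i)) * norm (\<Prod>i\<in>I. pochhammer (z i) k * rGamma (of_nat k + w i))"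
      using insert.hyps by (simp add: norm_mult)
    also have "\<dots> \<le> (B * (real k + 1) powr Re (z i - w i)) * (C * (real k + 1) powr Re (\<Sum>i\<in>I. z i - w i))"
      by (rule mult_mono [OF B(2) C(2)]) (use B in auto)
    also have "\<dots> = B * C * (real k + 1) powr Re (\<Sum>i\<in>insert i I. z i - w i)"
      using insert.hyps by (simp add: powr_add)
    finally show ?thesis .
  qed
  then show ?case using B C by (intro exI [of _ "B * C"]) simp
qed

lemma prod_pochhammer_rGamma_asymp:
  fixes z w :: "'i \<Rightarrow> complex"
  assumes I: "finite I" and s: "(\<Sum>i\<in>I. z i - w i) = of_nat m"
  shows "(\<lambda>n. (\<Prod>i\<in>I. pochhammer (z i) n * rGamma (of_nat n + w i)) / of_nat n ^ m) \<longlonglongrightarrow> (\<Prod>i\<in>I. rGamma (z i))"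
proof -
  have A: "(\<lambda>n. \<Prod>i\<in>I. pochhammer (z i) n * rGamma (of_nat n + w i) / of_nat n powr (z i - w i)) \<longlonglongrightarrow> (\<Prod>i\<in>I. rGamma (z i))"
  proof (rule tendsto_prod)
    fix i
    show "(\<lambda>n. pochhammer (z i) n * rGamma (of_nat n + w i) / of_nat n powr (z i - w i)) \<longlonglongrightarrow> rGamma (z i)"
      using pochhammer_rGamma_lists_asymp [of "[z i]" "[w i]"] by simp
  qed
  show ?thesis
  proof (rule Lim_transform_eventually [OF A], rule eventually_sequentiallyI [of 1])
    fix n :: nat assume "1 \<le> n"
    then have n: "(of_nat n :: complex) \<noteq> 0" by simp
    have "(\<Prod>i\<in>I. of_nat n powr (z i - w i)) = (of_nat n powr (\<Sum>i\<in>I. z i - w i) :: complex)"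
      using I n by (induction I rule: finite_induct) (simp_all add: powr_add del: sum_subtractf)
    also have "\<dots> = of_nat n ^ m" unfolding s using n by (simp add: powr_nat')
    finally show "(\<Prod>i\<in>I. pochhammer (z i) n * rGamma (of_nat n + w i) / of_nat n powr (z i - w i))
        = (\<Prod>i\<in>I. pochhammer (z i) n * rGamma (of_nat n + w i)) / of_nat n ^ m"
      by (simp add: prod_dividef)
  qed
qed

lemma pochhammer_minus_of_nat_split:
  fixes z :: complex
  assumes "k \<le> N"
  shows "pochhammer (z - of_nat k) N = (- 1) ^ k * pochhammer (1 - z) k * pochhammer z (N - k)"
proof -
  have "pochhammer (z - of_nat k) N = pochhammer (z - of_nat k) k * pochhammer (z - of_nat k + of_nat k) (N - k)"
    by (rule pochhammer_product [OF assms])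
  also have "pochhammer (z - of_nat k) k = (- 1) ^ k * pochhammer (1 - z) k"
    using pochhammer_minus [of "1 - z" k, symmetric] pochhammer_minus' [of "z - 1" k] by (simp add: algebra_simps)
  finally show ?thesis by simp
qed

lemma prod_of_nat_diff:
  assumes "k < N"
  shows "(\<Prod>m\<in>{..<N} - {k}. of_nat m - of_nat k) = ((- 1) ^ k * fact k * fact (N - Suc k) :: complex)"
proof -
  have split: "{..<N} - {k} = {..<k} \<union> {Suc k..<N}" using assms by auto
  have "(\<Prod>m<k. of_nat m - of_nat k) = ((- 1) ^ k * fact k :: complex)"
  proof -
    have "(\<Prod>m<k. of_nat m - of_nat k) = (\<Prod>m<k. - 1 * of_nat (Suc m) :: complex)"
      by (rule prod.reindex_bij_witness [where i = "\<lambda>m. k - Suc m" and j = "\<lambda>m. k - Suc m"]) (auto simp: of_nat_diff)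
    also have "\<dots> = (- 1) ^ k * fact k"
      unfolding prod.distrib by (simp add: fact_prod_Suc lessThan_atLeast0)
    finally show ?thesis .
  qed
  moreover have "(\<Prod>m\<in>{Suc k..<N}. of_nat m - of_nat k) = (fact (N - Suc k) :: complex)"
  proof -
    have "(\<Prod>m\<in>{Suc k..<N}. of_nat m - of_nat k) = (\<Prod>m<N - Suc k. of_nat (Suc m) :: complex)"
      by (rule prod.reindex_bij_witness [where i = "\<lambda>m. m + Suc k" and j = "\<lambda>m. m - Suc k"]) (auto simp: of_nat_diff)
    then show ?thesis by (simp add: fact_prod_Suc lessThan_atLeast0)
  qed
  ultimately show ?thesis unfolding split by (subst prod.union_disjoint) auto
qed

text \<open>The object is \<phi>(t) = \<Prod> \<Gamma>(a_i + t)/\<Gamma>(e_i + t):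
  \<open>balanced\<close> gives its decay t^(-2) away from the poles, and \<open>generic\<close>
  makes all its poles simple.\<close>

locale balanced_gamma_quotient =
  fixes I :: "'i set" and a e :: "'i \<Rightarrow> complex"
  assumes finite_I: "finite I"
    and balanced: "(\<Sum>i\<in>I. e i - a i) = 2"
    and generic: "\<And>i j. i \<in> I \<Longrightarrow> j \<in> I \<Longrightarrow> i \<noteq> j \<Longrightarrow> a i - a j \<notin> \<int>"
begin

text \<open>
  \<open>residue_0 i * tau i k\<close> is the residue of \<open>\<Prod> \<Gamma>(a_i+t)/\<Gamma>(e_i+t)\<close> at \<open>t = -a_i-k\<close>. The weights \<open>W i (N - k)\<close> correct these to the
  residues of the rational approximation \<open>\<Prod> (e_i+t)_N/(a_i+t)_N\<close>.
\<close>

definition tau :: "'i \<Rightarrow> nat \<Rightarrow> complex" where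
  "tau i k = (\<Prod>j\<in>I. pochhammer (1 + a i - e j) k) / ((\<Prod>j\<in>I - {i}. pochhammer (1 + a i - a j) k) * fact k)"

definition residue_0 :: "'i \<Rightarrow> complex" where
  "residue_0 i = (\<Prod>j\<in>I - {i}. Gamma (a j - a i)) * (\<Prod>j\<in>I. rGamma (e j - a i))"

definition W :: "'i \<Rightarrow> nat \<Rightarrow> complex" where
  "W i M = (\<Prod>j\<in>I. pochhammer (e j - a i) M) / ((\<Prod>j\<in>I - {i}. pochhammer (a j - a i) M) * fact (M - 1))"

lemma nonint_shift: "i \<in> I \<Longrightarrow> j \<in> I \<Longrightarrow> i \<noteq> j \<Longrightarrow> of_int m + (a i - a j) \<notin> \<int>"
  using generic [of i j] by simp

text \<open>Interpolation at the node t together with all poles -a_i - k. The numerator is monic of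
  degree one less than the number of nodes, so the weighted sum is 1; the node t contributes the
  rational function, and each pole minus its partial fraction.\<close>

lemma finite_partial_fractions:
  assumes t: "\<And>i. i \<in> I \<Longrightarrow> t + a i \<notin> \<int>\<^sub>\<le>\<^sub>0"
  shows "(\<Prod>j\<in>I. pochhammer (e j + t) N) / (\<Prod>j\<in>I. pochhammer (a j + t) N)
     = 1 + (\<Sum>i\<in>I. \<Sum>k<N. tau i k * W i (N - k) / (t + a i + of_nat k))"
proof -
  define pt where "pt = (\<lambda>(i, k). - a i - of_nat k :: complex)"
  define Ix where "Ix = I \<times> {..<N}"
  have finIx: "finite Ix" using finite_I by (simp add: Ix_def)
  have inj: "inj_on pt Ix"
  proof (rule inj_onI, clarify)
    fix i k j m assume h: "(i, k) \<in> Ix" "(j, m) \<in> Ix" "pt (i, k) = pt (j, m)"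
    then have eq: "a i - a j = of_int (int m - int k)" by (simp add: pt_def algebra_simps)
    have "i = j"
    proof (rule ccontr)
      assume "i \<noteq> j"
      then have "a i - a j \<notin> \<int>" using h by (intro generic) (auto simp: Ix_def)
      with eq show False by simp
    qed
    then show "i = j \<and> k = m" using h(3) by (simp add: pt_def)
  qed
  have t': "t \<noteq> pt x" if "x \<in> Ix" for x
  proof
    assume "t = pt x"
    then have "t + a (fst x) = - of_nat (snd x)" by (simp add: pt_def case_prod_unfold)
    then show False using t [of "fst x"] that by (auto simp: Ix_def)
  qed
  define X where "X = insert t (pt ` Ix)"
  have fX: "finite X" using finIx by (simp add: X_def)
  have tX: "t \<notin> pt ` Ix" using t' by auto
  have cX: "card X = Suc (card I * N)"
    using finIx tX by (simp add: X_def card_image [OF inj]) (simp add: Ix_def card_cartesian_product)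
  define p where "p = (\<Prod>j\<in>I. \<Prod>m<N. [:e j + of_nat m, 1:])"
  have degp: "degree p = card I * N"
    unfolding p_def using finite_I
    by (subst degree_prod_eq_sum_degree) (auto simp: degree_prod_eq_sum_degree)
  have "lead_coeff p = 1"
    unfolding p_def by (simp add: lead_coeff_prod)
  then have cp: "coeff p (card X - 1) = 1" by (simp add: cX degp)
  have polyp: "poly p z = (\<Prod>j\<in>I. pochhammer (e j + z) N)" for z
    unfolding p_def poly_prod by (simp add: pochhammer_prod lessThan_atLeast0 add_ac)
  have "degree p < card X" by (simp add: degp cX)
  from sum_poly_over_nodes [OF fX this]
  have "(\<Sum>x\<in>X. poly p x / (\<Prod>y\<in>X - {x}. x - y)) = 1" by (simp only: cp)
  also have "(\<Sum>x\<in>X. poly p x / (\<Prod>y\<in>X - {x}. x - y)) =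
      poly p t / (\<Prod>y\<in>X - {t}. t - y) + (\<Sum>x\<in>Ix. poly p (pt x) / (\<Prod>y\<in>X - {pt x}. pt x - y))"
    unfolding X_def using finIx tX by (simp add: sum.reindex [OF inj])
  also have "(\<Prod>y\<in>X - {t}. t - y) = (\<Prod>j\<in>I. pochhammer (a j + t) N)"
  proof -
    have "X - {t} = pt ` Ix" using tX by (auto simp: X_def)
    then have "(\<Prod>y\<in>X - {t}. t - y) = (\<Prod>x\<in>Ix. t - pt x)"
      by (simp add: prod.reindex [OF inj])
    also have "\<dots> = (\<Prod>j\<in>I. \<Prod>m<N. a j + t + of_nat m)"
      unfolding Ix_def prod.cartesian_product by (intro prod.cong) (auto simp: pt_def)
    finally show ?thesis by (simp add: pochhammer_prod lessThan_atLeast0)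
  qed
  also have "(\<Sum>x\<in>Ix. poly p (pt x) / (\<Prod>y\<in>X - {pt x}. pt x - y)) = (\<Sum>(i, k)\<in>Ix. - (tau i k * W i (N - k) / (t + a i + of_nat k)))"
  proof (rule sum.cong [OF refl], clarify)
    fix i k assume ik: "(i, k) \<in> Ix"
    then have i: "i \<in> I" and k: "k < N" by (auto simp: Ix_def)
    let ?s = "(- 1) ^ k :: complex"
    have s: "?s \<noteq> 0" by simp
    have num: "poly p (pt (i, k)) = (\<Prod>j\<in>I. ?s * pochhammer (1 + a i - e j) k * pochhammer (e j - a i) (N - k))"
      unfolding polyp
    proof (rule prod.cong [OF refl])
      fix j
      have "e j + pt (i, k) = (e j - a i) - of_nat k" by (simp add: pt_def)
      then show "pochhammer (e j + pt (i, k)) N = ?s * pochhammer (1 + a i - e j) k * pochhammer (e j - a i) (N - k)"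
        using k by (simp only: pochhammer_minus_of_nat_split) (simp add: algebra_simps)
    qed
    have Xins: "X - {pt (i, k)} = insert t (pt ` (Ix - {(i, k)}))"
      using inj ik tX t' [OF ik] by (auto simp: X_def inj_on_eq_iff)
    have "(\<Prod>y\<in>X - {pt (i, k)}. pt (i, k) - y) = (pt (i, k) - t) * (\<Prod>x\<in>Ix - {(i, k)}. pt (i, k) - pt x)"
      unfolding Xins using tX finIx inj by (subst prod.insert) (auto simp: prod.reindex inj_on_diff)
    also have "(\<Prod>x\<in>Ix - {(i, k)}. pt (i, k) - pt x) = (\<Prod>j\<in>I - {i}. pochhammer (a j - a i - of_nat k) N) * (\<Prod>m\<in>{..<N} - {k}. of_nat m - of_nat k)"
    proof -
      have "Ix - {(i, k)} = ((I - {i}) \<times> {..<N}) \<union> ({i} \<times> ({..<N} - {k}))"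
        using i k by (auto simp: Ix_def)
      then have "(\<Prod>x\<in>Ix - {(i, k)}. pt (i, k) - pt x) = (\<Prod>x\<in>(I - {i}) \<times> {..<N}. pt (i, k) - pt x) * (\<Prod>x\<in>{i} \<times> ({..<N} - {k}). pt (i, k) - pt x)"
        using finite_I by (simp only:) (rule prod.union_disjoint, auto)
      also have "(\<Prod>x\<in>(I - {i}) \<times> {..<N}. pt (i, k) - pt x) = (\<Prod>j\<in>I - {i}. \<Prod>m<N. a j - a i - of_nat k + of_nat m)"
        unfolding prod.cartesian_product by (intro prod.cong) (auto simp: pt_def)
      also have "(\<Prod>x\<in>{i} \<times> ({..<N} - {k}). pt (i, k) - pt x) = (\<Prod>m\<in>{..<N} - {k}. of_nat m - of_nat k)"
        by (rule prod.reindex_bij_witness [where i = "\<lambda>m. (i, m)" and j = snd]) (auto simp: pt_def)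
      finally show ?thesis by (simp add: pochhammer_prod lessThan_atLeast0)
    qed
    also have "(\<Prod>j\<in>I - {i}. pochhammer (a j - a i - of_nat k) N) = (\<Prod>j\<in>I - {i}. ?s * pochhammer (1 + a i - a j) k * pochhammer (a j - a i) (N - k))"
    proof (rule prod.cong [OF refl])
      fix j
      show "pochhammer (a j - a i - of_nat k) N = ?s * pochhammer (1 + a i - a j) k * pochhammer (a j - a i) (N - k)"
        using pochhammer_minus_of_nat_split [OF less_imp_le [OF k], of "a j - a i"] by (simp add: diff_diff_eq2)
    qed
    also have "(\<Prod>m\<in>{..<N} - {k}. of_nat m - of_nat k) = (?s * fact k * fact (N - k - 1) :: complex)"
      using prod_of_nat_diff [OF k] by simp
    finally have den: "(\<Prod>y\<in>X - {pt (i, k)}. pt (i, k) - y) = (pt (i, k) - t) * ((\<Prod>j\<in>I - {i}. ?s * pochhammer (1 + a i - a j) k * pochhammer (a j - a i) (N - k)) * (?s * fact k * fact (N - k - 1)))" .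
    \<comment> \<open>Numerator and denominator contain equally many factors (-1)^k: in the
      denominator the one for index i comes from the differences of integers within its own family
      of poles.\<close>
    have signs: "(\<Prod>j\<in>I. ?s) = (\<Prod>j\<in>I - {i}. ?s) * ?s"
      using prod.remove [OF finite_I i, of "\<lambda>_. ?s"] by (simp only: mult.commute)
    have ptt: "pt (i, k) - t = - (t + a i + of_nat k)" by (simp add: pt_def)
    have s2: "(\<Prod>j\<in>I - {i}. ?s) \<noteq> 0" by simp
    have "(S * s * A * B) / (- d * ((S * C * D) * (s * x * y))) = - (A / (C * x) * (B / (D * y)) / d)"
      if "S \<noteq> 0" "s \<noteq> 0" for S s A B C D x y d :: complex
      using that by (simp add: field_simps)
    from this [OF s2 s]
    show "poly p (pt (i, k)) / (\<Prod>y\<in>X - {pt (i, k)}. pt (i, k) - y) = - (tau i k * W i (N - k) / (t + a i + of_nat k))"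
      unfolding num den prod.distrib signs ptt tau_def W_def by (simp only:)
  qed
  also have "\<dots> = - (\<Sum>i\<in>I. \<Sum>k<N. tau i k * W i (N - k) / (t + a i + of_nat k))"
    unfolding Ix_def sum.cartesian_product [symmetric] by (simp add: sum_negf)
  finally show ?thesis by (simp add: polyp algebra_simps)
qed

end

section \<open>The limit of infinitely many poles\<close>

context balanced_gamma_quotient
begin

text \<open>The factor j = i is restored by reading 1/k! as \<open>rGamma (k + 1)\<close>. Every
  factor is now a Pochhammer symbol paired with an \<open>rGamma\<close> value, so the general
  growth estimate applies, with exponent -2.\<close>

lemma tau_alt:
  assumes i: "i \<in> I"
  shows "tau i k = (\<Prod>j\<in>I - {i}. Gamma (1 + a i - a j)) * (\<Prod>j\<in>I. pochhammer (1 + a i - e j) k * rGamma (of_nat k + (1 + a i - a j)))"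
proof -
  have "(\<Prod>j\<in>I. rGamma (of_nat k + (1 + a i - a j))) = rGamma (of_nat k + 1) * (\<Prod>j\<in>I - {i}. rGamma (of_nat k + (1 + a i - a j)))"
    using i finite_I by (simp add: prod.remove)
  moreover have "Gamma (1 + a i - a j) * rGamma (of_nat k + (1 + a i - a j)) = 1 / pochhammer (1 + a i - a j) k" if "j \<in> I - {i}" for j
  proof -
    have ni: "1 + a i - a j \<notin> \<int>"
      using nonint_shift [of i j 1] i that by (auto simp: algebra_simps)
    then have n: "1 + a i - a j \<notin> \<int>\<^sub>\<le>\<^sub>0" using nonpos_Ints_Int by blast
    have "rGamma (1 + a i - a j) = pochhammer (1 + a i - a j) k * rGamma (1 + a i - a j + of_nat k)" by (rule pochhammer_rGamma)
    moreover have "Gamma (1 + a i - a j) * rGamma (1 + a i - a j) = 1"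
      using n by (simp add: rGamma_inverse_Gamma Gamma_eq_zero_iff)
    moreover have "pochhammer (1 + a i - a j) k \<noteq> 0" using n by (auto simp: pochhammer_eq_0_iff)
    ultimately show ?thesis by (simp add: field_simps)
  qed
  then have "(\<Prod>j\<in>I - {i}. Gamma (1 + a i - a j)) * (\<Prod>j\<in>I - {i}. rGamma (of_nat k + (1 + a i - a j))) = (\<Prod>j\<in>I - {i}. 1 / pochhammer (1 + a i - a j) k)"
    unfolding prod.distrib [symmetric] by (intro prod.cong) auto
  ultimately show ?thesis
    unfolding tau_def prod.distrib by (simp add: rGamma_of_nat_plus_one prod_dividef mult_ac)
qed

lemma tau_bound: "i \<in> I \<Longrightarrow> \<exists>C>0. \<forall>k. norm (tau i k) \<le> C * (real k + 1) powr (- 2)"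
proof -
  assume i: "i \<in> I"
  obtain C where C: "C > 0" "\<And>k. norm (\<Prod>j\<in>I. pochhammer (1 + a i - e j) k * rGamma (of_nat k + (1 + a i - a j)))
     \<le> C * (real k + 1) powr Re (\<Sum>j\<in>I. (1 + a i - e j) - (1 + a i - a j))"
    using prod_pochhammer_rGamma_bound [OF finite_I, of "\<lambda>j. 1 + a i - e j" "\<lambda>j. 1 + a i - a j"] by blast
  have "(\<Sum>j\<in>I. (1 + a i - e j) - (1 + a i - a j)) = - (\<Sum>j\<in>I. e j - a j)"
    unfolding sum_negf [symmetric] by (intro sum.cong) auto
  then have s: "Re (\<Sum>j\<in>I. (1 + a i - e j) - (1 + a i - a j)) = - 2" by (simp only: balanced) simp
  let ?G = "norm (\<Prod>j\<in>I - {i}. Gamma (1 + a i - a j))"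
  have "norm (tau i k) \<le> (?G + 1) * C * (real k + 1) powr (- 2)" for k
  proof -
    have "norm (tau i k) = ?G * norm (\<Prod>j\<in>I. pochhammer (1 + a i - e j) k * rGamma (of_nat k + (1 + a i - a j)))"
      by (simp only: tau_alt [OF i] norm_mult)
    also have "\<dots> \<le> (?G + 1) * (C * (real k + 1) powr (- 2))"
      using C(2) [of k] unfolding s by (intro mult_mono) auto
    finally show ?thesis by (simp add: mult_ac)
  qed
  moreover have "(?G + 1) * C > 0" using C by (intro mult_pos_pos) (auto intro: add_nonneg_pos)
  ultimately show ?thesis by blast
qed

lemma W_alt:
  assumes i: "i \<in> I" and M: "M > 0"
  shows "W i M = (\<Prod>j\<in>I - {i}. Gamma (a j - a i)) * (\<Prod>j\<in>I. pochhammer (e j - a i) M * rGamma (of_nat M + (a j - a i)))"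
proof -
  have "rGamma (of_nat M) = (1 / fact (M - 1) :: complex)"
    using rGamma_of_nat_plus_one [of "M - 1"] M by (simp add: of_nat_diff)
  then have "(\<Prod>j\<in>I. rGamma (of_nat M + (a j - a i))) = 1 / fact (M - 1) * (\<Prod>j\<in>I - {i}. rGamma (of_nat M + (a j - a i)))"
    using i finite_I by (simp add: prod.remove)
  moreover have "Gamma (a j - a i) * rGamma (of_nat M + (a j - a i)) = 1 / pochhammer (a j - a i) M" if "j \<in> I - {i}" for j
  proof -
    have ni: "a j - a i \<notin> \<int>"
      using generic [of j i] i that by auto
    then have n: "a j - a i \<notin> \<int>\<^sub>\<le>\<^sub>0" using nonpos_Ints_Int by blast
    have "rGamma (a j - a i) = pochhammer (a j - a i) M * rGamma (a j - a i + of_nat M)" by (rule pochhammer_rGamma)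
    moreover have "Gamma (a j - a i) * rGamma (a j - a i) = 1"
      using n by (simp add: rGamma_inverse_Gamma Gamma_eq_zero_iff)
    moreover have "pochhammer (a j - a i) M \<noteq> 0" using n by (auto simp: pochhammer_eq_0_iff)
    ultimately show ?thesis by (simp add: field_simps)
  qed
  then have "(\<Prod>j\<in>I - {i}. Gamma (a j - a i)) * (\<Prod>j\<in>I - {i}. rGamma (of_nat M + (a j - a i))) = (\<Prod>j\<in>I - {i}. 1 / pochhammer (a j - a i) M)"
    unfolding prod.distrib [symmetric] by (intro prod.cong) auto
  ultimately show ?thesis
    unfolding W_def prod.distrib by (simp add: prod_dividef mult_ac)
qed

lemma W_tendsto:
  assumes i: "i \<in> I"
  shows "(\<lambda>M. W i M / of_nat M ^ 2) \<longlonglongrightarrow> residue_0 i"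
proof -
  have "(\<Sum>j\<in>I. (e j - a i) - (a j - a i)) = of_nat 2" using balanced by simp
  from prod_pochhammer_rGamma_asymp [OF finite_I this]
  have "(\<lambda>M. (\<Prod>j\<in>I - {i}. Gamma (a j - a i)) * ((\<Prod>j\<in>I. pochhammer (e j - a i) M * rGamma (of_nat M + (a j - a i))) / of_nat M ^ 2)) \<longlonglongrightarrow> residue_0 i"
    unfolding residue_0_def by (intro tendsto_mult tendsto_const)
  then show ?thesis
    by (rule Lim_transform_eventually, intro eventually_sequentiallyI [of 1]) (simp add: W_alt [OF i])
qed

lemma inverse_shift_bound:
  fixes z :: complex
  assumes "z \<notin> \<int>\<^sub>\<le>\<^sub>0"
  shows "\<exists>D>0. \<forall>k. norm (1 / (z + of_nat k)) \<le> D / (real k + 1)"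
proof -
  have "(\<lambda>k. (z - 1) / of_nat (Suc k) + 1) \<longlonglongrightarrow> 0 + 1"
    by (intro tendsto_add tendsto_const LIMSEQ_Suc [OF lim_const_over_n])
  then have "(\<lambda>k. inverse ((z - 1) / of_nat (Suc k) + 1)) \<longlonglongrightarrow> inverse (0 + 1)"
    by (intro tendsto_inverse) auto
  then have "Bseq (\<lambda>k. inverse ((z - 1) / of_nat (Suc k) + 1))"
    by (intro convergent_imp_Bseq) (auto simp: convergent_def)
  then obtain D where D: "D > 0" "\<And>k. norm (inverse ((z - 1) / of_nat (Suc k) + 1)) \<le> D"
    by (auto elim: BseqE)
  have "norm (1 / (z + of_nat k)) \<le> D / (real k + 1)" for k
  proof -
    have nz: "(of_nat (Suc k) :: complex) \<noteq> 0" by (rule of_nat_neq_0)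
    then have "(z - 1) / of_nat (Suc k) + 1 = (z + of_nat k) / of_nat (Suc k)"
      by (simp add: divide_simps)
    then have "norm (inverse ((z - 1) / of_nat (Suc k) + 1)) = norm (1 / (z + of_nat k)) * (real k + 1)"
      by (simp only: norm_divide norm_inverse norm_of_nat norm_one) (simp add: field_simps)
    with D(2) [of k] show ?thesis by (simp add: pos_le_divide_eq)
  qed
  with D show ?thesis by blast
qed

text \<open>Divide the finite expansion by N^2: the constant 1 disappears, W_i(N-k)/N^2 tends to
  \<open>residue_0 i\<close> and stays bounded, and the decay k^(-2) of \<open>tau\<close> dominates
  the sum.\<close>

theorem partial_fractions:
  assumes t: "\<And>i. i \<in> I \<Longrightarrow> t + a i \<notin> \<int>\<^sub>\<le>\<^sub>0"
  shows "(\<Prod>j\<in>I. Gamma (a j + t) * rGamma (e j + t)) = (\<Sum>i\<in>I. residue_0 i * (\<Sum>k. tau i k / (t + a i + of_nat k)))"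
proof -
  have L: "(\<lambda>N. (\<Prod>j\<in>I. pochhammer (e j + t) N) / (\<Prod>j\<in>I. pochhammer (a j + t) N) / of_nat N ^ 2)
      \<longlonglongrightarrow> (\<Prod>j\<in>I. Gamma (a j + t) * rGamma (e j + t))"
  proof -
    have "(\<Sum>j\<in>I. (e j + t) - (a j + t)) = of_nat 2" using balanced by simp
    from prod_pochhammer_rGamma_asymp [OF finite_I this]
    have "(\<lambda>N. (\<Prod>j\<in>I. Gamma (a j + t)) * ((\<Prod>j\<in>I. pochhammer (e j + t) N * rGamma (of_nat N + (a j + t))) / of_nat N ^ 2))
       \<longlonglongrightarrow> (\<Prod>j\<in>I. Gamma (a j + t)) * (\<Prod>j\<in>I. rGamma (e j + t))"
      by (intro tendsto_mult tendsto_const)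
    moreover have "(\<Prod>j\<in>I. Gamma (a j + t)) * (\<Prod>j\<in>I. pochhammer (e j + t) N * rGamma (of_nat N + (a j + t)))
       = (\<Prod>j\<in>I. pochhammer (e j + t) N) / (\<Prod>j\<in>I. pochhammer (a j + t) N)" for N
    proof -
      have "Gamma (a j + t) * (pochhammer (e j + t) N * rGamma (of_nat N + (a j + t))) = pochhammer (e j + t) N / pochhammer (a j + t) N" if "j \<in> I" for j
      proof -
        have n: "a j + t \<notin> \<int>\<^sub>\<le>\<^sub>0" using t [OF that] by (simp add: add.commute)
        have "rGamma (a j + t) = pochhammer (a j + t) N * rGamma (a j + t + of_nat N)" by (rule pochhammer_rGamma)
        moreover have "Gamma (a j + t) * rGamma (a j + t) = 1"
          using n by (simp add: rGamma_inverse_Gamma Gamma_eq_zero_iff)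
        moreover have "pochhammer (a j + t) N \<noteq> 0" using n by (auto simp: pochhammer_eq_0_iff)
        ultimately show ?thesis by (simp add: field_simps)
      qed
      then show ?thesis
        unfolding prod.distrib [symmetric] prod_dividef [symmetric] by (intro prod.cong) auto
    qed
    ultimately show ?thesis by (simp add: prod.distrib mult_ac)
  qed
  have R: "(\<lambda>N. \<Sum>k. if k < N then tau i k * W i (N - k) / (t + a i + of_nat k) / of_nat N ^ 2 else 0)
      \<longlonglongrightarrow> (\<Sum>k. residue_0 i * (tau i k / (t + a i + of_nat k)))" if i: "i \<in> I" for i
  proof -
    obtain C where C: "C > 0" "\<And>k. norm (tau i k) \<le> C * (real k + 1) powr (- 2)"
      using tau_bound [OF i] by blast
    obtain D where D: "D > 0" "\<And>k. norm (1 / (t + a i + of_nat k)) \<le> D / (real k + 1)"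
      using inverse_shift_bound [OF t [OF i]] by blast
    have "Bseq (\<lambda>M. W i M / of_nat M ^ 2)"
      using W_tendsto [OF i] by (intro convergent_imp_Bseq) (auto simp: convergent_def)
    then obtain B where B: "B > 0" "\<And>M. norm (W i M / of_nat M ^ 2) \<le> B"
      by (auto elim: BseqE)
    have lim: "(\<lambda>N. if k < N then tau i k * W i (N - k) / (t + a i + of_nat k) / of_nat N ^ 2 else 0) \<longlonglongrightarrow> residue_0 i * (tau i k / (t + a i + of_nat k))" for k
    proof -
      \<comment> \<open>The substitution N = M + k turns W_i(N-k)/N^2 into W_i(M)/M^2 times
        (M/(M+k))^2.\<close>
      have "(\<lambda>M. of_nat M / of_nat (M + k) :: complex) \<longlonglongrightarrow> 1"
      proof -
        have "(\<lambda>M. 1 - of_nat k / of_nat (M + k) :: complex) \<longlonglongrightarrow> 1 - 0"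
          by (intro tendsto_diff tendsto_const LIMSEQ_ignore_initial_segment [OF lim_const_over_n])
        then have "(\<lambda>M. 1 - of_nat k / of_nat (M + k) :: complex) \<longlonglongrightarrow> 1" by simp
        then show ?thesis
        proof (rule Lim_transform_eventually, intro eventually_sequentiallyI [of 1])
          fix M :: nat assume "1 \<le> M"
          then have "(of_nat (M + k) :: complex) \<noteq> 0" unfolding of_nat_eq_0_iff by simp
          then show "1 - of_nat k / of_nat (M + k) = (of_nat M / of_nat (M + k) :: complex)"
            by (simp add: divide_simps)
        qed
      qed
      then have "(\<lambda>M. (W i M / of_nat M ^ 2) * (of_nat M / of_nat (M + k)) ^ 2 * (tau i k / (t + a i + of_nat k))) \<longlonglongrightarrow> residue_0 i * 1 ^ 2 * (tau i k / (t + a i + of_nat k))"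
        by (intro tendsto_mult tendsto_power tendsto_const W_tendsto [OF i])
      then have "(\<lambda>M. (W i M / of_nat M ^ 2) * (of_nat M / of_nat (M + k)) ^ 2 * (tau i k / (t + a i + of_nat k))) \<longlonglongrightarrow> residue_0 i * (tau i k / (t + a i + of_nat k))" by simp
      then have "(\<lambda>M. if k < M + k then tau i k * W i (M + k - k) / (t + a i + of_nat k) / of_nat (M + k) ^ 2 else 0) \<longlonglongrightarrow> residue_0 i * (tau i k / (t + a i + of_nat k))"
        by (rule Lim_transform_eventually, intro eventually_sequentiallyI [of 1]) (simp add: power_divide mult_ac)
      then show ?thesis by (rule LIMSEQ_offset)
    qed
    have bound: "norm (if k < N then tau i k * W i (N - k) / (t + a i + of_nat k) / of_nat N ^ 2 else 0) \<le> C * D * B * (real k + 1) powr (- 2)" for k N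
    proof (cases "k < N")
      case True
      have "norm (tau i k * W i (N - k) / (t + a i + of_nat k) / of_nat N ^ 2)
        = norm (tau i k) * norm (1 / (t + a i + of_nat k)) * (norm (W i (N - k) / of_nat (N - k) ^ 2) * (real (N - k) / real N) ^ 2)"
      proof -
        obtain M where M: "N - k = M" "M > 0" using True by simp
        show ?thesis unfolding M using M(2) by (simp add: norm_mult norm_divide norm_power power_divide)
      qed
      also have "\<dots> \<le> (C * (real k + 1) powr (- 2)) * D * (B * 1)"
      proof -
        have "norm (1 / (t + a i + of_nat k)) \<le> D"
          by (rule order_trans [OF D(2)]) (use D(1) in \<open>simp add: divide_le_eq\<close>)
        moreover have "(real (N - k) / real N) ^ 2 \<le> 1 ^ 2"
          using True by (intro power_mono) auto
        ultimately show ?thesis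
          using C D B by (intro mult_mono) auto
      qed
      finally show ?thesis using True by (simp add: mult_ac)
    qed (use B C D in auto)
    have "summable (\<lambda>k. C * D * B * (real k + 1) powr (- 2))"
      by (intro summable_mult summable_powr_succ) simp
    from tannery_sequentially(1) [OF lim bound this] show ?thesis .
  qed
  have fin: "(\<Prod>j\<in>I. pochhammer (e j + t) N) / (\<Prod>j\<in>I. pochhammer (a j + t) N) / of_nat N ^ 2
      = 1 / of_nat N ^ 2 + (\<Sum>i\<in>I. \<Sum>k. if k < N then tau i k * W i (N - k) / (t + a i + of_nat k) / of_nat N ^ 2 else 0)" for N
  proof -
    have "(\<Sum>k. if k < N then tau i k * W i (N - k) / (t + a i + of_nat k) / of_nat N ^ 2 else 0) = (\<Sum>k<N. tau i k * W i (N - k) / (t + a i + of_nat k)) / of_nat N ^ 2" for i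
      by (subst suminf_finite [of "{..<N}"]) (auto simp: sum_divide_distrib)
    then show ?thesis
      using finite_partial_fractions [OF t, of N] by (simp add: add_divide_distrib sum_divide_distrib)
  qed
  have z: "(\<lambda>N. 1 / of_nat N ^ 2 :: complex) \<longlonglongrightarrow> 0"
  proof -
    have "(\<lambda>N. (1 / of_nat N) ^ 2 :: complex) \<longlonglongrightarrow> 0 ^ 2"
      by (intro tendsto_power lim_const_over_n)
    then show ?thesis by (simp add: power_divide)
  qed
  have "(\<lambda>N. 1 / of_nat N ^ 2 + (\<Sum>i\<in>I. \<Sum>k. if k < N then tau i k * W i (N - k) / (t + a i + of_nat k) / of_nat N ^ 2 else 0))
     \<longlonglongrightarrow> 0 + (\<Sum>i\<in>I. \<Sum>k. residue_0 i * (tau i k / (t + a i + of_nat k)))"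
    by (intro tendsto_add z tendsto_sum R)
  from LIMSEQ_unique [OF L [unfolded fin] this]
  have "(\<Prod>j\<in>I. Gamma (a j + t) * rGamma (e j + t)) = (\<Sum>i\<in>I. \<Sum>k. residue_0 i * (tau i k / (t + a i + of_nat k)))" by simp
  also have "\<dots> = (\<Sum>i\<in>I. residue_0 i * (\<Sum>k. tau i k / (t + a i + of_nat k)))"
  proof (intro sum.cong refl suminf_mult)
    fix i assume i: "i \<in> I"
    obtain C where C: "C > 0" "\<And>k. norm (tau i k) \<le> C * (real k + 1) powr (- 2)"
      using tau_bound [OF i] by blast
    obtain D where D: "D > 0" "\<And>k. norm (1 / (t + a i + of_nat k)) \<le> D / (real k + 1)"
      using inverse_shift_bound [OF t [OF i]] by blast
    have "norm (tau i k / (t + a i + of_nat k)) \<le> C * D * (real k + 1) powr (- 2)" for k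
    proof -
      have "norm (1 / (t + a i + of_nat k)) \<le> D"
        by (rule order_trans [OF D(2)]) (use D(1) in \<open>simp add: divide_le_eq\<close>)
      then have "norm (tau i k) * norm (1 / (t + a i + of_nat k)) \<le> C * (real k + 1) powr (- 2) * D"
        using C D by (intro mult_mono) auto
      then show ?thesis by (simp add: norm_divide mult_ac)
    qed
    then show "summable (\<lambda>k. tau i k / (t + a i + of_nat k))"
      by (rule summable_comparison_test' [rotated]) (intro summable_mult summable_powr_succ, simp)
  qed
  finally show ?thesis .
qed

end

section \<open>Partial sums of the cotangent expansion\<close>

text \<open>Partial sums of the expansion of \<pi> cot \<pi>z in which the poles -n and n + 1 are
  paired. The pairing matches that of the lattice points w + n and w - 1 - n in the summation of
  \<phi>.\<close>

definition cot_sum :: "nat \<Rightarrow> complex \<Rightarrow> complex" where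
  "cot_sum M z = (\<Sum>n<M. 1 / (z + of_nat n) - 1 / (1 - z + of_nat n))"

lemma cot_sum_plus_1: "cot_sum M (z + 1) = cot_sum M z + (1 / (z + of_nat M) + 1 / (of_nat M - z))"
proof (induction M)
  case (Suc M)
  have s: "z + 1 + of_nat M = z + of_nat (Suc M)" "1 - (z + 1) + of_nat M = of_nat M - z"
    "1 - z + of_nat M = of_nat (Suc M) - z" by simp_all
  have "cot_sum (Suc M) y = cot_sum M y + (1 / (y + of_nat M) - 1 / (1 - y + of_nat M))" for y
    by (simp add: cot_sum_def)
  then show ?case by (simp only: Suc s) simp
qed (simp add: cot_sum_def)

lemma cot_sum_plus_nat:
  "cot_sum M (z + of_nat k) = cot_sum M z + (\<Sum>i<k. 1 / (z + of_nat i + of_nat M) + 1 / (of_nat M - (z + of_nat i)))"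
proof (induction k)
  case (Suc k)
  have "z + of_nat (Suc k) = z + of_nat k + 1" by simp
  then show ?case by (simp only: cot_sum_plus_1 Suc sum.lessThan_Suc) simp
qed simp

text \<open>Differentiating the reflection formula gives Digamma(1-z) - Digamma(z) = \<pi> cot
  \<pi>z; in the limit formulas for the two Digamma values the logarithms cancel.\<close>

lemma cot_sum_tendsto:
  fixes z :: complex
  assumes z: "z \<notin> \<int>"
  shows "(\<lambda>M. cot_sum M z) \<longlonglongrightarrow> of_real pi * cot (of_real pi * z)"
proof -
  have z': "z \<notin> \<int>\<^sub>\<le>\<^sub>0" "1 - z \<notin> \<int>\<^sub>\<le>\<^sub>0"
    using z nonpos_Ints_Int [of z] nonpos_Ints_Int [of "1 - z"] by auto
  have s: "sin (of_real pi * z) \<noteq> 0"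
  proof
    assume "sin (of_real pi * z) = 0"
    then have "sin (z * of_real pi) = 0" by (simp add: mult.commute)
    then have "z \<in> \<int>" using sin_eq_0 by (auto simp: complex_is_Int_iff sin_eq_0)
    with z show False by simp
  qed
  have refl: "rGamma w * rGamma (1 - w) = sin (of_real pi * w) / of_real pi" for w :: complex
    by (rule rGamma_reflection_complex)
  have "((\<lambda>w. rGamma w * rGamma (1 - w)) has_field_derivative
      (- rGamma z * Digamma z) * rGamma (1 - z) + (- rGamma (1 - z) * Digamma (1 - z)) * (0 - 1) * rGamma z) (at z)"
    using z' by (intro DERIV_mult DERIV_chain' [where g = rGamma] derivative_intros has_field_derivative_rGamma_no_nonpos_int)
  moreover have "((\<lambda>w. sin (of_real pi * w) / of_real pi) has_field_derivative cos (of_real pi * z)) (at z)"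
    by (auto intro!: derivative_eq_intros)
  ultimately have "(- rGamma z * Digamma z) * rGamma (1 - z) + (- rGamma (1 - z) * Digamma (1 - z)) * (0 - 1) * rGamma z = cos (of_real pi * z)"
    unfolding refl by (rule DERIV_unique)
  then have "(Digamma (1 - z) - Digamma z) * (rGamma z * rGamma (1 - z)) = cos (of_real pi * z)"
    by (simp add: algebra_simps)
  then have D: "Digamma (1 - z) - Digamma z = of_real pi * cot (of_real pi * z)"
    using s unfolding refl by (simp add: cot_def field_simps)
  have "(\<lambda>M. (of_real (ln (real M)) - (\<Sum>n<M. inverse (1 - z + of_nat n))) - (of_real (ln (real M)) - (\<Sum>n<M. inverse (z + of_nat n)))) \<longlonglongrightarrow> Digamma (1 - z) - Digamma z"
    using z by (intro tendsto_diff Digamma_LIMSEQ) auto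
  then show ?thesis
    unfolding D by (simp add: cot_sum_def sum_subtractf inverse_eq_divide)
qed

text \<open>A minimum over finitely many n, and the triangle inequality for the others.\<close>

lemma nonint_dist:
  fixes c :: complex
  assumes "c \<notin> \<int>"
  shows "\<exists>\<delta>>0. \<forall>n::int. norm (c + of_int n) \<ge> \<delta> * (\<bar>real_of_int n\<bar> + 1)"
proof -
  define m where "m = \<lceil>2 * norm c + 1\<rceil>"
  define F where "F = (\<lambda>n::int. norm (c + of_int n) / (\<bar>real_of_int n\<bar> + 1)) ` {- m..m}"
  have F: "finite (insert (1 / 2) F)" by (simp add: F_def)
  define \<delta> where "\<delta> = Min (insert (1 / 2) F)"
  have nz: "c + of_int n \<noteq> 0" for n
  proof
    assume "c + of_int n = 0"
    then have "c = of_int (- n)" by (simp add: add_eq_0_iff2)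
    with assms show False by (metis Ints_of_int)
  qed
  have pos: "x > 0" if "x \<in> insert (1 / 2) F" for x
    using that nz by (auto simp: F_def intro!: divide_pos_pos)
  have "\<delta> > 0" unfolding \<delta>_def using F pos by (subst Min_gr_iff) auto
  moreover have "norm (c + of_int n) \<ge> \<delta> * (\<bar>real_of_int n\<bar> + 1)" for n
  proof (cases "n \<in> {- m..m}")
    case True
    then have "\<delta> \<le> norm (c + of_int n) / (\<bar>real_of_int n\<bar> + 1)"
      unfolding \<delta>_def using F by (intro Min_le) (auto simp: F_def)
    then show ?thesis by (simp add: pos_le_divide_eq)
  next
    case False
    then have "m < \<bar>n\<bar>" by auto
    then have "2 * norm c + 1 \<le> \<bar>real_of_int n\<bar>" unfolding m_def by linarith
    moreover have "norm (of_int n :: complex) - norm c \<le> norm (c + of_int n)"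
      using norm_diff_ineq [of "of_int n" c] by (simp add: add.commute)
    ultimately have "1 / 2 * (\<bar>real_of_int n\<bar> + 1) \<le> norm (c + of_int n)" by simp
    moreover have "\<delta> \<le> 1 / 2" unfolding \<delta>_def using F by (intro Min_le) auto
    then have "\<delta> * (\<bar>real_of_int n\<bar> + 1) \<le> 1 / 2 * (\<bar>real_of_int n\<bar> + 1)"
      by (intro mult_right_mono) auto
    ultimately show ?thesis by linarith
  qed
  ultimately show ?thesis by blast
qed

lemma sum_inverse_square_shift_le: "(\<Sum>i<k. 1 / (\<bar>real i - real M\<bar> + 1)\<^sup>2) \<le> 4"
proof -
  have "(\<Sum>i<k. 1 / (\<bar>real i - real M\<bar> + 1)\<^sup>2) \<le> (\<Sum>i\<in>{..M} \<union> {M..<M + k}. 1 / (\<bar>real i - real M\<bar> + 1)\<^sup>2)"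
    by (intro sum_mono2) auto
  also have "\<dots> \<le> (\<Sum>i\<le>M. 1 / (\<bar>real i - real M\<bar> + 1)\<^sup>2) + (\<Sum>i\<in>{M..<M + k}. 1 / (\<bar>real i - real M\<bar> + 1)\<^sup>2)"
    by (intro order_trans [OF eq_refl [OF sum_Un]]) (auto intro!: sum_nonneg)
  also have "(\<Sum>i\<le>M. 1 / (\<bar>real i - real M\<bar> + 1)\<^sup>2) = (\<Sum>j<Suc M. 1 / (real j + 1)\<^sup>2)"
    by (rule sum.reindex_bij_witness [where i = "\<lambda>i. M - i" and j = "\<lambda>i. M - i"]) (auto simp: of_nat_diff)
  also have "(\<Sum>i\<in>{M..<M + k}. 1 / (\<bar>real i - real M\<bar> + 1)\<^sup>2) = (\<Sum>j<k. 1 / (real j + 1)\<^sup>2)"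
    by (rule sum.reindex_bij_witness [where i = "\<lambda>i. i + M" and j = "\<lambda>i. i - M"]) (auto simp: of_nat_diff)
  finally show ?thesis
    using sum_inverse_squares_le [of "Suc M"] sum_inverse_squares_le [of k] by linarith
qed

text \<open>The shift by k changes the sum by terms of size 1/(i+1) and 1/(|i-M|+1). Uniformity in M
  is the point; any exponent below 1 is good enough, because \<open>tau\<close> decays like
  k^(-2).\<close>

lemma cot_sum_bound:
  fixes c :: complex
  assumes c: "c \<notin> \<int>"
  shows "\<exists>C>0. \<forall>M k. norm (cot_sum M (c + of_nat k)) \<le> C * (real k + 1) powr (1 / 2)"
proof -
  obtain \<delta> where d: "\<delta> > 0" "\<And>n::int. norm (c + of_int n) \<ge> \<delta> * (\<bar>real_of_int n\<bar> + 1)"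
    using nonint_dist [OF c] by blast
  have "Bseq (\<lambda>M. cot_sum M c)"
    using cot_sum_tendsto [OF c] by (intro convergent_imp_Bseq) (auto simp: convergent_def)
  then obtain B where B: "B > 0" "\<And>M. norm (cot_sum M c) \<le> B" by (auto elim: BseqE)
  have inv: "norm (1 / (c + of_int n)) \<le> (1 / \<delta>) * (1 / (\<bar>real_of_int n\<bar> + 1))" for n
  proof -
    have "norm (1 / (c + of_int n)) = 1 / norm (c + of_int n)" by (simp add: norm_divide)
    also have "\<dots> \<le> 1 / (\<delta> * (\<bar>real_of_int n\<bar> + 1))"
    proof -
      have "0 < \<delta> * (\<bar>real_of_int n\<bar> + 1)" using d(1) by simp
      then show ?thesis using d(2) [of n] by (simp add: frac_le del: zero_less_mult_iff)
    qed
    finally show ?thesis by simp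
  qed
  have "norm (cot_sum M (c + of_nat k)) \<le> (B + 4 / \<delta>) * (real k + 1) powr (1 / 2)" for M k
  proof -
    define r where "r = sqrt (real k + 1)"
    have r: "r \<ge> 1" "r * r = real k + 1" by (auto simp: r_def)
    \<comment> \<open>By this arithmetic-geometric inequality with r = sqrt (k+1), a sum of k terms
      is O(r) as soon as the sum of their squares is bounded. It takes the place of a logarithmic
      estimate for shifted harmonic sums.\<close>
    have am: "x \<le> (1 / r + r * x\<^sup>2) / 2" for x :: real
    proof -
      have "0 \<le> (r * x - 1)\<^sup>2 / r" using r by simp
      also have "\<dots> = 1 / r + r * x\<^sup>2 - 2 * x" using r by (simp add: field_simps power2_eq_square)
      finally show ?thesis by simp
    qed
    have amsum: "(\<Sum>i<k. x i) \<le> (r + r * Q) / 2" if "(\<Sum>i<k. (x i)\<^sup>2) \<le> Q" for x :: "nat \<Rightarrow> real" and Q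
    proof -
      have "(\<Sum>i<k. x i) \<le> (\<Sum>i<k. (1 / r + r * (x i)\<^sup>2) / 2)" by (intro sum_mono am)
      also have "\<dots> = (real k / r + r * (\<Sum>i<k. (x i)\<^sup>2)) / 2"
        by (simp add: sum_divide_distrib [symmetric] sum.distrib sum_distrib_left)
      also have "\<dots> \<le> (r + r * Q) / 2"
        using that r by (intro divide_right_mono add_mono mult_left_mono) (auto simp: divide_le_eq)
      finally show ?thesis .
    qed
    have "norm (\<Sum>i<k. 1 / (c + of_nat i + of_nat M) + 1 / (of_nat M - (c + of_nat i)))
       \<le> (\<Sum>i<k. (1 / \<delta>) * (1 / (real i + 1)) + (1 / \<delta>) * (1 / (\<bar>real i - real M\<bar> + 1)))"
    proof (intro sum_norm_le order_trans [OF norm_triangle_ineq] add_mono)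
      fix i
      have "norm (1 / (c + of_nat i + of_nat M)) = norm (1 / (c + of_int (int (i + M))))" by (simp add: add.assoc)
      also have "\<dots> \<le> (1 / \<delta>) * (1 / (\<bar>real_of_int (int (i + M))\<bar> + 1))" by (rule inv)
      also have "\<dots> \<le> (1 / \<delta>) * (1 / (real i + 1))"
        using d by (intro mult_left_mono divide_left_mono) auto
      finally show "norm (1 / (c + of_nat i + of_nat M)) \<le> (1 / \<delta>) * (1 / (real i + 1))" .
      have "norm (1 / (of_nat M - (c + of_nat i))) = norm (1 / (c + of_int (int i - int M)))"
        by (simp add: norm_divide norm_minus_commute algebra_simps)
      also have "\<dots> \<le> (1 / \<delta>) * (1 / (\<bar>real_of_int (int i - int M)\<bar> + 1))" by (rule inv)
      finally show "norm (1 / (of_nat M - (c + of_nat i))) \<le> (1 / \<delta>) * (1 / (\<bar>real i - real M\<bar> + 1))" by simp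
    qed
    also have "\<dots> = (1 / \<delta>) * ((\<Sum>i<k. 1 / (real i + 1)) + (\<Sum>i<k. 1 / (\<bar>real i - real M\<bar> + 1)))"
      by (simp add: sum.distrib sum_distrib_left distrib_left)
    also have "\<dots> \<le> (1 / \<delta>) * ((r + r * 2) / 2 + (r + r * 4) / 2)"
      using d sum_inverse_squares_le [of k] sum_inverse_square_shift_le [of M k]
      by (intro mult_left_mono add_mono amsum) (auto simp: power_divide)
    also have "\<dots> = 4 / \<delta> * r" by simp
    finally have "norm (cot_sum M (c + of_nat k)) \<le> B + 4 / \<delta> * r"
      unfolding cot_sum_plus_nat using B(2) [of M] by (intro order_trans [OF norm_triangle_ineq]) linarith
    also have "B \<le> B * r" using B r by simp
    finally have "norm (cot_sum M (c + of_nat k)) \<le> (B + 4 / \<delta>) * r" by (simp add: algebra_simps)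
    then show ?thesis by (simp add: r_def powr_half_sqrt)
  qed
  moreover have "B + 4 / \<delta> > 0" using B d by (intro add_pos_pos) auto
  ultimately show ?thesis by blast
qed

lemma cot_pi_plus_nat: "cot (of_real pi * (z + of_nat k)) = cot (of_real pi * z :: complex)"
proof (induction k)
  case (Suc k)
  have "of_real pi * (z + of_nat (Suc k)) = of_real pi * (z + of_nat k) + (of_real pi :: complex)"
    by (simp add: algebra_simps)
  then have "cot (of_real pi * (z + of_nat (Suc k))) = cot (of_real pi * (z + of_nat k))"
    by (simp add: cot_def sin_add cos_add sin_of_real [symmetric] cos_of_real [symmetric])
  with Suc show ?case by simp
qed simp

section \<open>Residue sums and sums over shifted lattices\<close>

context balanced_gamma_quotient
begin

lemma summable_tau:
  assumes "i \<in> I"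
  shows "summable (tau i)"
proof -
  obtain C where C: "C > 0" "\<And>k. norm (tau i k) \<le> C * (real k + 1) powr (- 2)"
    using tau_bound [OF assms] by blast
  have "summable (\<lambda>k. C * (real k + 1) powr (- 2))"
    by (intro summable_mult summable_powr_succ) simp
  then show ?thesis
    by (rule summable_comparison_test') (rule C(2))
qed

text \<open>Evaluate the partial fractions at t = w + n and multiply by n: each n/(t + a_i + k)
  tends to 1, while n times the Gamma quotient is O(1/n).\<close>

lemma sum_residues_eq_0:
  assumes w: "\<And>i. i \<in> I \<Longrightarrow> w + a i \<notin> \<int>"
  shows "(\<Sum>i\<in>I. residue_0 i * suminf (tau i)) = 0"
proof -
  have t: "w + of_nat n + a i \<notin> \<int>\<^sub>\<le>\<^sub>0" if "i \<in> I" for i n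
  proof
    assume "w + of_nat n + a i \<in> \<int>\<^sub>\<le>\<^sub>0"
    then have "w + of_nat n + a i \<in> \<int>" by (rule nonpos_Ints_Int)
    then have "w + of_nat n + a i - of_nat n \<in> \<int>" by (intro Ints_diff) auto
    with w [OF that] show False by (simp add: algebra_simps)
  qed
  have R: "(\<lambda>n. \<Sum>k. tau i k * (of_nat n / (w + of_nat n + a i + of_nat k))) \<longlonglongrightarrow> suminf (tau i)" if i: "i \<in> I" for i
  proof -
    obtain C where C: "C > 0" "\<And>k. norm (tau i k) \<le> C * (real k + 1) powr (- 2)"
      using tau_bound [OF i] by blast
    have "w + a i \<notin> \<int>\<^sub>\<le>\<^sub>0" using t [OF i, of 0] by simp
    then obtain D where D: "D > 0" "\<And>k. norm (1 / (w + a i + of_nat k)) \<le> D / (real k + 1)"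
      using inverse_shift_bound by blast
    have lim: "(\<lambda>n. tau i k * (of_nat n / (w + of_nat n + a i + of_nat k))) \<longlonglongrightarrow> tau i k" for k
    proof -
      have "(\<lambda>n. inverse ((w + a i + of_nat k) / of_nat n + 1)) \<longlonglongrightarrow> inverse (0 + 1)"
        by (intro tendsto_inverse tendsto_add tendsto_const lim_const_over_n) auto
      then have "(\<lambda>n. tau i k * inverse ((w + a i + of_nat k) / of_nat n + 1)) \<longlonglongrightarrow> tau i k * inverse (0 + 1)"
        by (intro tendsto_mult tendsto_const)
      then have "(\<lambda>n. tau i k * inverse ((w + a i + of_nat k) / of_nat n + 1)) \<longlonglongrightarrow> tau i k" by simp
      then show ?thesis
      proof (rule Lim_transform_eventually, intro eventually_sequentiallyI [of 1])
        fix n :: nat assume "1 \<le> n"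
        then have "(of_nat n :: complex) \<noteq> 0" by simp
        then have "(w + a i + of_nat k) / of_nat n + 1 = (w + of_nat n + a i + of_nat k) / of_nat n"
          by (simp add: divide_simps)
        then show "tau i k * inverse ((w + a i + of_nat k) / of_nat n + 1) = tau i k * (of_nat n / (w + of_nat n + a i + of_nat k))"
          by simp
      qed
    qed
    have bound: "norm (tau i k * (of_nat n / (w + of_nat n + a i + of_nat k))) \<le> C * D * (real k + 1) powr (- 2)" for k n
    proof -
      have "norm (of_nat n / (w + of_nat n + a i + of_nat k)) = real n * norm (1 / (w + a i + of_nat (n + k)))"
        by (simp add: norm_divide add_ac)
      also have "\<dots> \<le> real n * (D / (real (n + k) + 1))"
        by (intro mult_left_mono D) simp
      also have "\<dots> \<le> D" using D(1) by (simp add: divide_le_eq)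
      finally have "norm (tau i k) * norm (of_nat n / (w + of_nat n + a i + of_nat k)) \<le> C * (real k + 1) powr (- 2) * D"
        using C D by (intro mult_mono) auto
      then show ?thesis unfolding norm_mult by (simp add: mult_ac)
    qed
    show ?thesis
      by (rule tannery_sequentially(1) [OF lim bound]) (intro summable_mult summable_powr_succ, simp)
  qed
  have "(\<lambda>n. \<Sum>i\<in>I. residue_0 i * (\<Sum>k. tau i k * (of_nat n / (w + of_nat n + a i + of_nat k)))) \<longlonglongrightarrow> (\<Sum>i\<in>I. residue_0 i * suminf (tau i))"
    by (intro tendsto_sum tendsto_mult tendsto_const R)
  moreover have "(\<Sum>i\<in>I. residue_0 i * (\<Sum>k. tau i k * (of_nat n / (w + of_nat n + a i + of_nat k))))
      = of_nat n * (\<Prod>j\<in>I. Gamma (a j + w)) * (\<Prod>j\<in>I. pochhammer (a j + w) n * rGamma (of_nat n + (e j + w)))" for n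
  proof -
    have s: "summable (\<lambda>k. tau i k / (w + of_nat n + a i + of_nat k))" if i: "i \<in> I" for i
    proof -
      obtain C where C: "C > 0" "\<And>k. norm (tau i k) \<le> C * (real k + 1) powr (- 2)"
        using tau_bound [OF i] by blast
      obtain D where D: "D > 0" "\<And>k. norm (1 / (w + of_nat n + a i + of_nat k)) \<le> D / (real k + 1)"
        using inverse_shift_bound [OF t [OF i]] by blast
      have "norm (tau i k / (w + of_nat n + a i + of_nat k)) \<le> C * D * (real k + 1) powr (- 2)" for k
      proof -
        have "norm (1 / (w + of_nat n + a i + of_nat k)) \<le> D"
          by (rule order_trans [OF D(2)]) (use D(1) in \<open>simp add: divide_le_eq\<close>)
        then have "norm (tau i k) * norm (1 / (w + of_nat n + a i + of_nat k)) \<le> C * (real k + 1) powr (- 2) * D"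
          using C D by (intro mult_mono) auto
        then show ?thesis by (simp add: norm_divide mult_ac)
      qed
      then show ?thesis
        by (rule summable_comparison_test' [rotated]) (intro summable_mult summable_powr_succ, simp)
    qed
    have "(\<Sum>i\<in>I. residue_0 i * (\<Sum>k. tau i k * (of_nat n / (w + of_nat n + a i + of_nat k)))) = of_nat n * (\<Sum>i\<in>I. residue_0 i * (\<Sum>k. tau i k / (w + of_nat n + a i + of_nat k)))"
      unfolding sum_distrib_left
    proof (rule sum.cong [OF refl])
      fix i assume "i \<in> I"
      from suminf_mult [OF s [OF this], of "of_nat n"]
      show "residue_0 i * (\<Sum>k. tau i k * (of_nat n / (w + of_nat n + a i + of_nat k))) = of_nat n * (residue_0 i * (\<Sum>k. tau i k / (w + of_nat n + a i + of_nat k)))"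
        by (simp add: mult_ac)
    qed
    also have "\<dots> = of_nat n * (\<Prod>j\<in>I. Gamma (a j + (w + of_nat n)) * rGamma (e j + (w + of_nat n)))"
      by (simp only: partial_fractions [OF t])
    also have "(\<Prod>j\<in>I. Gamma (a j + (w + of_nat n)) * rGamma (e j + (w + of_nat n))) = (\<Prod>j\<in>I. Gamma (a j + w) * (pochhammer (a j + w) n * rGamma (of_nat n + (e j + w))))"
    proof (rule prod.cong [OF refl])
      fix j assume "j \<in> I"
      then have nn: "a j + w \<notin> \<int>\<^sub>\<le>\<^sub>0" using t [of j 0] by (simp add: add.commute)
      then have "Gamma (a j + w + of_nat n) = Gamma (a j + w) * pochhammer (a j + w) n"
        using pochhammer_Gamma [of "a j + w" n] by (simp add: Gamma_eq_zero_iff)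
      then show "Gamma (a j + (w + of_nat n)) * rGamma (e j + (w + of_nat n)) = Gamma (a j + w) * (pochhammer (a j + w) n * rGamma (of_nat n + (e j + w)))"
        by (simp add: add_ac)
    qed
    finally show ?thesis by (simp add: prod.distrib mult_ac)
  qed
  moreover have "(\<lambda>n. of_nat n * (\<Prod>j\<in>I. Gamma (a j + w)) * (\<Prod>j\<in>I. pochhammer (a j + w) n * rGamma (of_nat n + (e j + w)))) \<longlonglongrightarrow> 0"
  proof -
    obtain C where C: "C > 0" "\<And>k. norm (\<Prod>j\<in>I. pochhammer (a j + w) k * rGamma (of_nat k + (e j + w))) \<le> C * (real k + 1) powr Re (\<Sum>j\<in>I. (a j + w) - (e j + w))"
      using prod_pochhammer_rGamma_bound [OF finite_I, of "\<lambda>j. a j + w" "\<lambda>j. e j + w"] by blast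
    have "(\<Sum>j\<in>I. (a j + w) - (e j + w)) = - (\<Sum>j\<in>I. e j - a j)"
      unfolding sum_negf [symmetric] by (intro sum.cong) auto
    then have s: "Re (\<Sum>j\<in>I. (a j + w) - (e j + w)) = - 2" by (simp only: balanced) simp
    let ?G = "norm (\<Prod>j\<in>I. Gamma (a j + w))"
    have "(\<lambda>n. ?G * C * (1 / real (Suc n))) \<longlonglongrightarrow> ?G * C * 0"
      by (intro tendsto_mult tendsto_const LIMSEQ_Suc [OF lim_const_over_n])
    then have lim0: "(\<lambda>n. ?G * C * (1 / real (Suc n))) \<longlonglongrightarrow> 0" by simp
    show ?thesis
    proof (rule Lim_null_comparison [OF _ lim0], intro always_eventually allI)
      fix n
      have "norm (of_nat n * (\<Prod>j\<in>I. Gamma (a j + w)) * (\<Prod>j\<in>I. pochhammer (a j + w) n * rGamma (of_nat n + (e j + w))))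
        \<le> real n * ?G * (C * (real n + 1) powr (- 2))"
        unfolding norm_mult [of "_ * _ :: complex"] norm_mult [of "of_nat n"] norm_of_nat
        using C(2) [of n] unfolding s by (intro mult_left_mono) auto
      also have "\<dots> = ?G * C * (real n / (real n + 1) ^ 2)"
        by (simp add: powr_minus powr_numeral field_simps)
      also have "\<dots> \<le> ?G * C * (1 / real (Suc n))"
      proof -
        have "real n / (real n + 1) ^ 2 \<le> 1 / real (Suc n)"
          by (simp add: divide_simps power2_eq_square) (simp add: algebra_simps)
        then show ?thesis using C by (intro mult_left_mono) auto
      qed
      finally show "norm (of_nat n * (\<Prod>j\<in>I. Gamma (a j + w)) * (\<Prod>j\<in>I. pochhammer (a j + w) n * rGamma (of_nat n + (e j + w))))
        \<le> ?G * C * (1 / real (Suc n))" .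
    qed
  qed
  ultimately show ?thesis by (simp only: LIMSEQ_unique)
qed

text \<open>Since e_j + w = 1, the Gamma quotient vanishes at w - 1 - n, so its values there may be
  added to those at w + n. The two partial fraction expansions combine into \<open>cot_sum\<close>,
  and by periodicity its limit at w + a_i + k is the same for all k, so
  \<open>suminf (tau i)\<close> factors out.\<close>

theorem gamma_quotient_sums:
  assumes w: "\<And>i. i \<in> I \<Longrightarrow> w + a i \<notin> \<int>" and j: "j \<in> I" "e j + w = 1"
  shows "(\<lambda>n. \<Prod>i\<in>I. Gamma (a i + (w + of_nat n)) * rGamma (e i + (w + of_nat n))) sums
     (\<Sum>i\<in>I. residue_0 i * (suminf (tau i) * (of_real pi * cot (of_real pi * (w + a i)))))"
proof -
  have t: "w + of_int n + a i \<notin> \<int>\<^sub>\<le>\<^sub>0" if "i \<in> I" for i and n :: int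
  proof
    assume "w + of_int n + a i \<in> \<int>\<^sub>\<le>\<^sub>0"
    then have "w + of_int n + a i \<in> \<int>" by (rule nonpos_Ints_Int)
    then have "w + of_int n + a i - of_int n \<in> \<int>" by (intro Ints_diff) auto
    with w [OF that] show False by (simp add: algebra_simps)
  qed
  define f where "f z = (\<Prod>i\<in>I. Gamma (a i + z) * rGamma (e i + z))" for z
  have f0: "f (w - 1 - of_nat n) = 0" for n
  proof -
    have "rGamma (e j + (w - 1 - of_nat n)) = rGamma (- of_nat n)" using j(2) by (simp add: algebra_simps)
    also have "\<dots> = 0" by (simp add: rGamma_eq_zero_iff)
    finally show ?thesis unfolding f_def using j(1) finite_I by (intro prod_zero) auto
  qed
  have s: "summable (\<lambda>k. tau i k / (w + of_int n + a i + of_nat k))" if i: "i \<in> I" for i and n :: int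
  proof -
    obtain C where C: "C > 0" "\<And>k. norm (tau i k) \<le> C * (real k + 1) powr (- 2)"
      using tau_bound [OF i] by blast
    obtain D where D: "D > 0" "\<And>k. norm (1 / (w + of_int n + a i + of_nat k)) \<le> D / (real k + 1)"
      using inverse_shift_bound [OF t [OF i]] by blast
    have "norm (tau i k / (w + of_int n + a i + of_nat k)) \<le> C * D * (real k + 1) powr (- 2)" for k
    proof -
      have "norm (1 / (w + of_int n + a i + of_nat k)) \<le> D"
        by (rule order_trans [OF D(2)]) (use D(1) in \<open>simp add: divide_le_eq\<close>)
      then have "norm (tau i k) * norm (1 / (w + of_int n + a i + of_nat k)) \<le> C * (real k + 1) powr (- 2) * D"
        using C D by (intro mult_mono) auto
      then show ?thesis by (simp add: norm_divide mult_ac)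
    qed
    then show ?thesis
      by (rule summable_comparison_test' [rotated]) (intro summable_mult summable_powr_succ, simp)
  qed
  have f: "f (w + of_int n) = (\<Sum>i\<in>I. residue_0 i * (\<Sum>k. tau i k / (w + of_int n + a i + of_nat k)))" for n
    unfolding f_def by (rule partial_fractions [OF t])
  have pair: "f (w + of_nat n) = (\<Sum>i\<in>I. residue_0 i * (\<Sum>k. tau i k * (1 / (w + a i + of_nat k + of_nat n) - 1 / (1 - (w + a i + of_nat k) + of_nat n))))" for n
  proof -
    have "f (w + of_nat n) = f (w + of_int (int n)) + f (w + of_int (- 1 - int n))"
      using f0 [of n] by (simp add: algebra_simps)
    also have "\<dots> = (\<Sum>i\<in>I. residue_0 i * ((\<Sum>k. tau i k / (w + of_int (int n) + a i + of_nat k)) + (\<Sum>k. tau i k / (w + of_int (- 1 - int n) + a i + of_nat k))))"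
      unfolding f by (simp only: sum.distrib distrib_left)
    also have "\<dots> = (\<Sum>i\<in>I. residue_0 i * (\<Sum>k. tau i k * (1 / (w + a i + of_nat k + of_nat n) - 1 / (1 - (w + a i + of_nat k) + of_nat n))))"
    proof (intro sum.cong refl arg_cong2 [of _ _ _ _ "(*)"])
      fix i assume i: "i \<in> I"
      have "tau i k / (w + of_int (int n) + a i + of_nat k) + tau i k / (w + of_int (- 1 - int n) + a i + of_nat k)
        = tau i k * (1 / (w + a i + of_nat k + of_nat n) - 1 / (1 - (w + a i + of_nat k) + of_nat n))" for k
      proof -
        have "w + of_int (- 1 - int n) + a i + of_nat k = - (1 - (w + a i + of_nat k) + of_nat n)" by simp
        moreover have "w + of_int (int n) + a i + of_nat k = w + a i + of_nat k + of_nat n" by simp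
        ultimately show ?thesis by (simp only: divide_minus_right) (simp add: right_diff_distrib)
      qed
      then show "(\<Sum>k. tau i k / (w + of_int (int n) + a i + of_nat k)) + (\<Sum>k. tau i k / (w + of_int (- 1 - int n) + a i + of_nat k))
         = (\<Sum>k. tau i k * (1 / (w + a i + of_nat k + of_nat n) - 1 / (1 - (w + a i + of_nat k) + of_nat n)))"
        by (subst suminf_add [OF s [OF i] s [OF i]]) simp
    qed
    finally show ?thesis .
  qed
  have s2: "summable (\<lambda>k. tau i k * (1 / (w + a i + of_nat k + of_nat n) - 1 / (1 - (w + a i + of_nat k) + of_nat n)))" if i: "i \<in> I" for i n
  proof -
    have "summable (\<lambda>k. tau i k / (w + of_int (int n) + a i + of_nat k) + tau i k / (w + of_int (- 1 - int n) + a i + of_nat k))"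
      by (intro summable_add s i)
    moreover have "tau i k / (w + of_int (int n) + a i + of_nat k) + tau i k / (w + of_int (- 1 - int n) + a i + of_nat k)
        = tau i k * (1 / (w + a i + of_nat k + of_nat n) - 1 / (1 - (w + a i + of_nat k) + of_nat n))" for k
    proof -
      have "w + of_int (- 1 - int n) + a i + of_nat k = - (1 - (w + a i + of_nat k) + of_nat n)" by simp
      moreover have "w + of_int (int n) + a i + of_nat k = w + a i + of_nat k + of_nat n" by simp
      ultimately show ?thesis by (simp only: divide_minus_right) (simp add: right_diff_distrib)
    qed
    ultimately show ?thesis by simp
  qed
  have part: "(\<Sum>n<M. f (w + of_nat n)) = (\<Sum>i\<in>I. residue_0 i * (\<Sum>k. tau i k * cot_sum M (w + a i + of_nat k)))" for M
  proof -
    have "(\<Sum>n<M. f (w + of_nat n)) = (\<Sum>i\<in>I. residue_0 i * (\<Sum>n<M. \<Sum>k. tau i k * (1 / (w + a i + of_nat k + of_nat n) - 1 / (1 - (w + a i + of_nat k) + of_nat n))))"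
      unfolding pair by (subst sum.swap) (simp add: sum_distrib_left)
    also have "\<dots> = (\<Sum>i\<in>I. residue_0 i * (\<Sum>k. tau i k * cot_sum M (w + a i + of_nat k)))"
    proof (intro sum.cong refl arg_cong2 [of _ _ _ _ "(*)"])
      fix i assume i: "i \<in> I"
      show "(\<Sum>n<M. \<Sum>k. tau i k * (1 / (w + a i + of_nat k + of_nat n) - 1 / (1 - (w + a i + of_nat k) + of_nat n))) = (\<Sum>k. tau i k * cot_sum M (w + a i + of_nat k))"
        unfolding cot_sum_def sum_distrib_left by (rule suminf_sum [symmetric]) (rule s2 [OF i])
    qed
    finally show ?thesis .
  qed
  have lim: "(\<lambda>M. \<Sum>k. tau i k * cot_sum M (w + a i + of_nat k)) \<longlonglongrightarrow> suminf (tau i) * (of_real pi * cot (of_real pi * (w + a i)))" if i: "i \<in> I" for i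
  proof -
    obtain C where C: "C > 0" "\<And>k. norm (tau i k) \<le> C * (real k + 1) powr (- 2)"
      using tau_bound [OF i] by blast
    obtain D where D: "D > 0" "\<And>M k. norm (cot_sum M (w + a i + of_nat k)) \<le> D * (real k + 1) powr (1 / 2)"
      using cot_sum_bound [OF w [OF i]] by blast
    have l: "(\<lambda>M. tau i k * cot_sum M (w + a i + of_nat k)) \<longlonglongrightarrow> tau i k * (of_real pi * cot (of_real pi * (w + a i)))" for k
    proof -
      have "w + a i + of_nat k \<notin> \<int>" using w [OF i] by simp
      from cot_sum_tendsto [OF this]
      have "(\<lambda>M. cot_sum M (w + a i + of_nat k)) \<longlonglongrightarrow> of_real pi * cot (of_real pi * (w + a i))"
        by (simp only: cot_pi_plus_nat)
      then show ?thesis by (intro tendsto_mult tendsto_const)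
    qed
    have b: "norm (tau i k * cot_sum M (w + a i + of_nat k)) \<le> C * D * (real k + 1) powr (- 3 / 2)" for k M
    proof -
      have "norm (tau i k * cot_sum M (w + a i + of_nat k)) \<le> (C * (real k + 1) powr (- 2)) * (D * (real k + 1) powr (1 / 2))"
        unfolding norm_mult using C D by (intro mult_mono) auto
      also have "\<dots> = C * D * ((real k + 1) powr (- 2) * (real k + 1) powr (1 / 2))" by simp
      also have "\<dots> = C * D * (real k + 1) powr (- 3 / 2)" unfolding powr_add [symmetric] by simp
      finally show ?thesis .
    qed
    have "(\<lambda>M. \<Sum>k. tau i k * cot_sum M (w + a i + of_nat k)) \<longlonglongrightarrow> (\<Sum>k. tau i k * (of_real pi * cot (of_real pi * (w + a i))))"
      by (rule tannery_sequentially(1) [OF l b]) (intro summable_mult summable_powr_succ, simp)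
    then show ?thesis by (simp only: suminf_mult2 [OF summable_tau [OF i]])
  qed
  show ?thesis
    unfolding sums_def f_def [symmetric] part by (intro tendsto_sum tendsto_mult tendsto_const lim)
qed

end

subsection \<open>The trigonometric identity\<close>

text \<open>
  Here \<open>X_i = exp(2\<pi>\<i> A_i)\<close> and \<open>Y_i = exp(2\<pi>\<i> E_i)\<close>; up to monomial factors \<open>R\<close> is the coefficient \<open>\<eta>\<close> below in these variables.
\<close>

lemma eta_poly_identity:
  fixes X1 X2 X3 X4 Y1 Y2 Y3 Y4 :: complex
  defines "R \<equiv> \<lambda>Xj Xi Xk Yj Yi Yk. (Xj * Yk - Xk * Yj) - (Xj - Xk) * (Xi + X4) + (Yj - Yk) * (Yi + Y4) + X1 * X2 * X3 * X4 * (1 / (Xk * Yj) - 1 / (Xj * Yk))"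
  assumes nz: "X1 \<noteq> 0" "X2 \<noteq> 0" "X3 \<noteq> 0" "X4 \<noteq> 0" "Y1 \<noteq> 0" "Y2 \<noteq> 0" "Y3 \<noteq> 0" "Y4 \<noteq> 0"
    and P: "X1 * X2 * X3 * X4 = Y1 * Y2 * Y3 * Y4"
  shows "R X3 X1 X2 Y3 Y1 Y2 * ((Y1 - X4) * (X2 - X1) * (X3 - X1) / Y1 + (Y2 - X1) * (Y3 - X1) * (Y4 - X1) / X1)
    + R X1 X2 X3 Y1 Y2 Y3 * ((Y2 - X2) * (Y4 - X2) * (Y3 - X1) / X2)
    + R X2 X3 X1 Y2 Y3 Y1 * ((Y3 - X3) * (Y4 - X3) * (Y2 - X1) / X3) = 0"
proof -
  \<comment> \<open>Eliminating Y4 leaves an identity of rational functions in seven independent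
    variables.\<close>
  have Y4: "Y4 = X1 * X2 * X3 * X4 / (Y1 * Y2 * Y3)"
    using nz P by (simp add: field_simps)
  show ?thesis
    unfolding R_def Y4 using nz(1-7)
    apply (simp add: divide_simps)
    apply (simp add: algebra_simps)
    done
qed

definition sinpi :: "complex \<Rightarrow> complex" where "sinpi z = sin (of_real pi * z)"

text \<open>Half the exponent of X_i and Y_i: sines become Laurent polynomials in
  \<open>expi\<close>, and the polynomial identity is applied to the squares.\<close>

definition expi :: "complex \<Rightarrow> complex" where "expi z = exp (\<i> * of_real pi * z)"

lemma expi_nonzero [simp]: "expi z \<noteq> 0" by (simp add: expi_def)

lemma expi_add: "expi (u + v) = expi u * expi v" by (simp add: expi_def distrib_left exp_add)
lemma expi_diff: "expi (u - v) = expi u / expi v" by (simp add: expi_def right_diff_distrib exp_diff)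
lemma expi_double: "expi (2 * u) = (expi u)\<^sup>2"
  using expi_add [of u u] by (simp add: power2_eq_square flip: mult_2)
lemma expi_1: "expi 1 = - 1" by (simp add: expi_def)
lemma expi_2: "expi 2 = 1" using expi_double [of 1] by (simp add: expi_1)

lemma sinpi_expi: "sinpi z = (expi z - 1 / expi z) / (2 * \<i>)"
proof -
  have "exp (- (\<i> * (of_real pi * z))) = 1 / expi z"
    by (simp add: expi_def exp_minus inverse_eq_divide mult.assoc)
  then show ?thesis
    by (simp add: sinpi_def sin_exp_eq expi_def mult.assoc)
qed

lemma sinpi_diff_expi: "sinpi (u - v) = ((expi u)\<^sup>2 - (expi v)\<^sup>2) / (2 * \<i> * expi u * expi v)"
  unfolding sinpi_expi expi_diff by (simp add: field_simps power2_eq_square)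

text \<open>The cofactor of sin \<pi>(e-b) in \<gamma>, in frame coordinates. The second slot is the
  index i of the value f_i + g_i to which it belongs, (j,i,k) is a cyclic order of (1,2,3), and the
  last slot of each quadruple is the index 4.\<close>

definition eta :: "complex \<Rightarrow> complex \<Rightarrow> complex \<Rightarrow> complex \<Rightarrow> complex \<Rightarrow> complex \<Rightarrow> complex \<Rightarrow> complex \<Rightarrow> complex" where
  "eta Aj Ai Ak A Ej Ei Ek E =
     - (1 / 4) * (sinpi (2 * Aj + 2 * Ek - (Aj + Ai + Ak + A)) - sinpi (2 * Ak + 2 * Ej - (Aj + Ai + Ak + A))
       - sinpi (2 * Aj + 2 * Ai - (Aj + Ai + Ak + A)) - sinpi (2 * Aj + 2 * A - (Aj + Ai + Ak + A))
       + sinpi (2 * Ej + 2 * Ei - (Ej + Ei + Ek + E)) + sinpi (2 * Ej + 2 * E - (Ej + Ei + Ek + E)))"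

lemma eta_expi:
  fixes Aj Ai Ak A Ej Ei Ek E :: complex
  defines "Xj \<equiv> (expi Aj)\<^sup>2" and "Xi \<equiv> (expi Ai)\<^sup>2" and "Xk \<equiv> (expi Ak)\<^sup>2" and "X \<equiv> (expi A)\<^sup>2"
    and "Yj \<equiv> (expi Ej)\<^sup>2" and "Yi \<equiv> (expi Ei)\<^sup>2" and "Yk \<equiv> (expi Ek)\<^sup>2" and "Y \<equiv> (expi E)\<^sup>2"
  assumes bal: "Ej + Ei + Ek + E = Aj + Ai + Ak + A + 2"
  shows "eta Aj Ai Ak A Ej Ei Ek E = \<i> / (8 * expi (Aj + Ai + Ak + A)) *
    ((Xj * Yk - Xk * Yj) - (Xj - Xk) * (Xi + X) + (Yj - Yk) * (Yi + Y) + Xj * Xi * Xk * X * (1 / (Xk * Yj) - 1 / (Xj * Yk)))"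
proof -
  define p where "p = expi (Aj + Ai + Ak + A)"
  have p0: "p \<noteq> 0" by (simp add: p_def)
  have pX: "Xj * Xi * Xk * X = p\<^sup>2"
    by (simp add: p_def Xj_def Xi_def Xk_def X_def expi_add power_mult_distrib)
  \<comment> \<open>The excess 2 of the E-sum is invisible to \<open>expi\<close>, so sines with
    either sum in their argument share the same p.\<close>
  have pE: "expi (Ej + Ei + Ek + E) = p"
    unfolding bal by (simp add: expi_add expi_2 p_def)
  have pY: "Yj * Yi * Yk * Y = p\<^sup>2"
    by (simp add: pE [symmetric] Yj_def Yi_def Yk_def Y_def expi_add power_mult_distrib)
  have nz: "Xj \<noteq> 0" "Xi \<noteq> 0" "Xk \<noteq> 0" "X \<noteq> 0" "Yj \<noteq> 0" "Yi \<noteq> 0" "Yk \<noteq> 0" "Y \<noteq> 0"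
    by (simp_all add: Xj_def Xi_def Xk_def X_def Yj_def Yi_def Yk_def Y_def)
  have s: "sinpi (2 * u + 2 * v - w) = ((expi u)\<^sup>2 * (expi v)\<^sup>2 / q - q\<^sup>2 / ((expi u)\<^sup>2 * (expi v)\<^sup>2) / q) / (2 * \<i>)"
    if "expi w = q" for u v w q
    using that by (auto simp: sinpi_expi expi_diff expi_add expi_double power2_eq_square)
  have X: "p\<^sup>2 / (Xj * Xi) = Xk * X" "p\<^sup>2 / (Xj * X) = Xk * Xi" "p\<^sup>2 / (Yj * Yi) = Yk * Y" "p\<^sup>2 / (Yj * Y) = Yk * Yi"
  proof -
    show "p\<^sup>2 / (Xj * Xi) = Xk * X" "p\<^sup>2 / (Xj * X) = Xk * Xi" using nz by (simp_all add: pX [symmetric])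
    show "p\<^sup>2 / (Yj * Yi) = Yk * Y" "p\<^sup>2 / (Yj * Y) = Yk * Yi" using nz by (simp_all add: pY [symmetric])
  qed
  have *: "- (1 / 4) * ((a / p - a' / p) / (2 * \<i>) - (b / p - b' / p) / (2 * \<i>) - (c / p - c' / p) / (2 * \<i>) - (d / p - d' / p) / (2 * \<i>)
     + (x / p - x' / p) / (2 * \<i>) + (y / p - y' / p) / (2 * \<i>)) = \<i> / (8 * p) * (a - a' - b + b' - c + c' - d + d' + x - x' + y - y')"
    for a a' b b' c c' d d' x x' y y' :: complex
    using p0 by (simp add: field_simps)
  show ?thesis
    unfolding eta_def s [OF p_def [symmetric]] s [OF pE] Xj_def [symmetric] Xi_def [symmetric] Xk_def [symmetric] X_def [symmetric]
      Yj_def [symmetric] Yi_def [symmetric] Yk_def [symmetric] Y_def [symmetric] X * p_def [symmetric] pX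
    by (rule arg_cong2 [of _ _ _ _ "(*)"]) (simp_all add: algebra_simps)
qed

text \<open>Written in exponentials, the four sine products share the factor \<open>c\<close> and
  the three \<eta> share the factor i/(8p); what remains is the polynomial identity in the
  squares.\<close>

lemma eta_relation:
  fixes A1 A2 A3 A4 E1 E2 E3 E4 :: complex
  assumes bal: "E1 + E2 + E3 + E4 = A1 + A2 + A3 + A4 + 2"
  shows "eta A3 A1 A2 A4 E3 E1 E2 E4 * (sinpi (E1 - A4) * sinpi (A2 - A1) * sinpi (A3 - A1) + sinpi (E2 - A1) * sinpi (E3 - A1) * sinpi (E4 - A1))
    + eta A1 A2 A3 A4 E1 E2 E3 E4 * (sinpi (E2 - A2) * sinpi (E4 - A2) * sinpi (E3 - A1))
    + eta A2 A3 A1 A4 E2 E3 E1 E4 * (sinpi (E3 - A3) * sinpi (E4 - A3) * sinpi (E2 - A1)) = 0"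
proof -
  define x1 where "x1 = expi A1" define x2 where "x2 = expi A2" define x3 where "x3 = expi A3" define x4 where "x4 = expi A4"
  define y1 where "y1 = expi E1" define y2 where "y2 = expi E2" define y3 where "y3 = expi E3" define y4 where "y4 = expi E4"
  note defs = x1_def x2_def x3_def x4_def y1_def y2_def y3_def y4_def
  have nz: "x1 \<noteq> 0" "x2 \<noteq> 0" "x3 \<noteq> 0" "x4 \<noteq> 0" "y1 \<noteq> 0" "y2 \<noteq> 0" "y3 \<noteq> 0" "y4 \<noteq> 0"
    by (simp_all add: defs)
  define p where "p = x1 * x2 * x3 * x4"
  have p: "expi (A1 + A2 + A3 + A4) = p" "expi (A3 + A1 + A2 + A4) = p" "expi (A2 + A3 + A1 + A4) = p"
    by (simp_all add: p_def defs expi_add mult_ac)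
  have "expi (E1 + E2 + E3 + E4) = p" unfolding bal by (simp add: expi_add expi_2 p_def defs)
  then have py: "y1 * y2 * y3 * y4 = p" by (simp add: defs expi_add)
  define R where "R Xj Xi Xk Yj Yi Yk = (Xj * Yk - Xk * Yj) - (Xj - Xk) * (Xi + x4\<^sup>2) + (Yj - Yk) * (Yi + y4\<^sup>2) + x1\<^sup>2 * x2\<^sup>2 * x3\<^sup>2 * x4\<^sup>2 * (1 / (Xk * Yj) - 1 / (Xj * Yk))"
    for Xj Xi Xk Yj Yi Yk
  have P: "x1\<^sup>2 * x2\<^sup>2 * x3\<^sup>2 * x4\<^sup>2 = y1\<^sup>2 * y2\<^sup>2 * y3\<^sup>2 * y4\<^sup>2"
    using py by (simp add: p_def power_mult_distrib [symmetric])
  have e1: "eta A3 A1 A2 A4 E3 E1 E2 E4 = \<i> / (8 * p) * R (x3\<^sup>2) (x1\<^sup>2) (x2\<^sup>2) (y3\<^sup>2) (y1\<^sup>2) (y2\<^sup>2)"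
  proof -
    have b: "E3 + E1 + E2 + E4 = A3 + A1 + A2 + A4 + 2" using bal by (simp add: algebra_simps)
    have q: "x3\<^sup>2 * x1\<^sup>2 * x2\<^sup>2 * x4\<^sup>2 = x1\<^sup>2 * x2\<^sup>2 * x3\<^sup>2 * x4\<^sup>2" by (simp only: mult_ac)
    show ?thesis unfolding eta_expi [OF b] p R_def defs [symmetric] q ..
  qed
  have e2: "eta A1 A2 A3 A4 E1 E2 E3 E4 = \<i> / (8 * p) * R (x1\<^sup>2) (x2\<^sup>2) (x3\<^sup>2) (y1\<^sup>2) (y2\<^sup>2) (y3\<^sup>2)"
  proof -
    have b: "E1 + E2 + E3 + E4 = A1 + A2 + A3 + A4 + 2" using bal by (simp add: algebra_simps)
    show ?thesis unfolding eta_expi [OF b] p R_def defs [symmetric] ..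
  qed
  have e3: "eta A2 A3 A1 A4 E2 E3 E1 E4 = \<i> / (8 * p) * R (x2\<^sup>2) (x3\<^sup>2) (x1\<^sup>2) (y2\<^sup>2) (y3\<^sup>2) (y1\<^sup>2)"
  proof -
    have b: "E2 + E3 + E1 + E4 = A2 + A3 + A1 + A4 + 2" using bal by (simp add: algebra_simps)
    have q: "x2\<^sup>2 * x3\<^sup>2 * x1\<^sup>2 * x4\<^sup>2 = x1\<^sup>2 * x2\<^sup>2 * x3\<^sup>2 * x4\<^sup>2" by (simp only: mult_ac)
    show ?thesis unfolding eta_expi [OF b] p R_def defs [symmetric] q ..
  qed
  define c where "c = y1 / ((2 * \<i>) ^ 3 * p * x1)"
  have s1: "sinpi (E1 - A4) * sinpi (A2 - A1) * sinpi (A3 - A1) = c * ((y1\<^sup>2 - x4\<^sup>2) * (x2\<^sup>2 - x1\<^sup>2) * (x3\<^sup>2 - x1\<^sup>2) / y1\<^sup>2)"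
    unfolding sinpi_diff_expi defs [symmetric] c_def p_def using nz by (simp add: field_simps power2_eq_square power3_eq_cube)
  have s2: "sinpi (E2 - A1) * sinpi (E3 - A1) * sinpi (E4 - A1) = c * ((y2\<^sup>2 - x1\<^sup>2) * (y3\<^sup>2 - x1\<^sup>2) * (y4\<^sup>2 - x1\<^sup>2) / x1\<^sup>2)"
    unfolding sinpi_diff_expi defs [symmetric] c_def py [symmetric] using nz by (simp add: divide_simps) (simp add: power2_eq_square power3_eq_cube mult_ac)
  have s3: "sinpi (E2 - A2) * sinpi (E4 - A2) * sinpi (E3 - A1) = c * ((y2\<^sup>2 - x2\<^sup>2) * (y4\<^sup>2 - x2\<^sup>2) * (y3\<^sup>2 - x1\<^sup>2) / x2\<^sup>2)"
    unfolding sinpi_diff_expi defs [symmetric] c_def py [symmetric] using nz by (simp add: divide_simps) (simp add: power2_eq_square power3_eq_cube mult_ac)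
  have s4: "sinpi (E3 - A3) * sinpi (E4 - A3) * sinpi (E2 - A1) = c * ((y3\<^sup>2 - x3\<^sup>2) * (y4\<^sup>2 - x3\<^sup>2) * (y2\<^sup>2 - x1\<^sup>2) / x3\<^sup>2)"
    unfolding sinpi_diff_expi defs [symmetric] c_def py [symmetric] using nz by (simp add: divide_simps) (simp add: power2_eq_square power3_eq_cube mult_ac)
  have "\<i> / (8 * p) * c * (R (x3\<^sup>2) (x1\<^sup>2) (x2\<^sup>2) (y3\<^sup>2) (y1\<^sup>2) (y2\<^sup>2) *
        ((y1\<^sup>2 - x4\<^sup>2) * (x2\<^sup>2 - x1\<^sup>2) * (x3\<^sup>2 - x1\<^sup>2) / y1\<^sup>2 + (y2\<^sup>2 - x1\<^sup>2) * (y3\<^sup>2 - x1\<^sup>2) * (y4\<^sup>2 - x1\<^sup>2) / x1\<^sup>2)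
     + R (x1\<^sup>2) (x2\<^sup>2) (x3\<^sup>2) (y1\<^sup>2) (y2\<^sup>2) (y3\<^sup>2) * ((y2\<^sup>2 - x2\<^sup>2) * (y4\<^sup>2 - x2\<^sup>2) * (y3\<^sup>2 - x1\<^sup>2) / x2\<^sup>2)
     + R (x2\<^sup>2) (x3\<^sup>2) (x1\<^sup>2) (y2\<^sup>2) (y3\<^sup>2) (y1\<^sup>2) * ((y3\<^sup>2 - x3\<^sup>2) * (y4\<^sup>2 - x3\<^sup>2) * (y2\<^sup>2 - x1\<^sup>2) / x3\<^sup>2)) = 0"
    unfolding R_def by (subst eta_poly_identity) (use nz P in simp_all)
  moreover have "k * r1 * (c * u1 + c * u2) + k * r2 * (c * u3) + k * r3 * (c * u4) = k * c * (r1 * (u1 + u2) + r2 * u3 + r3 * u4)"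
    for k r1 c u1 u2 r2 u3 r3 u4 :: complex
    by (simp add: algebra_simps)
  ultimately show ?thesis unfolding e1 e2 e3 s1 s2 s3 s4 by (simp only:)
qed

text \<open>The value of \<open>\<gamma>\<close> with the denominator \<open>sin \<pi>(c-b)\<close> divided out, hence defined on all of \<open>V\<close>.\<close>

definition gamma_trig :: "complex \<Rightarrow> complex \<Rightarrow> complex \<Rightarrow> complex \<Rightarrow> complex \<Rightarrow> complex \<Rightarrow> complex \<Rightarrow> complex" where
  "gamma_trig a b c d e f g = sinpi (e - b) * (sinpi (2 * a + g - e - f) + sinpi (2 * a + f - e - g) + sinpi (e - f - g)
     + sinpi (a + b - c - d) + sinpi (a + c - b - d) + sinpi (a + d - b - c)) / 4"

text \<open>Both sides are expanded into cosines by product-to-sum formulas and matched through the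
  balance condition. Thus the bracket of \<gamma> is divisible by sin \<pi>(c-b), which is why its
  singularities are removable.\<close>

lemma gamma_trig_bracket:
  fixes a b c d e f g :: complex
  assumes "e + f + g = 1 + a + b + c + d"
  shows "sinpi (c - b) * (sinpi (2 * a + g - e - f) + sinpi (2 * a + f - e - g) + sinpi (e - f - g)
     + sinpi (a + b - c - d) + sinpi (a + c - b - d) + sinpi (a + d - b - c)) / 4 =
    sinpi (a - c) * sinpi (e - a - b) * sinpi (f - b) * sinpi (g - b) - sinpi (a - b) * sinpi (e - a - c) * sinpi (f - c) * sinpi (g - c)"
proof -
  define C where "C z = cos (of_real pi * z)" for z :: complex
  have even: "C (- z) = C z" for z by (simp add: C_def)
  have even': "C u = C v" if "u = - v" for u v using that even by simp
  have one: "C (z - 1) = - C z" for z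
    by (simp add: C_def right_diff_distrib cos_diff sin_of_real [symmetric] cos_of_real [symmetric])
  have one': "C u = - C v" if "u + v = 1 \<or> u + v = - 1 \<or> u - v = 1 \<or> u - v = - 1" for u v
  proof -
    have "u = - (v - 1) \<or> u = - v - 1 \<or> v = u - 1 \<or> u = v - 1"
      using that by (metis add_diff_cancel_left' diff_add_cancel diff_diff_eq2 minus_diff_eq uminus_add_conv_diff add.commute diff_minus_eq_add add_diff_cancel_right')
    then show ?thesis using one [of v] one [of "- v"] one [of u] by (auto simp: even)
  qed
  have prod: "sinpi u * sinpi v = (C (u - v) - C (u + v)) / 2" for u v
    by (simp add: sinpi_def C_def right_diff_distrib distrib_left cos_diff cos_add)
  have cprod: "C u * C v = (C (u - v) + C (u + v)) / 2" for u v
    by (simp add: C_def right_diff_distrib distrib_left cos_diff cos_add)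
  have quad: "sinpi u * sinpi v * sinpi w * sinpi z =
     (C (u - v - (w - z)) + C (u - v + (w - z)) - (C (u - v - (w + z)) + C (u - v + (w + z)))
      - (C (u + v - (w - z)) + C (u + v + (w - z))) + (C (u + v - (w + z)) + C (u + v + (w + z)))) / 8" for u v w z
  proof -
    have "sinpi u * sinpi v * sinpi w * sinpi z = (sinpi u * sinpi v) * (sinpi w * sinpi z)" by simp
    also have "\<dots> = (C (u - v) * C (w - z) - C (u - v) * C (w + z) - C (u + v) * C (w - z) + C (u + v) * C (w + z)) / 4"
      unfolding prod by (simp add: field_simps)
    also have "\<dots> = (C (u - v - (w - z)) + C (u - v + (w - z)) - (C (u - v - (w + z)) + C (u - v + (w + z)))
      - (C (u + v - (w - z)) + C (u + v + (w - z))) + (C (u + v - (w + z)) + C (u + v + (w + z)))) / 8"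
      unfolding cprod by (simp only: add_divide_distrib diff_divide_distrib divide_divide_eq_left) simp
    finally show ?thesis .
  qed
  have lhs: "8 * (sinpi (c - b) * (t1 + t2 + t3 + t4 + t5 + t6) / 4) = 2 * (sinpi (c - b) * t1) + 2 * (sinpi (c - b) * t2)
     + 2 * (sinpi (c - b) * t3) + 2 * (sinpi (c - b) * t4) + 2 * (sinpi (c - b) * t5) + 2 * (sinpi (c - b) * t6)" for t1 t2 t3 t4 t5 t6
    by (simp add: field_simps)
  have bal: "e = 1 + a + b + c + d - f - g" using assms by (simp add: algebra_simps)
  \<comment> \<open>After e is eliminated, two arguments agree exactly, up to sign, or up to sign
    and a shift by 1, which reverses the sign of the cosine.\<close>
  have arg_eqs:
    "C (c - b - (2 * a + g - e - f)) = C (a - c - (e - a - b) - (f - b - (g - b)))"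
    "C (c - b + (2 * a + g - e - f)) = C (a - b - (e - a - c) - (f - c - (g - c)))"
    "C (c - b - (2 * a + f - e - g)) = C (a - c - (e - a - b) + (f - b - (g - b)))"
    "C (c - b + (2 * a + f - e - g)) = C (a - b - (e - a - c) + (f - c - (g - c)))"
    "C (c - b - (e - f - g)) = C (a - c + (e - a - b) - (f - b + (g - b)))"
    "C (c - b + (e - f - g)) = C (a - b + (e - a - c) - (f - c + (g - c)))"
    "C (c - b - (a + b - c - d)) = - C (a - c - (e - a - b) - (f - b + (g - b)))"
    "C (c - b + (a + c - b - d)) = - C (a - b - (e - a - c) - (f - c + (g - c)))"
    "C (c - b + (a + b - c - d)) = C (c - b - (a + c - b - d))"
    "C (c - b - (a + d - b - c)) = - C (a - b + (e - a - c) + (f - c + (g - c)))"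
    "C (c - b + (a + d - b - c)) = - C (a - c + (e - a - b) + (f - b + (g - b)))"
    "C (a - c - (e - a - b) + (f - b + (g - b))) = C (a - b - (e - a - c) + (f - c + (g - c)))"
    "C (a - c + (e - a - b) - (f - b - (g - b))) = C (a - b + (e - a - c) - (f - c - (g - c)))"
    "C (a - c + (e - a - b) + (f - b - (g - b))) = C (a - b + (e - a - c) + (f - c - (g - c)))"
    by ((rule arg_cong [of _ _ C], (simp add: bal algebra_simps; fail)) | (rule even', (simp add: bal algebra_simps; fail))
        | (rule one', (simp add: bal algebra_simps; fail)))+
  have "8 * (sinpi (c - b) * (sinpi (2 * a + g - e - f) + sinpi (2 * a + f - e - g) + sinpi (e - f - g)
     + sinpi (a + b - c - d) + sinpi (a + c - b - d) + sinpi (a + d - b - c)) / 4) =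
    8 * (sinpi (a - c) * sinpi (e - a - b) * sinpi (f - b) * sinpi (g - b) - sinpi (a - b) * sinpi (e - a - c) * sinpi (f - c) * sinpi (g - c))"
    unfolding lhs quad unfolding prod arg_eqs by (simp add: field_simps)
  then show ?thesis
    by (rule mult_left_cancel [of "8::complex", THEN iffD1, rotated]) simp
qed

section \<open>Linear relations between the two kinds of series\<close>

lemma rGamma_mult_rGamma_eq_sinpi: "rGamma z * rGamma (1 - z) = sinpi z / of_real pi"
  using rGamma_reflection_complex [of z] by (simp add: sinpi_def)

lemma Gamma_mult_Gamma_eq_sinpi: "Gamma z * Gamma (1 - z) = of_real pi / sinpi z"
  using Gamma_reflection_complex [of z] by (simp add: sinpi_def)

lemma sinpi_nonzero: "z \<notin> \<int> \<Longrightarrow> sinpi z \<noteq> 0"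
  by (metis (no_types, lifting) Gamma_mult_Gamma_eq_sinpi Gamma_eq_zero_iff Ints_1 Ints_diff diff_diff_eq2
      add_diff_cancel_left' div_by_0 mult_eq_0_iff nonpos_Ints_Int)

lemma sinpi_minus: "sinpi (- z) = - sinpi z" by (simp add: sinpi_def)

lemma sinpi_1_plus: "sinpi (1 + z) = - sinpi z"
  by (simp add: sinpi_def distrib_left sin_add sin_of_real [symmetric] cos_of_real [symmetric])

lemma cot_pi_diff:
  assumes "sinpi u \<noteq> 0" "sinpi v \<noteq> 0"
  shows "cot (of_real pi * u) - cot (of_real pi * v) = sinpi (v - u) / (sinpi u * sinpi v)"
  using assms by (simp add: cot_def sinpi_def right_diff_distrib sin_diff field_simps)

context balanced_gamma_quotient
begin

text \<open>The Gamma factors of the residues, turned into sines by reflection. Those left over form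
  the prefactor of \<open>g_ser\<close>; with this choice \<open>f_ser i + g_ser i\<close> is
  proportional to a single value of \<open>KK\<close>.\<close>

definition rho :: "'i \<Rightarrow> complex" where
  "rho i = (\<Prod>j\<in>I. sinpi (e j - a i)) / (\<Prod>l\<in>I - {i}. sinpi (a l - a i))"

definition g_ser :: "'i \<Rightarrow> complex" where
  "g_ser i = (\<Prod>j\<in>I. Gamma (1 + a i - e j)) *
     (\<Sum>k. \<Prod>j\<in>I. pochhammer (1 + a i - e j) k * rGamma (of_nat k + (1 + a i - a j)))"

definition f_ser :: "'i \<Rightarrow> complex" where
  "f_ser j = (\<Prod>i\<in>I. Gamma (1 + a i - e j)) *
     (\<Sum>k. \<Prod>i\<in>I. pochhammer (1 + a i - e j) k * rGamma (of_nat k + (1 + e i - e j)))"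

context
  assumes nonint: "\<And>i j. i \<in> I \<Longrightarrow> j \<in> I \<Longrightarrow> a i - e j \<notin> \<int>"
begin

lemma Gamma_rGamma_1: "i \<in> I \<Longrightarrow> j \<in> I \<Longrightarrow> Gamma (1 + a i - e j) * rGamma (1 + a i - e j) = 1"
proof -
  assume "i \<in> I" "j \<in> I"
  then have "1 + (a i - e j) \<notin> \<int>" using nonint by simp
  then have "1 + a i - e j \<notin> \<int>\<^sub>\<le>\<^sub>0" using nonpos_Ints_Int by (auto simp: algebra_simps)
  then show ?thesis by (simp add: rGamma_inverse_Gamma Gamma_eq_zero_iff)
qed

text \<open>Each pair of Gamma values gives \<pi> over a sine and each \<open>rGamma\<close> value a
  sine over \<pi>. The second product has one index more, which leaves 1/\<pi>; it cancels the \<pi>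
  in front of the cotangent in \<open>f_ser_eq\<close>.\<close>

lemma residue_0_tau:
  assumes i: "i \<in> I"
  shows "residue_0 i * suminf (tau i) = rho i * g_ser i / of_real pi"
proof -
  define S where "S = (\<Sum>k. \<Prod>j\<in>I. pochhammer (1 + a i - e j) k * rGamma (of_nat k + (1 + a i - a j)))"
  define c where "c = (\<Prod>j\<in>I - {i}. Gamma (1 + a i - a j))"
  have c0: "c \<noteq> 0"
    unfolding c_def using finite_I
  proof (simp add: Gamma_eq_zero_iff, intro ballI impI)
    fix j assume "j \<in> I - {i}"
    then have "1 + (a i - a j) \<notin> \<int>" using nonint_shift [of i j 1] i by auto
    then show "1 + a i - a j \<notin> \<int>\<^sub>\<le>\<^sub>0" using nonpos_Ints_Int by (auto simp: algebra_simps)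
  qed
  have tau: "tau i = (\<lambda>k. c * (\<Prod>j\<in>I. pochhammer (1 + a i - e j) k * rGamma (of_nat k + (1 + a i - a j))))"
    unfolding c_def using tau_alt [OF i] by blast
  have "summable (\<lambda>k. \<Prod>j\<in>I. pochhammer (1 + a i - e j) k * rGamma (of_nat k + (1 + a i - a j)))"
    using summable_tau [OF i] c0 unfolding tau by (simp add: summable_cmult_iff)
  then have T: "suminf (tau i) = c * S"
    unfolding tau S_def by (rule suminf_mult)
  have "(\<Prod>j\<in>I - {i}. Gamma (a j - a i)) * c = (\<Prod>j\<in>I - {i}. of_real pi / sinpi (a j - a i))"
    unfolding c_def prod.distrib [symmetric]
  proof (rule prod.cong [OF refl])
    fix j
    show "Gamma (a j - a i) * Gamma (1 + a i - a j) = of_real pi / sinpi (a j - a i)"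
      using Gamma_mult_Gamma_eq_sinpi [of "a j - a i"] by (simp add: algebra_simps)
  qed
  moreover have "(\<Prod>j\<in>I. rGamma (e j - a i)) = (\<Prod>j\<in>I. sinpi (e j - a i) / of_real pi * Gamma (1 + a i - e j))"
  proof (rule prod.cong [OF refl])
    fix j assume j: "j \<in> I"
    have "rGamma (e j - a i) * rGamma (1 + a i - e j) = sinpi (e j - a i) / of_real pi"
      using rGamma_mult_rGamma_eq_sinpi [of "e j - a i"] by (simp add: algebra_simps)
    moreover have "rGamma (e j - a i) * (Gamma (1 + a i - e j) * rGamma (1 + a i - e j)) =
        rGamma (e j - a i) * rGamma (1 + a i - e j) * Gamma (1 + a i - e j)"
      by (simp only: mult_ac)
    ultimately have "rGamma (e j - a i) * (Gamma (1 + a i - e j) * rGamma (1 + a i - e j)) = sinpi (e j - a i) / of_real pi * Gamma (1 + a i - e j)"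
      by (simp only:)
    then show "rGamma (e j - a i) = sinpi (e j - a i) / of_real pi * Gamma (1 + a i - e j)"
      using Gamma_rGamma_1 [OF i j] by simp
  qed
  ultimately have "residue_0 i * suminf (tau i) = (\<Prod>j\<in>I - {i}. of_real pi / sinpi (a j - a i)) * ((\<Prod>j\<in>I. sinpi (e j - a i) / of_real pi * Gamma (1 + a i - e j)) * S)"
    by (simp add: residue_0_def T mult_ac)
  also have "\<dots> = (\<Prod>j\<in>I - {i}. of_real pi) / (\<Prod>j\<in>I. of_real pi) * (rho i * g_ser i)"
    by (simp add: prod.distrib prod_dividef rho_def g_ser_def S_def mult_ac)
  also have "(\<Prod>j\<in>I. of_real pi :: complex) = of_real pi * (\<Prod>j\<in>I - {i}. of_real pi)"
    by (rule prod.remove [OF finite_I i])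
  also have "(\<Prod>j\<in>I - {i}. of_real pi :: complex) / (of_real pi * (\<Prod>j\<in>I - {i}. of_real pi)) = 1 / of_real pi"
    by simp
  finally show ?thesis by simp
qed

lemma sum_rho_g: "j \<in> I \<Longrightarrow> (\<Sum>i\<in>I. rho i * g_ser i) = 0"
proof -
  assume j: "j \<in> I"
  have "(\<Sum>i\<in>I. residue_0 i * suminf (tau i)) = 0"
  \<comment> \<open>The shift w = -e_j stays off the poles because no a_i - e_j is an
    integer.\<close>
  proof (rule sum_residues_eq_0 [of "- e j"])
    fix i assume "i \<in> I"
    with nonint [OF this j] show "- e j + a i \<notin> \<int>" by simp
  qed
  also have "(\<Sum>i\<in>I. residue_0 i * suminf (tau i)) = (\<Sum>i\<in>I. rho i * g_ser i) / of_real pi"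
    unfolding sum_divide_distrib by (intro sum.cong refl residue_0_tau)
  finally show ?thesis by simp
qed

lemma f_ser_eq:
  assumes j: "j \<in> I"
  shows "f_ser j = (\<Sum>i\<in>I. rho i * g_ser i * cot (of_real pi * (a i - e j)))"
proof -
  have w: "(1 - e j) + a i \<notin> \<int>" if "i \<in> I" for i
  proof -
    have "1 + (a i - e j) \<notin> \<int>" using nonint [OF that j] by simp
    then show ?thesis by (simp add: algebra_simps)
  qed
  have "(\<lambda>n. \<Prod>i\<in>I. Gamma (a i + (1 - e j + of_nat n)) * rGamma (e i + (1 - e j + of_nat n))) sums
     (\<Sum>i\<in>I. residue_0 i * (suminf (tau i) * (of_real pi * cot (of_real pi * (1 - e j + a i)))))"
    by (rule gamma_quotient_sums [OF w j]) simp_all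
  also have "(\<lambda>n. \<Prod>i\<in>I. Gamma (a i + (1 - e j + of_nat n)) * rGamma (e i + (1 - e j + of_nat n))) =
     (\<lambda>n. (\<Prod>i\<in>I. Gamma (1 + a i - e j)) * (\<Prod>i\<in>I. pochhammer (1 + a i - e j) n * rGamma (of_nat n + (1 + e i - e j))))"
  proof
    fix n
    show "(\<Prod>i\<in>I. Gamma (a i + (1 - e j + of_nat n)) * rGamma (e i + (1 - e j + of_nat n))) =
      (\<Prod>i\<in>I. Gamma (1 + a i - e j)) * (\<Prod>i\<in>I. pochhammer (1 + a i - e j) n * rGamma (of_nat n + (1 + e i - e j)))"
      unfolding prod.distrib [symmetric]
    proof (rule prod.cong [OF refl])
      fix i assume i: "i \<in> I"
      have nn: "1 + a i - e j \<notin> \<int>\<^sub>\<le>\<^sub>0" using w [OF i] nonpos_Ints_Int by (auto simp: algebra_simps)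
      then have "Gamma (1 + a i - e j + of_nat n) = Gamma (1 + a i - e j) * pochhammer (1 + a i - e j) n"
        using pochhammer_Gamma [of "1 + a i - e j" n] by (simp add: Gamma_eq_zero_iff)
      moreover have "a i + (1 - e j + of_nat n) = 1 + a i - e j + of_nat n" "e i + (1 - e j + of_nat n) = of_nat n + (1 + e i - e j)" by simp_all
      ultimately show "Gamma (a i + (1 - e j + of_nat n)) * rGamma (e i + (1 - e j + of_nat n)) =
        Gamma (1 + a i - e j) * (pochhammer (1 + a i - e j) n * rGamma (of_nat n + (1 + e i - e j)))"
        by (simp only: mult_ac)
    qed
  qed
  finally have s: "(\<lambda>n. (\<Prod>i\<in>I. Gamma (1 + a i - e j)) * (\<Prod>i\<in>I. pochhammer (1 + a i - e j) n * rGamma (of_nat n + (1 + e i - e j)))) sums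
     (\<Sum>i\<in>I. residue_0 i * (suminf (tau i) * (of_real pi * cot (of_real pi * (1 - e j + a i)))))" .
  have c0: "(\<Prod>i\<in>I. Gamma (1 + a i - e j)) \<noteq> 0"
    using Gamma_rGamma_1 [OF _ j] finite_I by force
  have "f_ser j = (\<Sum>n. (\<Prod>i\<in>I. Gamma (1 + a i - e j)) * (\<Prod>i\<in>I. pochhammer (1 + a i - e j) n * rGamma (of_nat n + (1 + e i - e j))))"
    unfolding f_ser_def using s c0 by (intro suminf_mult [symmetric]) (auto simp: sums_iff summable_cmult_iff)
  also have "\<dots> = (\<Sum>i\<in>I. residue_0 i * (suminf (tau i) * (of_real pi * cot (of_real pi * (1 - e j + a i)))))"
    using s by (simp add: sums_iff)
  also have "\<dots> = (\<Sum>i\<in>I. rho i * g_ser i * cot (of_real pi * (a i - e j)))"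
  proof (rule sum.cong [OF refl])
    fix i assume i: "i \<in> I"
    have "cot (of_real pi * (1 - e j + a i)) = cot (of_real pi * (a i - e j))"
      using cot_pi_plus_nat [of "a i - e j" 1] by (simp add: algebra_simps)
    then have "residue_0 i * (suminf (tau i) * (of_real pi * cot (of_real pi * (1 - e j + a i)))) = (residue_0 i * suminf (tau i)) * of_real pi * cot (of_real pi * (a i - e j))"
      by simp
    then show "residue_0 i * (suminf (tau i) * (of_real pi * cot (of_real pi * (1 - e j + a i)))) = rho i * g_ser i * cot (of_real pi * (a i - e j))"
      by (simp add: residue_0_tau [OF i])
  qed
  finally show ?thesis .
qed

text \<open>Subtracting cot \<pi>(a_p - e_j) times the relation \<Sum> \<rho>_i g_i = 0 removes the
  series \<open>g_ser p\<close>.\<close>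

lemma f_ser_pivot:
  assumes j: "j \<in> I" and p: "p \<in> I"
  shows "f_ser j = (\<Sum>i\<in>I - {p}. rho i * g_ser i * (cot (of_real pi * (a i - e j)) - cot (of_real pi * (a p - e j))))"
proof -
  have "f_ser j = (\<Sum>i\<in>I. rho i * g_ser i * cot (of_real pi * (a i - e j))) - (\<Sum>i\<in>I. rho i * g_ser i) * cot (of_real pi * (a p - e j))"
    using f_ser_eq [OF j] sum_rho_g [OF j] by simp
  also have "\<dots> = (\<Sum>i\<in>I. rho i * g_ser i * (cot (of_real pi * (a i - e j)) - cot (of_real pi * (a p - e j))))"
    by (simp add: sum_distrib_right sum_subtractf right_diff_distrib)
  also have "\<dots> = (\<Sum>i\<in>I - {p}. rho i * g_ser i * (cot (of_real pi * (a i - e j)) - cot (of_real pi * (a p - e j))))"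
    using sum.remove [OF finite_I p, of "\<lambda>i. rho i * g_ser i * (cot (of_real pi * (a i - e j)) - cot (of_real pi * (a p - e j)))"] by simp
  finally show ?thesis .
qed

end

end

subsection \<open>The three-term relation\<close>

text \<open>This is the coefficient of g_1 after g_4 has been eliminated; those of g_2 and g_3 arise
  from it by cyclic permutation of the indices 1, 2, 3. Each difference of cotangents is a quotient
  of sines, and clearing denominators gives \<open>eta_relation\<close>.\<close>

lemma eta_coefficient:
  fixes A1 A2 A3 A4 E1 E2 E3 E4 :: complex
  defines "\<eta>1 \<equiv> eta A3 A1 A2 A4 E3 E1 E2 E4" and "\<eta>2 \<equiv> eta A1 A2 A3 A4 E1 E2 E3 E4" and "\<eta>3 \<equiv> eta A2 A3 A1 A4 E2 E3 E1 E4"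
  defines "\<rho> \<equiv> sinpi (E1 - A1) * sinpi (E2 - A1) * sinpi (E3 - A1) * sinpi (E4 - A1) / (sinpi (A2 - A1) * sinpi (A3 - A1) * sinpi (A4 - A1))"
  defines "D \<equiv> \<lambda>E. cot (of_real pi * (A1 - E)) - cot (of_real pi * (A4 - E))"
  assumes bal: "E1 + E2 + E3 + E4 = A1 + A2 + A3 + A4 + 2"
    and nz: "sinpi (E1 - A1) \<noteq> 0" "sinpi (E2 - A1) \<noteq> 0" "sinpi (E3 - A1) \<noteq> 0"
      "sinpi (E1 - A4) \<noteq> 0" "sinpi (E2 - A4) \<noteq> 0" "sinpi (E3 - A4) \<noteq> 0"
      "sinpi (A2 - A1) \<noteq> 0" "sinpi (A3 - A1) \<noteq> 0" "sinpi (A4 - A1) \<noteq> 0"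
  shows "sinpi (E1 - A1) * \<eta>1 * sinpi (E4 - A1) * sinpi (E1 - A4) + \<rho> *
    (sinpi (E1 - A1) * \<eta>1 * sinpi (E4 - A1) * sinpi (E1 - A4) * D E1 + sinpi (E2 - A2) * \<eta>2 * sinpi (E4 - A2) * sinpi (E2 - A4) * D E2
     + sinpi (E3 - A3) * \<eta>3 * sinpi (E4 - A3) * sinpi (E3 - A4) * D E3) = 0"
proof -
  have D: "D E = sinpi (A4 - A1) / (sinpi (E - A1) * sinpi (E - A4))" if "sinpi (E - A1) \<noteq> 0" "sinpi (E - A4) \<noteq> 0" for E
    using that cot_pi_diff [of "A1 - E" "A4 - E"] sinpi_minus [of "E - A1"] sinpi_minus [of "E - A4"] by (simp add: D_def)
  have T: "\<eta>1 * (sinpi (E1 - A4) * sinpi (A2 - A1) * sinpi (A3 - A1) + sinpi (E2 - A1) * sinpi (E3 - A1) * sinpi (E4 - A1))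
    + \<eta>2 * (sinpi (E2 - A2) * sinpi (E4 - A2) * sinpi (E3 - A1))
    + \<eta>3 * (sinpi (E3 - A3) * sinpi (E4 - A3) * sinpi (E2 - A1)) = 0"
    unfolding \<eta>1_def \<eta>2_def \<eta>3_def by (rule eta_relation [OF bal])
  have gen: "s11 * h1 * s41 * s14 + s11 * s21 * s31 * s41 / (a21 * a31 * a41) *
     (s11 * h1 * s41 * s14 * (a41 / (s11 * s14)) + s22 * h2 * s42 * s24 * (a41 / (s21 * s24)) + s33 * h3 * s43 * s34 * (a41 / (s31 * s34))) = 0"
    if "h1 * (s14 * a21 * a31 + s21 * s31 * s41) + h2 * (s22 * s42 * s31) + h3 * (s33 * s43 * s21) = 0"
      "s11 \<noteq> 0" "s21 \<noteq> 0" "s31 \<noteq> 0" "s14 \<noteq> 0" "s24 \<noteq> 0" "s34 \<noteq> 0" "a21 \<noteq> 0" "a31 \<noteq> 0" "a41 \<noteq> 0"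
    for s11 s21 s31 s41 s14 s24 s34 a21 a31 a41 h1 h2 h3 s22 s42 s33 s43 :: complex
  proof -
    have "s11 * h1 * s41 * s14 + s11 * s21 * s31 * s41 / (a21 * a31 * a41) *
     (s11 * h1 * s41 * s14 * (a41 / (s11 * s14)) + s22 * h2 * s42 * s24 * (a41 / (s21 * s24)) + s33 * h3 * s43 * s34 * (a41 / (s31 * s34)))
     = s11 * s41 / (a21 * a31) * (h1 * (s14 * a21 * a31 + s21 * s31 * s41) + h2 * (s22 * s42 * s31) + h3 * (s33 * s43 * s21))"
      using that(2-) by (simp add: divide_simps) (simp add: algebra_simps)
    with that(1) show ?thesis by simp
  qed
  show ?thesis
    unfolding \<rho>_def D [OF nz(1,4)] D [OF nz(2,5)] D [OF nz(3,6)] by (rule gen [OF T nz])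
qed

text \<open>The Gamma weight of each value is complementary to the normalisation of f_i + g_i: their
  product is the same for all three values up to sines, so after division only trigonometric weights
  remain.\<close>

theorem KK_three_term_generic:
  fixes A1 A2 A3 A4 E1 E2 E3 E4 :: complex
  assumes bal: "E1 + E2 + E3 + E4 = A1 + A2 + A3 + A4 + 2"
    and gA: "A1 - A2 \<notin> \<int>" "A1 - A3 \<notin> \<int>" "A1 - A4 \<notin> \<int>" "A2 - A3 \<notin> \<int>" "A2 - A4 \<notin> \<int>" "A3 - A4 \<notin> \<int>"
    and gE: "A1 - E1 \<notin> \<int>" "A1 - E2 \<notin> \<int>" "A1 - E3 \<notin> \<int>" "A1 - E4 \<notin> \<int>"
      "A2 - E1 \<notin> \<int>" "A2 - E2 \<notin> \<int>" "A2 - E3 \<notin> \<int>" "A2 - E4 \<notin> \<int>"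
      "A3 - E1 \<notin> \<int>" "A3 - E2 \<notin> \<int>" "A3 - E3 \<notin> \<int>" "A3 - E4 \<notin> \<int>"
      "A4 - E1 \<notin> \<int>" "A4 - E2 \<notin> \<int>" "A4 - E3 \<notin> \<int>" "A4 - E4 \<notin> \<int>"
  shows "sinpi (E1 - A1) * eta A3 A1 A2 A4 E3 E1 E2 E4 *
      (rGamma (1 + A2 - E2) * rGamma (1 + A3 - E3) * rGamma (1 + A2 - E3) * rGamma (1 + A3 - E2) * rGamma (E1 - A4) * rGamma (E4 - A1)) *
      KK (1 + A1 - E1) (1 + A2 - E1) (1 + A3 - E1) (1 + A4 - E1) (1 + E2 - E1) (1 + E3 - E1) (1 + E4 - E1)
    + sinpi (E2 - A2) * eta A1 A2 A3 A4 E1 E2 E3 E4 *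
      (rGamma (1 + A1 - E1) * rGamma (1 + A3 - E3) * rGamma (1 + A1 - E3) * rGamma (1 + A3 - E1) * rGamma (E2 - A4) * rGamma (E4 - A2)) *
      KK (1 + A2 - E2) (1 + A1 - E2) (1 + A3 - E2) (1 + A4 - E2) (1 + E1 - E2) (1 + E3 - E2) (1 + E4 - E2)
    + sinpi (E3 - A3) * eta A2 A3 A1 A4 E2 E3 E1 E4 *
      (rGamma (1 + A1 - E1) * rGamma (1 + A2 - E2) * rGamma (1 + A1 - E2) * rGamma (1 + A2 - E1) * rGamma (E3 - A4) * rGamma (E4 - A3)) *
      KK (1 + A3 - E3) (1 + A1 - E3) (1 + A2 - E3) (1 + A4 - E3) (1 + E1 - E3) (1 + E2 - E3) (1 + E4 - E3) = 0"
proof -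
  define a where "a = (\<lambda>i::nat. if i = 1 then A1 else if i = 2 then A2 else if i = 3 then A3 else A4)"
  define e where "e = (\<lambda>i::nat. if i = 1 then E1 else if i = 2 then E2 else if i = 3 then E3 else E4)"
  define I where "I = {1, 2, 3, 4::nat}"
  have mI: "x - y \<notin> \<int> \<Longrightarrow> y - x \<notin> \<int>" for x y :: complex
    using Ints_minus [of "y - x"] by auto
  interpret balanced_gamma_quotient I a e
  proof
    show "finite I" by (simp add: I_def)
    have "E1 + E2 + E3 + E4 - (A1 + A2 + A3 + A4) = 2" using bal by simp
    then show "(\<Sum>i\<in>I. e i - a i) = 2" by (simp add: I_def a_def e_def algebra_simps)
    show "a i - a j \<notin> \<int>" if "i \<in> I" "j \<in> I" "i \<noteq> j" for i j
      using that gA gA [THEN mI] by (auto simp: I_def a_def)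
  qed
  have nonint: "a i - e j \<notin> \<int>" if "i \<in> I" "j \<in> I" for i j
    using that gE by (auto simp: I_def a_def e_def)
  have I: "1 \<in> I" "2 \<in> I" "3 \<in> I" "4 \<in> I" by (auto simp: I_def)
  have ae: "a 1 = A1" "a 2 = A2" "a 3 = A3" "a 4 = A4" "e 1 = E1" "e 2 = E2" "e 3 = E3" "e 4 = E4"
    by (simp_all add: a_def e_def)
  define G where "G i j = Gamma (1 + a i - e j)" for i j
  define r where "r i j = rGamma (1 + a i - e j)" for i j
  have Gr: "G i j * r i j = 1" if "i \<in> I" "j \<in> I" for i j
    unfolding G_def r_def by (rule Gamma_rGamma_1 [OF nonint that])
  have prodI: "prod u I = u 1 * u 2 * u 3 * u 4" for u :: "nat \<Rightarrow> complex"
    by (simp add: I_def mult_ac)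
  have IdI: "I - {4} = {1, 2, 3}" "I - {1} = {2, 3, 4}" "I - {2} = {1, 3, 4}" "I - {3} = {1, 2, 4}" by (auto simp: I_def)
  define F where "F j = (\<Sum>k. \<Prod>i\<in>I. pochhammer (1 + a i - e j) k * rGamma (of_nat k + (1 + e i - e j)))" for j
  define H where "H i = (\<Sum>k. \<Prod>j\<in>I. pochhammer (1 + a i - e j) k * rGamma (of_nat k + (1 + a i - a j)))" for i
  have f: "f_ser j = G 1 j * G 2 j * G 3 j * G 4 j * F j" for j
    unfolding f_ser_def F_def prodI G_def by simp
  have g: "g_ser i = G i 1 * G i 2 * G i 3 * G i 4 * H i" for i
    unfolding g_ser_def H_def prodI G_def by simp
  have S: "sinpi (e j - a i) \<noteq> 0" if "i \<in> I" "j \<in> I" for i j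
    using nonint [OF that] mI by (intro sinpi_nonzero) blast
  have SA: "sinpi (a j - a i) \<noteq> 0" if "i \<in> I" "j \<in> I" "i \<noteq> j" for i j
    using generic [of j i] that by (intro sinpi_nonzero) blast
  define K where "K i = (case i of (i, j, k) \<Rightarrow> KK (1 + a i - e i) (1 + a j - e i) (1 + a k - e i) (1 + a 4 - e i) (1 + e j - e i) (1 + e k - e i) (1 + e 4 - e i))" for i
  \<comment> \<open>The \<open>rGamma\<close> product cancels the prefactors of both series at once;
    the value at (i,i), common to the two prefactors, occurs in it a single time.\<close>
  have K: "K (1, 2, 3) = (f_ser 1 + g_ser 1) * (r 1 1 * r 2 1 * r 3 1 * r 4 1 * r 1 2 * r 1 3 * r 1 4)"
     "K (2, 1, 3) = (f_ser 2 + g_ser 2) * (r 2 2 * r 1 2 * r 3 2 * r 4 2 * r 2 1 * r 2 3 * r 2 4)"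
     "K (3, 1, 2) = (f_ser 3 + g_ser 3) * (r 3 3 * r 1 3 * r 2 3 * r 4 3 * r 3 1 * r 3 2 * r 3 4)"
  proof -
    have alg: "(c1 * c2 * c3 * c4 * Fj + c1 * d2 * d3 * d4 * Hi) * (s1 * s2 * s3 * s4 * t2 * t3 * t4) = Fj * t2 * t3 * t4 + Hi * s2 * s3 * s4"
      if "c1 * s1 = 1" "c2 * s2 = 1" "c3 * s3 = 1" "c4 * s4 = 1" "d2 * t2 = 1" "d3 * t3 = 1" "d4 * t4 = 1"
      for c1 c2 c3 c4 d2 d3 d4 s1 s2 s3 s4 t2 t3 t4 Fj Hi :: complex
    proof -
      have "(c1 * c2 * c3 * c4 * Fj + c1 * d2 * d3 * d4 * Hi) * (s1 * s2 * s3 * s4 * t2 * t3 * t4)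
        = (c1 * s1) * (c2 * s2) * (c3 * s3) * (c4 * s4) * Fj * t2 * t3 * t4 + (c1 * s1) * (d2 * t2) * (d3 * t3) * (d4 * t4) * Hi * s2 * s3 * s4"
        by (simp add: algebra_simps)
      then show ?thesis by (simp add: that)
    qed
    have Freg: "F43_reg (1 + a i - e i) (1 + a j - e i) (1 + a k - e i) (1 + a 4 - e i) (1 + e j - e i) (1 + e k - e i) (1 + e 4 - e i) = F i"
      if "(i, j, k) \<in> {(1, 2, 3), (2, 1, 3), (3, 1, 2)}" for i j k
      using that unfolding F43_reg_def F_def prodI
      by (auto intro!: arg_cong [of _ _ suminf] simp: rGamma_of_nat_plus_one mult_ac)
    have Hreg: "F43_reg (1 + a i - e i) (1 + (1 + a i - e i) - (1 + e j - e i)) (1 + (1 + a i - e i) - (1 + e k - e i)) (1 + (1 + a i - e i) - (1 + e 4 - e i))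
       (1 + (1 + a i - e i) - (1 + a j - e i)) (1 + (1 + a i - e i) - (1 + a k - e i)) (1 + (1 + a i - e i) - (1 + a 4 - e i)) = H i"
      if "(i, j, k) \<in> {(1, 2, 3), (2, 1, 3), (3, 1, 2)}" for i j k
      using that unfolding F43_reg_def H_def prodI
      by (auto intro!: arg_cong [of _ _ suminf] simp: rGamma_of_nat_plus_one mult_ac add_diff_eq)
    have Kij: "K (i, j, k) = F i * r i j * r i k * r i 4 + H i * r j i * r k i * r 4 i" if "(i, j, k) \<in> {(1, 2, 3), (2, 1, 3), (3, 1, 2)}" for i j k
      unfolding K_def KK_def prod.case Freg [OF that] Hreg [OF that] by (simp add: r_def add_diff_eq)
    note Gr = Gr [OF I(1) I(1)] Gr [OF I(1) I(2)] Gr [OF I(1) I(3)] Gr [OF I(1) I(4)] Gr [OF I(2) I(1)] Gr [OF I(2) I(2)] Gr [OF I(2) I(3)] Gr [OF I(2) I(4)]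
       Gr [OF I(3) I(1)] Gr [OF I(3) I(2)] Gr [OF I(3) I(3)] Gr [OF I(3) I(4)] Gr [OF I(4) I(1)] Gr [OF I(4) I(2)] Gr [OF I(4) I(3)] Gr [OF I(4) I(4)]
    show "K (1, 2, 3) = (f_ser 1 + g_ser 1) * (r 1 1 * r 2 1 * r 3 1 * r 4 1 * r 1 2 * r 1 3 * r 1 4)"
      unfolding f g using alg [of "G 1 1" "r 1 1" "G 2 1" "r 2 1" "G 3 1" "r 3 1" "G 4 1" "r 4 1" "G 1 2" "r 1 2" "G 1 3" "r 1 3" "G 1 4" "r 1 4" "F 1" "H 1"] Gr Kij [of 1 2 3]
      by simp
    show "K (2, 1, 3) = (f_ser 2 + g_ser 2) * (r 2 2 * r 1 2 * r 3 2 * r 4 2 * r 2 1 * r 2 3 * r 2 4)"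
      unfolding f g using alg [of "G 2 2" "r 2 2" "G 1 2" "r 1 2" "G 3 2" "r 3 2" "G 4 2" "r 4 2" "G 2 1" "r 2 1" "G 2 3" "r 2 3" "G 2 4" "r 2 4" "F 2" "H 2"] Gr Kij [of 2 1 3]
      by (simp add: mult_ac)
    show "K (3, 1, 2) = (f_ser 3 + g_ser 3) * (r 3 3 * r 1 3 * r 2 3 * r 4 3 * r 3 1 * r 3 2 * r 3 4)"
      unfolding f g using alg [of "G 3 3" "r 3 3" "G 1 3" "r 1 3" "G 2 3" "r 2 3" "G 4 3" "r 4 3" "G 3 1" "r 3 1" "G 3 2" "r 3 2" "G 3 4" "r 3 4" "F 3" "H 3"] Gr Kij [of 3 1 2]
      by (simp add: mult_ac)
  qed
  define w1 where "w1 = sinpi (E1 - A1) * eta A3 A1 A2 A4 E3 E1 E2 E4 * sinpi (E4 - A1) * sinpi (E1 - A4)"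
  define w2 where "w2 = sinpi (E2 - A2) * eta A1 A2 A3 A4 E1 E2 E3 E4 * sinpi (E4 - A2) * sinpi (E2 - A4)"
  define w3 where "w3 = sinpi (E3 - A3) * eta A2 A3 A1 A4 E2 E3 E1 E4 * sinpi (E4 - A3) * sinpi (E3 - A4)"
  define D where "D i j = cot (of_real pi * (a i - e j)) - cot (of_real pi * (a 4 - e j))" for i j
  have fp: "f_ser j = rho 1 * g_ser 1 * D 1 j + rho 2 * g_ser 2 * D 2 j + rho 3 * g_ser 3 * D 3 j" if "j \<in> I" for j
    using f_ser_pivot [OF nonint that I(4)] by (simp add: IdI D_def)
  have rho: "rho 1 = sinpi (E1 - A1) * sinpi (E2 - A1) * sinpi (E3 - A1) * sinpi (E4 - A1) / (sinpi (A2 - A1) * sinpi (A3 - A1) * sinpi (A4 - A1))"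
    "rho 2 = sinpi (E2 - A2) * sinpi (E3 - A2) * sinpi (E1 - A2) * sinpi (E4 - A2) / (sinpi (A3 - A2) * sinpi (A1 - A2) * sinpi (A4 - A2))"
    "rho 3 = sinpi (E3 - A3) * sinpi (E1 - A3) * sinpi (E2 - A3) * sinpi (E4 - A3) / (sinpi (A1 - A3) * sinpi (A2 - A3) * sinpi (A4 - A3))"
    unfolding rho_def prodI IdI ae by (simp_all add: ae ae [unfolded One_nat_def] mult_ac)
  have bal': "E2 + E3 + E1 + E4 = A2 + A3 + A1 + A4 + 2" "E3 + E1 + E2 + E4 = A3 + A1 + A2 + A4 + 2"
    using bal by (simp_all add: algebra_simps)
  note Snz = S [OF I(1) I(1)] S [OF I(1) I(2)] S [OF I(1) I(3)] S [OF I(2) I(1)] S [OF I(2) I(2)] S [OF I(2) I(3)]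
     S [OF I(3) I(1)] S [OF I(3) I(2)] S [OF I(3) I(3)] S [OF I(4) I(1)] S [OF I(4) I(2)] S [OF I(4) I(3)]
  note SAnz = SA [OF I(1) I(2)] SA [OF I(1) I(3)] SA [OF I(1) I(4)] SA [OF I(2) I(1)] SA [OF I(2) I(3)] SA [OF I(2) I(4)]
     SA [OF I(3) I(1)] SA [OF I(3) I(2)] SA [OF I(3) I(4)]
  have c1: "w1 + rho 1 * (w1 * D 1 1 + w2 * D 1 2 + w3 * D 1 3) = 0"
    using eta_coefficient [OF bal] Snz SAnz unfolding rho w1_def w2_def w3_def D_def ae by simp
  have c2: "w2 + rho 2 * (w2 * D 2 2 + w3 * D 2 3 + w1 * D 2 1) = 0"
    using eta_coefficient [OF bal'(1)] Snz SAnz unfolding rho w1_def w2_def w3_def D_def ae by simp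
  have c3: "w3 + rho 3 * (w3 * D 3 3 + w1 * D 3 1 + w2 * D 3 2) = 0"
    using eta_coefficient [OF bal'(2)] Snz SAnz unfolding rho w1_def w2_def w3_def D_def ae by simp
  have "w1 * (f_ser 1 + g_ser 1) + w2 * (f_ser 2 + g_ser 2) + w3 * (f_ser 3 + g_ser 3) =
      g_ser 1 * (w1 + rho 1 * (w1 * D 1 1 + w2 * D 1 2 + w3 * D 1 3)) + g_ser 2 * (w2 + rho 2 * (w2 * D 2 2 + w3 * D 2 3 + w1 * D 2 1))
      + g_ser 3 * (w3 + rho 3 * (w3 * D 3 3 + w1 * D 3 1 + w2 * D 3 2))"
    unfolding fp [OF I(1)] fp [OF I(2)] fp [OF I(3)] by (simp add: algebra_simps)
  then have main: "w1 * (f_ser 1 + g_ser 1) + w2 * (f_ser 2 + g_ser 2) + w3 * (f_ser 3 + g_ser 3) = 0"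
    by (simp only: c1 c2 c3 mult_zero_right add_0_right)
  have rr: "rGamma (e j - a i) * r i j = sinpi (e j - a i) / of_real pi" for i j
    using rGamma_mult_rGamma_eq_sinpi [of "e j - a i"] by (simp add: r_def algebra_simps)
  \<comment> \<open>These are the nine \<open>rGamma\<close> values with both indices in {1,2,3}.
    The two that involve index 4 pair with \<open>rGamma (e j - a 4)\<close> and
    \<open>rGamma (e 4 - a j)\<close> to sines over \<pi>, hence the square of \<pi>.\<close>
  define N where "N = r 1 1 * r 1 2 * r 1 3 * r 2 1 * r 2 2 * r 2 3 * r 3 1 * r 3 2 * r 3 3"
  have k1: "sinpi (E1 - A1) * eta A3 A1 A2 A4 E3 E1 E2 E4 * (r 2 2 * r 3 3 * r 2 3 * r 3 2 * rGamma (E1 - A4) * rGamma (E4 - A1)) * K (1, 2, 3)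
      = N / of_real pi ^ 2 * (w1 * (f_ser 1 + g_ser 1))"
  proof -
    have "sinpi (E1 - A1) * eta A3 A1 A2 A4 E3 E1 E2 E4 * (r 2 2 * r 3 3 * r 2 3 * r 3 2 * rGamma (E1 - A4) * rGamma (E4 - A1)) * K (1, 2, 3)
       = sinpi (E1 - A1) * eta A3 A1 A2 A4 E3 E1 E2 E4 * N * (rGamma (e 1 - a 4) * r 4 1) * (rGamma (e 4 - a 1) * r 1 4) * (f_ser 1 + g_ser 1)"
      unfolding K N_def ae by (simp only: mult_ac)
    also have "\<dots> = N / of_real pi ^ 2 * (w1 * (f_ser 1 + g_ser 1))"
      unfolding rr unfolding ae w1_def by (simp add: power2_eq_square)
    finally show ?thesis .
  qed
  have k2: "sinpi (E2 - A2) * eta A1 A2 A3 A4 E1 E2 E3 E4 * (r 1 1 * r 3 3 * r 1 3 * r 3 1 * rGamma (E2 - A4) * rGamma (E4 - A2)) * K (2, 1, 3)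
      = N / of_real pi ^ 2 * (w2 * (f_ser 2 + g_ser 2))"
  proof -
    have "sinpi (E2 - A2) * eta A1 A2 A3 A4 E1 E2 E3 E4 * (r 1 1 * r 3 3 * r 1 3 * r 3 1 * rGamma (E2 - A4) * rGamma (E4 - A2)) * K (2, 1, 3)
       = sinpi (E2 - A2) * eta A1 A2 A3 A4 E1 E2 E3 E4 * N * (rGamma (e 2 - a 4) * r 4 2) * (rGamma (e 4 - a 2) * r 2 4) * (f_ser 2 + g_ser 2)"
      unfolding K N_def ae by (simp only: mult_ac)
    also have "\<dots> = N / of_real pi ^ 2 * (w2 * (f_ser 2 + g_ser 2))"
      unfolding rr unfolding ae w2_def by (simp add: power2_eq_square)
    finally show ?thesis .
  qed
  have k3: "sinpi (E3 - A3) * eta A2 A3 A1 A4 E2 E3 E1 E4 * (r 1 1 * r 2 2 * r 1 2 * r 2 1 * rGamma (E3 - A4) * rGamma (E4 - A3)) * K (3, 1, 2)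
      = N / of_real pi ^ 2 * (w3 * (f_ser 3 + g_ser 3))"
  proof -
    have "sinpi (E3 - A3) * eta A2 A3 A1 A4 E2 E3 E1 E4 * (r 1 1 * r 2 2 * r 1 2 * r 2 1 * rGamma (E3 - A4) * rGamma (E4 - A3)) * K (3, 1, 2)
       = sinpi (E3 - A3) * eta A2 A3 A1 A4 E2 E3 E1 E4 * N * (rGamma (e 3 - a 4) * r 4 3) * (rGamma (e 4 - a 3) * r 3 4) * (f_ser 3 + g_ser 3)"
      unfolding K N_def ae by (simp only: mult_ac)
    also have "\<dots> = N / of_real pi ^ 2 * (w3 * (f_ser 3 + g_ser 3))"
      unfolding rr unfolding ae w3_def by (simp add: power2_eq_square)
    finally show ?thesis .
  qed
  have "N / of_real pi ^ 2 * (w1 * (f_ser 1 + g_ser 1)) + N / of_real pi ^ 2 * (w2 * (f_ser 2 + g_ser 2)) + N / of_real pi ^ 2 * (w3 * (f_ser 3 + g_ser 3)) = 0"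
    unfolding distrib_left [symmetric] main by (rule mult_zero_right)
  then show ?thesis
    unfolding k1 [symmetric] k2 [symmetric] k3 [symmetric] K_def prod.case r_def ae .
qed

section \<open>From the frame back to the coordinates of x\<close>

lemma sinpi_eq:
  "u = v - 1 \<Longrightarrow> sinpi u = - sinpi v"
  "u = 1 - v \<Longrightarrow> sinpi u = sinpi v"
  "u = - 1 - v \<Longrightarrow> sinpi u = sinpi v"
  "u = v \<Longrightarrow> sinpi u = sinpi v"
  "u = - v \<Longrightarrow> sinpi u = - sinpi v"
proof -
  show 1: "sinpi u = - sinpi v" if "u = v - 1" for u v
    using sinpi_1_plus [of u] that by simp
  show 2: "sinpi u = - sinpi v" if "u = - v" for u v
    using that sinpi_minus by simp
  show "u = 1 - v \<Longrightarrow> sinpi u = sinpi v" using sinpi_1_plus [of "- v"] sinpi_minus [of v] by simp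
  show "u = - 1 - v \<Longrightarrow> sinpi u = sinpi v" using 1 [of u "- v"] 2 [of "- v" v] by simp
qed simp

text \<open>In the frame A = (a, f-c, d, f-b), E = (1, e+f-b-c, g+f-b-c, f) the six sines of
  \<gamma> match those of \<open>eta\<close> one by one, up to the sign and an integer shift of the
  argument. The next two lemmas do the same at \<sigma>x and \<sigma>^2 x, where the indices 1, 2, 3
  are rotated.\<close>

lemma gamma_trig_eq_eta_1:
  fixes a b c d e f g :: complex
  assumes g: "g = 1 + a + b + c + d - e - f"
  shows "gamma_trig a b c d e f g = sinpi ((e + f - b - c) - (f - c)) * eta a (f - c) d (f - b) 1 (e + f - b - c) (g + f - b - c) f"
proof -
  define t0 where "t0 = sinpi (2 * a + 2 * (g + f - b - c) - (a + (f - c) + d + (f - b)))"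
  define t1 where "t1 = sinpi (2 * d + 2 * 1 - (a + (f - c) + d + (f - b)))"
  define t2 where "t2 = sinpi (2 * a + 2 * (f - c) - (a + (f - c) + d + (f - b)))"
  define t3 where "t3 = sinpi (2 * a + 2 * (f - b) - (a + (f - c) + d + (f - b)))"
  define t4 where "t4 = sinpi (2 * 1 + 2 * (e + f - b - c) - (1 + (e + f - b - c) + (g + f - b - c) + f))"
  define t5 where "t5 = sinpi (2 * 1 + 2 * f - (1 + (e + f - b - c) + (g + f - b - c) + f))"
  have h0: "sinpi (2 * a + g - e - f) = - t0"
    unfolding t0_def by (rule sinpi_eq(1)) (simp add: g algebra_simps)
  have h1: "sinpi (2 * a + f - e - g) = t1"
    unfolding t1_def by (rule sinpi_eq(2)) (simp add: g algebra_simps)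
  have h2: "sinpi (e - f - g) = - t4"
    unfolding t4_def by (rule sinpi_eq(1)) (simp add: g algebra_simps)
  have h3: "sinpi (a + b - c - d) = t2"
    unfolding t2_def by (rule sinpi_eq(4)) (simp add: g algebra_simps)
  have h4: "sinpi (a + c - b - d) = t3"
    unfolding t3_def by (rule sinpi_eq(4)) (simp add: g algebra_simps)
  have h5: "sinpi (a + d - b - c) = - t5"
    unfolding t5_def by (rule sinpi_eq(5)) (simp add: g algebra_simps)
  have p: "e - b = (e + f - b - c) - (f - c)" by (simp add: g algebra_simps)
  show ?thesis
    unfolding gamma_trig_def h0 h1 h2 h3 h4 h5 p eta_def t0_def [symmetric] t1_def [symmetric] t2_def [symmetric] t3_def [symmetric] t4_def [symmetric] t5_def [symmetric]
    by (simp add: field_simps)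
qed

lemma gamma_trig_eq_eta_2:
  fixes a b c d e f g :: complex
  assumes g: "g = 1 + a + b + c + d - e - f"
  shows "gamma_trig (1 + b - e) b (f - c) (g - c) (1 + a + b - e) (1 + b - c) (1 + b + d - e) = sinpi ((g + f - b - c) - d) * eta (f - c) d a (f - b) (e + f - b - c) (g + f - b - c) 1 f"
proof -
  define t0 where "t0 = sinpi (2 * (f - c) + 2 * 1 - ((f - c) + d + a + (f - b)))"
  define t1 where "t1 = sinpi (2 * a + 2 * (e + f - b - c) - ((f - c) + d + a + (f - b)))"
  define t2 where "t2 = sinpi (2 * (f - c) + 2 * d - ((f - c) + d + a + (f - b)))"
  define t3 where "t3 = sinpi (2 * (f - c) + 2 * (f - b) - ((f - c) + d + a + (f - b)))"
  define t4 where "t4 = sinpi (2 * (e + f - b - c) + 2 * (g + f - b - c) - ((e + f - b - c) + (g + f - b - c) + 1 + f))"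
  define t5 where "t5 = sinpi (2 * (e + f - b - c) + 2 * f - ((e + f - b - c) + (g + f - b - c) + 1 + f))"
  have h0: "sinpi (2 * (1 + b - e) + (1 + b + d - e) - (1 + a + b - e) - (1 + b - c)) = t1"
    unfolding t1_def by (rule sinpi_eq(2)) (simp add: g algebra_simps)
  have h1: "sinpi (2 * (1 + b - e) + (1 + b - c) - (1 + a + b - e) - (1 + b + d - e)) = - t0"
    unfolding t0_def by (rule sinpi_eq(1)) (simp add: g algebra_simps)
  have h2: "sinpi ((1 + a + b - e) - (1 + b - c) - (1 + b + d - e)) = t2"
    unfolding t2_def by (rule sinpi_eq(3)) (simp add: g algebra_simps)
  have h3: "sinpi ((1 + b - e) + b - (f - c) - (g - c)) = - t4"
    unfolding t4_def by (rule sinpi_eq(5)) (simp add: g algebra_simps)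
  have h4: "sinpi ((1 + b - e) + (f - c) - b - (g - c)) = t3"
    unfolding t3_def by (rule sinpi_eq(4)) (simp add: g algebra_simps)
  have h5: "sinpi ((1 + b - e) + (g - c) - b - (f - c)) = - t5"
    unfolding t5_def by (rule sinpi_eq(5)) (simp add: g algebra_simps)
  have p: "(1 + a + b - e) - b = (g + f - b - c) - d" by (simp add: g algebra_simps)
  show ?thesis
    unfolding gamma_trig_def h0 h1 h2 h3 h4 h5 p eta_def t0_def [symmetric] t1_def [symmetric] t2_def [symmetric] t3_def [symmetric] t4_def [symmetric] t5_def [symmetric]
    by (simp add: field_simps)
qed

lemma gamma_trig_eq_eta_3:
  fixes a b c d e f g :: complex
  assumes g: "g = 1 + a + b + c + d - e - f"
  shows "gamma_trig (e - a) b (1 + b - f) (g - a) (1 + b - a) (1 + b - f + c) (e + g - a - c) = sinpi (1 - a) * eta d a (f - c) (f - b) (g + f - b - c) 1 (e + f - b - c) f"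
proof -
  define t0 where "t0 = sinpi (2 * d + 2 * (e + f - b - c) - (d + a + (f - c) + (f - b)))"
  define t1 where "t1 = sinpi (2 * (f - c) + 2 * (g + f - b - c) - (d + a + (f - c) + (f - b)))"
  define t2 where "t2 = sinpi (2 * d + 2 * a - (d + a + (f - c) + (f - b)))"
  define t3 where "t3 = sinpi (2 * d + 2 * (f - b) - (d + a + (f - c) + (f - b)))"
  define t4 where "t4 = sinpi (2 * (g + f - b - c) + 2 * 1 - ((g + f - b - c) + 1 + (e + f - b - c) + f))"
  define t5 where "t5 = sinpi (2 * (g + f - b - c) + 2 * f - ((g + f - b - c) + 1 + (e + f - b - c) + f))"
  have h0: "sinpi (2 * (e - a) + (e + g - a - c) - (1 + b - a) - (1 + b - f + c)) = - t0"
    unfolding t0_def by (rule sinpi_eq(1)) (simp add: g algebra_simps)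
  have h1: "sinpi (2 * (e - a) + (1 + b - f + c) - (1 + b - a) - (e + g - a - c)) = t1"
    unfolding t1_def by (rule sinpi_eq(2)) (simp add: g algebra_simps)
  have h2: "sinpi ((1 + b - a) - (1 + b - f + c) - (e + g - a - c)) = t2"
    unfolding t2_def by (rule sinpi_eq(3)) (simp add: g algebra_simps)
  have h3: "sinpi ((e - a) + b - (1 + b - f) - (g - a)) = - t4"
    unfolding t4_def by (rule sinpi_eq(5)) (simp add: g algebra_simps)
  have h4: "sinpi ((e - a) + (1 + b - f) - b - (g - a)) = - t5"
    unfolding t5_def by (rule sinpi_eq(5)) (simp add: g algebra_simps)
  have h5: "sinpi ((e - a) + (g - a) - b - (1 + b - f)) = t3"
    unfolding t3_def by (rule sinpi_eq(4)) (simp add: g algebra_simps)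
  have p: "(1 + b - a) - b = 1 - a" by (simp add: g algebra_simps)
  show ?thesis
    unfolding gamma_trig_def h0 h1 h2 h3 h4 h5 p eta_def t0_def [symmetric] t1_def [symmetric] t2_def [symmetric] t3_def [symmetric] t4_def [symmetric] t5_def [symmetric]
    by (simp add: field_simps)
qed

lemma KK_permute:
  "KK a b c d e f g = KK a c b d e f g" "KK a b c d e f g = KK a b d c e f g" "KK a b c d e f g = KK a d c b e f g"
  "KK a b c d e f g = KK a b c d f e g" "KK a b c d e f g = KK a b c d e g f" "KK a b c d e f g = KK a b c d g f e"
  by (simp_all add: KK_def F43_reg_def mult_ac)

text \<open>One use of \<open>KK_transform\<close> per value, between permutations of parameters,
  gives x, p_5 x and n_4 x the parameter pattern 1 + A_l - E_i, 1 + E_l - E_i of the frame.\<close>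

lemma KK_frame:
  fixes a b c d e f g :: complex
  assumes g: "g = 1 + a + b + c + d - e - f"
  shows "KK a (f - c) d (f - b) (e + f - b - c) (g + f - b - c) f = KK a b c d e f g"
    and "KK (1 + b - e) (1 + a + b + c - e - f) (1 + d + b + c - e - f) (1 + c - e) (2 + b + c - e - f) (1 + g - e) (1 + b + c - e) =
      KK (1 + b - e) (1 + c - e) (1 + d - e) (1 + a - e) (1 + f - e) (1 + g - e) (2 - e)"
    and "KK (e - a) (e - d) (1 + b - g) (1 + c - g) (1 + e - a - d) (1 + e - g) (1 + b + c - g) =
      KK (e - a) (e - b) (e - c) (e - d) (1 + e - f) (1 + e - g) e"
proof -
  have "KK a b c d e f g = KK a b c d f e g" by (rule KK_permute(4))
  also have "\<dots> = KK a (f - b) (f - c) d f (e - (b + c - f)) (g - (b + c - f))"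
    by (rule KK_transform) (simp add: g)
  also have "\<dots> = KK a (f - c) d (f - b) (e - (b + c - f)) (g - (b + c - f)) f"
    by (simp add: KK_def F43_reg_def mult_ac)
  finally show "KK a (f - c) d (f - b) (e + f - b - c) (g + f - b - c) f = KK a b c d e f g"
    by (simp add: algebra_simps)
next
  have "KK (1 + b - e) (1 + c - e) (1 + d - e) (1 + a - e) (1 + f - e) (1 + g - e) (2 - e)
     = KK (1 + b - e) (1 + d - e) (1 + a - e) (1 + c - e) (1 + g - e) (1 + f - e) (2 - e)"
    by (simp add: KK_def F43_reg_def mult_ac)
  also have "\<dots> = KK (1 + b - e) (1 + g - e - (1 + d - e)) (1 + g - e - (1 + a - e)) (1 + c - e) (1 + g - e)
      (1 + f - e - (1 + d - e + (1 + a - e) - (1 + g - e))) (2 - e - (1 + d - e + (1 + a - e) - (1 + g - e)))"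
    by (rule KK_transform) (simp add: g)
  also have "\<dots> = KK (1 + b - e) (1 + a + b + c - e - f) (1 + d + b + c - e - f) (1 + c - e) (1 + g - e) (1 + b + c - e) (2 + b + c - e - f)"
    by (simp add: g algebra_simps)
  also have "\<dots> = KK (1 + b - e) (1 + a + b + c - e - f) (1 + d + b + c - e - f) (1 + c - e) (2 + b + c - e - f) (1 + g - e) (1 + b + c - e)"
    by (simp add: KK_def F43_reg_def mult_ac)
  finally show "KK (1 + b - e) (1 + a + b + c - e - f) (1 + d + b + c - e - f) (1 + c - e) (2 + b + c - e - f) (1 + g - e) (1 + b + c - e) =
      KK (1 + b - e) (1 + c - e) (1 + d - e) (1 + a - e) (1 + f - e) (1 + g - e) (2 - e)" by simp
next
  have "KK (e - a) (e - b) (e - c) (e - d) (1 + e - f) (1 + e - g) e = KK (e - a) (e - b) (e - c) (e - d) (1 + e - g) (1 + e - f) e"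
    by (rule KK_permute(4))
  also have "\<dots> = KK (e - a) (1 + e - g - (e - b)) (1 + e - g - (e - c)) (e - d) (1 + e - g) (1 + e - f - (e - b + (e - c) - (1 + e - g))) (e - (e - b + (e - c) - (1 + e - g)))"
    by (rule KK_transform) (simp add: g)
  also have "\<dots> = KK (e - a) (1 + b - g) (1 + c - g) (e - d) (1 + e - g) (1 + e - a - d) (1 + b + c - g)"
    by (simp add: g algebra_simps)
  also have "\<dots> = KK (e - a) (e - d) (1 + b - g) (1 + c - g) (1 + e - a - d) (1 + e - g) (1 + b + c - g)"
    by (simp add: KK_def F43_reg_def mult_ac)
  finally show "KK (e - a) (e - d) (1 + b - g) (1 + c - g) (1 + e - a - d) (1 + e - g) (1 + b + c - g) =
      KK (e - a) (e - b) (e - c) (e - d) (1 + e - f) (1 + e - g) e" by simp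
qed

lemma KK_transform_eq:
  fixes a b c d e f g :: complex
  assumes "e + f + g = 1 + a + b + c + d" "b' = e - b" "c' = e - c" "f' = f - (b + c - e)" "g' = g - (b + c - e)"
  shows "KK a b c d e f g = KK a b' c' d e f' g'"
  unfolding assms(2-) by (rule KK_transform [OF assms(1)])

text \<open>Two uses of \<open>KK_transform\<close>, with permutations, identify K(\<sigma>x) with
  the value at p_5 x and K(\<sigma>^2 x) with the value at n_4 x. This links the two forms of the
  relation.\<close>

lemma KK_sigma:
  fixes a b c d e f g :: complex
  assumes g: "g = 1 + a + b + c + d - e - f"
  shows "KK (1 + b - e) b (f - c) (g - c) (1 + a + b - e) (1 + b - c) (1 + b + d - e) =
      KK (1 + b - e) (1 + c - e) (1 + d - e) (1 + a - e) (1 + f - e) (1 + g - e) (2 - e)"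
    and "KK (e - a) b (1 + b - f) (g - a) (1 + b - a) (1 + b - f + c) (e + g - a - c) =
      KK (e - a) (e - b) (e - c) (e - d) (1 + e - f) (1 + e - g) e"
proof -
  have "KK (1 + b - e) (1 + c - e) (1 + d - e) (1 + a - e) (1 + f - e) (1 + g - e) (2 - e)
    = KK (1 + b - e) (1 + c - e) (1 + a - e) (1 + d - e) (1 + f - e) (1 + g - e) (2 - e)"
    by (rule KK_permute(2))
  also have "\<dots> = KK (1 + b - e) (f - c) (f - a) (1 + d - e) (1 + f - e) (1 + b + d - e) (1 + f - a - c)"
    by (rule KK_transform_eq) (simp_all add: g)
  also have "\<dots> = KK (1 + b - e) (f - a) (1 + d - e) (f - c) (1 + b + d - e) (1 + f - e) (1 + f - a - c)"
    by (simp add: KK_def F43_reg_def mult_ac)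
  also have "\<dots> = KK (1 + b - e) (g - c) b (f - c) (1 + b + d - e) (1 + a + b - e) (1 + b - c)"
    by (rule KK_transform_eq) (simp_all add: g)
  also have "\<dots> = KK (1 + b - e) b (f - c) (g - c) (1 + a + b - e) (1 + b - c) (1 + b + d - e)"
    by (simp add: KK_def F43_reg_def mult_ac)
  finally show "KK (1 + b - e) b (f - c) (g - c) (1 + a + b - e) (1 + b - c) (1 + b + d - e) =
      KK (1 + b - e) (1 + c - e) (1 + d - e) (1 + a - e) (1 + f - e) (1 + g - e) (2 - e)" by simp
next
  have "KK (e - a) (e - b) (e - c) (e - d) (1 + e - f) (1 + e - g) e = KK (e - a) (e - b) (e - d) (e - c) (1 + e - f) (1 + e - g) e"
    by (rule KK_permute(2))
  also have "\<dots> = KK (e - a) (1 + b - f) (1 + d - f) (e - c) (1 + e - f) (1 + e - a - c) (1 + b + d - f)"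
    by (rule KK_transform_eq) (simp_all add: g)
  also have "\<dots> = KK (e - a) (1 + d - f) (e - c) (1 + b - f) (1 + b + d - f) (1 + e - f) (1 + e - a - c)"
    by (simp add: KK_def F43_reg_def mult_ac)
  also have "\<dots> = KK (e - a) b (g - a) (1 + b - f) (1 + b + d - f) (1 + b - f + c) (1 + b - a)"
    by (rule KK_transform_eq) (simp_all add: g)
  also have "\<dots> = KK (e - a) b (1 + b - f) (g - a) (1 + b - a) (1 + b - f + c) (1 + b + d - f)"
    by (simp add: KK_def F43_reg_def mult_ac)
  also have "1 + b + d - f = e + g - a - c" by (simp add: g)
  finally show "KK (e - a) b (1 + b - f) (g - a) (1 + b - a) (1 + b - f + c) (e + g - a - c) =
      KK (e - a) (e - b) (e - c) (e - d) (1 + e - f) (1 + e - g) e" by simp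
qed

definition beta_c :: "complex \<Rightarrow> complex \<Rightarrow> complex \<Rightarrow> complex \<Rightarrow> complex \<Rightarrow> complex \<Rightarrow> complex \<Rightarrow> complex" where
  "beta_c a b c d e f g = rGamma a * rGamma (1 + b - e) * rGamma (f - c) * rGamma (f - d) * rGamma (g - c) * rGamma (g - d)"

lemma three_term_generic:
  fixes a b c d e f g :: complex
  assumes g: "g = 1 + a + b + c + d - e - f"
    and gA: "a - (f - c) \<notin> \<int>" "a - d \<notin> \<int>" "a - (f - b) \<notin> \<int>" "(f - c) - d \<notin> \<int>" "b - c \<notin> \<int>" "d - (f - b) \<notin> \<int>"
    and gE: "a \<notin> \<int>" "a - (e + f - b - c) \<notin> \<int>" "a - (g + f - b - c) \<notin> \<int>" "a - f \<notin> \<int>"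
      "f - c \<notin> \<int>" "b - e \<notin> \<int>" "b - g \<notin> \<int>" "c \<notin> \<int>"
      "d \<notin> \<int>" "d - (e + f - b - c) \<notin> \<int>" "d - (g + f - b - c) \<notin> \<int>" "d - f \<notin> \<int>"
      "f - b \<notin> \<int>" "c - e \<notin> \<int>" "c - g \<notin> \<int>" "b \<notin> \<int>"
  shows "gamma_trig (e - a) b (1 + b - f) (g - a) (1 + b - a) (1 + b - f + c) (e + g - a - c)
      * beta_c (1 + b - e) b (f - c) (g - c) (1 + a + b - e) (1 + b - c) (1 + b + d - e) * KK a b c d e f g
    + gamma_trig (1 + b - e) b (f - c) (g - c) (1 + a + b - e) (1 + b - c) (1 + b + d - e)
      * beta_c a b c d e f g * KK (e - a) (e - b) (e - c) (e - d) (1 + e - f) (1 + e - g) e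
    + gamma_trig a b c d e f g
      * beta_c (e - a) b (1 + b - f) (g - a) (1 + b - a) (1 + b - f + c) (e + g - a - c)
      * KK (1 + b - e) (1 + c - e) (1 + d - e) (1 + a - e) (1 + f - e) (1 + g - e) (2 - e) = 0"
proof -
  let ?A1 = a and ?A2 = "f - c" and ?A3 = d and ?A4 = "f - b" and ?E1 = 1 and ?E2 = "e + f - b - c" and ?E3 = "g + f - b - c" and ?E4 = f
  have m1: "x \<notin> \<int> \<Longrightarrow> x - 1 \<notin> \<int>" and mm: "x \<notin> \<int> \<Longrightarrow> - x \<notin> \<int>" for x :: complex
    using Ints_add [of "x - 1" 1] Ints_minus [of "- x"] by auto
  have bal: "?E1 + ?E2 + ?E3 + ?E4 = ?A1 + ?A2 + ?A3 + ?A4 + 2" by (simp add: g)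
  have r: "f - c - (f - b) = b - c" "f - c - (e + f - b - c) = b - e" "f - c - (g + f - b - c) = b - g" "f - c - f = - c"
    "f - b - (e + f - b - c) = c - e" "f - b - (g + f - b - c) = c - g" "f - b - f = - b" by simp_all
  \<comment> \<open>The hypotheses are the differences A_i - A_l and A_i - E_j simplified by
    \<open>r\<close>; since E_1 = 1, one column is off by an integer, which \<open>m1\<close>
    corrects, and \<open>mm\<close> changes signs.\<close>
  note K = KK_three_term_generic [OF bal gA(1-4), unfolded r, OF gA(5,6) m1 [OF gE(1)] gE(2-4) m1 [OF gE(5)] gE(6,7) mm [OF gE(8)]
     m1 [OF gE(9)] gE(10-12) m1 [OF gE(13)] gE(14,15) mm [OF gE(16)]]
  note k1 = KK_frame(1) [OF g] and k2 = KK_frame(2) [OF g] and k3 = KK_frame(3) [OF g]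
  have K1: "KK (1 + ?A1 - ?E1) (1 + ?A2 - ?E1) (1 + ?A3 - ?E1) (1 + ?A4 - ?E1) (1 + ?E2 - ?E1) (1 + ?E3 - ?E1) (1 + ?E4 - ?E1) = KK a b c d e f g"
    unfolding k1 [symmetric] by simp
  have K2: "KK (1 + ?A2 - ?E2) (1 + ?A1 - ?E2) (1 + ?A3 - ?E2) (1 + ?A4 - ?E2) (1 + ?E1 - ?E2) (1 + ?E3 - ?E2) (1 + ?E4 - ?E2)
    = KK (1 + b - e) (1 + c - e) (1 + d - e) (1 + a - e) (1 + f - e) (1 + g - e) (2 - e)"
    unfolding k2 [symmetric] by (simp add: algebra_simps)
  have K3: "KK (1 + ?A3 - ?E3) (1 + ?A1 - ?E3) (1 + ?A2 - ?E3) (1 + ?A4 - ?E3) (1 + ?E1 - ?E3) (1 + ?E2 - ?E3) (1 + ?E4 - ?E3)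
    = KK (e - a) (e - b) (e - c) (e - d) (1 + e - f) (1 + e - g) e"
    unfolding k3 [symmetric] by (simp add: g algebra_simps)
  have b1: "rGamma (1 + ?A2 - ?E2) * rGamma (1 + ?A3 - ?E3) * rGamma (1 + ?A2 - ?E3) * rGamma (1 + ?A3 - ?E2) * rGamma (?E1 - ?A4) * rGamma (?E4 - ?A1)
     = beta_c (1 + b - e) b (f - c) (g - c) (1 + a + b - e) (1 + b - c) (1 + b + d - e)"
    by (simp add: beta_c_def g algebra_simps)
  have b2: "rGamma (1 + ?A1 - ?E1) * rGamma (1 + ?A3 - ?E3) * rGamma (1 + ?A1 - ?E3) * rGamma (1 + ?A3 - ?E1) * rGamma (?E2 - ?A4) * rGamma (?E4 - ?A2)
     = beta_c (e - a) b (1 + b - f) (g - a) (1 + b - a) (1 + b - f + c) (e + g - a - c)"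
    by (simp add: beta_c_def g algebra_simps)
  have b3: "rGamma (1 + ?A1 - ?E1) * rGamma (1 + ?A2 - ?E2) * rGamma (1 + ?A1 - ?E2) * rGamma (1 + ?A2 - ?E1) * rGamma (?E3 - ?A4) * rGamma (?E4 - ?A3)
     = beta_c a b c d e f g"
    by (simp add: beta_c_def g algebra_simps)
  have fin: "x + z + y = 0" if "x + y + z = 0" for x y z :: complex
    using that by (simp add: add_ac)
  show ?thesis
    using K unfolding K1 K2 K3 b1 b2 b3 gamma_trig_eq_eta_1 [OF g, symmetric] gamma_trig_eq_eta_2 [OF g, symmetric] gamma_trig_eq_eta_3 [OF g, symmetric]
    by (rule fin)
qed

section \<open>Continuity on V and the removable singularities of the coefficient\<close>

lemma continuous_on_rGamma_compose:
  fixes f :: "'a::topological_space \<Rightarrow> complex"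
  assumes "continuous_on S f"
  shows "continuous_on S (\<lambda>x. rGamma (f x))"
  by (rule continuous_on_compose2 [OF holomorphic_on_imp_continuous_on [OF holomorphic_rGamma [of UNIV]] assms]) simp

lemma continuous_on_pochhammer_compose:
  fixes f :: "'a::topological_space \<Rightarrow> complex"
  assumes "continuous_on S f"
  shows "continuous_on S (\<lambda>x. pochhammer (f x) k)"
  unfolding pochhammer_prod by (intro continuous_intros assms)

text \<open>By the Weierstrass test: bounded parameters share the constants of the growth bounds,
  and the pointwise balance makes the exponents add up to exactly -2, however the single parameters
  vary.\<close>

lemma continuous_on_F43_reg:
  fixes A B C D E F G :: "'a::topological_space \<Rightarrow> complex"
  assumes cont: "continuous_on S A" "continuous_on S B" "continuous_on S C" "continuous_on S D"
      "continuous_on S E" "continuous_on S F" "continuous_on S G"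
    and bd: "\<And>x. x \<in> S \<Longrightarrow> norm (A x) \<le> R \<and> norm (B x) \<le> R \<and> norm (C x) \<le> R \<and> norm (D x) \<le> R \<and> norm (E x) \<le> R \<and> norm (F x) \<le> R \<and> norm (G x) \<le> R"
    and bal: "\<And>x. x \<in> S \<Longrightarrow> E x + F x + G x = 1 + A x + B x + C x + D x"
  shows "continuous_on S (\<lambda>x. F43_reg (A x) (B x) (C x) (D x) (E x) (F x) (G x))"
proof (cases "S = {}")
  case False
  then have R: "R \<ge> 0" using bd by (meson all_not_in_conv norm_ge_zero order_trans)
  obtain P where P: "P > 0" "\<And>z k. norm (z :: complex) \<le> R \<Longrightarrow> norm (pochhammer z k) \<le> P * fact k * (real k + 1) powr (Re z - 1)"
    using norm_pochhammer_le [OF R] by blast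
  obtain Q where Q: "Q > 0" "\<And>z k. norm (z :: complex) \<le> R \<Longrightarrow> norm (rGamma (of_nat k + z)) \<le> Q * (real k + 1) powr (1 - Re z) / fact k"
    using norm_rGamma_le [OF R] by blast
  define t where "t k x = pochhammer (A x) k * pochhammer (B x) k * pochhammer (C x) k * pochhammer (D x) k / fact k
            * rGamma (of_nat k + E x) * rGamma (of_nat k + F x) * rGamma (of_nat k + G x)" for k x
  have b: "norm (t k x) \<le> P ^ 4 * Q ^ 3 * (real k + 1) powr (- 2)" if x: "x \<in> S" for k x
  proof -
    let ?n = "real k + 1"
    have "norm (t k x) = norm (pochhammer (A x) k) * norm (pochhammer (B x) k) * norm (pochhammer (C x) k) * norm (pochhammer (D x) k) / fact k
            * norm (rGamma (of_nat k + E x)) * norm (rGamma (of_nat k + F x)) * norm (rGamma (of_nat k + G x))"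
      by (simp add: t_def norm_mult norm_divide)
    also have "\<dots> \<le> (P * fact k * ?n powr (Re (A x) - 1)) * (P * fact k * ?n powr (Re (B x) - 1)) * (P * fact k * ?n powr (Re (C x) - 1)) * (P * fact k * ?n powr (Re (D x) - 1)) / fact k
        * (Q * ?n powr (1 - Re (E x)) / fact k) * (Q * ?n powr (1 - Re (F x)) / fact k) * (Q * ?n powr (1 - Re (G x)) / fact k)"
      by (intro mult_mono divide_right_mono P(2) Q(2)) (use bd [OF x] P(1) Q(1) in \<open>auto intro!: mult_nonneg_nonneg divide_nonneg_nonneg\<close>)
    also have "\<dots> = P ^ 4 * Q ^ 3 * (?n powr (Re (A x) - 1) * ?n powr (Re (B x) - 1) * ?n powr (Re (C x) - 1) * ?n powr (Re (D x) - 1) * ?n powr (1 - Re (E x)) * ?n powr (1 - Re (F x)) * ?n powr (1 - Re (G x)))"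
      by (simp add: field_simps power_numeral_reduce)
    also have "?n powr (Re (A x) - 1) * ?n powr (Re (B x) - 1) * ?n powr (Re (C x) - 1) * ?n powr (Re (D x) - 1) * ?n powr (1 - Re (E x)) * ?n powr (1 - Re (F x)) * ?n powr (1 - Re (G x)) = ?n powr (- 2)"
      unfolding powr_add [symmetric] using arg_cong [OF bal [OF x], of Re] by (intro arg_cong2 [of _ _ _ _ "(powr)"]) auto
    finally show ?thesis .
  qed
  have "summable (\<lambda>k. P ^ 4 * Q ^ 3 * (real k + 1) powr (- 2))"
    by (intro summable_mult summable_powr_succ) simp
  from Weierstrass_m_test [OF b this]
  have U: "uniform_limit S (\<lambda>n x. \<Sum>k<n. t k x) (\<lambda>x. \<Sum>k. t k x) sequentially" .
  have c: "continuous_on S (t k)" for k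
    unfolding t_def by (intro continuous_on_mult continuous_on_divide continuous_on_pochhammer_compose continuous_on_rGamma_compose continuous_on_add continuous_on_const cont) simp
  have "continuous_on S (\<lambda>x. \<Sum>k. t k x)"
    by (rule uniform_limit_theorem [OF _ U]) (auto intro!: always_eventually continuous_on_sum c)
  then show ?thesis unfolding t_def F43_reg_def .
qed simp

lemma K_fun_eq_KK: "K_fun x = KK (x$1) (x$2) (x$3) (x$4) (x$5) (x$6) (x$7)"
  by (simp add: K_fun_def KK_def Let_def)

lemma V_iff: "x \<in> V \<longleftrightarrow> x$7 = 1 + x$1 + x$2 + x$3 + x$4 - x$5 - x$6"
  by (auto simp: V_def algebra_simps)

text \<open>The ball provides the common bound on the parameters; 2r + 1 covers both x_i and 1 + x_i
  - x_j.\<close>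

lemma continuous_on_K_fun: "continuous_on (V \<inter> cball 0 r) K_fun"
proof -
  let ?S = "V \<inter> cball 0 r"
  have c: "continuous_on ?S (\<lambda>x :: complex^7. x $ i)" for i by (intro continuous_intros)
  have n: "norm (x $ i) \<le> 2 * r + 1" if "x \<in> ?S" for x :: "complex^7" and i
    using Finite_Cartesian_Product.norm_nth_le [of x i] that norm_ge_zero [of "x $ i"] by (simp add: dist_norm del: norm_ge_zero)
  have n3: "norm (1 + x $ i - x $ j) \<le> 2 * r + 1" if "x \<in> ?S" for x :: "complex^7" and i j
  proof -
    have "norm (1 + x $ i - x $ j) \<le> norm (1 + x $ i) + norm (x $ j)" by (rule norm_triangle_ineq4)
    also have "\<dots> \<le> 1 + norm (x $ i) + norm (x $ j)" using norm_triangle_ineq [of 1 "x $ i"] by simp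
    also have "\<dots> \<le> 2 * r + 1"
      using Finite_Cartesian_Product.norm_nth_le [of x i] Finite_Cartesian_Product.norm_nth_le [of x j] that by (simp add: dist_norm)
    finally show ?thesis .
  qed
  have F1: "continuous_on ?S (\<lambda>x. F43_reg (x$1) (x$2) (x$3) (x$4) (x$5) (x$6) (x$7))"
  proof (rule continuous_on_F43_reg [where R = "2 * r + 1"])
    show "x$5 + x$6 + x$7 = 1 + x$1 + x$2 + x$3 + x$4" if "x \<in> ?S" for x :: "complex^7"
      using that by (simp add: V_iff)
  qed (intro c conjI n; assumption)+
  have F2: "continuous_on ?S (\<lambda>x. F43_reg (x$1) (1 + x$1 - x$5) (1 + x$1 - x$6) (1 + x$1 - x$7) (1 + x$1 - x$2) (1 + x$1 - x$3) (1 + x$1 - x$4))"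
  proof (rule continuous_on_F43_reg [where R = "2 * r + 1"])
    show "(1 + x$1 - x$2) + (1 + x$1 - x$3) + (1 + x$1 - x$4) = 1 + x$1 + (1 + x$1 - x$5) + (1 + x$1 - x$6) + (1 + x$1 - x$7)"
      if "x \<in> ?S" for x :: "complex^7"
      using that by (simp add: V_iff)
  qed (intro c continuous_on_add continuous_on_diff continuous_on_const conjI n n3; assumption)+
  show ?thesis
    unfolding K_fun_eq_KK [abs_def] KK_def
    by (intro continuous_on_add continuous_on_mult F1 F2 continuous_on_rGamma_compose continuous_on_diff continuous_on_const c)
qed

lemma K_fun_tendsto:
  assumes "Y \<longlonglongrightarrow> y" "\<And>n. Y n \<in> V" "y \<in> V"
  shows "(\<lambda>n. K_fun (Y n)) \<longlonglongrightarrow> K_fun y"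
proof -
  have "Bseq Y" using assms(1) by (intro convergent_imp_Bseq) (auto simp: convergent_def)
  then obtain r where "r > 0" and r: "\<And>n. norm (Y n) \<le> r" by (auto elim: BseqE)
  have "norm y \<le> r" using r by (intro LIMSEQ_le_const2 [OF tendsto_norm [OF assms(1)]]) auto
  then show ?thesis
    using assms r by (intro continuous_on_tendsto_compose [OF continuous_on_K_fun [of r]]) (auto simp: dist_norm)
qed

definition gamma_t :: "complex^7 \<Rightarrow> complex" where
  "gamma_t x = gamma_trig (x$1) (x$2) (x$3) (x$4) (x$5) (x$6) (x$7)"

lemma isCont_sinpi: "isCont sinpi z"
  unfolding sinpi_def [abs_def] by (intro continuous_intros)

lemma sinpi_tendsto: "(f \<longlongrightarrow> l) F \<Longrightarrow> ((\<lambda>x. sinpi (f x)) \<longlongrightarrow> sinpi l) F"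
  by (rule isCont_tendsto_compose [OF isCont_sinpi])

lemma gamma_t_tendsto:
  assumes "(Y \<longlongrightarrow> y) F"
  shows "((\<lambda>n. gamma_t (Y n)) \<longlongrightarrow> gamma_t y) F"
  unfolding gamma_t_def gamma_trig_def
  by (intro tendsto_divide tendsto_mult tendsto_add tendsto_diff tendsto_const sinpi_tendsto tendsto_vec_nth assms) simp

lemma gamma_formula_eq:
  assumes "x \<in> V" "x$3 - x$2 \<notin> \<int>"
  shows "gamma_formula x = gamma_t x"
proof -
  have nz: "sinpi (x$3 - x$2) \<noteq> 0" using assms(2) by (rule sinpi_nonzero)
  have "x$5 + x$6 + x$7 = 1 + x$1 + x$2 + x$3 + x$4" using assms(1) by (simp add: V_iff)
  note br = gamma_trig_bracket [OF this]
  have gf: "gamma_formula x = sinpi (x$5 - x$2) / sinpi (x$3 - x$2) *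
     (sinpi (x$1 - x$3) * sinpi (x$5 - x$1 - x$2) * sinpi (x$6 - x$2) * sinpi (x$7 - x$2)
      - sinpi (x$1 - x$2) * sinpi (x$5 - x$1 - x$3) * sinpi (x$6 - x$3) * sinpi (x$7 - x$3))"
    by (simp add: gamma_formula_def sinpi_def Let_def)
  show ?thesis
    unfolding gf br [symmetric] using nz by (simp add: gamma_t_def gamma_trig_def)
qed

text \<open>\<open>gamma_t\<close> is continuous and agrees with the formula at regular points. To
  evaluate \<open>Lim\<close> at a singular point of V it remains to show that regular points of V
  accumulate there.\<close>

lemma gamma_fun_eq:
  assumes x: "x \<in> V"
  shows "gamma_fun x = gamma_t x"
proof (cases "x$3 - x$2 \<in> \<int>")
  case False
  then show ?thesis using gamma_formula_eq [OF x] by (simp add: gamma_fun_def)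
next
  case True
  let ?S = "{y \<in> V. y$3 - y$2 \<notin> \<int>}"
  have "((\<lambda>y. gamma_t y) \<longlongrightarrow> gamma_t x) (at x within ?S)"
    by (intro gamma_t_tendsto tendsto_ident_at)
  moreover have "\<forall>\<^sub>F y in at x within ?S. gamma_t y = gamma_formula y"
    using gamma_formula_eq by (auto simp: eventually_at_filter)
  ultimately have lim: "(gamma_formula \<longlongrightarrow> gamma_t x) (at x within ?S)"
    by (rule Lim_transform_eventually)
  have "x islimpt ?S"
    unfolding islimpt_approachable
  proof (intro allI impI)
    fix \<epsilon> :: real assume e: "\<epsilon> > 0"
    define \<delta> where "\<delta> = min (\<epsilon> / 4) (1 / 2)"
    have d: "0 < \<delta>" "\<delta> < 1" "2 * \<delta> < \<epsilon>" using e by (auto simp: \<delta>_def)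
    \<comment> \<open>Moving c by \<delta> and d by -\<delta> stays in V, and 0 < \<delta> < 1 takes
      c - b off the integers.\<close>
    define y where "y = (\<chi> i. x $ i + (if i = 3 then of_real \<delta> else if i = 4 then - of_real \<delta> else 0))"
    have y: "y$1 = x$1" "y$2 = x$2" "y$3 = x$3 + of_real \<delta>" "y$4 = x$4 - of_real \<delta>" "y$5 = x$5" "y$6 = x$6" "y$7 = x$7"
      by (simp_all add: y_def)
    have "complex_of_real \<delta> \<notin> \<int>"
    proof
      assume "complex_of_real \<delta> \<in> \<int>"
      then obtain n :: int where "complex_of_real \<delta> = of_int n" by (auto elim: Ints_cases)
      then have "\<delta> = of_int n" by (metis of_real_eq_iff of_real_of_int_eq)
      with d show False by simp
    qed
    then have "y$3 - y$2 \<notin> \<int>"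
    proof -
      have "y$3 - y$2 = (x$3 - x$2) + of_real \<delta>" by (simp add: y)
      then show ?thesis using True \<open>complex_of_real \<delta> \<notin> \<int>\<close> Ints_diff [of "y$3 - y$2" "x$3 - x$2"] by auto
    qed
    moreover have "y \<in> V" using x by (simp add: V_iff y)
    moreover have "y \<noteq> x" using d y(3) by auto
    moreover have "dist y x < \<epsilon>"
    proof -
      have "norm (y - x) \<le> (\<Sum>i\<in>UNIV. norm ((y - x) $ i))" 
        unfolding norm_vec_def by (rule L2_set_le_sum) simp
      also have "\<dots> = 2 * \<delta>" using d by (simp add: sum_7 y)
      finally show ?thesis using d by (simp add: dist_norm)
    qed
    ultimately show "\<exists>x'\<in>?S. x' \<noteq> x \<and> dist x' x < \<epsilon>" by blast
  qed
  then have "\<not> trivial_limit (at x within ?S)" by (simp add: trivial_limit_within)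
  from tendsto_Lim [OF this lim] show ?thesis using True by (simp add: gamma_fun_def)
qed

lemma beta_fun_eq: "beta_fun x = beta_c (x$1) (x$2) (x$3) (x$4) (x$5) (x$6) (x$7)"
  by (simp add: beta_fun_def beta_c_def Let_def)

lemma rGamma_tendsto:
  assumes "(f \<longlongrightarrow> (l :: complex)) F"
  shows "((\<lambda>x. rGamma (f x)) \<longlongrightarrow> rGamma l) F"
proof -
  have "isCont rGamma l"
    using holomorphic_on_imp_continuous_on [OF holomorphic_rGamma [of UNIV]] by (simp add: continuous_on_eq_continuous_at)
  then show ?thesis using assms by (rule isCont_tendsto_compose)
qed

lemma beta_fun_tendsto:
  assumes "(Y \<longlongrightarrow> y) F"
  shows "((\<lambda>n. beta_fun (Y n)) \<longlongrightarrow> beta_fun y) F"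
  unfolding beta_fun_eq beta_c_def
  by (intro tendsto_mult tendsto_add tendsto_diff tendsto_const rGamma_tendsto tendsto_vec_nth assms)

lemma sigma_map_nth:
  "sigma_map x $ 1 = 1 + x$2 - x$5" "sigma_map x $ 2 = x$2" "sigma_map x $ 3 = x$6 - x$3" "sigma_map x $ 4 = x$7 - x$3"
  "sigma_map x $ 5 = 1 + x$1 + x$2 - x$5" "sigma_map x $ 6 = 1 + x$2 - x$3" "sigma_map x $ 7 = 1 + x$2 + x$4 - x$5"
  by (simp_all add: sigma_map_def Let_def)

lemma sigma_map_V: "x \<in> V \<Longrightarrow> sigma_map x \<in> V"
  by (simp add: V_iff sigma_map_nth)

lemma sigma_map_cubed: "x \<in> V \<Longrightarrow> sigma_map (sigma_map (sigma_map x)) = x"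
  by (simp add: vec_eq_iff forall_7 sigma_map_nth V_iff)

lemma sigma_map_tendsto:
  assumes "(Y \<longlongrightarrow> y) F"
  shows "((\<lambda>n. sigma_map (Y n)) \<longlongrightarrow> sigma_map y) F"
proof (rule vec_tendstoI)
  fix i :: 7
  have "\<forall>i. ((\<lambda>n. sigma_map (Y n) $ i) \<longlongrightarrow> sigma_map y $ i) F"
    unfolding forall_7 sigma_map_nth
    by (intro conjI tendsto_add tendsto_diff tendsto_const tendsto_vec_nth assms)
  then show "((\<lambda>n. sigma_map (Y n) $ i) \<longlongrightarrow> sigma_map y $ i) F" by blast
qed

lemma vector_7_collapse: "vector [x$1, x$2, x$3, x$4, x$5, x$6, x$7] = (x :: 'a::zero^7)"
  by (simp add: vec_eq_iff forall_7)

lemma act_n4_nth: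
  assumes "x \<in> V"
  shows "act n4_mat x = vector [x$5 - x$1, x$5 - x$2, x$5 - x$3, x$5 - x$4, 1 + x$5 - x$6, 1 + x$5 - x$7, x$5]"
  using act_n4 [of "x$1" "x$2" "x$3" "x$4" "x$5" "x$6" "x$7"] assms vector_7_collapse [of x] by simp

lemma act_p5_nth:
  assumes "x \<in> V"
  shows "act p5_mat x = vector [1 + x$2 - x$5, 1 + x$3 - x$5, 1 + x$4 - x$5, 1 + x$1 - x$5, 1 + x$6 - x$5, 1 + x$7 - x$5, 2 - x$5]"
  using act_p5 [of "x$1" "x$2" "x$3" "x$4" "x$5" "x$6" "x$7"] assms vector_7_collapse [of x] by simp

lemma sigma_map_sq_nth:
  assumes "x \<in> V"
  shows "sigma_map (sigma_map x) $ 1 = x$5 - x$1" "sigma_map (sigma_map x) $ 2 = x$2" "sigma_map (sigma_map x) $ 3 = 1 + x$2 - x$6"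
    "sigma_map (sigma_map x) $ 4 = x$7 - x$1" "sigma_map (sigma_map x) $ 5 = 1 + x$2 - x$1" "sigma_map (sigma_map x) $ 6 = 1 + x$2 - x$6 + x$3"
    "sigma_map (sigma_map x) $ 7 = x$5 + x$7 - x$1 - x$3"
  using assms by (simp_all add: sigma_map_nth V_iff)

lemma K_sub_n4:
  assumes x: "x \<in> V"
  shows "K_sub n4_mat x = K_fun (sigma_map (sigma_map x))"
proof -
  have "x$7 = 1 + x$1 + x$2 + x$3 + x$4 - x$5 - x$6" using x by (simp add: V_iff)
  from KK_sigma(2) [OF this] show ?thesis
    unfolding K_fun_eq_KK sigma_map_sq_nth [OF x] by (simp add: K_sub_def act_n4_nth [OF x] K_fun_eq_KK)
qed

lemma K_sub_p5:
  assumes x: "x \<in> V"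
  shows "K_sub p5_mat x = K_fun (sigma_map x)"
proof -
  have "x$7 = 1 + x$1 + x$2 + x$3 + x$4 - x$5 - x$6" using x by (simp add: V_iff)
  from KK_sigma(1) [OF this] show ?thesis
    unfolding K_fun_eq_KK sigma_map_nth by (simp add: K_sub_def act_p5_nth [OF x] K_fun_eq_KK)
qed

text \<open>Both forms of the relation reduce to this one, since the inverse of \<sigma> on V is
  \<sigma>^2 and the values at n_4 x and p_5 x are K after \<sigma>^2 and \<sigma>. With
  \<open>gamma_t\<close> in place of \<open>gamma_fun\<close> its continuity is immediate factor by
  factor.\<close>

definition three_term_expr :: "complex^7 \<Rightarrow> complex" where
  "three_term_expr x = gamma_t (sigma_map (sigma_map x)) * beta_fun (sigma_map x) * K_fun x
     + gamma_t (sigma_map x) * beta_fun x * K_fun (sigma_map (sigma_map x))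
     + gamma_t x * beta_fun (sigma_map (sigma_map x)) * K_fun (sigma_map x)"

lemma three_term_expr_tendsto:
  assumes "Y \<longlonglongrightarrow> y" "\<And>n. Y n \<in> V" "y \<in> V"
  shows "(\<lambda>n. three_term_expr (Y n)) \<longlonglongrightarrow> three_term_expr y"
  unfolding three_term_expr_def
  by (intro tendsto_add tendsto_mult gamma_t_tendsto beta_fun_tendsto K_fun_tendsto sigma_map_tendsto sigma_map_V assms)

section \<open>Generic points and approximation along a line\<close>

text \<open>Up to sign and integers, the list consists of the six A_i - A_l and the sixteen A_i -
  E_j of the frame.\<close>

definition generic :: "complex^7 \<Rightarrow> bool" where
  "generic x \<longleftrightarrow> (let a = x$1; b = x$2; c = x$3; d = x$4; e = x$5; f = x$6; g = x$7 in
     \<forall>z\<in>set [a - (f - c), a - d, a - (f - b), (f - c) - d, b - c, d - (f - b),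
       a, a - (e + f - b - c), a - (g + f - b - c), a - f, f - c, b - e, b - g, c,
       d, d - (e + f - b - c), d - (g + f - b - c), d - f, f - b, c - e, c - g, b]. z \<notin> \<int>)"

lemma three_term_expr_generic:
  assumes x: "x \<in> V" and gen: "generic x"
  shows "three_term_expr x = 0"
proof -
  let ?a = "x$1" and ?b = "x$2" and ?c = "x$3" and ?d = "x$4" and ?e = "x$5" and ?f = "x$6" and ?g = "x$7"
  have g: "?g = 1 + ?a + ?b + ?c + ?d - ?e - ?f" using x by (simp add: V_iff)
  have "gamma_trig (?e - ?a) ?b (1 + ?b - ?f) (?g - ?a) (1 + ?b - ?a) (1 + ?b - ?f + ?c) (?e + ?g - ?a - ?c)
      * beta_c (1 + ?b - ?e) ?b (?f - ?c) (?g - ?c) (1 + ?a + ?b - ?e) (1 + ?b - ?c) (1 + ?b + ?d - ?e) * KK ?a ?b ?c ?d ?e ?f ?g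
    + gamma_trig (1 + ?b - ?e) ?b (?f - ?c) (?g - ?c) (1 + ?a + ?b - ?e) (1 + ?b - ?c) (1 + ?b + ?d - ?e)
      * beta_c ?a ?b ?c ?d ?e ?f ?g * KK (?e - ?a) (?e - ?b) (?e - ?c) (?e - ?d) (1 + ?e - ?f) (1 + ?e - ?g) ?e
    + gamma_trig ?a ?b ?c ?d ?e ?f ?g
      * beta_c (?e - ?a) ?b (1 + ?b - ?f) (?g - ?a) (1 + ?b - ?a) (1 + ?b - ?f + ?c) (?e + ?g - ?a - ?c)
      * KK (1 + ?b - ?e) (1 + ?c - ?e) (1 + ?d - ?e) (1 + ?a - ?e) (1 + ?f - ?e) (1 + ?g - ?e) (2 - ?e) = 0"
    using gen unfolding generic_def Let_def by (intro three_term_generic g) simp_all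
  then show ?thesis
    unfolding three_term_expr_def gamma_t_def beta_fun_eq K_fun_eq_KK sigma_map_sq_nth [OF x] unfolding sigma_map_nth KK_sigma [OF g] .
qed

text \<open>For integral z the displacement is nonzero and eventually shorter than 1/2; for other z
  the complement of the integers is an open neighbourhood.\<close>

lemma of_real_scaled_notin_Ints:
  fixes z w :: complex
  assumes "w \<noteq> 0"
  shows "\<forall>\<^sub>F n in sequentially. z + of_real (1 / real (Suc n)) * w \<notin> \<int>"
proof -
  have lim: "(\<lambda>n. z + of_real (1 / real (Suc n)) * w) \<longlonglongrightarrow> z + of_real 0 * w"
    by (intro tendsto_intros LIMSEQ_Suc [OF lim_1_over_n])
  then have "\<forall>\<^sub>F n in sequentially. dist (z + of_real (1 / real (Suc n)) * w) z < 1 / 2"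
    by (intro tendstoD) auto
  show ?thesis
  proof (cases "z \<in> \<int>")
    case True
    show ?thesis
      using \<open>\<forall>\<^sub>F n in sequentially. dist _ z < 1 / 2\<close>
    proof eventually_elim
      case (elim n)
      show ?case
      proof
        assume "z + of_real (1 / real (Suc n)) * w \<in> \<int>"
        then have "z + of_real (1 / real (Suc n)) * w - z \<in> \<int>" using True by (rule Ints_diff)
        then obtain m :: int where m: "of_real (1 / real (Suc n)) * w = of_int m" by (auto elim: Ints_cases)
        have "norm (of_int m :: complex) < 1 / 2" using elim unfolding dist_norm m [symmetric] by simp
        then have "m = 0" by simp
        with m assms show False by (simp del: of_nat_Suc)
      qed
    qed
  next
    case False
    then have "z \<in> - \<int>" by simp
    moreover have "open (- \<int> :: complex set)" using closed_Ints by (rule open_Compl)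
    ultimately have "\<forall>\<^sub>F n in sequentially. z + of_real (1 / real (Suc n)) * w \<in> - \<int>"
      using lim by (intro topological_tendstoD) auto
    then show ?thesis by simp
  qed
qed

lemma three_term_expr_eq_0:
  assumes x: "x \<in> V"
  shows "three_term_expr x = 0"
proof -
  \<comment> \<open>The direction is tangent to V, as 7 + 11 - 7 - 1 - 2 - 3 - 5 = 0, and all 22
    linear forms of \<open>generic\<close> are nonzero on it.\<close>
  define v :: "complex^7" where "v = vector [1, 2, 3, 5, 7, 11, - 7]"
  define Y where "Y n = x + of_real (1 / real (Suc n)) *s v" for n
  have Yi: "Y n $ i = x $ i + of_real (1 / real (Suc n)) * v $ i" for n i
    by (simp add: Y_def)
  have vi: "v $ 1 = 1" "v $ 2 = 2" "v $ 3 = 3" "v $ 4 = 5" "v $ 5 = 7" "v $ 6 = 11" "v $ 7 = - 7"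
    by (simp_all add: v_def)
  have YV: "Y n \<in> V" for n
    using x by (simp add: V_iff Yi vi algebra_simps)
  have "Y \<longlonglongrightarrow> x"
  proof (rule vec_tendstoI)
    fix i
    have "(\<lambda>n. x $ i + of_real (1 / real (Suc n)) * v $ i) \<longlonglongrightarrow> x $ i + of_real 0 * v $ i"
      by (intro tendsto_intros LIMSEQ_Suc [OF lim_1_over_n])
    then show "(\<lambda>n. Y n $ i) \<longlonglongrightarrow> x $ i" by (simp add: Yi del: of_nat_Suc)
  qed
  then have lim: "(\<lambda>n. three_term_expr (Y n)) \<longlonglongrightarrow> three_term_expr x" using YV x by (rule three_term_expr_tendsto)
  define r where "r n = complex_of_real (1 / real (Suc n))" for n
  have ev: "\<forall>\<^sub>F n in sequentially. z + r n * w \<notin> \<int>" if "w \<noteq> 0" for z w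
    unfolding r_def by (rule of_real_scaled_notin_Ints [OF that])
  have "\<forall>\<^sub>F n in sequentially. generic (Y n)"
  proof -
    let ?a = "x$1" and ?b = "x$2" and ?c = "x$3" and ?d = "x$4" and ?e = "x$5" and ?f = "x$6" and ?g = "x$7"
    \<comment> \<open>Each pair consists of the value of a form at x and its value on v, the rate of
      change along the line.\<close>
    let ?L = "[(?a - (?f - ?c), -7), (?a - ?d, -4), (?a - (?f - ?b), -8), ((?f - ?c) - ?d, 3), (?b - ?c, -1), (?d - (?f - ?b), -4),
       (?a, 1), (?a - (?e + ?f - ?b - ?c), -12), (?a - (?g + ?f - ?b - ?c), 2), (?a - ?f, -10), (?f - ?c, 8), (?b - ?e, -5), (?b - ?g, 9), (?c, 3),
       (?d, 5), (?d - (?e + ?f - ?b - ?c), -8), (?d - (?g + ?f - ?b - ?c), 6), (?d - ?f, -6), (?f - ?b, 9), (?c - ?e, -4), (?c - ?g, 10), (?b, 2)] :: (complex \<times> complex) list"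
    have "\<forall>\<^sub>F n in sequentially. \<forall>p\<in>set ?L. fst p + r n * snd p \<notin> \<int>"
    proof (intro eventually_ball_finite ballI ev)
      show "snd p \<noteq> 0" if "p \<in> set ?L" for p using that by auto
    qed simp
    then show ?thesis
    proof eventually_elim
      case (elim n)
      then show ?case
        unfolding generic_def Let_def Yi vi r_def [symmetric] by (simp add: algebra_simps)
    qed
  qed
  then have "\<forall>\<^sub>F n in sequentially. three_term_expr (Y n) = 0"
    by eventually_elim (rule three_term_expr_generic [OF YV])
  then have "(\<lambda>n. three_term_expr (Y n)) \<longlonglongrightarrow> 0" by (rule tendsto_eventually)
  with lim show ?thesis by (rule LIMSEQ_unique)
qed

lemma sigma_map_inv_into:
  assumes "x \<in> V"
  shows "inv_into V sigma_map x = sigma_map (sigma_map x)"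
proof (rule inv_into_f_eq)
  show "inj_on sigma_map V" by (rule inj_on_inverseI [where g = "\<lambda>x. sigma_map (sigma_map x)"]) (rule sigma_map_cubed)
qed (use assms in \<open>simp_all add: sigma_map_V sigma_map_cubed\<close>)

lemma sigma_pow_numerals:
  assumes "x \<in> V"
  shows "sigma_pow 2 x = sigma_map (sigma_map x)" "sigma_pow 1 x = sigma_map x" "sigma_pow 0 x = x"
    "sigma_pow (- 1) x = sigma_map (sigma_map x)" "sigma_pow (- 2) x = sigma_map x"
  using assms by (simp_all add: sigma_pow_def numeral_2_eq_2 nat_numeral sigma_map_inv_into sigma_map_V sigma_map_cubed)

lemma three_term_relation:
  assumes x: "x \<in> V"
  shows "gamma_fun ((sigma_map ^^ 2) x) * beta_fun (sigma_map x) * K_sub p0_mat x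
        + gamma_fun (sigma_map x) * beta_fun x * K_sub n4_mat x
        + gamma_fun x * beta_fun (inv_into V sigma_map x) * K_sub p5_mat x = 0"
proof -
  have p0: "K_sub p0_mat x = K_fun x" by (simp add: K_sub_def act_p0)
  have "(sigma_map ^^ 2) x = sigma_map (sigma_map x)" by (simp add: numeral_2_eq_2)
  with three_term_expr_eq_0 [OF x] show ?thesis
    by (simp add: three_term_expr_def p0 K_sub_n4 K_sub_p5 sigma_map_inv_into gamma_fun_eq sigma_map_V x)
qed

lemma three_term_relation_sum:
  assumes x: "x \<in> V"
  shows "(\<Sum>j = 0..(2::int). gamma_fun (sigma_pow (2 - j) x) * beta_fun (sigma_pow (1 - j) x) * K_fun (sigma_pow (- j) x)) = 0"
proof -
  have "{0..2::int} = {0, 1, 2}" by auto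
  with three_term_expr_eq_0 [OF x] show ?thesis
    by (simp add: three_term_expr_def add.assoc sigma_pow_numerals [OF x] gamma_fun_eq sigma_map_V x)
qed

subsection \<open>The Hamming type\<close>

lemma exhaust_6:
  fixes i :: 6
  shows "i = 1 \<or> i = 2 \<or> i = 3 \<or> i = 4 \<or> i = 5 \<or> i = 6"
proof (induct i)
  case (of_int z)
  then have "0 \<le> z" and "z < 6" by simp_all
  then have "z = 0 \<or> z = 1 \<or> z = 2 \<or> z = 3 \<or> z = 4 \<or> z = 5" by arith
  then show ?case by auto
qed

lemma forall_6: "(\<forall>i::6. P i) \<longleftrightarrow> P 1 \<and> P 2 \<and> P 3 \<and> P 4 \<and> P 5 \<and> P 6"
  by (metis exhaust_6)

lemma UNIV_6: "UNIV = {1, 2, 3, 4, 5, 6::6}"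
  using exhaust_6 by auto

lemma sum_6: "sum f (UNIV::6 set) = f 1 + f 2 + f 3 + f 4 + f 5 + f 6"
  unfolding UNIV_6 by (simp add: ac_simps)

lemma vector_6 [simp]:
  "(vector [a,b,c,d,e,f] :: 'a::zero^6) $ 1 = a"
  "(vector [a,b,c,d,e,f] :: 'a::zero^6) $ 2 = b"
  "(vector [a,b,c,d,e,f] :: 'a::zero^6) $ 3 = c"
  "(vector [a,b,c,d,e,f] :: 'a::zero^6) $ 4 = d"
  "(vector [a,b,c,d,e,f] :: 'a::zero^6) $ 5 = e"
  "(vector [a,b,c,d,e,f] :: 'a::zero^6) $ 6 = f"
  unfolding vector_def by simp_all

lemma invertible_mat_1: "invertible (mat 1 :: real^'n^'n)"
  unfolding invertible_def by (rule exI [of _ "mat 1"]) simp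

lemma group_GL: "group (GL :: (real^'n^'n) monoid)"
proof (rule groupI)
  fix A :: "real^'n^'n" assume "A \<in> carrier GL"
  then obtain B where "A ** B = mat 1" "B ** A = mat 1" by (auto simp: GL_def invertible_def)
  then show "\<exists>y\<in>carrier GL. y \<otimes>\<^bsub>GL\<^esub> A = \<one>\<^bsub>GL\<^esub>" by (auto simp: GL_def invertible_def)
qed (auto simp: GL_def invertible_mult matrix_mul_assoc invertible_mat_1)

section \<open>The coordinate change S and permutation matrices\<close>

definition S_inv :: "real^7^7" where
  "S_inv = vector
     [vector [1,0,0,0,0,0,0],
      vector [0,-1/2,1/2,1/2,0,0,0],
      vector [0,1/2,-1/2,1/2,0,0,0],
      vector [0,1/2,1/2,-1/2,0,0,0],
      vector [0,-1/2,-1/2,-1/2,1,0,0],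
      vector [0,-1/2,-1/2,-1/2,0,1,0],
      vector [0,-1/2,-1/2,-1/2,0,0,1]]"

lemma S_mat_mult_vec: "S_mat *v y = vector [y$1, y$3 + y$4, y$2 + y$4, y$2 + y$3, y$2 + y$3 + y$4 + y$5, y$2 + y$3 + y$4 + y$6, y$2 + y$3 + y$4 + y$7]"
  by (simp add: S_mat_def vec_eq_iff matrix_vector_mult_def forall_7 sum_7)

lemma S_inv_mult_vec: "S_inv *v x = vector [x$1, (x$3 + x$4 - x$2) / 2, (x$2 + x$4 - x$3) / 2, (x$2 + x$3 - x$4) / 2,
    x$5 - (x$2 + x$3 + x$4) / 2, x$6 - (x$2 + x$3 + x$4) / 2, x$7 - (x$2 + x$3 + x$4) / 2]"
  by (simp add: S_inv_def vec_eq_iff matrix_vector_mult_def forall_7 sum_7 field_simps)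

lemma S_mat_S_inv: "S_mat ** S_inv = mat 1" "S_inv ** S_mat = mat 1"
  unfolding matrix_eq matrix_vector_mul_assoc [symmetric]
  by (simp_all add: S_mat_mult_vec S_inv_mult_vec vec_eq_iff forall_7 field_simps)

lemma invertible_S: "invertible S_mat" "invertible S_inv"
  using S_mat_S_inv by (auto simp: invertible_def)

lemma matrix_inv_mult_left:
  assumes "invertible A"
  shows "matrix_inv A ** A = mat 1"
proof -
  have "A ** matrix_inv A = mat 1 \<and> matrix_inv A ** A = mat 1"
    using assms unfolding invertible_def matrix_inv_def by (rule someI_ex)
  then show ?thesis by simp
qed

lemma matrix_inv_S_mat: "matrix_inv S_mat = S_inv"
proof -
  have "matrix_inv S_mat = (matrix_inv S_mat ** S_mat) ** S_inv"
    unfolding matrix_mul_assoc [symmetric] S_mat_S_inv by simp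
  then show ?thesis by (simp add: matrix_inv_mult_left invertible_S)
qed

lemma perm_mat_mult_vec:
  fixes p :: "'n::finite \<Rightarrow> 'n"
  assumes "bij p"
  shows "perm_mat p *v y = (\<chi> i. y $ inv_into UNIV p i)"
proof -
  have eq: "(i = p j) = (j = inv_into UNIV p i)" for i j
    using assms by (metis bij_inv_eq_iff)
  have "(if Q then 1 else 0) * z = (if Q then z else 0)" for Q and z :: real by simp
  then show ?thesis
    by (simp add: vec_eq_iff matrix_vector_mult_def perm_mat_def eq)
qed

lemma swap_mat_mult_vec: "swap_mat i j *v y = (\<chi> k. y $ Transposition.transpose i j k)"
  unfolding swap_mat_def by (subst perm_mat_mult_vec) (simp_all add: inv_equality)

section \<open>Invariants of the group and an overgroup defined by them\<close>

definition defect :: "real^7 \<Rightarrow> real" where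
  "defect x = x$5 + x$6 + x$7 - x$1 - x$2 - x$3 - x$4"

text \<open>The fixed point in \<open>V\<close> of the group \<open>M_K\<close>; \<open>defect x = 1\<close> is the equation of \<open>V\<close>.\<close>

definition center :: "real^7" where
  "center = vector [1/2, 1/2, 1/2, 1/2, 1, 1, 1]"

text \<open>An overgroup of \<open>M_K\<close> whose elements are determined by their action on the
  hyperplane \<open>defect x = 0\<close>, because they fix \<open>center\<close>, which lies off it.
  Membership is easy to check on generators, and it is all that multiplicativity and injectivity of
  \<open>theta0\<close> require.\<close>

definition W :: "(real^7^7) set" where
  "W = {\<mu>. invertible \<mu> \<and> \<mu> *v center = center \<and> (\<forall>x. defect (\<mu> *v x) = defect x)}"

lemma W_subgroup: "subgroup W GL"
proof
  show "W \<subseteq> carrier GL" by (auto simp: W_def GL_def)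
  show "\<one>\<^bsub>GL\<^esub> \<in> W" by (simp add: W_def GL_def invertible_mat_1)
  show "\<mu> \<otimes>\<^bsub>GL\<^esub> \<nu> \<in> W" if "\<mu> \<in> W" "\<nu> \<in> W" for \<mu> \<nu>
    using that by (simp add: W_def GL_def invertible_mult matrix_vector_mul_assoc [symmetric])
next
  fix \<mu> assume \<mu>: "\<mu> \<in> W"
  let ?\<nu> = "inv\<^bsub>GL\<^esub> \<mu>"
  interpret GL: group "GL :: (real^7^7) monoid" by (rule group_GL)
  have c: "\<mu> \<in> carrier GL" using \<mu> by (simp add: W_def GL_def)
  have "?\<nu> \<in> carrier GL" using c by simp
  then have inv: "invertible ?\<nu>" by (simp add: GL_def)
  have 1: "?\<nu> ** \<mu> = mat 1" "\<mu> ** ?\<nu> = mat 1" using GL.l_inv [OF c] GL.r_inv [OF c] by (simp_all add: GL_def)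
  have "?\<nu> *v center = ?\<nu> *v (\<mu> *v center)" using \<mu> by (simp add: W_def)
  also have "\<dots> = center" by (simp add: matrix_vector_mul_assoc 1)
  finally have 2: "?\<nu> *v center = center" .
  have "defect (?\<nu> *v x) = defect x" for x
  proof -
    have "defect (?\<nu> *v x) = defect (\<mu> *v (?\<nu> *v x))" using \<mu> by (simp add: W_def)
    then show ?thesis by (simp add: matrix_vector_mul_assoc 1)
  qed
  with inv 2 show "?\<nu> \<in> W" by (simp add: W_def)
qed

lemma invertible_perm_mat:
  fixes p :: "'n::finite \<Rightarrow> 'n"
  assumes "bij p"
  shows "invertible (perm_mat p)"
proof -
  have "perm_mat p ** perm_mat (inv_into UNIV p) = mat 1" "perm_mat (inv_into UNIV p) ** perm_mat p = mat 1"
    unfolding matrix_eq matrix_vector_mul_assoc [symmetric] using assms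
    by (simp_all add: perm_mat_mult_vec bij_imp_bij_inv inv_inv_eq vec_eq_iff bij_is_inj bij_is_surj surj_f_inv_f)
  then show ?thesis by (auto simp: invertible_def)
qed

text \<open>In the coordinates y with x = S y, \<open>center\<close> has equal entries in positions
  2 to 7, and \<open>defect\<close> is the sum of all y_i minus 2 y_1; permutations fixing the first
  position preserve both.\<close>

lemma G_K_subset_W: "G_K \<subseteq> W"
proof
  fix \<mu> assume "\<mu> \<in> G_K"
  then obtain p where p: "bij p" "p 1 = 1" and \<mu>: "\<mu> = S_mat ** perm_mat p ** S_inv"
    by (auto simp: G_K_def P16_def matrix_inv_S_mat)
  have q: "bij (inv_into UNIV p)" "inv_into UNIV p 1 = 1" using p by (auto simp: bij_imp_bij_inv bij_is_inj inv_f_eq)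
  have q1: "inv_into UNIV p i = 1 \<longleftrightarrow> i = 1" for i using p by (metis bij_inv_eq_iff)
  have "(\<chi> i. (S_inv *v center) $ inv_into UNIV p i) = S_inv *v center"
  proof -
    have "S_inv *v center = (\<chi> i. if i = 1 then 1/2 else 1/4)"
      by (simp add: vec_eq_iff S_inv_mult_vec center_def forall_7)
    then show ?thesis by (simp add: q1)
  qed
  moreover have "S_mat *v (S_inv *v center) = center" by (simp add: matrix_vector_mul_assoc S_mat_S_inv)
  ultimately have 1: "\<mu> *v center = center"
    using p by (simp add: \<mu> matrix_vector_mul_assoc [symmetric] perm_mat_mult_vec)
  have dS: "defect (S_mat *v y) = (\<Sum>i\<in>UNIV. y $ i) - 2 * y $ 1" for y
    by (simp add: defect_def S_mat_mult_vec sum_7)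
  have 2: "defect (\<mu> *v x) = defect x" for x
  proof -
    let ?y = "S_inv *v x"
    have "defect (\<mu> *v x) = (\<Sum>i\<in>UNIV. ?y $ inv_into UNIV p i) - 2 * ?y $ 1"
      using p q by (simp add: \<mu> matrix_vector_mul_assoc [symmetric] perm_mat_mult_vec dS)
    also have "(\<Sum>i\<in>UNIV. ?y $ inv_into UNIV p i) = (\<Sum>i\<in>UNIV. ?y $ i)"
      using q by (intro sum.reindex_bij_betw) simp
    also have "\<dots> - 2 * ?y $ 1 = defect (S_mat *v ?y)" by (simp add: dS)
    finally show ?thesis by (simp add: matrix_vector_mul_assoc S_mat_S_inv)
  qed
  have "invertible \<mu>" unfolding \<mu> using p by (intro invertible_mult invertible_S invertible_perm_mat)
  with 1 2 show "\<mu> \<in> W" by (simp add: W_def)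
qed

lemma swap_1_2_W: "swap_mat 1 2 \<in> W"
proof -
  have "invertible (swap_mat 1 2 :: real^7^7)" unfolding swap_mat_def by (intro invertible_perm_mat) simp
  then show ?thesis
    by (simp add: W_def swap_mat_mult_vec defect_def center_def vec_eq_iff forall_7 Transposition.transpose_def)
qed

lemma M_K_subgroup: "subgroup M_K GL"
  unfolding M_K_def
  using G_K_subset_W swap_1_2_W subgroup.subset [OF W_subgroup]
  by (intro group.generate_is_subgroup [OF group_GL]) auto

lemma M_K_subset_W: "M_K \<subseteq> W"
  unfolding M_K_def
  using G_K_subset_W swap_1_2_W
  by (intro group.generate_subgroup_incl [OF group_GL _ W_subgroup]) auto

text \<open>
  \<open>T_mat\<close> computes the coordinates \<open>\<alpha>\<close>, which vanish at \<open>center\<close>, and \<open>T_inv\<close> is the inverse of its restriction to the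
  hyperplane \<open>defect x = 0\<close>.
\<close>

definition T_mat :: "real^7^6" where
  "T_mat = vector
     [vector [-1/2,-1/2,1/2,1/2,0,0,0],
      vector [-1/2,1/2,-1/2,1/2,0,0,0],
      vector [-1/2,1/2,1/2,-1/2,0,0,0],
      vector [-1/2,-1/2,-1/2,-1/2,1,0,0],
      vector [-1/2,-1/2,-1/2,-1/2,0,1,0],
      vector [-1/2,-1/2,-1/2,-1/2,0,0,1]]"

definition T_inv :: "real^6^7" where
  "T_inv = vector
     [vector [-1/2,-1/2,-1/2,-1/2,-1/2,-1/2],
      vector [-1/2,1/2,1/2,-1/2,-1/2,-1/2],
      vector [1/2,-1/2,1/2,-1/2,-1/2,-1/2],
      vector [1/2,1/2,-1/2,-1/2,-1/2,-1/2],
      vector [0,0,0,0,-1,-1],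
      vector [0,0,0,-1,0,-1],
      vector [0,0,0,-1,-1,0]]"

lemma T_mat_mult_vec: "T_mat *v x = vector [(x$3 + x$4 - x$1 - x$2) / 2, (x$2 + x$4 - x$1 - x$3) / 2, (x$2 + x$3 - x$1 - x$4) / 2,
    x$5 - (x$1 + x$2 + x$3 + x$4) / 2, x$6 - (x$1 + x$2 + x$3 + x$4) / 2, x$7 - (x$1 + x$2 + x$3 + x$4) / 2]"
  by (simp add: T_mat_def vec_eq_iff matrix_vector_mult_def forall_6 sum_7 field_simps)

lemma T_inv_mult_vec: "T_inv *v u = vector [- (u$1 + u$2 + u$3 + u$4 + u$5 + u$6) / 2, (u$2 + u$3 - u$1 - u$4 - u$5 - u$6) / 2,
    (u$1 + u$3 - u$2 - u$4 - u$5 - u$6) / 2, (u$1 + u$2 - u$3 - u$4 - u$5 - u$6) / 2, - u$5 - u$6, - u$4 - u$6, - u$4 - u$5]"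
  by (simp add: T_inv_def vec_eq_iff matrix_vector_mult_def forall_7 sum_6 field_simps)

lemma T_mat_T_inv: "T_mat *v (T_inv *v u) = u"
  by (simp add: T_mat_mult_vec T_inv_mult_vec vec_eq_iff forall_6 field_simps)

lemma T_inv_T_mat: "T_inv *v (T_mat *v x) = x - defect x *s center"
  by (simp add: T_mat_mult_vec T_inv_mult_vec vec_eq_iff forall_7 center_def defect_def field_simps)

lemma defect_T_inv: "defect (T_inv *v u) = 0"
  by (simp add: T_inv_mult_vec defect_def field_simps)

section \<open>The homomorphism theta and its values\<close>

text \<open>For \<mu> in \<open>W\<close> this is the matrix, in the coordinates \<alpha>, of \<mu>
  on the hyperplane \<open>defect x = 0\<close>.\<close>

definition theta0 :: "real^7^7 \<Rightarrow> real^6^6" where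
  "theta0 \<mu> = T_mat ** \<mu> ** T_inv"

lemma theta0_mult_vec: "theta0 \<mu> *v u = T_mat *v (\<mu> *v (T_inv *v u))"
  by (simp add: theta0_def matrix_vector_mul_assoc [symmetric])

text \<open>\<open>T_inv\<close> after \<open>T_mat\<close> is only the projection along
  \<open>center\<close> onto the hyperplane. Vectors in the image of \<open>T_inv\<close> have
  defect 0 and \<mu> preserves it, so the projection acts trivially here; multiplicativity of
  \<open>theta0\<close> follows.\<close>

lemma T_inv_theta0:
  assumes "\<mu> \<in> W"
  shows "T_inv *v (theta0 \<mu> *v u) = \<mu> *v (T_inv *v u)"
  using assms by (simp add: theta0_mult_vec T_inv_T_mat W_def defect_T_inv)

lemma theta0_mult:
  assumes "\<nu> \<in> W"
  shows "theta0 (\<mu> ** \<nu>) = theta0 \<mu> ** theta0 \<nu>"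
  unfolding matrix_eq
  using T_inv_theta0 [OF assms]
  by (simp add: theta0_mult_vec [of "\<mu> ** \<nu>"] theta0_mult_vec [of \<mu>] matrix_vector_mul_assoc [symmetric])

lemma theta0_1: "theta0 (mat 1) = mat 1"
  by (simp add: matrix_eq theta0_mult_vec T_mat_T_inv)

text \<open>Every x is a vector of the hyperplane plus a multiple of \<open>center\<close>: equal
  images under \<open>theta0\<close> force agreement on the first, and both matrices fix the
  second.\<close>

lemma theta0_inj: "inj_on theta0 W"
proof
  fix \<mu> \<nu> assume W: "\<mu> \<in> W" "\<nu> \<in> W" and eq: "theta0 \<mu> = theta0 \<nu>"
  have "\<mu> *v x = \<nu> *v x" for x
  proof -
    have x: "x = T_inv *v (T_mat *v x) + defect x *s center" by (simp add: T_inv_T_mat)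
    have "\<mu> *v x = \<mu> *v (T_inv *v (T_mat *v x)) + defect x *s center" if "\<mu> \<in> W" for \<mu>
      using that by (subst x) (simp add: matrix_vector_right_distrib vector_scalar_commute W_def)
    with W eq T_inv_theta0 [of \<mu>] T_inv_theta0 [of \<nu>] show ?thesis by metis
  qed
  then show "\<mu> = \<nu>" by (simp add: matrix_eq)
qed

text \<open>The conjugated adjacent transpositions of the positions 2 to 7, which generate
  \<open>G_K\<close>. For i = 6 the second index is 7, which equals 0 in the index type.\<close>

definition reflection :: "nat \<Rightarrow> real^7^7" where
  "reflection i = S_mat ** swap_mat (of_nat i) (of_nat (i + 1)) ** matrix_inv S_mat"

lemma reflection_mult_vec: "reflection i *v x = S_mat *v (\<chi> k. (S_inv *v x) $ Transposition.transpose (of_nat i) (of_nat (i + 1)) k)"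
  by (simp add: reflection_def matrix_inv_S_mat matrix_vector_mul_assoc [symmetric] swap_mat_mult_vec)

text \<open>Only \<open>reflection 4\<close> is more than a permutation of coordinates: up to
  exchanging b and c it is the substitution of \<open>KK_transform\<close>.\<close>

lemma reflection_vectors:
  "reflection 2 *v vector [a,b,c,d,e,f,g] = vector [a,c,b,d,e,f,g]"
  "reflection 3 *v vector [a,b,c,d,e,f,g] = vector [a,b,d,c,e,f,g]"
  "reflection 4 *v vector [a,b,c,d,e,f,g] = vector [a,e-c,e-b,d,e,e+f-b-c,e+g-b-c]"
  "reflection 5 *v vector [a,b,c,d,e,f,g] = vector [a,b,c,d,f,e,g]"
  "reflection 6 *v vector [a,b,c,d,e,f,g] = vector [a,b,c,d,e,g,f]"
  by (simp_all add: reflection_mult_vec S_mat_mult_vec S_inv_mult_vec vec_eq_iff forall_7 Transposition.transpose_def field_simps)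

lemma swap_1_2_vector: "swap_mat 1 2 *v vector [a,b,c,d,e,f,g] = (vector [b,a,c,d,e,f,g] :: real^7)"
  by (simp add: swap_mat_mult_vec vec_eq_iff forall_7 Transposition.transpose_def)

lemma reflection_mem:
  assumes "i \<in> {2..6}"
  shows "reflection i \<in> M_K"
proof -
  have "i = 2 \<or> i = 3 \<or> i = 4 \<or> i = 5 \<or> i = 6" using assms by auto
  then have "(1 :: 7) \<noteq> of_nat i" "(1 :: 7) \<noteq> of_nat (i + 1)" by auto
  then have "Transposition.transpose (of_nat i) (of_nat (i + 1)) (1 :: 7) = 1" by (simp add: Transposition.transpose_def)
  then have "reflection i \<in> G_K" unfolding reflection_def G_K_def P16_def swap_mat_def by (intro imageI) auto
  then show ?thesis unfolding M_K_def by (intro generate.incl) simp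
qed

lemma swap_1_2_mem: "swap_mat 1 2 \<in> M_K"
  unfolding M_K_def by (intro generate.incl) simp

lemma M6_mult_vec:
  assumes "i \<noteq> j"
  shows "M6 \<epsilon> i j *v u = (\<chi> r. if r = i then \<epsilon> * u $ j else if r = j then \<epsilon> * u $ i else u $ r)"
proof -
  have "M6 \<epsilon> i j $ r $ s = (if s = Transposition.transpose i j r then if r \<in> {i, j} then \<epsilon> else 1 else 0)" for r s
    using assms by (auto simp: M6_def swap_mat_def perm_mat_def doubleton_eq_iff Transposition.transpose_def)
  moreover have "(if Q then c else 0) * z = (if Q then c * z else 0)" for Q and c z :: real by simp
  ultimately have "(M6 \<epsilon> i j *v u) $ r = (if r \<in> {i, j} then \<epsilon> else 1) * u $ Transposition.transpose i j r" for r
    by (simp only: matrix_vector_mult_def vec_lambda_beta sum.delta finite UNIV_I if_True)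
  then show ?thesis by (simp add: vec_eq_iff Transposition.transpose_def)
qed

lemma theta0_reflection:
  assumes "i \<in> {2..6}"
  shows "theta0 (reflection i) = M6 1 (of_nat (i - 1)) (of_nat i)"
proof -
  have "i = 2 \<or> i = 3 \<or> i = 4 \<or> i = 5 \<or> i = 6" using assms by auto
  then show ?thesis
    by (elim disjE; hypsubst) (simp_all add: matrix_eq theta0_mult_vec M6_mult_vec T_mat_mult_vec T_inv_mult_vec reflection_vectors
        vec_eq_iff forall_6 field_simps)
qed

lemma theta0_swap: "theta0 (swap_mat 1 2) = M6 (- 1) 2 3"
  by (simp add: matrix_eq theta0_mult_vec M6_mult_vec T_mat_mult_vec T_inv_mult_vec swap_1_2_vector vec_eq_iff forall_6 field_simps)

lemma theta0_carrier:
  assumes "\<mu> \<in> W"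
  shows "invertible (theta0 \<mu>)"
proof -
  interpret GL: group "GL :: (real^7^7) monoid" by (rule group_GL)
  have c: "\<mu> \<in> carrier GL" using assms by (simp add: W_def GL_def)
  have "inv\<^bsub>GL\<^esub> \<mu> \<in> W" using W_subgroup assms by (rule subgroup.m_inv_closed)
  moreover have "inv\<^bsub>GL\<^esub> \<mu> ** \<mu> = mat 1" "\<mu> ** inv\<^bsub>GL\<^esub> \<mu> = mat 1" using GL.l_inv [OF c] GL.r_inv [OF c] by (simp_all add: GL_def)
  ultimately show ?thesis unfolding invertible_def using assms by (metis theta0_mult theta0_1)
qed

text \<open>Existence of \<theta>, by which the chosen \<open>theta\<close> satisfies its defining
  conditions.\<close>

lemma is_theta_theta0: "is_theta theta0"
  unfolding is_theta_def reflection_def [symmetric]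
proof (intro conjI ballI theta0_swap theta0_reflection)
  show "theta0 \<in> hom (GL\<lparr>carrier := M_K\<rparr>) GL"
    using M_K_subset_W by (auto simp: hom_def GL_def theta0_carrier theta0_mult subset_eq)
  show "inj_on theta0 M_K" using theta0_inj M_K_subset_W by (rule inj_on_subset)
qed

lemma is_theta_theta: "is_theta theta"
  unfolding theta_def by (rule someI [of is_theta, OF is_theta_theta0])

text \<open>Instead of proving \<open>theta = theta0\<close> on all of \<open>M_K\<close>, it suffices to compare them on words in the generators.\<close>

definition theta_agree :: "(real^7^7) set" where
  "theta_agree = {\<mu> \<in> M_K. theta \<mu> = theta0 \<mu>}"

lemma theta_agree_mult:
  assumes "\<mu> \<in> theta_agree" "\<nu> \<in> theta_agree"
  shows "\<mu> ** \<nu> \<in> theta_agree"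
proof -
  have "theta (\<mu> ** \<nu>) = theta \<mu> ** theta \<nu>"
    using is_theta_theta assms by (auto simp: is_theta_def hom_def GL_def theta_agree_def)
  moreover have "\<mu> ** \<nu> \<in> M_K"
    using subgroup.m_closed [OF M_K_subgroup, of \<mu> \<nu>] assms by (simp add: theta_agree_def GL_def)
  moreover have "\<nu> \<in> W" using assms M_K_subset_W by (auto simp: theta_agree_def)
  ultimately show ?thesis using assms by (simp add: theta_agree_def theta0_mult)
qed

lemma theta_agree_reflection: "i \<in> {2..6} \<Longrightarrow> reflection i \<in> theta_agree"
  using is_theta_theta unfolding is_theta_def reflection_def [symmetric] theta_agree_def
  by (simp add: reflection_mem theta0_reflection)

lemma theta_agree_swap: "swap_mat 1 2 \<in> theta_agree"
  using is_theta_theta by (simp add: theta_agree_def swap_1_2_mem theta0_swap is_theta_def)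

lemma reflection_squared: "reflection 2 ** reflection 2 = mat 1"
  unfolding matrix_eq matrix_vector_mul_assoc [symmetric]
  by (metis vector_7_collapse reflection_vectors(1) matrix_vector_mul_lid)

text \<open>The identity is the word \<open>reflection 2\<close> squared, so closure under products
  covers it.\<close>

lemma p0_theta_agree: "p0_mat \<in> theta_agree"
  using theta_agree_mult [OF theta_agree_reflection theta_agree_reflection, of 2 2] by (simp add: p0_mat_def reflection_squared)

lemma n4_vector: "n4_mat *v vector [a,b,c,d,e,f,g] = vector [e-a, e-b, e-c, e-d, 2*e+g-a-b-c-d, 2*e+f-a-b-c-d, e]"
  by (simp add: n4_mat_def vec_eq_iff matrix_vector_mult_def forall_7 sum_7)

lemma p5_vector: "p5_mat *v vector [a,b,c,d,e,f,g] = vector [f+g-a-c-d, f+g-a-b-d, f+g-a-b-c, f+g-b-c-d,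
    2*f+g-a-b-c-d, f+2*g-a-b-c-d, e+2*f+2*g-2*a-2*b-2*c-2*d]"
  by (simp add: p5_mat_def vec_eq_iff matrix_vector_mult_def forall_7 sum_7)

text \<open>The words for \<open>n_4\<close> and \<open>p_5\<close> come from a breadth-first search in \<open>M_K\<close>, a group of order 23040.\<close>

lemma n4_word: "n4_mat = swap_mat 1 2 ** (reflection 2 ** (reflection 5 ** (reflection 6 ** (reflection 5 ** (reflection 4 ** (swap_mat 1 2 ** (reflection 3 **
    (reflection 2 ** (reflection 4 ** reflection 3)))))))))"
proof -
  \<comment> \<open>Acting on a symbolic vector turns each generator into an explicit substitution,
    so the word is evaluated without multiplying matrices.\<close>
  have "n4_mat *v vector [a,b,c,d,e,f,g] = (swap_mat 1 2 ** (reflection 2 ** (reflection 5 ** (reflection 6 ** (reflection 5 ** (reflection 4 ** (swap_mat 1 2 ** (reflection 3 **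
    (reflection 2 ** (reflection 4 ** reflection 3)))))))))) *v vector [a,b,c,d,e,f,g]" for a b c d e f g
    by (simp only: matrix_vector_mul_assoc [symmetric] reflection_vectors swap_1_2_vector n4_vector) (simp add: vec_eq_iff forall_7)
  then show ?thesis unfolding matrix_eq by (metis vector_7_collapse)
qed

lemma p5_word: "p5_mat = swap_mat 1 2 ** (reflection 4 ** (swap_mat 1 2 ** (reflection 3 ** (reflection 2 ** (reflection 4 ** (swap_mat 1 2 ** (reflection 5 **
    (reflection 4 ** (swap_mat 1 2 ** (reflection 3 ** (reflection 4 ** (reflection 6 ** reflection 5))))))))))))"
proof -
  have "p5_mat *v vector [a,b,c,d,e,f,g] = (swap_mat 1 2 ** (reflection 4 ** (swap_mat 1 2 ** (reflection 3 ** (reflection 2 ** (reflection 4 ** (swap_mat 1 2 ** (reflection 5 **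
    (reflection 4 ** (swap_mat 1 2 ** (reflection 3 ** (reflection 4 ** (reflection 6 ** reflection 5))))))))))))) *v vector [a,b,c,d,e,f,g]" for a b c d e f g
    by (simp only: matrix_vector_mul_assoc [symmetric] reflection_vectors swap_1_2_vector p5_vector) (simp add: vec_eq_iff forall_7)
  then show ?thesis unfolding matrix_eq by (metis vector_7_collapse)
qed

lemma n4_theta_agree: "n4_mat \<in> theta_agree"
  unfolding n4_word by (intro theta_agree_mult theta_agree_reflection theta_agree_swap) simp_all

lemma p5_theta_agree: "p5_mat \<in> theta_agree"
  unfolding p5_word by (intro theta_agree_mult theta_agree_reflection theta_agree_swap) simp_all

lemma subset_M_K: "{p0_mat, n4_mat, p5_mat} \<subseteq> M_K"
  using p0_theta_agree n4_theta_agree p5_theta_agree by (simp add: theta_agree_def)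

text \<open>A preimage of \<open>omega0\<close> under \<open>theta0 \<mu>\<close> is enough; the
  inverse matrix itself is never computed.\<close>

lemma matrix_inv_theta:
  assumes "\<mu> \<in> theta_agree" "theta0 \<mu> *v u = omega0"
  shows "matrix_inv (theta \<mu>) *v omega0 = u"
proof -
  have \<mu>: "theta \<mu> = theta0 \<mu>" "invertible (theta0 \<mu>)"
    using assms(1) M_K_subset_W by (auto simp: theta_agree_def intro!: theta0_carrier)
  have "matrix_inv (theta \<mu>) ** theta \<mu> = mat 1" using \<mu> by (simp add: matrix_inv_mult_left)
  moreover have "matrix_inv (theta \<mu>) *v omega0 = (matrix_inv (theta \<mu>) ** theta \<mu>) *v u"
    using assms(2) \<mu>(1) by (simp add: matrix_vector_mul_assoc [symmetric])
  ultimately show ?thesis by simp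
qed

text \<open>The preimages are sign vectors, as \<theta> maps \<open>M_K\<close> to signed
  permutations. Any two of the three differ in exactly four places.\<close>

lemma theta_inv_omega0:
  "matrix_inv (theta p0_mat) *v omega0 = vector [1, 1, 1, 1, 1, 1]"
  "matrix_inv (theta n4_mat) *v omega0 = vector [-1, -1, -1, -1, 1, 1]"
  "matrix_inv (theta p5_mat) *v omega0 = vector [1, -1, -1, 1, -1, -1]"
  by (intro matrix_inv_theta p0_theta_agree n4_theta_agree p5_theta_agree;
      simp add: theta0_mult_vec T_inv_mult_vec n4_vector p5_vector p0_mat_def T_mat_mult_vec omega0_def vec_eq_iff forall_6)+

lemma card_differing_6: "card {i::6. P i} = (\<Sum>i\<in>UNIV. if P i then 1 else 0)"
  by (simp add: sum.If_cases)

lemma hamming_type_444: "hamming_type p0_mat n4_mat p5_mat = [4, 4, 4]"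
  by (simp add: hamming_type_def hamming_dist_def theta_inv_omega0 card_differing_6 sum_6)

theorem proposition6p6:
  shows "sigma_map \<in> V \<rightarrow> V
    \<and> (\<forall>x\<in>V. (sigma_map ^^ 3) x = x)
    \<and> (\<forall>x\<in>V.
          gamma_fun ((sigma_map ^^ 2) x) * beta_fun (sigma_map x) * K_sub p0_mat x
        + gamma_fun (sigma_map x) * beta_fun x * K_sub n4_mat x
        + gamma_fun x * beta_fun (inv_into V sigma_map x) * K_sub p5_mat x = 0)
    \<and> (\<forall>x\<in>V.
          (\<Sum>j = 0..(2::int). gamma_fun (sigma_pow (2 - j) x) * beta_fun (sigma_pow (1 - j) x)
                               * K_fun (sigma_pow (- j) x)) = 0)
    \<and> {p0_mat, n4_mat, p5_mat} \<subseteq> M_K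
    \<and> hamming_type p0_mat n4_mat p5_mat = [4, 4, 4]"
proof -
  have "(sigma_map ^^ 3) x = x" if "x \<in> V" for x
    using sigma_map_cubed [OF that] by (simp add: numeral_3_eq_3)
  then show ?thesis
    using sigma_map_V three_term_relation three_term_relation_sum subset_M_K hamming_type_444 by blast
qed

end
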